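(* Let $r,s\ge1$ be integers, $a_0=0\le a_1\le\dots\le a_r$ integers with $\sum_{i=1}^r a_i\le s$, and $X=\mathbb{P}\left(\mathcal{O}_{\mathbb{P}^s}\oplus\bigoplus_{i=1}^r\mathcal{O}_{\mathbb{P}^s}(a_i)\right)$. With the line bundles $E_{kl}=k\,\pi^*H+l\,\xi$ ($0\le k\le s$, $0\le l\le r$), the labelling of the solutions in $Crit(X)$ by pairs $(k,l)$, the sets $M(\cdot,\cdot)$ and the spaces $Hom_{mon}$ defined in the context, for any two solutions $(k_1,l_1),(k_2,l_2)\in Crit(X)$ there is an isomorphism $$Hom(E_{k_1l_1},E_{k_2l_2})\simeq Hom_{mon}((k_1,l_1),(k_2,l_2)).$$ Furthermore, under these isomorphisms, for any three solutions $(k_1,l_1),(k_2,l_2),(k_3,l_3)\in Crit(X)$ the composition map $$Hom(E_{k_1l_1},E_{k_2l_2})\otimes Hom(E_{k_2l_2},E_{k_3l_3})\to Hom(E_{k_1l_1},E_{k_3l_3})$$ is induced by the map $$M((k_1,l_1),(k_2,l_2))\times M((k_2,l_2),(k_3,l_3))\to M((k_1,l_1),(k_3,l_3)),\qquad (D_1,D_2)\mapsto D_1+D_2 .$$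
   Context: Picard group: $\pi:X\to\mathbb{P}^s$ is the projection, $H$ is the positive generator of $Pic(\mathbb{P}^s)$, and $\xi$ is the tautological line bundle of $X$, normalized so that $\pi_*\xi=\mathcal{O}_{\mathbb{P}^s}\oplus\bigoplus_{i=1}^r\mathcal{O}_{\mathbb{P}^s}(a_i)$; then $Pic(X)=\mathbb{Z}\,\pi^*H\oplus\mathbb{Z}\,\xi$ (written additively). $Hom$ denotes homomorphisms of coherent sheaves on $X$. Toric divisors: $Div_T(X)$ is the free abelian group on the torus-invariant prime divisors $V(v_0),\dots,V(v_s),V(e_0),\dots,V(e_r)$ of $X$, with classes $[V(v_i)]=\pi^*H$ for $0\le i\le s$ and $[V(e_j)]=\xi-a_j\pi^*H$ for $0\le j\le r$; a general element is $D=\sum_{i=0}^s n_iV(v_i)+\sum_{j=0}^r m_jV(e_j)$, and $Div_T^+(X)$ is the semigroup of those with all $n_i,m_j\ge0$. Landau-Ginzburg side: $L$ denotes the space of Laurent polynomials $$1+\sum_{i=1}^s\alpha_i z_i+\sum_{j=1}^r\beta_j w_j+\alpha_0\frac{\prod_{j=1}^r w_j^{a_j}}{\prod_{i=1}^s z_i}+\beta_0\frac{1}{\prod_{j=1}^r w_j},\qquad \alpha_i,\beta_j\in\mathbb{C}^*$$ (the constant term plays no role). For $f\in L$, $Crit(X;f)\subset(\mathbb{C}^* )^{s+r}$ is the scheme of solutions of $z_i\,\partial f/\partial z_i=0$ ($1\le i\le s$), $w_j\,\partial f/\partial w_j=0$ ($1\le j\le r$). For $t\in\mathbb{R}$, $f_t\in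 L$ is the element with $\alpha_0=e^t$ and all other $\alpha_i,\beta_j$ equal to $1$; $f_X=f_0$ and $Crit(X)=Crit(X;f_X)$. $R_X\subset L$ is the hypersurface of those $f$ for which $Crit(X;f)$ is non-reduced, and $M:\pi_1(L\setminus R_X,f_X)\to Aut(Crit(X))$ is the monodromy action on the finite set $Crit(X)$ obtained by analytic continuation of solutions along loops. Labelling: each solution $(z,w)\in Crit(X)$ is taken to extend to a unique smooth curve $(z(t),w(t))\in Crit(X;f_t)$, $t\le0$, $(z(0),w(0))=(z,w)$ (standing assumption: $f_t\notin R_X$ for all real $t\le 0$). Let $\mathbb{T}$ be the unit circle, and let $\Theta(z,w)\in\mathbb{T}^2$ be obtained by dividing each coordinate of $\left(\frac{\prod_j w_j^{a_j}}{\prod_i z_i},\frac1{\prod_j w_j}\right)$ by its absolute value. The limit $\lim_{t\to-\infty}\Theta(z(t),w(t))$ equals $\left(e^{2\pi i\left(\frac{l\sum_j a_j}{(s+1)(r+1)}+\frac{k}{s+1}\right)},e^{\frac{2\pi i l}{r+1}}\right)$ for a unique pair $0\le k\le s$, $0\le l\le r$; the solution is then denoted $(k,l)$. This identifies $Crit(X)$ with $\{0,\dots,s\}\times\{0,\dots,r\}\simeq\mathbb{Z}/(s+1)\mathbb{Z}\oplus\mathbb{Z}/(r+1)\mathbb{Z}$. Monodromies: for $D=\sum_{i=0}^s n_iV(v_i)+\sum_{j=0}^r m_jV(e_j)\in Div_T(X)$ and $t\in\mathbb{R}$, let $\gamma^t_D(\theta)\in L$, $\theta\in[0,1]$, be the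 loop based at $f_t$ with $\alpha_i=e^{2\pi i n_i\theta}$ for $1\le i\le s$, $\alpha_0=e^te^{2\pi i n_0\theta}$, $\beta_j=e^{2\pi i m_j\theta}$ for $0\le j\le r$ (in exponentials, $i$ in $2\pi i$ is $\sqrt{-1}$). Let $\widetilde\gamma^t_D$ be the loop based at $f_X$ that follows the straight segment from $f_X$ to $f_t$, then $\gamma^t_D$, then the straight segment back from $f_t$ to $f_X$. For $t$ sufficiently negative its class in $\pi_1(L\setminus R_X,f_X)$ is independent of $t$; this class is $\Gamma_D:=\lim_{t\to-\infty}[\widetilde\gamma^t_D]$, and $\widetilde{M}_D:=M(\Gamma_D)$. Set $|D|_1=\sum_{i=0}^s n_i-\sum_{i=0}^r a_im_i$, $|D|_2=\sum_{i=0}^r m_i$, and for $0\le k\le s$, $0\le l\le r$, $$Div^+(k,l)=\{D\in Div_T^+(X): 0< k+|D|_1\le s\ \text{ and }\ 0< l+|D|_2\le r\}.$$ Let $M((k_1,l_1),(k_2,l_2))=\{D\in Div^+(k_1,l_1):\widetilde{M}_D(k_1,l_1)=(k_2,l_2)\}$, and let $Hom_{mon}((k_1,l_1),(k_2,l_2))=\bigoplus_{D\in M((k_1,l_1),(k_2,l_2))}\mathbb{C}\cdot\widetilde{M}_D$, the complex vector space with basis indexed by this set. "Induced" means that under the isomorphisms the composition map is the bilinear map sending the pair of basis elements indexed by $D_1$ and $D_2$ to the basis element indexed by $D_1+D_2$.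
   Formalization: The lower bounds in Div^+(k,l) are taken as 0 ≤ k+|D|_1 and 0 ≤ l+|D|_2 instead of strict inequalities; with the strict bounds D=0 is lost and the claim fails, e.g. Hom(E_00,E_00)=C while Hom_mon((0,0),(0,0))=0. *)

theory Defs
  imports "HOL-Analysis.Analysis" "HOL-Library.Poly_Mapping"
begin

text \<open>
  Throughout, \<open>a 0 = 0, a 1, \<dots>, a r\<close> are the twists, so that
  \<open>X = \<bbbP>(O(a 0) \<oplus> \<dots> \<oplus> O(a r))\<close> over \<open>\<bbbP>\<^sup>s\<close>. A pair of functions supported on
  \<open>{0..s}\<close> and \<open>{0..r}\<close> encodes a vector of \<open>\<complex>\<^bsup>s+1\<^esup> \<times> \<complex>\<^bsup>r+1\<^esup>\<close>; a pair supported on \<open>{1..s}\<close> and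
  \<open>{1..r}\<close> encodes a vector of \<open>\<complex>\<^sup>s \<times> \<complex>\<^sup>r\<close>. On these the product topology of function spaces is
  the usual one.
\<close>

type_synonym pt = "(nat \<Rightarrow> complex) \<times> (nat \<Rightarrow> complex)"

inductive_set generated_algebra :: "('p \<Rightarrow> complex) set \<Rightarrow> ('p \<Rightarrow> complex) set" for G where
  gen: "g \<in> G \<Longrightarrow> g \<in> generated_algebra G"
| const: "(\<lambda>_. c) \<in> generated_algebra G"
| add: "g \<in> generated_algebra G \<Longrightarrow> h \<in> generated_algebra G \<Longrightarrow> (\<lambda>p. g p + h p) \<in> generated_algebra G"
| mult: "g \<in> generated_algebra G \<Longrightarrow> h \<in> generated_algebra G \<Longrightarrow> (\<lambda>p. g p * h p) \<in> generated_algebra G"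


section \<open>The projective bundle and its line bundles\<close>

text \<open>
  The dual bundle of \<open>O(a 0) \<oplus> \<dots> \<oplus> O(a r)\<close> has total space
  \<open>((\<complex>\<^bsup>s+1\<^esup> - 0) \<times> \<complex>\<^bsup>r+1\<^esup>) / \<complex>\<^sup>*\<close> for the action of weights \<open>1\<close> on \<open>x\<close> and \<open>- a j\<close> on \<open>y j\<close>. The points
  of \<open>X\<close>, the rank one quotients of the fibres of the bundle, are the lines in the fibres of its
  dual, that is the orbits of the following action of \<open>(\<complex>\<^sup>*)\<^sup>2\<close>. The projection to \<open>\<bbbP>\<^sup>s\<close> is
  \<open>[x, y] \<mapsto> [x]\<close>.
\<close>

definition cone :: "nat \<Rightarrow> nat \<Rightarrow> pt set" where
  "cone s r = {(x, y). (\<forall>i>s. x i = 0) \<and> (\<forall>j>r. y j = 0) \<and> (\<exists>i. x i \<noteq> 0) \<and> (\<exists>j. y j \<noteq> 0)}"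

definition act :: "(nat \<Rightarrow> int) \<Rightarrow> complex \<Rightarrow> complex \<Rightarrow> pt \<Rightarrow> pt" where
  "act a u v = (\<lambda>(x, y). (\<lambda>i. u * x i, \<lambda>j. u powi (- a j) * v * y j))"

definition proj_bundle :: "nat \<Rightarrow> nat \<Rightarrow> (nat \<Rightarrow> int) \<Rightarrow> pt set set" where
  "proj_bundle s r a = (\<lambda>p. {act a u v p | u v. u \<noteq> 0 \<and> v \<noteq> 0}) ` cone s r"

definition polynomials :: "nat \<Rightarrow> nat \<Rightarrow> (pt \<Rightarrow> complex) set" where
  "polynomials s r = generated_algebra ({\<lambda>p. fst p i | i. i \<le> s} \<union> {\<lambda>p. snd p j | j. j \<le> r})"

text \<open>A set of points of \<open>X\<close> is Zariski open if the union of its orbits is so in affine space.\<close>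

definition zariski_open :: "nat \<Rightarrow> nat \<Rightarrow> (nat \<Rightarrow> int) \<Rightarrow> pt set set \<Rightarrow> bool" where
  "zariski_open s r a U \<longleftrightarrow> U \<subseteq> proj_bundle s r a \<and>
     (\<exists>P \<subseteq> polynomials s r. \<Union>U = {p \<in> cone s r. \<exists>g\<in>P. g p \<noteq> 0})"

definition regular_on :: "nat \<Rightarrow> nat \<Rightarrow> pt set \<Rightarrow> (pt \<Rightarrow> complex) \<Rightarrow> bool" where
  "regular_on s r W \<sigma> \<longleftrightarrow>
     (\<forall>p\<in>W. \<exists>g\<in>polynomials s r. \<exists>h\<in>polynomials s r. h p \<noteq> 0 \<and> (\<forall>q\<in>W. h q \<noteq> 0 \<longrightarrow> \<sigma> q = g q / h q))"

text \<open>
  The sheaf of sections of the line bundle \<open>k \<pi>\<^sup>*H + l \<xi>\<close>, which is the bundle associated with the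
  character \<open>(u, v) \<mapsto> u\<^sup>k v\<^sup>l\<close>: its sections over \<open>U\<close> are the regular functions of that weight on
  the cone over \<open>U\<close>, extended by zero to the whole type. Tensor products of line bundles correspond
  to sums of weights. The coordinates \<open>x i\<close> have weight \<open>(1, 0)\<close>, the class of \<open>V(v i)\<close>, and the
  coordinates \<open>y j\<close> have weight \<open>(- a j, 1)\<close>, the class of \<open>V(e j)\<close>. The sections of weight \<open>(0, 1)\<close>
  over the preimage of an open subset of \<open>\<bbbP>\<^sup>s\<close> are the sums of \<open>c j * y j\<close> with \<open>c j\<close> a section of
  \<open>O(a j)\<close>, in accordance with the normalization of \<open>\<xi>\<close>. The structure sheaf is the case of
  weight \<open>(0, 0)\<close>.
\<close>

definition line_bundle :: "nat \<Rightarrow> nat \<Rightarrow> (nat \<Rightarrow> int) \<Rightarrow> int \<Rightarrow> int \<Rightarrow> pt set set \<Rightarrow> (pt \<Rightarrow> complex) set" where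
  "line_bundle s r a k l U = {\<sigma>.
     (\<forall>p. p \<notin> \<Union>U \<longrightarrow> \<sigma> p = 0) \<and> regular_on s r (\<Union>U) \<sigma> \<and>
     (\<forall>p\<in>\<Union>U. \<forall>u v. u \<noteq> 0 \<longrightarrow> v \<noteq> 0 \<longrightarrow> \<sigma> (act a u v p) = u powi k * v powi l * \<sigma> p)}"

definition restrict_section :: "pt set set \<Rightarrow> (pt \<Rightarrow> complex) \<Rightarrow> pt \<Rightarrow> complex" where
  "restrict_section V \<sigma> = (\<lambda>p. if p \<in> \<Union>V then \<sigma> p else 0)"

text \<open>
  Homomorphisms of sheaves of \<open>O\<^sub>X\<close>-modules, as families of maps on sections indexed by the open
  sets. The first condition fixes the values at irrelevant arguments, so that equality, sums and
  composites of homomorphisms are those of HOL functions.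
\<close>

type_synonym sheaf_map = "pt set set \<Rightarrow> (pt \<Rightarrow> complex) \<Rightarrow> (pt \<Rightarrow> complex)"

definition sheaf_hom ::
  "nat \<Rightarrow> nat \<Rightarrow> (nat \<Rightarrow> int) \<Rightarrow> (pt set set \<Rightarrow> (pt \<Rightarrow> complex) set) \<Rightarrow> (pt set set \<Rightarrow> (pt \<Rightarrow> complex) set)
     \<Rightarrow> sheaf_map set" where
  "sheaf_hom s r a E F = {\<phi>.
     (\<forall>U \<sigma>. \<not> (zariski_open s r a U \<and> \<sigma> \<in> E U) \<longrightarrow> \<phi> U \<sigma> = (\<lambda>_. 0)) \<and>
     (\<forall>U. zariski_open s r a U \<longrightarrow>
        (\<forall>\<sigma>\<in>E U. \<phi> U \<sigma> \<in> F U) \<and>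
        (\<forall>\<sigma>\<in>E U. \<forall>\<tau>\<in>E U. \<phi> U (\<lambda>p. \<sigma> p + \<tau> p) = (\<lambda>p. \<phi> U \<sigma> p + \<phi> U \<tau> p)) \<and>
        (\<forall>\<sigma>\<in>E U. \<forall>g\<in>line_bundle s r a 0 0 U. \<phi> U (\<lambda>p. g p * \<sigma> p) = (\<lambda>p. g p * \<phi> U \<sigma> p)) \<and>
        (\<forall>\<sigma>\<in>E U. \<forall>V\<subseteq>U. zariski_open s r a V \<longrightarrow>
           \<phi> V (restrict_section V \<sigma>) = restrict_section V (\<phi> U \<sigma>)))}"

definition sheaf_map_add :: "sheaf_map \<Rightarrow> sheaf_map \<Rightarrow> sheaf_map" where
  "sheaf_map_add \<phi> \<psi> = (\<lambda>U \<sigma> p. \<phi> U \<sigma> p + \<psi> U \<sigma> p)"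

definition sheaf_map_scale :: "complex \<Rightarrow> sheaf_map \<Rightarrow> sheaf_map" where
  "sheaf_map_scale c \<phi> = (\<lambda>U \<sigma> p. c * \<phi> U \<sigma> p)"

definition sheaf_map_comp :: "sheaf_map \<Rightarrow> sheaf_map \<Rightarrow> sheaf_map" where
  "sheaf_map_comp \<psi> \<phi> = (\<lambda>U \<sigma>. \<psi> U (\<phi> U \<sigma>))"

definition labels :: "nat \<Rightarrow> nat \<Rightarrow> (nat \<times> nat) set" where
  "labels s r = {0..s} \<times> {0..r}"

definition E :: "nat \<Rightarrow> nat \<Rightarrow> (nat \<Rightarrow> int) \<Rightarrow> nat \<times> nat \<Rightarrow> pt set set \<Rightarrow> (pt \<Rightarrow> complex) set" where
  "E s r a = (\<lambda>(k, l). line_bundle s r a (int k) (int l))"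

definition Hom_E :: "nat \<Rightarrow> nat \<Rightarrow> (nat \<Rightarrow> int) \<Rightarrow> nat \<times> nat \<Rightarrow> nat \<times> nat \<Rightarrow> sheaf_map set" where
  "Hom_E s r a P Q = sheaf_hom s r a (E s r a P) (E s r a Q)"


section \<open>Toric divisors\<close>

datatype toric_prime = Vv nat | Ve nat

type_synonym divisor = "toric_prime \<Rightarrow>\<^sub>0 int"

definition Div_T :: "nat \<Rightarrow> nat \<Rightarrow> divisor set" where
  "Div_T s r = {D. Poly_Mapping.keys D \<subseteq> Vv ` {0..s} \<union> Ve ` {0..r}}"

definition Div_T_plus :: "nat \<Rightarrow> nat \<Rightarrow> divisor set" where
  "Div_T_plus s r = {D \<in> Div_T s r. \<forall>v. Poly_Mapping.lookup D v \<ge> 0}"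

definition deg1 :: "nat \<Rightarrow> nat \<Rightarrow> (nat \<Rightarrow> int) \<Rightarrow> divisor \<Rightarrow> int" where
  "deg1 s r a D = (\<Sum>i=0..s. Poly_Mapping.lookup D (Vv i)) - (\<Sum>j=0..r. a j * Poly_Mapping.lookup D (Ve j))"

definition deg2 :: "nat \<Rightarrow> divisor \<Rightarrow> int" where
  "deg2 r D = (\<Sum>j=0..r. Poly_Mapping.lookup D (Ve j))"

text \<open>
  The lower bounds have to be non-strict. With \<open>0 < k + deg1 D\<close> and \<open>0 < l + deg2 D\<close> instead, the set
  would not contain \<open>D = 0\<close> when \<open>k = 0\<close> or \<open>l = 0\<close>, and nothing would correspond to the identity
  of the line bundle \<open>E (k, l)\<close>.
\<close>

definition Div_plus :: "nat \<Rightarrow> nat \<Rightarrow> (nat \<Rightarrow> int) \<Rightarrow> nat \<times> nat \<Rightarrow> divisor set" where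
  "Div_plus s r a = (\<lambda>(k, l). {D \<in> Div_T_plus s r.
     0 \<le> int k + deg1 s r a D \<and> int k + deg1 s r a D \<le> int s \<and>
     0 \<le> int l + deg2 r D \<and> int l + deg2 r D \<le> int r})"


section \<open>Landau-Ginzburg polynomials and their critical schemes\<close>

text \<open>Elements of \<open>L\<close> are given by their coefficients \<open>(\<alpha>, \<beta>)\<close>.\<close>

definition L :: "nat \<Rightarrow> nat \<Rightarrow> pt set" where
  "L s r = {(\<alpha>, \<beta>). (\<forall>i. \<alpha> i \<noteq> 0 \<longleftrightarrow> i \<le> s) \<and> (\<forall>j. \<beta> j \<noteq> 0 \<longleftrightarrow> j \<le> r)}"

definition torus :: "nat \<Rightarrow> nat \<Rightarrow> pt set" where
  "torus s r = {(z, w). (\<forall>i. z i \<noteq> 0 \<longleftrightarrow> i \<in> {1..s}) \<and> (\<forall>j. w j \<noteq> 0 \<longleftrightarrow> j \<in> {1..r})}"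

definition LG :: "nat \<Rightarrow> nat \<Rightarrow> (nat \<Rightarrow> int) \<Rightarrow> pt \<Rightarrow> pt \<Rightarrow> complex" where
  "LG s r a = (\<lambda>(\<alpha>, \<beta>) (z, w).
     1 + (\<Sum>i=1..s. \<alpha> i * z i) + (\<Sum>j=1..r. \<beta> j * w j)
       + \<alpha> 0 * ((\<Prod>j=1..r. w j powi a j) / (\<Prod>i=1..s. z i))
       + \<beta> 0 * (1 / (\<Prod>j=1..r. w j)))"

definition log_deriv_z :: "nat \<Rightarrow> nat \<Rightarrow> (nat \<Rightarrow> int) \<Rightarrow> pt \<Rightarrow> nat \<Rightarrow> pt \<Rightarrow> complex" where
  "log_deriv_z s r a f i = (\<lambda>(z, w). z i * deriv (\<lambda>u. LG s r a f (z(i := u), w)) (z i))"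

definition log_deriv_w :: "nat \<Rightarrow> nat \<Rightarrow> (nat \<Rightarrow> int) \<Rightarrow> pt \<Rightarrow> nat \<Rightarrow> pt \<Rightarrow> complex" where
  "log_deriv_w s r a f j = (\<lambda>(z, w). w j * deriv (\<lambda>u. LG s r a f (z, w(j := u))) (w j))"

definition Crit :: "nat \<Rightarrow> nat \<Rightarrow> (nat \<Rightarrow> int) \<Rightarrow> pt \<Rightarrow> pt set" where
  "Crit s r a f = {p \<in> torus s r.
     (\<forall>i\<in>{1..s}. log_deriv_z s r a f i p = 0) \<and> (\<forall>j\<in>{1..r}. log_deriv_w s r a f j p = 0)}"

text \<open>
  The affine scheme of solutions is reduced if and only if the ideal of its equations in the ring of
  Laurent polynomials is radical. Laurent polynomials are identified with the functions they
  define on the torus.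
\<close>

definition laurent_polynomials :: "nat \<Rightarrow> nat \<Rightarrow> (pt \<Rightarrow> complex) set" where
  "laurent_polynomials s r = generated_algebra
     ({\<lambda>p. fst p i | i. i \<in> {1..s}} \<union> {\<lambda>p. inverse (fst p i) | i. i \<in> {1..s}} \<union>
      {\<lambda>p. snd p j | j. j \<in> {1..r}} \<union> {\<lambda>p. inverse (snd p j) | j. j \<in> {1..r}})"

definition Crit_ideal :: "nat \<Rightarrow> nat \<Rightarrow> (nat \<Rightarrow> int) \<Rightarrow> pt \<Rightarrow> (pt \<Rightarrow> complex) set" where
  "Crit_ideal s r a f = {g \<in> laurent_polynomials s r.
     \<exists>b c. (\<forall>i\<in>{1..s}. b i \<in> laurent_polynomials s r) \<and> (\<forall>j\<in>{1..r}. c j \<in> laurent_polynomials s r) \<and>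
       (\<forall>p\<in>torus s r. g p = (\<Sum>i=1..s. b i p * log_deriv_z s r a f i p)
                              + (\<Sum>j=1..r. c j p * log_deriv_w s r a f j p))}"

definition Crit_reduced :: "nat \<Rightarrow> nat \<Rightarrow> (nat \<Rightarrow> int) \<Rightarrow> pt \<Rightarrow> bool" where
  "Crit_reduced s r a f \<longleftrightarrow>
     (\<forall>g\<in>laurent_polynomials s r. \<forall>n. (\<lambda>p. g p ^ n) \<in> Crit_ideal s r a f \<longrightarrow> g \<in> Crit_ideal s r a f)"

definition R_X :: "nat \<Rightarrow> nat \<Rightarrow> (nat \<Rightarrow> int) \<Rightarrow> pt set" where
  "R_X s r a = {f \<in> L s r. \<not> Crit_reduced s r a f}"

definition f_at :: "nat \<Rightarrow> nat \<Rightarrow> real \<Rightarrow> pt" where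
  "f_at s r t = (\<lambda>i. if i = 0 then of_real (exp t) else if i \<le> s then 1 else 0, \<lambda>j. if j \<le> r then 1 else 0)"

definition f_X :: "nat \<Rightarrow> nat \<Rightarrow> pt" where
  "f_X s r = f_at s r 0"

definition Crit_X :: "nat \<Rightarrow> nat \<Rightarrow> (nat \<Rightarrow> int) \<Rightarrow> pt set" where
  "Crit_X s r a = Crit s r a (f_X s r)"


section \<open>Labelling of the solutions\<close>

definition smooth_nonpos :: "(real \<Rightarrow> complex) \<Rightarrow> bool" where
  "smooth_nonpos g \<longleftrightarrow>
     (\<exists>d. d 0 = g \<and> (\<forall>n. \<forall>t\<le>0. (d n has_vector_derivative d (Suc n) t) (at t within {..0})))"

definition is_solution_curve :: "nat \<Rightarrow> nat \<Rightarrow> (nat \<Rightarrow> int) \<Rightarrow> pt \<Rightarrow> (real \<Rightarrow> pt) \<Rightarrow> bool" where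
  "is_solution_curve s r a p c \<longleftrightarrow>
     c 0 = p \<and> (\<forall>t\<le>0. c t \<in> Crit s r a (f_at s r t)) \<and>
     (\<forall>i. smooth_nonpos (\<lambda>t. fst (c t) i)) \<and> (\<forall>j. smooth_nonpos (\<lambda>t. snd (c t) j))"

definition Theta :: "nat \<Rightarrow> nat \<Rightarrow> (nat \<Rightarrow> int) \<Rightarrow> pt \<Rightarrow> complex \<times> complex" where
  "Theta s r a = (\<lambda>(z, w).
     (sgn ((\<Prod>j=1..r. w j powi a j) / (\<Prod>i=1..s. z i)), sgn (1 / (\<Prod>j=1..r. w j))))"

definition has_label :: "nat \<Rightarrow> nat \<Rightarrow> (nat \<Rightarrow> int) \<Rightarrow> pt \<Rightarrow> nat \<times> nat \<Rightarrow> bool" where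
  "has_label s r a p = (\<lambda>(k, l). (k, l) \<in> labels s r \<and>
     (\<exists>c. is_solution_curve s r a p c \<and>
        ((\<lambda>t. Theta s r a (c t)) \<longlongrightarrow>
           (cis (2 * pi * (real l * real_of_int (\<Sum>j=1..r. a j) / (real (s + 1) * real (r + 1))
                            + real k / real (s + 1))),
            cis (2 * pi * real l / real (r + 1)))) at_bot))"

definition solution :: "nat \<Rightarrow> nat \<Rightarrow> (nat \<Rightarrow> int) \<Rightarrow> nat \<times> nat \<Rightarrow> pt" where
  "solution s r a P = (THE p. p \<in> Crit_X s r a \<and> has_label s r a p P)"


section \<open>Monodromy\<close>

text \<open>Elements of the fundamental group are homotopy classes, as sets of loops.\<close>

definition loop_class :: "nat \<Rightarrow> nat \<Rightarrow> (nat \<Rightarrow> int) \<Rightarrow> (real \<Rightarrow> pt) \<Rightarrow> (real \<Rightarrow> pt) set" where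
  "loop_class s r a \<gamma> = {\<gamma>'. homotopic_paths (L s r - R_X s r a) \<gamma> \<gamma>'}"

definition continues_to :: "nat \<Rightarrow> nat \<Rightarrow> (nat \<Rightarrow> int) \<Rightarrow> (real \<Rightarrow> pt) \<Rightarrow> pt \<Rightarrow> pt \<Rightarrow> bool" where
  "continues_to s r a \<gamma> p q \<longleftrightarrow>
     (\<exists>c. path c \<and> (\<forall>\<theta>\<in>{0..1}. c \<theta> \<in> Crit s r a (\<gamma> \<theta>)) \<and> pathstart c = p \<and> pathfinish c = q)"

definition monodromy :: "nat \<Rightarrow> nat \<Rightarrow> (nat \<Rightarrow> int) \<Rightarrow> (real \<Rightarrow> pt) set \<Rightarrow> pt \<Rightarrow> pt" where
  "monodromy s r a C p = (THE q. \<exists>\<gamma>\<in>C. continues_to s r a \<gamma> p q)"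

definition gamma :: "nat \<Rightarrow> nat \<Rightarrow> divisor \<Rightarrow> real \<Rightarrow> real \<Rightarrow> pt" where
  "gamma s r D t \<theta> =
     (\<lambda>i. fst (f_at s r t) i * cis (2 * pi * real_of_int (Poly_Mapping.lookup D (Vv i)) * \<theta>),
      \<lambda>j. snd (f_at s r t) j * cis (2 * pi * real_of_int (Poly_Mapping.lookup D (Ve j)) * \<theta>))"

text \<open>Only the coefficient \<open>\<alpha>\<^sub>0\<close> varies along the straight segment from \<open>f_X\<close> to \<open>f_at s r t\<close>.\<close>

definition segment_to :: "nat \<Rightarrow> nat \<Rightarrow> real \<Rightarrow> real \<Rightarrow> pt" where
  "segment_to s r t \<theta> = ((fst (f_X s r))(0 := linepath 1 (of_real (exp t)) \<theta>), snd (f_X s r))"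

definition gamma_tilde :: "nat \<Rightarrow> nat \<Rightarrow> divisor \<Rightarrow> real \<Rightarrow> real \<Rightarrow> pt" where
  "gamma_tilde s r D t = segment_to s r t +++ gamma s r D t +++ reversepath (segment_to s r t)"

definition Gamma_class :: "nat \<Rightarrow> nat \<Rightarrow> (nat \<Rightarrow> int) \<Rightarrow> divisor \<Rightarrow> (real \<Rightarrow> pt) set" where
  "Gamma_class s r a D = (THE C. \<forall>\<^sub>F t in at_bot. loop_class s r a (gamma_tilde s r D t) = C)"

definition M_tilde :: "nat \<Rightarrow> nat \<Rightarrow> (nat \<Rightarrow> int) \<Rightarrow> divisor \<Rightarrow> pt \<Rightarrow> pt" where
  "M_tilde s r a D = monodromy s r a (Gamma_class s r a D)"

definition M_set :: "nat \<Rightarrow> nat \<Rightarrow> (nat \<Rightarrow> int) \<Rightarrow> nat \<times> nat \<Rightarrow> nat \<times> nat \<Rightarrow> divisor set" where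
  "M_set s r a P Q = {D \<in> Div_plus s r a P. M_tilde s r a D (solution s r a P) = solution s r a Q}"

definition Hom_mon :: "nat \<Rightarrow> nat \<Rightarrow> (nat \<Rightarrow> int) \<Rightarrow> nat \<times> nat \<Rightarrow> nat \<times> nat \<Rightarrow> (divisor \<Rightarrow>\<^sub>0 complex) set" where
  "Hom_mon s r a P Q = {u. Poly_Mapping.keys u \<subseteq> M_set s r a P Q}"

definition linear_iso :: "sheaf_map set \<Rightarrow> (divisor \<Rightarrow>\<^sub>0 complex) set \<Rightarrow> (sheaf_map \<Rightarrow> (divisor \<Rightarrow>\<^sub>0 complex)) \<Rightarrow> bool" where
  "linear_iso A B \<Phi> \<longleftrightarrow> bij_betw \<Phi> A B \<and>
     (\<forall>\<phi>\<in>A. \<forall>\<psi>\<in>A. \<Phi> (sheaf_map_add \<phi> \<psi>) = \<Phi> \<phi> + \<Phi> \<psi>) \<and>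
     (\<forall>\<phi>\<in>A. \<forall>c. \<Phi> (sheaf_map_scale c \<phi>) = Poly_Mapping.map ((*) c) (\<Phi> \<phi>))"

text \<open>The bilinear map that sends the basis elements indexed by \<open>D1\<close>, \<open>D2\<close> to the one indexed by \<open>D1 + D2\<close>.\<close>

definition mon_comp :: "(divisor \<Rightarrow>\<^sub>0 complex) \<Rightarrow> (divisor \<Rightarrow>\<^sub>0 complex) \<Rightarrow> (divisor \<Rightarrow>\<^sub>0 complex)" where
  "mon_comp u v = (\<Sum>D1\<in>Poly_Mapping.keys u. \<Sum>D2\<in>Poly_Mapping.keys v.
     Poly_Mapping.single (D1 + D2) (Poly_Mapping.lookup u D1 * Poly_Mapping.lookup v D2))"

end

theory Submission
  imports Defs "HOL-Complex_Analysis.Complex_Analysis" "HOL-Library.Function_Algebras"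
begin

text \<open>
  Both sides are computed explicitly. For \<open>P = (k, l)\<close> and \<open>Q = (k', l')\<close>, each of them turns out to
  be the vector space with basis the effective toric divisors \<open>D\<close> with \<open>deg1 D = k' - k\<close> and
  \<open>deg2 D = l' - l\<close>.

  On the side of sheaves, the frames of a line bundle show that a homomorphism is multiplication by a global section
  of weight \<open>Q - P\<close>. Such a section is a Cox polynomial. Indeed, it is entire in each coordinate
  \<open>u\<close>, and the action of the torus turns the point at infinity of the coordinate line into a point of
  the cone, so that the section grows at most like a power of \<open>u\<close> and is polynomial in \<open>u\<close> by
  Liouville's theorem (\<open>regular_section_polynomial_in_coordinate\<close>). Interpolation in one coordinate
  after the other makes it a polynomial, and the independence of characters selects the monomials of
  the right weight (\<open>regular_section_cox_poly\<close>, \<open>Hom_E_cox_poly\<close>). The monomials are indexed by the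
  effective divisors of this weight, and their products by the sums of divisors
  (\<open>hom_coeffs_linear_iso\<close>, \<open>hom_coeffs_comp\<close>).

  On the side of critical points, let \<open>A\<close> and \<open>B\<close> be the values of the last two terms of the Laurent polynomial. The
  critical equations say that \<open>\<alpha>\<^sub>i z\<^sub>i = A\<close> and \<open>\<beta>\<^sub>j w\<^sub>j = B - a\<^sub>j A\<close>. Substituting this into the
  definitions of \<open>A\<close> and \<open>B\<close> identifies the critical points of \<open>f\<close> with the fibre of a fixed map
  \<open>crit_map\<close> of two variables over a point \<open>crit_value f\<close> of \<open>(\<complex>\<^sup>*)\<^sup>2\<close>, namely over
  \<open>(\<Prod> \<alpha>\<^sub>i / \<Prod> \<beta>\<^sub>j ^ a\<^sub>j, \<Prod> \<beta>\<^sub>j)\<close>. The loop of a divisor \<open>D\<close> has a value with winding numbers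
  \<open>deg1 D\<close> and \<open>deg2 D\<close>, which is how the degrees enter the monodromy.

  It remains to compute the monodromy. If the critical scheme is reduced, then \<open>crit_map\<close> has an invertible differential at the
  points of the fibre (\<open>reduced_imp_nondegenerate\<close>). As \<open>crit_map\<close> is proper, which rests on
  \<open>\<Sum> a\<^sub>j \<le> s\<close>, it is a covering over the regular values in its image (\<open>covering_space_crit_map\<close>), so that the
  continuation of solutions only depends on homotopy classes. For small \<open>\<alpha>\<^sub>0\<close> the implicit function
  theorem provides \<open>(s + 1)(r + 1)\<close> solutions, with \<open>A\<close> and \<open>B\<close> close to \<open>\<rho> exp(\<i> \<psi>1)\<close> and \<open>exp(\<i> \<psi>2)\<close>
  for the solutions \<open>\<psi>1\<close>, \<open>\<psi>2\<close> of two linear equations modulo \<open>2 \<pi>\<close>. There are no others, and the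
  scheme is reduced, because the Laurent polynomials modulo the ideal of the critical equations are
  spanned by \<open>(s + 1)(r + 1)\<close> elements (\<open>card_Crit_le\<close>, \<open>reduced_of_card\<close>, \<open>small_fiber\<close>). The label
  \<open>(k, l)\<close> records the choice of \<open>\<psi>1\<close> and \<open>\<psi>2\<close> (\<open>has_label_iff\<close>). Following the phases once along the
  loop of \<open>D\<close> adds \<open>deg1 D\<close> to \<open>k\<close> and \<open>deg2 D\<close> to \<open>l\<close> (\<open>continues_along_gamma\<close>), and the bounds in
  the definition of \<open>Div_plus\<close> exclude that labels are reduced modulo \<open>s + 1\<close> and \<open>r + 1\<close>. Hence
  \<open>M_set P Q\<close> is the above set of divisors (\<open>M_set_eq\<close>).
\<close>

section \<open>The twists\<close>

locale twisted_bundle =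
  fixes r s :: nat and a :: "nat \<Rightarrow> int"
  assumes r_pos: "1 \<le> r" and s_pos: "1 \<le> s"
    and a_0: "a 0 = 0" and a_Suc: "\<And>j. j < r \<Longrightarrow> a j \<le> a (Suc j)"
    and sum_a_le: "(\<Sum>j=1..r. a j) \<le> int s"
begin

lemma a_mono: "i \<le> j \<Longrightarrow> j \<le> r \<Longrightarrow> a i \<le> a j"
proof (induction j rule: dec_induct)
  case (step n)
  then show ?case using a_Suc[of n] by simp
qed simp

lemma a_nonneg: "j \<le> r \<Longrightarrow> 0 \<le> a j"
  using a_mono[of 0 j] a_0 by simp

end

section \<open>Cox polynomials\<close>

definition toric_primes :: "nat \<Rightarrow> nat \<Rightarrow> toric_prime set" where
  "toric_primes s r = Vv ` {0..s} \<union> Ve ` {0..r}"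

definition coord :: "pt \<Rightarrow> toric_prime \<Rightarrow> complex" where
  "coord p v = (case v of Vv i \<Rightarrow> fst p i | Ve j \<Rightarrow> snd p j)"

definition pt_of :: "(toric_prime \<Rightarrow> complex) \<Rightarrow> pt" where
  "pt_of \<xi> = (\<lambda>i. \<xi> (Vv i), \<lambda>j. \<xi> (Ve j))"

definition cox_monomial :: "nat \<Rightarrow> nat \<Rightarrow> divisor \<Rightarrow> pt \<Rightarrow> complex" where
  "cox_monomial s r D p = (\<Prod>v\<in>toric_primes s r. coord p v ^ nat (Poly_Mapping.lookup D v))"

definition cox_poly :: "nat \<Rightarrow> nat \<Rightarrow> (divisor \<Rightarrow>\<^sub>0 complex) \<Rightarrow> pt \<Rightarrow> complex" where
  "cox_poly s r u p = (\<Sum>D\<in>Poly_Mapping.keys u. Poly_Mapping.lookup u D * cox_monomial s r D p)"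

definition open_orbit :: "nat \<Rightarrow> nat \<Rightarrow> pt set" where
  "open_orbit s r = {p. \<forall>v. coord p v \<noteq> 0 \<longleftrightarrow> v \<in> toric_primes s r}"

lemma finite_toric_primes [simp]: "finite (toric_primes s r)"
  by (simp add: toric_primes_def)

lemma toric_primes_iff [simp]:
  "Vv i \<in> toric_primes s r \<longleftrightarrow> i \<le> s" "Ve j \<in> toric_primes s r \<longleftrightarrow> j \<le> r"
  by (auto simp: toric_primes_def)

lemma coord_simps [simp]: "coord p (Vv i) = fst p i" "coord p (Ve j) = snd p j"
  by (simp_all add: coord_def)

lemma coord_pt_of [simp]: "coord (pt_of \<xi>) = \<xi>"
  by (auto simp: coord_def pt_of_def fun_eq_iff split: toric_prime.splits)

lemma pt_of_coord [simp]: "pt_of (coord p) = p"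
  by (simp add: pt_of_def)

lemma prod_toric_primes:
  "(\<Prod>v\<in>toric_primes s r. f v) = (\<Prod>i=0..s. f (Vv i)) * (\<Prod>j=0..r. f (Ve j))"
  for f :: "toric_prime \<Rightarrow> 'a::comm_monoid_mult"
  unfolding toric_primes_def
  by (subst prod.union_disjoint) (auto simp: prod.reindex inj_on_def)

lemma Div_T_plus_add: "D \<in> Div_T_plus s r \<Longrightarrow> D' \<in> Div_T_plus s r \<Longrightarrow> D + D' \<in> Div_T_plus s r"
  using Poly_Mapping.keys_add[of D D'] by (auto simp: Div_T_plus_def Div_T_def lookup_add)

lemma zero_in_Div_T_plus: "0 \<in> Div_T_plus s r"
  by (auto simp: Div_T_plus_def Div_T_def)

lemma deg1_add: "deg1 s r a (D + D') = deg1 s r a D + deg1 s r a D'"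
  by (simp add: deg1_def lookup_add sum.distrib algebra_simps)

lemma deg2_add: "deg2 r (D + D') = deg2 r D + deg2 r D'"
  by (simp add: deg2_def lookup_add sum.distrib)

lemma cox_monomial_add:
  assumes "D \<in> Div_T_plus s r" "D' \<in> Div_T_plus s r"
  shows "cox_monomial s r (D + D') p = cox_monomial s r D p * cox_monomial s r D' p"
  using assms
  by (simp add: cox_monomial_def lookup_add nat_add_distrib Div_T_plus_def power_add prod.distrib)

lemma cox_poly_superset:
  "finite A \<Longrightarrow> Poly_Mapping.keys u \<subseteq> A \<Longrightarrow>
     cox_poly s r u p = (\<Sum>D\<in>A. Poly_Mapping.lookup u D * cox_monomial s r D p)"
  unfolding cox_poly_def by (rule sum.mono_neutral_left) (auto simp: in_keys_iff)

lemma cox_poly_zero [simp]: "cox_poly s r 0 p = 0"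
  by (simp add: cox_poly_def)

lemma cox_poly_single [simp]: "cox_poly s r (Poly_Mapping.single D c) p = c * cox_monomial s r D p"
  by (simp add: cox_poly_def)

lemma cox_poly_add: "cox_poly s r (u + v) p = cox_poly s r u p + cox_poly s r v p"
proof -
  let ?A = "Poly_Mapping.keys u \<union> Poly_Mapping.keys v"
  have *: "finite ?A" "Poly_Mapping.keys u \<subseteq> ?A" "Poly_Mapping.keys v \<subseteq> ?A" "Poly_Mapping.keys (u + v) \<subseteq> ?A"
    using Poly_Mapping.keys_add[of u v] by auto
  show ?thesis
    by (simp add: cox_poly_superset[OF *(1)] * lookup_add sum.distrib algebra_simps)
qed

lemma cox_poly_sum: "cox_poly s r (\<Sum>i\<in>I. f i) p = (\<Sum>i\<in>I. cox_poly s r (f i) p)"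
  by (induction I rule: infinite_finite_induct) (auto simp: cox_poly_add)

lemma keys_sum_subset: "(\<And>i. i \<in> I \<Longrightarrow> Poly_Mapping.keys (f i) \<subseteq> K) \<Longrightarrow> Poly_Mapping.keys (\<Sum>i\<in>I. f i) \<subseteq> K"
  using Poly_Mapping.keys_sum[of f I] by blast

lemma cox_poly_map_scale: "cox_poly s r (Poly_Mapping.map ((*) c) u) p = c * cox_poly s r u p"
proof -
  have *: "Poly_Mapping.keys (Poly_Mapping.map ((*) c) u) \<subseteq> Poly_Mapping.keys u"
    by (auto simp: in_keys_iff Poly_Mapping.map.rep_eq when_def)
  show ?thesis
    by (subst cox_poly_superset[OF _ *])
       (auto simp: cox_poly_def Poly_Mapping.map.rep_eq when_def sum_distrib_left mult.assoc intro!: sum.cong)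
qed

lemma cox_poly_mon_comp:
  assumes "Poly_Mapping.keys u \<subseteq> Div_T_plus s r" "Poly_Mapping.keys v \<subseteq> Div_T_plus s r"
  shows "cox_poly s r (mon_comp u v) p = cox_poly s r u p * cox_poly s r v p"
proof -
  have "cox_poly s r (mon_comp u v) p = (\<Sum>D1\<in>Poly_Mapping.keys u. \<Sum>D2\<in>Poly_Mapping.keys v.
     (Poly_Mapping.lookup u D1 * Poly_Mapping.lookup v D2) * cox_monomial s r (D1 + D2) p)"
    by (simp add: mon_comp_def cox_poly_sum)
  also have "\<dots> = cox_poly s r u p * cox_poly s r v p"
    unfolding cox_poly_def sum_product
    using assms by (auto intro!: sum.cong simp: cox_monomial_add subset_iff)
  finally show ?thesis .
qed

lemma keys_mon_comp:
  "Poly_Mapping.keys (mon_comp u v) \<subseteq> {D1 + D2 | D1 D2. D1 \<in> Poly_Mapping.keys u \<and> D2 \<in> Poly_Mapping.keys v}"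
  unfolding mon_comp_def
  by (intro keys_sum_subset) (auto split: if_splits)

text \<open>Dedekind's argument. The operators \<open>T\<close> have all the functions as eigenvectors and separate any two
  of them. Composing a relation with \<open>T\<close> and subtracting \<open>l d\<close> times the relation eliminates \<open>d\<close> and
  multiplies the coefficient of \<open>e\<close> by \<open>l e - l d \<noteq> 0\<close>.\<close>

lemma independent_characters:
  fixes ch :: "'d \<Rightarrow> 'p \<Rightarrow> complex"
  assumes "finite A" and "p0 \<in> X" and "\<And>d. d \<in> A \<Longrightarrow> ch d p0 \<noteq> 0"
    and sep: "\<And>d e. d \<in> A \<Longrightarrow> e \<in> A \<Longrightarrow> d \<noteq> e \<Longrightarrow>
        \<exists>T l. T ` X \<subseteq> X \<and> l d \<noteq> l e \<and> (\<forall>f\<in>A. \<forall>p\<in>X. ch f (T p) = l f * ch f p)"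
    and "\<And>p. p \<in> X \<Longrightarrow> (\<Sum>d\<in>A. c d * ch d p) = 0" and "e \<in> A"
  shows "c e = (0::complex)"
  using assms
proof (induction "card A" arbitrary: A c e rule: less_induct)
  case less
  show ?case
  proof (cases "A = {e}")
    case True
    then show ?thesis using less.prems(2,3,5) by force
  next
    case False
    then obtain d where d: "d \<in> A" "d \<noteq> e" using less.prems(6) by blast
    obtain T l where T: "T ` X \<subseteq> X" "l d \<noteq> l e" "\<And>f p. f \<in> A \<Longrightarrow> p \<in> X \<Longrightarrow> ch f (T p) = l f * ch f p"
      using less.prems(4)[OF d(1) less.prems(6) d(2)] by blast
    have "(\<lambda>f. c f * (l f - l d)) e = 0"
    proof (rule less.hyps[where c = "\<lambda>f. c f * (l f - l d)" and e = e and A = "A - {d}"])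
      show "card (A - {d}) < card A" using d less.prems(1) by (meson card_Diff1_less)
      show "finite (A - {d})" "p0 \<in> X" "e \<in> A - {d}" using less.prems d by auto
      show "ch f p0 \<noteq> 0" if "f \<in> A - {d}" for f using that less.prems(3) by auto
      show "\<exists>T l. T ` X \<subseteq> X \<and> l f \<noteq> l g \<and> (\<forall>f\<in>A - {d}. \<forall>p\<in>X. ch f (T p) = l f * ch f p)"
        if "f \<in> A - {d}" "g \<in> A - {d}" "f \<noteq> g" for f g
        using less.prems(4)[of f g] that by blast
      show "(\<Sum>f\<in>A - {d}. c f * (l f - l d) * ch f p) = 0" if "p \<in> X" for p
      proof -
        have "(\<Sum>f\<in>A - {d}. c f * (l f - l d) * ch f p) = (\<Sum>f\<in>A. c f * (l f - l d) * ch f p)"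
          using less.prems(1) d by (subst sum.remove[of A d]) auto
        also have "\<dots> = (\<Sum>f\<in>A. c f * ch f (T p)) - l d * (\<Sum>f\<in>A. c f * ch f p)"
          using that by (simp add: T(3) sum_distrib_left sum_subtractf[symmetric] algebra_simps)
        also have "\<dots> = 0" using that T(1) less.prems(5) by (auto simp: image_subset_iff)
        finally show ?thesis .
      qed
    qed
    then show ?thesis using T(2) by simp
  qed
qed

text \<open>Two effective divisors differ in the multiplicity of some \<open>v\<close>. Doubling the coordinate \<open>v\<close>
  multiplies their monomials by different powers of \<open>2\<close> and preserves the open orbit.\<close>

lemma cox_monomials_independent:
  assumes "finite A" "A \<subseteq> Div_T_plus s r"
    and "\<And>p. p \<in> open_orbit s r \<Longrightarrow> (\<Sum>D\<in>A. c D * cox_monomial s r D p) = 0" and "D \<in> A"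
  shows "c D = 0"
proof (rule independent_characters[where X = "open_orbit s r" and ch = "cox_monomial s r"])
  let ?one = "pt_of (\<lambda>v. if v \<in> toric_primes s r then 1 else 0)"
  show "?one \<in> open_orbit s r" by (simp add: open_orbit_def)
  show "cox_monomial s r d ?one \<noteq> 0" if "d \<in> A" for d by (simp add: cox_monomial_def)
  fix d e assume de: "d \<in> A" "e \<in> A" "d \<noteq> e"
  then obtain v where v: "Poly_Mapping.lookup d v \<noteq> Poly_Mapping.lookup e v" using poly_mapping_eqI by metis
  have nn: "\<And>f. f \<in> A \<Longrightarrow> Poly_Mapping.lookup f v \<ge> 0" using assms(2) by (auto simp: Div_T_plus_def)
  have "v \<in> toric_primes s r" if "f \<in> A" "Poly_Mapping.lookup f v \<noteq> 0" for f
    using that assms(2) unfolding Div_T_plus_def Div_T_def toric_primes_def by (auto simp flip: in_keys_iff)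
  then have vin: "v \<in> toric_primes s r" using v de by metis
  define T where "T p = pt_of (\<lambda>w. (if w = v then 2 else 1) * coord p w)" for p
  define l where "l f = (2::complex) ^ nat (Poly_Mapping.lookup f v)" for f :: divisor
  have "T ` open_orbit s r \<subseteq> open_orbit s r"
  proof (rule image_subsetI)
    fix p assume p: "p \<in> open_orbit s r"
    have "coord (T p) w \<noteq> 0 \<longleftrightarrow> coord p w \<noteq> 0" for w by (simp add: T_def)
    then show "T p \<in> open_orbit s r" using p by (simp only: open_orbit_def mem_Collect_eq) blast
  qed
  moreover have "l d \<noteq> l e"
  proof
    assume "l d = l e"
    then have "norm (l d) = norm (l e)" by simp
    then have "(2::real) ^ nat (Poly_Mapping.lookup d v) = 2 ^ nat (Poly_Mapping.lookup e v)"
      by (simp add: l_def norm_power del: power_inject_exp)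
    then have "nat (Poly_Mapping.lookup d v) = nat (Poly_Mapping.lookup e v)"
      by (subst (asm) power_inject_exp) auto
    then show False using v nn[OF de(1)] nn[OF de(2)] by linarith
  qed
  moreover have "cox_monomial s r f (T p) = l f * cox_monomial s r f p" for f p
  proof -
    have "cox_monomial s r f (T p) = (\<Prod>w\<in>toric_primes s r.
        (if w = v then l f else 1) * coord p w ^ nat (Poly_Mapping.lookup f w))"
      unfolding cox_monomial_def by (rule prod.cong) (simp_all add: T_def l_def power_mult_distrib)
    also have "\<dots> = l f * cox_monomial s r f p"
      using vin by (simp add: prod.distrib cox_monomial_def)
    finally show ?thesis .
  qed
  ultimately show "\<exists>T l. T ` open_orbit s r \<subseteq> open_orbit s r \<and> l d \<noteq> l e \<and>
      (\<forall>f\<in>A. \<forall>p\<in>open_orbit s r. cox_monomial s r f (T p) = l f * cox_monomial s r f p)" by blast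
qed (use assms in auto)

lemma cox_poly_inject:
  assumes "Poly_Mapping.keys u \<subseteq> Div_T_plus s r" "Poly_Mapping.keys v \<subseteq> Div_T_plus s r"
    and "\<And>p. p \<in> open_orbit s r \<Longrightarrow> cox_poly s r u p = cox_poly s r v p"
  shows "u = v"
proof (rule poly_mapping_eqI)
  fix D
  let ?A = "Poly_Mapping.keys u \<union> Poly_Mapping.keys v"
  show "Poly_Mapping.lookup u D = Poly_Mapping.lookup v D"
  proof (cases "D \<in> ?A")
    case True
    have "(\<lambda>D. Poly_Mapping.lookup u D - Poly_Mapping.lookup v D) D = 0"
    proof (rule cox_monomials_independent[OF _ _ _ True])
      fix p assume "p \<in> open_orbit s r"
      then have "cox_poly s r u p - cox_poly s r v p = 0" using assms(3) by simp
      then show "(\<Sum>D\<in>?A. (Poly_Mapping.lookup u D - Poly_Mapping.lookup v D) * cox_monomial s r D p) = 0"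
        by (simp add: cox_poly_superset[of ?A] sum_subtractf left_diff_distrib)
    qed (use assms in auto)
    then show ?thesis by simp
  next
    case False
    then show ?thesis by (simp add: in_keys_iff)
  qed
qed


section \<open>Regular functions on the cone are Cox polynomials\<close>

lemma generated_algebra_holomorphic:
  assumes "g \<in> generated_algebra G" and "\<And>h. h \<in> G \<Longrightarrow> (\<lambda>u. h (\<kappa> u)) holomorphic_on \<Omega>"
  shows "(\<lambda>u. g (\<kappa> u)) holomorphic_on \<Omega>"
  using assms(1)
proof induction
  case (gen g)
  then show ?case by (rule assms(2))
qed (auto intro: holomorphic_intros)

lemma polynomials_holomorphic:
  assumes "g \<in> polynomials s r" and "\<And>v. (\<lambda>u. coord (\<kappa> u) v) holomorphic_on \<Omega>"
  shows "(\<lambda>u. g (\<kappa> u)) holomorphic_on \<Omega>"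
proof (rule generated_algebra_holomorphic[where g = g and \<kappa> = \<kappa>])
  show "g \<in> generated_algebra ({\<lambda>p. fst p i | i. i \<le> s} \<union> {\<lambda>p. snd p j | j. j \<le> r})"
    using assms(1) by (simp add: polynomials_def)
  fix h :: "pt \<Rightarrow> complex"
  assume "h \<in> {\<lambda>p. fst p i | i. i \<le> s} \<union> {\<lambda>p. snd p j | j. j \<le> r}"
  then consider i where "h = (\<lambda>p. fst p i)" | j where "h = (\<lambda>p. snd p j)" by blast
  then show "(\<lambda>u. h (\<kappa> u)) holomorphic_on \<Omega>"
  proof cases
    case (1 i)
    then show ?thesis using assms(2)[of "Vv i"] by simp
  next
    case (2 j)
    then show ?thesis using assms(2)[of "Ve j"] by simp
  qed
qed

text \<open>The bridge from regularity to complex analysis: a function that is locally a quotient of polynomials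
  becomes a holomorphic function of one variable along every holomorphic curve in its domain.\<close>

lemma regular_on_holomorphic:
  assumes reg: "regular_on s r W \<sigma>" and hol: "\<And>v. (\<lambda>u. coord (\<kappa> u) v) holomorphic_on \<Omega>"
    and "open \<Omega>" and W: "\<And>u. u \<in> \<Omega> \<Longrightarrow> \<kappa> u \<in> W"
  shows "(\<lambda>u. \<sigma> (\<kappa> u)) holomorphic_on \<Omega>"
  unfolding holomorphic_on_open[OF \<open>open \<Omega>\<close>]
proof
  fix u assume u: "u \<in> \<Omega>"
  obtain g h where gh: "g \<in> polynomials s r" "h \<in> polynomials s r" "h (\<kappa> u) \<noteq> 0"
      "\<And>q. q \<in> W \<Longrightarrow> h q \<noteq> 0 \<Longrightarrow> \<sigma> q = g q / h q"
    using reg W[OF u] unfolding regular_on_def by blast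
  have hg: "(\<lambda>u. g (\<kappa> u)) holomorphic_on \<Omega>" and hh: "(\<lambda>u. h (\<kappa> u)) holomorphic_on \<Omega>"
    using polynomials_holomorphic[OF _ hol] gh by auto
  let ?N = "\<Omega> \<inter> (\<lambda>u. h (\<kappa> u)) -` (- {0})"
  have "open ?N"
    using holomorphic_on_imp_continuous_on[OF hh] \<open>open \<Omega>\<close> by (intro continuous_open_preimage) auto
  moreover have "u \<in> ?N" using u gh by simp
  moreover have "(\<lambda>u. g (\<kappa> u) / h (\<kappa> u)) holomorphic_on ?N"
    using hg hh by (auto intro!: holomorphic_intros elim: holomorphic_on_subset)
  then have "(\<lambda>u. \<sigma> (\<kappa> u)) holomorphic_on ?N"
    by (rule holomorphic_transform) (use gh W in auto)
  ultimately show "\<exists>f'. ((\<lambda>u. \<sigma> (\<kappa> u)) has_field_derivative f') (at u)"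
    by (metis holomorphic_on_open)
qed

text \<open>Since \<open>g\<close> is bounded near \<open>0\<close>, the function \<open>f\<close> grows at most like the \<open>d\<close>-th power, and
  Liouville's theorem applies.\<close>

lemma polynomial_of_growth:
  assumes hol: "f holomorphic_on UNIV" and cont: "isCont g 0"
    and fg: "\<And>u. u \<noteq> 0 \<Longrightarrow> f u = u powi m * g (1 / u)" and m: "nat m \<le> d"
  shows "\<exists>P. degree P \<le> d \<and> (\<forall>u. f u = poly P u)"
proof -
  obtain \<delta> where \<delta>: "\<delta> > 0" "\<And>e. dist e 0 < \<delta> \<Longrightarrow> dist (g e) (g 0) < 1"
    using cont[unfolded continuous_at, THEN tendstoD, of 1] cont
    by (metis continuous_at_eps_delta dist_norm zero_less_one)
  have "norm (f u) \<le> (norm (g 0) + 1) * norm u ^ d" if u: "norm u \<ge> max 1 (2 / \<delta>)" for u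
  proof -
    have "norm u \<noteq> 0" using u by (metis max.bounded_iff not_one_le_zero)
    then have u0: "u \<noteq> 0" by simp
    have "2 \<le> norm u * \<delta>" using u \<delta>(1) by (simp add: field_simps)
    then have "dist (1 / u) 0 < \<delta>" using u0 \<delta>(1) by (simp add: norm_divide field_simps)
    then have "norm (g (1 / u)) \<le> norm (g 0) + 1" using \<delta>(2)
      by (smt (verit, ccfv_SIG) dist_norm norm_triangle_sub)
    moreover have "norm (u powi m) \<le> norm u ^ d"
    proof -
      have "norm u powi m \<le> norm u powi int d"
        using u m by (intro power_int_increasing) auto
      then show ?thesis by (simp add: norm_power_int)
    qed
    ultimately show ?thesis
      using fg[OF u0] by (simp add: norm_mult mult.commute mult_mono)
  qed
  from Liouville_polynomial[OF hol this]
  have "f u = (\<Sum>k\<le>d. (deriv ^^ k) f 0 / fact k * u ^ k)" for u .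
  moreover have "degree (\<Sum>k\<le>d. monom ((deriv ^^ k) f 0 / fact k) k) \<le> d"
    by (intro degree_sum_le) (auto intro: order.trans[OF degree_monom_le])
  ultimately show ?thesis
    by (intro exI[of _ "\<Sum>k\<le>d. monom ((deriv ^^ k) f 0 / fact k) k"]) (simp add: poly_sum poly_monom)
qed

text \<open>The nodes are \<open>1, \<dots>, d + 1\<close> instead of \<open>0, \<dots>, d\<close>, because substituting a node for a coordinate must
  not lead out of the open orbit.\<close>

definition lagrange_basis :: "nat \<Rightarrow> nat \<Rightarrow> complex poly" where
  "lagrange_basis d j =
     (\<Prod>i\<in>{..d} - {j}. smult (1 / (of_nat (Suc j) - of_nat (Suc i))) [:- of_nat (Suc i), 1:])"

lemma poly_lagrange_basis:
  "i \<le> d \<Longrightarrow> poly (lagrange_basis d j) (of_nat (Suc i)) = (if i = j then 1 else 0)"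
proof -
  assume i: "i \<le> d"
  show ?thesis
  proof (cases "i = j")
    case True
    have "poly (smult (1 / (of_nat (Suc j) - of_nat (Suc x))) [:- of_nat (Suc x), 1:]) (of_nat (Suc j)) = (1::complex)"
      if "x \<noteq> j" for x
      using that by (simp add: divide_simps)
    then show ?thesis
      using True unfolding lagrange_basis_def poly_prod by (simp del: of_nat_Suc poly_smult)
  next
    case False
    moreover have "poly (smult c [:- of_nat (Suc i), 1:]) (of_nat (Suc i)) = (0::complex)" for c
      by (simp add: algebra_simps)
    ultimately show ?thesis
      using i unfolding lagrange_basis_def poly_prod
      by (auto intro!: prod_zero bexI[of _ i] simp del: of_nat_Suc poly_smult)
  qed
qed

lemma degree_lagrange_basis: "j \<le> d \<Longrightarrow> degree (lagrange_basis d j) \<le> d"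
proof -
  assume j: "j \<le> d"
  have "degree (lagrange_basis d j) \<le> (\<Sum>i\<in>{..d} - {j}. 1)"
    unfolding lagrange_basis_def
    by (rule order.trans[OF degree_prod_sum_le]) (auto intro!: sum_mono order.trans[OF degree_smult_le])
  then show ?thesis using j by simp
qed

lemma lagrange_interpolation:
  assumes "degree P \<le> d"
  shows "poly P u = (\<Sum>j\<le>d. poly P (of_nat (Suc j)) * poly (lagrange_basis d j) u)"
proof -
  let ?Q = "\<Sum>j\<le>d. smult (poly P (of_nat (Suc j))) (lagrange_basis d j)"
  have "inj_on (\<lambda>i. of_nat (Suc i) :: complex) {..d}" by (auto simp: inj_on_def simp del: of_nat_Suc)
  then have card: "card ((\<lambda>i. of_nat (Suc i) :: complex) ` {..d}) = Suc d" by (simp add: card_image del: of_nat_Suc)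
  have "P = ?Q"
  proof (rule poly_eqI_degree[where A = "(\<lambda>i. of_nat (Suc i)) ` {..d}"])
    show "poly P x = poly ?Q x" if "x \<in> (\<lambda>i. of_nat (Suc i)) ` {..d}" for x
      using that by (auto simp: poly_sum poly_lagrange_basis if_distrib[of "\<lambda>x. _ * x"] simp del: of_nat_Suc cong: if_cong)
    have "degree ?Q \<le> d"
      by (intro degree_sum_le) (auto intro: order.trans[OF degree_smult_le degree_lagrange_basis] simp del: degree_smult_eq)
    then show "degree ?Q < card ((\<lambda>i. of_nat (Suc i) :: complex) ` {..d})" unfolding card by simp
    show "degree P < card ((\<lambda>i. of_nat (Suc i) :: complex) ` {..d})" using assms unfolding card by simp
  qed
  then have "poly P u = poly ?Q u" by simp
  then show ?thesis by (simp add: poly_sum)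
qed

definition is_cox_poly :: "nat \<Rightarrow> nat \<Rightarrow> pt set \<Rightarrow> (pt \<Rightarrow> complex) \<Rightarrow> bool" where
  "is_cox_poly s r X f \<longleftrightarrow>
     (\<exists>u. Poly_Mapping.keys u \<subseteq> Div_T_plus s r \<and> (\<forall>p\<in>X. f p = cox_poly s r u p))"

lemma is_cox_poly_const: "is_cox_poly s r X (\<lambda>_. c)"
  unfolding is_cox_poly_def
  by (rule exI[of _ "Poly_Mapping.single 0 c"]) (auto simp: cox_monomial_def zero_in_Div_T_plus)

lemma is_cox_poly_coord: "v \<in> toric_primes s r \<Longrightarrow> is_cox_poly s r X (\<lambda>p. coord p v)"
proof -
  assume v: "v \<in> toric_primes s r"
  have "cox_monomial s r (Poly_Mapping.single v 1) p = coord p v" for p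
  proof -
    have "cox_monomial s r (Poly_Mapping.single v 1) p =
        (\<Prod>w\<in>toric_primes s r. if w = v then coord p v else 1)"
      unfolding cox_monomial_def by (rule prod.cong) (auto simp: lookup_single when_def)
    then show ?thesis using v by simp
  qed
  moreover have "Poly_Mapping.single v 1 \<in> Div_T_plus s r"
    using v by (auto simp: Div_T_plus_def Div_T_def toric_primes_def lookup_single when_def)
  ultimately show ?thesis
    unfolding is_cox_poly_def
    by (intro exI[of _ "Poly_Mapping.single (Poly_Mapping.single v 1) 1"]) auto
qed

lemma is_cox_poly_add:
  assumes "is_cox_poly s r X f" "is_cox_poly s r X g"
  shows "is_cox_poly s r X (\<lambda>p. f p + g p)"
proof -
  obtain u v where u: "Poly_Mapping.keys u \<subseteq> Div_T_plus s r" "\<And>p. p \<in> X \<Longrightarrow> f p = cox_poly s r u p"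
    and v: "Poly_Mapping.keys v \<subseteq> Div_T_plus s r" "\<And>p. p \<in> X \<Longrightarrow> g p = cox_poly s r v p"
    using assms unfolding is_cox_poly_def by blast
  have "Poly_Mapping.keys (u + v) \<subseteq> Div_T_plus s r"
    using Poly_Mapping.keys_add[of u v] u(1) v(1) by blast
  then show ?thesis
    unfolding is_cox_poly_def by (intro exI[of _ "u + v"]) (simp add: cox_poly_add u v)
qed

lemma is_cox_poly_mult:
  assumes "is_cox_poly s r X f" "is_cox_poly s r X g"
  shows "is_cox_poly s r X (\<lambda>p. f p * g p)"
proof -
  obtain u v where u: "Poly_Mapping.keys u \<subseteq> Div_T_plus s r" "\<And>p. p \<in> X \<Longrightarrow> f p = cox_poly s r u p"
    and v: "Poly_Mapping.keys v \<subseteq> Div_T_plus s r" "\<And>p. p \<in> X \<Longrightarrow> g p = cox_poly s r v p"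
    using assms unfolding is_cox_poly_def by blast
  have "Poly_Mapping.keys (mon_comp u v) \<subseteq> Div_T_plus s r"
    using keys_mon_comp[of u v] u(1) v(1) by (auto intro!: Div_T_plus_add)
  then show ?thesis
    unfolding is_cox_poly_def
    by (intro exI[of _ "mon_comp u v"]) (auto simp: cox_poly_mon_comp u v)
qed

lemma is_cox_poly_sum:
  "(\<And>i. i \<in> I \<Longrightarrow> is_cox_poly s r X (f i)) \<Longrightarrow> is_cox_poly s r X (\<lambda>p. \<Sum>i\<in>I. f i p)"
  by (induction I rule: infinite_finite_induct) (auto simp: is_cox_poly_const intro!: is_cox_poly_add)

lemma is_cox_poly_poly:
  "v \<in> toric_primes s r \<Longrightarrow> is_cox_poly s r X (\<lambda>p. poly Q (coord p v))"
  by (induction Q) (auto simp: is_cox_poly_const intro!: is_cox_poly_add is_cox_poly_mult is_cox_poly_coord)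

context twisted_bundle
begin

lemma pt_of_in_cone:
  assumes "\<And>v. \<xi> v \<noteq> 0 \<Longrightarrow> v \<in> toric_primes s r" "\<xi> (Vv i) \<noteq> 0" "\<xi> (Ve j) \<noteq> 0"
  shows "pt_of \<xi> \<in> cone s r"
proof -
  have "\<xi> (Vv i) = 0" if "i > s" for i using assms(1)[of "Vv i"] that by auto
  moreover have "\<xi> (Ve j) = 0" if "j > r" for j using assms(1)[of "Ve j"] that by auto
  ultimately show ?thesis using assms(2,3) by (auto simp: cone_def pt_of_def)
qed

text \<open>Up to the action of the torus, letting one coordinate \<open>u\<close> tend to infinity is the same as letting
  other coordinates tend to \<open>0\<close>. If \<open>u\<close> is the coordinate \<open>x i\<close>, the element \<open>(u, u ^ a r)\<close> carries a
  point with \<open>x i = 1\<close>, with the other \<open>x\<close> multiplied by \<open>1 / u\<close> and with \<open>y j\<close> multiplied by the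
  \<open>(a r - a j)\<close>-th power of \<open>1 / u\<close>, to the given one. The exponents are nonnegative since \<open>a r\<close> is the
  largest twist, and the limit for \<open>1 / u = 0\<close> is in the cone since \<open>x i = 1\<close> and \<open>y r\<close> is unchanged.
  So the section grows like \<open>u ^ (k + a r * l)\<close>. If \<open>u\<close> is a coordinate \<open>y j\<close>, the element \<open>(1, u)\<close>
  and the point with \<open>y j = 1\<close> and the other \<open>y\<close> multiplied by \<open>1 / u\<close> play the same role, and the
  section grows like \<open>u ^ l\<close>.\<close>

lemma regular_section_polynomial_in_coordinate:
  assumes reg: "regular_on s r (cone s r) \<sigma>"
    and weight: "\<And>p u v. p \<in> cone s r \<Longrightarrow> u \<noteq> 0 \<Longrightarrow> v \<noteq> 0 \<Longrightarrow> \<sigma> (act a u v p) = u powi k * v powi l * \<sigma> p"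
    and \<xi>: "\<And>w. \<xi> w \<noteq> 0 \<longleftrightarrow> w \<in> toric_primes s r" and v: "v \<in> toric_primes s r"
    and d: "nat l \<le> d" "nat (k + a r * l) \<le> d"
  shows "\<exists>P. degree P \<le> d \<and> (\<forall>u. \<sigma> (pt_of (\<xi>(v := u))) = poly P u)"
proof -
  \<comment> \<open>The coordinates \<open>i'\<close> and \<open>j'\<close> stay nonzero and keep the whole coordinate line in the cone.\<close>
  obtain i' where i': "i' \<le> s" "v \<noteq> Vv i'" using s_pos by (cases "v = Vv 0") auto
  obtain j' where j': "j' \<le> r" "v \<noteq> Ve j'" using r_pos by (cases "v = Ve 0") auto
  have "pt_of (\<xi>(v := u)) \<in> cone s r" for u
    by (rule pt_of_in_cone[of _ i' j']) (use \<xi> v i' j' in \<open>auto split: if_splits\<close>)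
  moreover have "(\<lambda>u. coord (pt_of (\<xi>(v := u))) w) holomorphic_on UNIV" for w
    by (cases "w = v") (auto intro!: holomorphic_intros)
  ultimately have hol: "(\<lambda>u. \<sigma> (pt_of (\<xi>(v := u)))) holomorphic_on UNIV"
    by (intro regular_on_holomorphic[OF reg]) auto
  show ?thesis
  proof (cases v)
    case (Vv i)
    define \<xi>' where "\<xi>' e = (\<lambda>w. case w of Vv i' \<Rightarrow> if i' = i then 1 else e * \<xi> w
        | Ve j \<Rightarrow> e ^ nat (a r - a j) * \<xi> w)" for e :: complex
    have "i \<le> s" using Vv v by simp
    have cone: "pt_of (\<xi>' e) \<in> cone s r" for e
      by (rule pt_of_in_cone[of _ i r]) (use \<xi> \<open>i \<le> s\<close> in \<open>auto simp: \<xi>'_def split: toric_prime.splits if_splits\<close>)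
    have "(\<lambda>e. coord (pt_of (\<xi>' e)) w) holomorphic_on UNIV" for w
      by (cases "w = v"; cases w) (auto simp: Vv \<xi>'_def intro!: holomorphic_intros)
    then have "(\<lambda>e. \<sigma> (pt_of (\<xi>' e))) holomorphic_on UNIV"
      using cone by (intro regular_on_holomorphic[OF reg]) auto
    then have cont: "isCont (\<lambda>e. \<sigma> (pt_of (\<xi>' e))) 0"
      using holomorphic_on_imp_continuous_on continuous_on_eq_continuous_at by blast
    show ?thesis
    proof (rule polynomial_of_growth[OF hol cont _ d(2)])
      fix u :: complex assume u: "u \<noteq> 0"
      have "u powi (- a j) * u powi (a r) * (1 / u) ^ nat (a r - a j) = 1" if "j \<le> r" for j
      proof -
        have "a j \<le> a r" using a_mono that by simp
        then have "(1 / u) ^ nat (a r - a j) = inverse (u powi (a r - a j))"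
          by (simp add: power_int_def power_one_over inverse_eq_divide)
        moreover have "u powi (- a j) * u powi (a r) = u powi (a r - a j)"
          using u by (simp add: power_int_add[symmetric])
        ultimately show ?thesis using u by simp
      qed
      then have "u powi (- a j) * u powi (a r) * ((1 / u) ^ nat (a r - a j) * \<xi> (Ve j)) = \<xi> (Ve j)" for j
        using \<xi>[of "Ve j"] by (cases "j \<le> r") (simp_all flip: mult.assoc)
      then have "act a u (u powi (a r)) (pt_of (\<xi>' (1 / u))) = pt_of (\<xi>(v := u))"
        using u Vv by (auto simp: act_def pt_of_def \<xi>'_def fun_eq_iff)
      moreover have "\<sigma> (act a u (u powi (a r)) (pt_of (\<xi>' (1 / u)))) =
          u powi k * (u powi (a r)) powi l * \<sigma> (pt_of (\<xi>' (1 / u)))"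
        using u by (intro weight cone) auto
      ultimately show "\<sigma> (pt_of (\<xi>(v := u))) = u powi (k + a r * l) * \<sigma> (pt_of (\<xi>' (1 / u)))"
        using u by (simp add: power_int_add power_int_mult)
    qed
  next
    case (Ve j)
    define \<xi>' where "\<xi>' e = (\<lambda>w. case w of Vv i \<Rightarrow> \<xi> w | Ve j' \<Rightarrow> if j' = j then 1 else e * \<xi> w)"
      for e :: complex
    have "j \<le> r" using Ve v by simp
    have cone: "pt_of (\<xi>' e) \<in> cone s r" for e
      by (rule pt_of_in_cone[of _ 0 j]) (use \<xi> \<open>j \<le> r\<close> in \<open>auto simp: \<xi>'_def split: toric_prime.splits if_splits\<close>)
    have "(\<lambda>e. coord (pt_of (\<xi>' e)) w) holomorphic_on UNIV" for w
      by (cases "w = v"; cases w) (auto simp: Ve \<xi>'_def intro!: holomorphic_intros)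
    then have "(\<lambda>e. \<sigma> (pt_of (\<xi>' e))) holomorphic_on UNIV"
      using cone by (intro regular_on_holomorphic[OF reg]) auto
    then have cont: "isCont (\<lambda>e. \<sigma> (pt_of (\<xi>' e))) 0"
      using holomorphic_on_imp_continuous_on continuous_on_eq_continuous_at by blast
    show ?thesis
    proof (rule polynomial_of_growth[OF hol cont _ d(1)])
      fix u :: complex assume u: "u \<noteq> 0"
      have "act a 1 u (pt_of (\<xi>' (1 / u))) = pt_of (\<xi>(v := u))"
        using u Ve by (auto simp: act_def pt_of_def \<xi>'_def fun_eq_iff)
      moreover have "\<sigma> (act a 1 u (pt_of (\<xi>' (1 / u)))) = 1 powi k * u powi l * \<sigma> (pt_of (\<xi>' (1 / u)))"
        using u by (intro weight cone) auto
      ultimately show "\<sigma> (pt_of (\<xi>(v := u))) = u powi l * \<sigma> (pt_of (\<xi>' (1 / u)))" by simp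
    qed
  qed
qed

text \<open>Interpolation expresses the section through its values at the nodes of one coordinate \<open>v\<close>, with
  polynomials in that coordinate as coefficients. Hence induction on the set \<open>V\<close> of coordinates that
  vary, the remaining ones being frozen at nonzero values \<open>\<nu>\<close>, reduces to a constant.\<close>

lemma regular_section_cox_poly_on_open_orbit:
  assumes reg: "regular_on s r (cone s r) \<sigma>"
    and weight: "\<And>p u v. p \<in> cone s r \<Longrightarrow> u \<noteq> 0 \<Longrightarrow> v \<noteq> 0 \<Longrightarrow> \<sigma> (act a u v p) = u powi k * v powi l * \<sigma> p"
  shows "is_cox_poly s r (open_orbit s r) \<sigma>"
proof -
  define d where "d = nat l + nat (k + a r * l)"
  define mix where "mix V \<nu> p = (\<lambda>w. if w \<in> V then coord p w else \<nu> w)"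
    for V p and \<nu> :: "toric_prime \<Rightarrow> complex"
  have "is_cox_poly s r (open_orbit s r) (\<lambda>p. \<sigma> (pt_of (mix V \<nu> p)))"
    if "finite V" "\<And>w. \<nu> w \<noteq> 0 \<longleftrightarrow> w \<in> toric_primes s r" "V \<subseteq> toric_primes s r" for V \<nu>
    using that
  proof (induction V arbitrary: \<nu> rule: finite_induct)
    case empty
    then show ?case by (simp add: mix_def is_cox_poly_const)
  next
    case (insert v V)
    let ?\<nu> = "\<lambda>j. \<nu>(v := of_nat (Suc j))"
    have IH: "is_cox_poly s r (open_orbit s r) (\<lambda>p. \<sigma> (pt_of (mix V (?\<nu> j) p)))" for j
      using insert.prems by (intro insert.IH) (auto simp del: of_nat_Suc)
    have "is_cox_poly s r (open_orbit s r)
       (\<lambda>p. \<Sum>j\<le>d. \<sigma> (pt_of (mix V (?\<nu> j) p)) * poly (lagrange_basis d j) (coord p v))"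
      using insert.prems by (intro is_cox_poly_sum is_cox_poly_mult is_cox_poly_poly IH) auto
    moreover have "\<sigma> (pt_of (mix (insert v V) \<nu> p)) =
      (\<Sum>j\<le>d. \<sigma> (pt_of (mix V (?\<nu> j) p)) * poly (lagrange_basis d j) (coord p v))"
      if p: "p \<in> open_orbit s r" for p
    proof -
      define \<xi> where "\<xi> = mix (insert v V) \<nu> p"
      have "\<exists>P. degree P \<le> d \<and> (\<forall>u. \<sigma> (pt_of (\<xi>(v := u))) = poly P u)"
        using insert.prems p
        by (intro regular_section_polynomial_in_coordinate[OF reg weight])
           (auto simp: \<xi>_def mix_def open_orbit_def d_def)
      then obtain P where P: "degree P \<le> d" "\<And>u. \<sigma> (pt_of (\<xi>(v := u))) = poly P u" by blast
      have "\<xi>(v := coord p v) = mix (insert v V) \<nu> p" by (auto simp: \<xi>_def mix_def)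
      moreover have "\<xi>(v := of_nat (Suc j)) = mix V (?\<nu> j) p" for j
        using insert.hyps by (auto simp: \<xi>_def mix_def fun_eq_iff)
      ultimately show ?thesis
        using lagrange_interpolation[OF P(1), of "coord p v"] by (simp add: P(2)[symmetric] del: of_nat_Suc)
    qed
    ultimately show ?case unfolding is_cox_poly_def by auto
  qed
  note this[of "toric_primes s r" "\<lambda>w. if w \<in> toric_primes s r then 1 else 0"]
  moreover have "mix (toric_primes s r) (\<lambda>w. if w \<in> toric_primes s r then 1 else 0) p = coord p"
    if "p \<in> open_orbit s r" for p
    using that by (auto simp: mix_def open_orbit_def fun_eq_iff)
  ultimately show ?thesis unfolding is_cox_poly_def by auto
qed

end


section \<open>Homomorphisms of line bundles\<close>

lemma act_in_cone: "p \<in> cone s r \<Longrightarrow> u \<noteq> 0 \<Longrightarrow> v \<noteq> 0 \<Longrightarrow> act a u v p \<in> cone s r"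
  by (auto simp: cone_def act_def)

lemma coord_act:
  "coord (act a u v p) (Vv i) = u * coord p (Vv i)"
  "coord (act a u v p) (Ve j) = u powi (- a j) * v * coord p (Ve j)"
  by (simp_all add: act_def split: prod.split)

lemma act_one: "act a 1 1 p = p"
  by (simp add: act_def split: prod.split)

lemma act_act: "u \<noteq> 0 \<Longrightarrow> u' \<noteq> 0 \<Longrightarrow> act a u v (act a u' v' p) = act a (u * u') (v * v') p"
  by (auto simp: act_def power_int_mult_distrib fun_eq_iff mult_ac split: prod.split)

lemma Union_proj_bundle: "\<Union>(proj_bundle s r a) = cone s r"
proof
  show "\<Union>(proj_bundle s r a) \<subseteq> cone s r" by (auto simp: proj_bundle_def act_in_cone)
  show "cone s r \<subseteq> \<Union>(proj_bundle s r a)"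
  proof
    fix p assume "p \<in> cone s r"
    then have "{act a u v p | u v. u \<noteq> 0 \<and> v \<noteq> 0} \<in> proj_bundle s r a" by (simp add: proj_bundle_def)
    moreover have "p \<in> {act a u v p | u v. u \<noteq> 0 \<and> v \<noteq> 0}"
      by (rule CollectI, rule exI[of _ 1], rule exI[of _ 1]) (simp add: act_one)
    ultimately show "p \<in> \<Union>(proj_bundle s r a)" by blast
  qed
qed

lemma cox_monomial_act:
  assumes "D \<in> Div_T_plus s r" "u \<noteq> 0" "v \<noteq> 0"
  shows "cox_monomial s r D (act a u v p) =
    u powi deg1 s r a D * v powi deg2 r D * cox_monomial s r D p"
proof -
  have nn: "0 \<le> Poly_Mapping.lookup D w" for w using assms(1) by (simp add: Div_T_plus_def)
  have x: "(u * c) ^ nat (Poly_Mapping.lookup D w) =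
      u powi Poly_Mapping.lookup D w * c ^ nat (Poly_Mapping.lookup D w)" for c w
    using nn[of w] by (simp add: power_mult_distrib power_int_def)
  have y: "(u powi (- a j) * v * c) ^ nat (Poly_Mapping.lookup D w) =
      u powi (- a j * Poly_Mapping.lookup D w) * v powi Poly_Mapping.lookup D w * c ^ nat (Poly_Mapping.lookup D w)" for c w j
  proof -
    have "u powi (- a j * Poly_Mapping.lookup D w) = (u powi (- a j)) ^ nat (Poly_Mapping.lookup D w)"
      using nn[of w] by (metis int_nat_eq power_int_mult power_int_of_nat)
    moreover have "v powi Poly_Mapping.lookup D w = v ^ nat (Poly_Mapping.lookup D w)"
      using nn[of w] by (simp add: power_int_def)
    ultimately show ?thesis by (simp add: power_mult_distrib)
  qed
  have e: "(\<Prod>i\<in>I. c powi f i) = c powi (\<Sum>i\<in>I. f i)" if "c \<noteq> 0" for c :: complex and f :: "nat \<Rightarrow> int" and I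
    using that by (induction I rule: infinite_finite_induct) (auto simp: power_int_add)
  have "cox_monomial s r D (act a u v p) =
      (\<Prod>i=0..s. u powi Poly_Mapping.lookup D (Vv i)) *
      (\<Prod>j=0..r. u powi (- a j * Poly_Mapping.lookup D (Ve j))) *
      (\<Prod>j=0..r. v powi Poly_Mapping.lookup D (Ve j)) * cox_monomial s r D p"
    unfolding cox_monomial_def prod_toric_primes coord_act x y by (simp add: prod.distrib mult_ac)
  also have "(\<Prod>i=0..s. u powi Poly_Mapping.lookup D (Vv i)) *
      (\<Prod>j=0..r. u powi (- a j * Poly_Mapping.lookup D (Ve j))) = u powi deg1 s r a D"
    using assms by (simp add: e deg1_def power_int_add[symmetric] sum_negf)
  also have "(\<Prod>j=0..r. v powi Poly_Mapping.lookup D (Ve j)) = v powi deg2 r D"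
    using assms by (simp add: e deg2_def)
  finally show ?thesis .
qed

lemma open_orbit_subset_cone: "open_orbit s r \<subseteq> cone s r"
proof
  fix p assume p: "p \<in> open_orbit s r"
  have "fst p i \<noteq> 0 \<longleftrightarrow> i \<le> s" "snd p j \<noteq> 0 \<longleftrightarrow> j \<le> r" for i j
    using p[unfolded open_orbit_def mem_Collect_eq, rule_format, of "Vv i"]
      p[unfolded open_orbit_def mem_Collect_eq, rule_format, of "Ve j"] by simp_all
  then show "p \<in> cone s r" by (cases p) (force simp: cone_def)
qed

lemma cox_poly_holomorphic:
  assumes "\<And>v. (\<lambda>u. coord (\<kappa> u) v) holomorphic_on \<Omega>"
  shows "(\<lambda>u. cox_poly s r q (\<kappa> u)) holomorphic_on \<Omega>"
  unfolding cox_poly_def cox_monomial_def by (intro holomorphic_intros assms)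

text \<open>Adding the same small \<open>u \<noteq> 0\<close> to all coordinates of a point of the cone leads into the open orbit,
  and both sides are continuous in \<open>u\<close>.\<close>

lemma regular_eq_cox_poly_on_cone:
  assumes reg: "regular_on s r (cone s r) \<sigma>"
    and eq: "\<And>p. p \<in> open_orbit s r \<Longrightarrow> \<sigma> p = cox_poly s r q p" and p: "p \<in> cone s r"
  shows "\<sigma> p = cox_poly s r q p"
proof -
  define \<kappa> where "\<kappa> u = pt_of (\<lambda>v. coord p v + (if v \<in> toric_primes s r then u else 0))" for u
  have zero: "coord p v = 0" if "v \<notin> toric_primes s r" for v
    using p that by (cases v) (auto simp: cone_def)
  obtain i j where ij: "coord p (Vv i) \<noteq> 0" "coord p (Ve j) \<noteq> 0"
    using p by (auto simp: cone_def)
  then have ij': "i \<le> s" "j \<le> r" using zero[of "Vv i"] zero[of "Ve j"] by auto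
  define R where "R = min (norm (coord p (Vv i))) (norm (coord p (Ve j)))"
  have R: "R > 0" using ij by (simp add: R_def)
  have hol: "(\<lambda>u. coord (\<kappa> u) v) holomorphic_on ball 0 R" for v
    by (cases "v \<in> toric_primes s r") (auto simp: \<kappa>_def intro!: holomorphic_intros)
  have "\<kappa> u \<in> cone s r" if "u \<in> ball 0 R" for u
  proof -
    have "coord p (Vv i) + u \<noteq> 0" "coord p (Ve j) + u \<noteq> 0"
      using that by (auto simp: R_def add_eq_0_iff2)
    then have "coord (\<kappa> u) (Vv i) \<noteq> 0" "coord (\<kappa> u) (Ve j) \<noteq> 0" using ij' by (simp_all add: \<kappa>_def)
    moreover have "coord (\<kappa> u) v = 0" if "v \<notin> toric_primes s r" for v
      using that zero[OF that] by (simp add: \<kappa>_def)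
    then have "fst (\<kappa> u) i = 0" if "i > s" for i using that by (metis coord_simps(1) not_le toric_primes_iff(1))
    moreover have "snd (\<kappa> u) j = 0" if "j > r" for j
      using that \<open>\<And>v. v \<notin> toric_primes s r \<Longrightarrow> coord (\<kappa> u) v = 0\<close>[of "Ve j"] by simp
    ultimately show ?thesis by (cases "\<kappa> u") (auto simp: cone_def)
  qed
  then have "(\<lambda>u. \<sigma> (\<kappa> u) - cox_poly s r q (\<kappa> u)) holomorphic_on ball 0 R"
    by (intro holomorphic_intros regular_on_holomorphic[OF reg hol] cox_poly_holomorphic hol) auto
  then have "continuous_on (ball 0 R) (\<lambda>u. \<sigma> (\<kappa> u) - cox_poly s r q (\<kappa> u))"
    by (rule holomorphic_on_imp_continuous_on)
  then have "isCont (\<lambda>u. \<sigma> (\<kappa> u) - cox_poly s r q (\<kappa> u)) 0"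
    using R by (simp add: continuous_on_eq_continuous_at)
  then have lim: "(\<lambda>u. \<sigma> (\<kappa> u) - cox_poly s r q (\<kappa> u)) \<midarrow>0\<rightarrow> \<sigma> (\<kappa> 0) - cox_poly s r q (\<kappa> 0)"
    by (simp add: isCont_def)
  have "finite ((\<lambda>v. - coord p v) ` toric_primes s r - {0})" by simp
  then have "open (- ((\<lambda>v. - coord p v) ` toric_primes s r - {0}))"
    by (intro open_Compl finite_imp_closed)
  then have "\<forall>\<^sub>F u in at 0. u \<in> - ((\<lambda>v. - coord p v) ` toric_primes s r - {0})"
    by (intro eventually_at_in_open') auto
  moreover have "\<forall>\<^sub>F u in at 0. u \<noteq> (0::complex)" by (simp add: eventually_at_filter)
  ultimately have "\<forall>\<^sub>F u in at 0. \<sigma> (\<kappa> u) - cox_poly s r q (\<kappa> u) = 0"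
  proof eventually_elim
    case (elim u)
    have "coord p v + u \<noteq> 0" if "v \<in> toric_primes s r" for v
    proof
      assume "coord p v + u = 0"
      then have "u = - coord p v" by (simp add: eq_neg_iff_add_eq_0 add.commute)
      then show False using elim that by auto
    qed
    then have "\<kappa> u \<in> open_orbit s r" using zero by (auto simp: open_orbit_def \<kappa>_def)
    then show ?case using eq by simp
  qed
  then have "(\<lambda>u. \<sigma> (\<kappa> u) - cox_poly s r q (\<kappa> u)) \<midarrow>0\<rightarrow> 0" by (simp add: tendsto_eventually)
  then have "\<sigma> (\<kappa> 0) - cox_poly s r q (\<kappa> 0) = 0" using lim LIM_unique by blast
  moreover have "\<kappa> 0 = p" by (simp add: \<kappa>_def)
  ultimately show ?thesis by simp
qed

definition weight_divisors :: "nat \<Rightarrow> nat \<Rightarrow> (nat \<Rightarrow> int) \<Rightarrow> int \<Rightarrow> int \<Rightarrow> divisor set" where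
  "weight_divisors s r a k l = {D \<in> Div_T_plus s r. deg1 s r a D = k \<and> deg2 r D = l}"

lemma cox_poly_act:
  assumes "Poly_Mapping.keys q \<subseteq> weight_divisors s r a k l" "u \<noteq> 0" "v \<noteq> 0"
  shows "cox_poly s r q (act a u v p) = u powi k * v powi l * cox_poly s r q p"
  unfolding cox_poly_def sum_distrib_left
  using assms by (intro sum.cong) (auto simp: weight_divisors_def cox_monomial_act subset_iff)

context twisted_bundle
begin

text \<open>The torus element \<open>(u, v)\<close> multiplies the coefficient of \<open>D\<close> by \<open>u powi deg1 D * v powi deg2 D\<close>.
  By independence of the monomials this factor is that of the section whenever \<open>D\<close> occurs. The elements
  \<open>(2, 1)\<close> and \<open>(1, 2)\<close> suffice to recover the weight, as the powers of \<open>2\<close> are distinct.\<close>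

theorem regular_section_cox_poly:
  assumes reg: "regular_on s r (cone s r) \<sigma>"
    and weight: "\<And>p u v. p \<in> cone s r \<Longrightarrow> u \<noteq> 0 \<Longrightarrow> v \<noteq> 0 \<Longrightarrow> \<sigma> (act a u v p) = u powi k * v powi l * \<sigma> p"
  shows "\<exists>q. Poly_Mapping.keys q \<subseteq> weight_divisors s r a k l \<and> (\<forall>p\<in>cone s r. \<sigma> p = cox_poly s r q p)"
proof -
  obtain q where q: "Poly_Mapping.keys q \<subseteq> Div_T_plus s r" "\<And>p. p \<in> open_orbit s r \<Longrightarrow> \<sigma> p = cox_poly s r q p"
    using regular_section_cox_poly_on_open_orbit[OF reg weight] unfolding is_cox_poly_def by blast
  have eq: "\<sigma> p = cox_poly s r q p" if "p \<in> cone s r" for p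
    using regular_eq_cox_poly_on_cone[OF reg q(2) that] .
  have coeff: "Poly_Mapping.lookup q D * (u powi deg1 s r a D * v powi deg2 r D - u powi k * v powi l) = 0"
    if uv: "u \<noteq> 0" "v \<noteq> 0" and D: "D \<in> Poly_Mapping.keys q" for u v D
  proof -
    have "(\<lambda>D. Poly_Mapping.lookup q D * (u powi deg1 s r a D * v powi deg2 r D - u powi k * v powi l)) D = 0"
    proof (rule cox_monomials_independent[OF _ q(1) _ D])
      fix p assume "p \<in> open_orbit s r"
      then have p: "p \<in> cone s r" using open_orbit_subset_cone by auto
      have "(\<Sum>D\<in>Poly_Mapping.keys q. Poly_Mapping.lookup q D *
          (u powi deg1 s r a D * v powi deg2 r D - u powi k * v powi l) * cox_monomial s r D p) =
          cox_poly s r q (act a u v p) - u powi k * v powi l * cox_poly s r q p"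
        unfolding cox_poly_def sum_distrib_left sum_subtractf[symmetric]
        using q(1) uv by (intro sum.cong) (auto simp: cox_monomial_act subset_iff algebra_simps)
      also have "\<dots> = 0"
        using weight[OF p uv] eq[OF p] eq[OF act_in_cone[OF p uv]] by simp
      finally show "(\<Sum>D\<in>Poly_Mapping.keys q. Poly_Mapping.lookup q D *
          (u powi deg1 s r a D * v powi deg2 r D - u powi k * v powi l) * cox_monomial s r D p) = 0" .
    qed simp
    then show ?thesis .
  qed
  have two: "m = n" if "2 powi m = (2 powi n :: complex)" for m n
  proof -
    have "norm (2 powi m :: complex) = norm (2 powi n :: complex)" using that by simp
    then have "(2::real) powi m = 2 powi n" by (simp add: norm_power_int)
    then show ?thesis by (smt (verit) power_int_strict_increasing)
  qed
  have "Poly_Mapping.keys q \<subseteq> weight_divisors s r a k l"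
  proof
    fix D assume D: "D \<in> Poly_Mapping.keys q"
    then have "Poly_Mapping.lookup q D \<noteq> 0" by (simp add: in_keys_iff)
    then have "2 powi deg1 s r a D = (2 powi k :: complex)" "2 powi deg2 r D = (2 powi l :: complex)"
      using coeff[of 2 1 D] coeff[of 1 2 D] D by auto
    then show "D \<in> weight_divisors s r a k l" using q(1) D two by (auto simp: weight_divisors_def)
  qed
  then show ?thesis using eq by blast
qed

end


subsection \<open>Multiplication by a section\<close>

definition mult_map :: "nat \<Rightarrow> nat \<Rightarrow> (nat \<Rightarrow> int) \<Rightarrow> nat \<times> nat \<Rightarrow> (pt \<Rightarrow> complex) \<Rightarrow> sheaf_map" where
  "mult_map s r a P g = (\<lambda>U \<sigma>. if zariski_open s r a U \<and> \<sigma> \<in> E s r a P U then (\<lambda>p. g p * \<sigma> p) else (\<lambda>_. 0))"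

lemma polynomials_sum: "(\<And>i. i \<in> I \<Longrightarrow> f i \<in> polynomials s r) \<Longrightarrow> (\<lambda>p. \<Sum>i\<in>I. f i p) \<in> polynomials s r"
  unfolding polynomials_def
  by (induction I rule: infinite_finite_induct) (auto intro: generated_algebra.intros)

lemma polynomials_prod: "(\<And>i. i \<in> I \<Longrightarrow> f i \<in> polynomials s r) \<Longrightarrow> (\<lambda>p. \<Prod>i\<in>I. f i p) \<in> polynomials s r"
  unfolding polynomials_def
  by (induction I rule: infinite_finite_induct) (auto intro: generated_algebra.intros)

lemma polynomials_mult: "f \<in> polynomials s r \<Longrightarrow> g \<in> polynomials s r \<Longrightarrow> (\<lambda>p. f p * g p) \<in> polynomials s r"
  unfolding polynomials_def by (rule generated_algebra.mult)

lemma polynomials_power: "f \<in> polynomials s r \<Longrightarrow> (\<lambda>p. f p ^ n) \<in> polynomials s r"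
  using polynomials_prod[of "{..<n}" "\<lambda>_. f"] by simp

lemma polynomials_const: "(\<lambda>_. c) \<in> polynomials s r"
  unfolding polynomials_def by (rule generated_algebra.const)

lemma polynomials_coord: "v \<in> toric_primes s r \<Longrightarrow> (\<lambda>p. coord p v) \<in> polynomials s r"
  unfolding polynomials_def by (cases v) (auto intro!: generated_algebra.gen)

lemma cox_poly_in_polynomials: "cox_poly s r q \<in> polynomials s r"
proof -
  have "(\<lambda>p. \<Sum>D\<in>Poly_Mapping.keys q. Poly_Mapping.lookup q D *
      (\<Prod>v\<in>toric_primes s r. coord p v ^ nat (Poly_Mapping.lookup D v))) \<in> polynomials s r"
    by (intro polynomials_sum polynomials_mult polynomials_const polynomials_prod polynomials_power polynomials_coord)
  then show ?thesis by (simp add: cox_poly_def[abs_def] cox_monomial_def)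
qed

lemma regular_on_mult:
  assumes "regular_on s r W f" "regular_on s r W g"
  shows "regular_on s r W (\<lambda>p. f p * g p)"
  unfolding regular_on_def
proof
  fix p assume p: "p \<in> W"
  obtain g1 h1 where 1: "g1 \<in> polynomials s r" "h1 \<in> polynomials s r" "h1 p \<noteq> 0"
      "\<And>q. q \<in> W \<Longrightarrow> h1 q \<noteq> 0 \<Longrightarrow> f q = g1 q / h1 q" using assms(1) p unfolding regular_on_def by blast
  obtain g2 h2 where 2: "g2 \<in> polynomials s r" "h2 \<in> polynomials s r" "h2 p \<noteq> 0"
      "\<And>q. q \<in> W \<Longrightarrow> h2 q \<noteq> 0 \<Longrightarrow> g q = g2 q / h2 q" using assms(2) p unfolding regular_on_def by blast
  show "\<exists>g'\<in>polynomials s r. \<exists>h\<in>polynomials s r. h p \<noteq> 0 \<and> (\<forall>q\<in>W. h q \<noteq> 0 \<longrightarrow> f q * g q = g' q / h q)"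
    using 1 2 polynomials_mult[OF 1(1) 2(1)] polynomials_mult[OF 1(2) 2(2)]
    by (intro bexI[of _ "\<lambda>p. g1 p * g2 p"] bexI[of _ "\<lambda>p. h1 p * h2 p"]) auto
qed

lemma regular_on_polynomial: "f \<in> polynomials s r \<Longrightarrow> regular_on s r W f"
  unfolding regular_on_def by (intro ballI bexI[of _ f] bexI[of _ "\<lambda>_. 1"]) (auto intro: polynomials_const)

lemma regular_on_inverse_polynomial:
  "f \<in> polynomials s r \<Longrightarrow> (\<And>p. p \<in> W \<Longrightarrow> f p \<noteq> 0) \<Longrightarrow> regular_on s r W (\<lambda>p. inverse (f p))"
  unfolding regular_on_def
  by (intro ballI bexI[of _ "\<lambda>_. 1"] bexI[of _ f]) (auto intro: polynomials_const simp: divide_inverse)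

lemma regular_on_subset:
  assumes "regular_on s r W f" "W' \<subseteq> W"
  shows "regular_on s r W' f"
  unfolding regular_on_def
proof
  fix p assume "p \<in> W'"
  then obtain g h where gh: "g \<in> polynomials s r" "h \<in> polynomials s r" "h p \<noteq> 0"
      "\<forall>q\<in>W. h q \<noteq> 0 \<longrightarrow> f q = g q / h q" using assms unfolding regular_on_def by blast
  then have "\<forall>q\<in>W'. h q \<noteq> 0 \<longrightarrow> f q = g q / h q" using assms(2) by blast
  then show "\<exists>g\<in>polynomials s r. \<exists>h\<in>polynomials s r. h p \<noteq> 0 \<and> (\<forall>q\<in>W'. h q \<noteq> 0 \<longrightarrow> f q = g q / h q)"
    using gh(1-3) by blast
qed

lemma regular_on_cong: "regular_on s r W f \<Longrightarrow> (\<And>p. p \<in> W \<Longrightarrow> f p = g p) \<Longrightarrow> regular_on s r W g"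
  unfolding regular_on_def by simp

lemma regular_on_local:
  assumes "\<And>p. p \<in> W \<Longrightarrow> \<exists>f\<in>polynomials s r. f p \<noteq> 0 \<and> regular_on s r {q\<in>W. f q \<noteq> 0} \<sigma>"
  shows "regular_on s r W \<sigma>"
  unfolding regular_on_def
proof
  fix p assume p: "p \<in> W"
  then obtain f where f: "f \<in> polynomials s r" "f p \<noteq> 0" "regular_on s r {q\<in>W. f q \<noteq> 0} \<sigma>"
    using assms by blast
  then obtain g h where gh: "g \<in> polynomials s r" "h \<in> polynomials s r" "h p \<noteq> 0"
      "\<And>q. q \<in> W \<Longrightarrow> f q \<noteq> 0 \<Longrightarrow> h q \<noteq> 0 \<Longrightarrow> \<sigma> q = g q / h q"
    using p unfolding regular_on_def by blast
  show "\<exists>g\<in>polynomials s r. \<exists>h\<in>polynomials s r. h p \<noteq> 0 \<and> (\<forall>q\<in>W. h q \<noteq> 0 \<longrightarrow> \<sigma> q = g q / h q)"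
    using gh f polynomials_mult[OF f(1) gh(1)] polynomials_mult[OF f(1) gh(2)]
    by (intro bexI[of _ "\<lambda>p. f p * g p"] bexI[of _ "\<lambda>p. f p * h p"]) auto
qed

lemma open_union_subset_cone: "zariski_open s r a U \<Longrightarrow> \<Union>U \<subseteq> cone s r"
  unfolding zariski_open_def by auto

lemma open_union_act:
  assumes U: "zariski_open s r a U" and p: "p \<in> \<Union>U" and "u \<noteq> 0" "v \<noteq> 0"
  shows "act a u v p \<in> \<Union>U"
proof -
  obtain O' where O': "O' \<in> U" "p \<in> O'" using p by blast
  then obtain p0 where "O' = {act a u v p0 | u v. u \<noteq> 0 \<and> v \<noteq> 0}"
    using U unfolding zariski_open_def proj_bundle_def by blast
  then show ?thesis using O' assms(3,4) by (auto simp: act_act intro!: bexI[of _ O'])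
    (metis mult_eq_0_iff)
qed

lemma regular_on_add:
  assumes "regular_on s r W f" "regular_on s r W g"
  shows "regular_on s r W (\<lambda>p. f p + g p)"
  unfolding regular_on_def
proof
  fix p assume p: "p \<in> W"
  obtain g1 h1 where 1: "g1 \<in> polynomials s r" "h1 \<in> polynomials s r" "h1 p \<noteq> 0"
      "\<And>q. q \<in> W \<Longrightarrow> h1 q \<noteq> 0 \<Longrightarrow> f q = g1 q / h1 q" using assms(1) p unfolding regular_on_def by blast
  obtain g2 h2 where 2: "g2 \<in> polynomials s r" "h2 \<in> polynomials s r" "h2 p \<noteq> 0"
      "\<And>q. q \<in> W \<Longrightarrow> h2 q \<noteq> 0 \<Longrightarrow> g q = g2 q / h2 q" using assms(2) p unfolding regular_on_def by blast
  have "(\<lambda>p. g1 p * h2 p + g2 p * h1 p) \<in> polynomials s r"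
    using 1 2 unfolding polynomials_def by (intro generated_algebra.add generated_algebra.mult)
  then show "\<exists>g'\<in>polynomials s r. \<exists>h\<in>polynomials s r. h p \<noteq> 0 \<and> (\<forall>q\<in>W. h q \<noteq> 0 \<longrightarrow> f q + g q = g' q / h q)"
    using 1 2 polynomials_mult[OF 1(2) 2(2)]
    by (intro bexI[of _ "\<lambda>p. g1 p * h2 p + g2 p * h1 p"] bexI[of _ "\<lambda>p. h1 p * h2 p"]) (auto simp: add_frac_eq)
qed

lemma line_bundleI:
  assumes "\<And>p. p \<notin> \<Union>U \<Longrightarrow> \<sigma> p = 0" "regular_on s r (\<Union>U) \<sigma>"
    and "\<And>p u v. p \<in> \<Union>U \<Longrightarrow> u \<noteq> 0 \<Longrightarrow> v \<noteq> 0 \<Longrightarrow> \<sigma> (act a u v p) = u powi k * v powi l * \<sigma> p"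
  shows "\<sigma> \<in> line_bundle s r a k l U"
  unfolding line_bundle_def mem_Collect_eq using assms by blast

lemma line_bundleD:
  assumes "\<sigma> \<in> line_bundle s r a k l U"
  shows "p \<notin> \<Union>U \<Longrightarrow> \<sigma> p = 0" "regular_on s r (\<Union>U) \<sigma>"
    and "p \<in> \<Union>U \<Longrightarrow> u \<noteq> 0 \<Longrightarrow> v \<noteq> 0 \<Longrightarrow> \<sigma> (act a u v p) = u powi k * v powi l * \<sigma> p"
  using assms unfolding line_bundle_def mem_Collect_eq by blast+

lemma line_bundle_add:
  assumes "\<sigma> \<in> line_bundle s r a k l U" "\<tau> \<in> line_bundle s r a k l U"
  shows "(\<lambda>p. \<sigma> p + \<tau> p) \<in> line_bundle s r a k l U"
proof (rule line_bundleI)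
  show "\<sigma> p + \<tau> p = 0" if "p \<notin> \<Union>U" for p
    using line_bundleD(1)[OF assms(1) that] line_bundleD(1)[OF assms(2) that] by simp
  show "\<sigma> (act a u v p) + \<tau> (act a u v p) = u powi k * v powi l * (\<sigma> p + \<tau> p)"
    if "p \<in> \<Union>U" "u \<noteq> 0" "v \<noteq> 0" for p u v
    using line_bundleD(3)[OF assms(1) that] line_bundleD(3)[OF assms(2) that] by (simp add: distrib_left)
qed (intro regular_on_add line_bundleD(2)[OF assms(1)] line_bundleD(2)[OF assms(2)])

lemma line_bundle_mult:
  assumes "\<sigma> \<in> line_bundle s r a k l U" "\<tau> \<in> line_bundle s r a k' l' U"
  shows "(\<lambda>p. \<sigma> p * \<tau> p) \<in> line_bundle s r a (k + k') (l + l') U"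
proof (rule line_bundleI)
  show "\<sigma> (act a u v p) * \<tau> (act a u v p) = u powi (k + k') * v powi (l + l') * (\<sigma> p * \<tau> p)"
    if "p \<in> \<Union>U" "u \<noteq> 0" "v \<noteq> 0" for p u v
    using line_bundleD(3)[OF assms(1) that] line_bundleD(3)[OF assms(2) that] that(2,3)
    by (simp add: power_int_add)
  show "\<sigma> p * \<tau> p = 0" if "p \<notin> \<Union>U" for p
    using line_bundleD(1)[OF assms(1) that] by simp
qed (intro regular_on_mult line_bundleD(2)[OF assms(1)] line_bundleD(2)[OF assms(2)])

lemma line_bundle_restrict:
  assumes "\<sigma> \<in> line_bundle s r a k l U" "zariski_open s r a V" "V \<subseteq> U"
  shows "restrict_section V \<sigma> \<in> line_bundle s r a k l V"
proof -
  have sub: "\<Union>V \<subseteq> \<Union>U" using assms(3) by blast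
  have "regular_on s r (\<Union>V) (restrict_section V \<sigma>)"
  proof (rule regular_on_cong)
    show "regular_on s r (\<Union>V) \<sigma>"
      using line_bundleD(2)[OF assms(1)] regular_on_subset[OF _ sub] by blast
  qed (simp add: restrict_section_def)
  moreover have "restrict_section V \<sigma> (act a u v p) = u powi k * v powi l * restrict_section V \<sigma> p"
    if "p \<in> \<Union>V" "u \<noteq> 0" "v \<noteq> 0" for p u v
  proof -
    have "p \<in> \<Union>U" using that sub by blast
    then have "\<sigma> (act a u v p) = u powi k * v powi l * \<sigma> p"
      using that(2,3) line_bundleD(3)[OF assms(1)] by blast
    then show ?thesis using open_union_act[OF assms(2) that] that(1) unfolding restrict_section_def by (simp only: if_True)
  qed
  ultimately show ?thesis by (intro line_bundleI) (simp_all only: restrict_section_def if_False)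
qed

lemma cox_poly_section:
  assumes q: "Poly_Mapping.keys q \<subseteq> weight_divisors s r a k l" and U: "zariski_open s r a U"
  shows "restrict_section U (cox_poly s r q) \<in> line_bundle s r a k l U"
proof -
  have "restrict_section U (cox_poly s r q) (act a u v p) = u powi k * v powi l * restrict_section U (cox_poly s r q) p"
    if "p \<in> \<Union>U" "u \<noteq> 0" "v \<noteq> 0" for p u v
    using open_union_act[OF U that] that(1) cox_poly_act[OF q that(2,3)] unfolding restrict_section_def
    by (simp only: if_True)
  moreover have "regular_on s r (\<Union>U) (restrict_section U (cox_poly s r q))"
    by (rule regular_on_cong[OF regular_on_polynomial[OF cox_poly_in_polynomials[of s r q]]])
       (simp add: restrict_section_def)
  ultimately show ?thesis by (intro line_bundleI) (simp_all only: restrict_section_def if_False)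
qed

lemma mult_map_in_Hom_E:
  assumes q: "Poly_Mapping.keys q \<subseteq> weight_divisors s r a (int k2 - int k1) (int l2 - int l1)"
  shows "mult_map s r a (k1, l1) (cox_poly s r q) \<in> Hom_E s r a (k1, l1) (k2, l2)"
proof -
  let ?g = "cox_poly s r q" and ?E = "E s r a (k1, l1)"
  have F: "(\<lambda>p. ?g p * \<sigma> p) \<in> E s r a (k2, l2) U" if "zariski_open s r a U" "\<sigma> \<in> ?E U" for U \<sigma>
  proof -
    have "(\<lambda>p. restrict_section U ?g p * \<sigma> p) \<in> E s r a (k2, l2) U"
      using line_bundle_mult[OF cox_poly_section[OF q that(1)], of \<sigma> "int k1" "int l1"] that(2)
      by (simp add: E_def)
    moreover have "restrict_section U ?g p * \<sigma> p = ?g p * \<sigma> p" for p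
      using that(2) line_bundleD(1)[of \<sigma> s r a "int k1" "int l1" U p]
      by (cases "p \<in> \<Union>U") (simp_all only: E_def restrict_section_def split if_True if_False mult_zero_left mult_zero_right not_False_eq_True)
    ultimately show ?thesis by simp
  qed
  have add: "(\<lambda>p. \<sigma> p + \<tau> p) \<in> ?E U" if "\<sigma> \<in> ?E U" "\<tau> \<in> ?E U" for \<sigma> \<tau> U
    using that line_bundle_add by (simp add: E_def)
  have mul: "(\<lambda>p. g p * \<sigma> p) \<in> ?E U" if "\<sigma> \<in> ?E U" "g \<in> line_bundle s r a 0 0 U" for \<sigma> g U
    using line_bundle_mult[OF that(2)] that(1) by (fastforce simp: E_def)
  have res: "restrict_section V \<sigma> \<in> ?E V" if "\<sigma> \<in> ?E U" "zariski_open s r a V" "V \<subseteq> U" for U V \<sigma>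
    using that line_bundle_restrict by (fastforce simp: E_def)
  show ?thesis
    unfolding Hom_E_def sheaf_hom_def mem_Collect_eq
  proof (intro conjI allI impI ballI)
    fix U assume U: "zariski_open s r a U"
    fix \<sigma> assume \<sigma>: "\<sigma> \<in> ?E U"
    show "mult_map s r a (k1, l1) ?g U \<sigma> \<in> E s r a (k2, l2) U"
      using F[OF U \<sigma>] U \<sigma> by (simp add: mult_map_def)
    show "mult_map s r a (k1, l1) ?g U (\<lambda>p. \<sigma> p + \<tau> p) =
        (\<lambda>p. mult_map s r a (k1, l1) ?g U \<sigma> p + mult_map s r a (k1, l1) ?g U \<tau> p)" if "\<tau> \<in> ?E U" for \<tau>
      using U \<sigma> that add by (simp add: mult_map_def algebra_simps)
    show "mult_map s r a (k1, l1) ?g U (\<lambda>p. g p * \<sigma> p) = (\<lambda>p. g p * mult_map s r a (k1, l1) ?g U \<sigma> p)"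
      if "g \<in> line_bundle s r a 0 0 U" for g
      using U \<sigma> that mul by (simp add: mult_map_def algebra_simps)
    show "mult_map s r a (k1, l1) ?g V (restrict_section V \<sigma>) = restrict_section V (mult_map s r a (k1, l1) ?g U \<sigma>)"
      if "V \<subseteq> U" "zariski_open s r a V" for V
      using U \<sigma> that res[OF \<sigma> that(2,1)] by (auto simp: mult_map_def restrict_section_def fun_eq_iff)
  qed (auto simp: mult_map_def)
qed

text \<open>A section of weight \<open>(k, l)\<close> that has no zeros where \<open>x i\<close> and \<open>y j\<close> are nonzero and thus generates
  the line bundle there. The factor \<open>y j ^ l\<close> has weight \<open>(- a j * l, l)\<close>, which the exponent of \<open>x i\<close>
  corrects.\<close>

definition frame :: "(nat \<Rightarrow> int) \<Rightarrow> nat \<Rightarrow> nat \<Rightarrow> nat \<Rightarrow> nat \<Rightarrow> pt \<Rightarrow> complex" where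
  "frame a k l i j p = fst p i ^ nat (int k + a j * int l) * snd p j ^ l"

definition chart :: "pt set set \<Rightarrow> nat \<Rightarrow> nat \<Rightarrow> pt set set" where
  "chart U i j = {O'\<in>U. \<forall>p\<in>O'. fst p i \<noteq> 0 \<and> snd p j \<noteq> 0}"

lemma Union_chart:
  assumes "zariski_open s r a U"
  shows "\<Union>(chart U i j) = {p\<in>\<Union>U. fst p i \<noteq> 0 \<and> snd p j \<noteq> 0}"
proof
  show "{p\<in>\<Union>U. fst p i \<noteq> 0 \<and> snd p j \<noteq> 0} \<subseteq> \<Union>(chart U i j)"
  proof
    fix p assume p: "p \<in> {p\<in>\<Union>U. fst p i \<noteq> 0 \<and> snd p j \<noteq> 0}"
    then obtain O' where O': "O' \<in> U" "p \<in> O'" by blast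
    then obtain p0 where p0: "O' = {act a u v p0 | u v. u \<noteq> 0 \<and> v \<noteq> 0}"
      using assms unfolding zariski_open_def proj_bundle_def by blast
    then have "fst p0 i \<noteq> 0" "snd p0 j \<noteq> 0"
      using O'(2) p by (cases p0; auto simp: act_def)+
    then have "O' \<in> chart U i j" using O'(1) unfolding chart_def p0 by (cases p0) (auto simp: act_def)
    then show "p \<in> \<Union>(chart U i j)" using O'(2) by blast
  qed
qed (auto simp: chart_def)

lemma zariski_open_chart:
  assumes U: "zariski_open s r a U" and "i \<le> s" "j \<le> r"
  shows "zariski_open s r a (chart U i j)"
proof -
  from U have "\<exists>P \<subseteq> polynomials s r. \<Union>U = {p \<in> cone s r. \<exists>g\<in>P. g p \<noteq> 0}"
    unfolding zariski_open_def by (rule conjunct2)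
  then obtain P where P: "P \<subseteq> polynomials s r" "\<Union>U = {p \<in> cone s r. \<exists>g\<in>P. g p \<noteq> 0}"
    by (elim exE conjE)
  let ?Q = "(\<lambda>g p. g p * (coord p (Vv i) * coord p (Ve j))) ` P"
  have "?Q \<subseteq> polynomials s r"
  proof clarify
    fix g assume "g \<in> P"
    then show "(\<lambda>p. g p * (coord p (Vv i) * coord p (Ve j))) \<in> polynomials s r"
      using P assms(2,3) by (intro polynomials_mult polynomials_coord) auto
  qed
  moreover have "(\<exists>g\<in>?Q. g p \<noteq> 0) \<longleftrightarrow> (\<exists>g\<in>P. g p \<noteq> 0) \<and> fst p i \<noteq> 0 \<and> snd p j \<noteq> 0" for p
    by simp
  then have "\<Union>(chart U i j) = {p \<in> cone s r. \<exists>g\<in>?Q. g p \<noteq> 0}"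
    unfolding Union_chart[OF U] P(2) by (simp only: mem_Collect_eq conj_assoc)
  moreover have "chart U i j \<subseteq> proj_bundle s r a" using U by (auto simp: chart_def zariski_open_def)
  ultimately show ?thesis unfolding zariski_open_def by blast
qed

lemma zariski_open_whole: "zariski_open s r a (proj_bundle s r a)"
  unfolding zariski_open_def Union_proj_bundle
  by (intro conjI exI[of _ "{\<lambda>_. 1}"]) (auto intro: polynomials_const)

context twisted_bundle
begin

lemma frame_act:
  assumes "j \<le> r" "u \<noteq> 0" "v \<noteq> 0"
  shows "frame a k l i j (act a u v p) = u powi int k * v powi int l * frame a k l i j p"
proof -
  have n: "nat (int k + a j * int l) = k + nat (a j) * l"
    using a_nonneg[OF assms(1)] by (simp add: nat_add_distrib nat_mult_distrib)
  have "u powi (- a j) * u ^ nat (a j) = 1"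
    using a_nonneg[OF assms(1)] assms(2)
    by (simp add: power_int_def flip: power_mult_distrib)
  then have one: "(u ^ nat (a j)) ^ l * (u powi (- a j)) ^ l = 1"
    by (simp add: power_mult_distrib[symmetric] mult.commute)
  obtain x y where p: "p = (x, y)" by (cases p)
  have power_commutes_exp: "(u ^ l) ^ nat (a j) = (u ^ nat (a j)) ^ l"
    by (simp add: power_mult[symmetric] mult.commute)
  have "frame a k l i j (act a u v p) =
      u ^ k * v ^ l * frame a k l i j p * ((u ^ nat (a j)) ^ l * (u powi (- a j)) ^ l)"
    using power_commutes_exp unfolding frame_def n p by (simp add: act_def power_mult_distrib power_add power_mult mult_ac)
  then show ?thesis unfolding one by simp
qed

lemma frame_polynomial: "i \<le> s \<Longrightarrow> j \<le> r \<Longrightarrow> frame a k l i j \<in> polynomials s r"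
  unfolding frame_def[abs_def]
  using polynomials_coord[of "Vv i" s r] polynomials_coord[of "Ve j" s r]
  by (intro polynomials_mult polynomials_power) simp_all

lemma frame_section:
  assumes "i \<le> s" "j \<le> r" "zariski_open s r a U"
  shows "restrict_section U (frame a k l i j) \<in> line_bundle s r a (int k) (int l) U"
proof -
  have "regular_on s r (\<Union>U) (restrict_section U (frame a k l i j))"
    by (rule regular_on_cong[OF regular_on_polynomial[OF frame_polynomial[OF assms(1,2)]]])
       (simp add: restrict_section_def)
  moreover have "restrict_section U (frame a k l i j) (act a u v p) =
      u powi int k * v powi int l * restrict_section U (frame a k l i j) p"
    if "p \<in> \<Union>U" "u \<noteq> 0" "v \<noteq> 0" for p u v
    using open_union_act[OF assms(3) that] that(1) frame_act[OF assms(2) that(2,3)]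
    unfolding restrict_section_def by (simp only: if_True)
  ultimately show ?thesis by (intro line_bundleI) (simp_all only: restrict_section_def if_False)
qed


lemma frame_nonzero: "fst p i \<noteq> 0 \<Longrightarrow> snd p j \<noteq> 0 \<Longrightarrow> frame a k l i j p \<noteq> 0"
  by (simp add: frame_def)

lemma Hom_E_D:
  assumes "\<phi> \<in> Hom_E s r a P Q"
  shows "\<not> (zariski_open s r a U \<and> \<sigma> \<in> E s r a P U) \<Longrightarrow> \<phi> U \<sigma> = (\<lambda>_. 0)"
    and "zariski_open s r a U \<Longrightarrow> \<sigma> \<in> E s r a P U \<Longrightarrow> \<phi> U \<sigma> \<in> E s r a Q U"
    and "zariski_open s r a U \<Longrightarrow> \<sigma> \<in> E s r a P U \<Longrightarrow> g \<in> line_bundle s r a 0 0 U \<Longrightarrow>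
           \<phi> U (\<lambda>p. g p * \<sigma> p) = (\<lambda>p. g p * \<phi> U \<sigma> p)"
    and "zariski_open s r a U \<Longrightarrow> \<sigma> \<in> E s r a P U \<Longrightarrow> zariski_open s r a V \<Longrightarrow> V \<subseteq> U \<Longrightarrow>
           \<phi> V (restrict_section V \<sigma>) = restrict_section V (\<phi> U \<sigma>)"
  using assms unfolding Hom_E_def sheaf_hom_def by simp_all

text \<open>On the chart, \<open>\<sigma>\<close> is a section of the structure sheaf times the frame, and \<open>\<phi>\<close> is linear over the
  structure sheaf and compatible with restriction to the chart. So \<open>\<phi>\<close> multiplies \<open>\<sigma>\<close> and the frame by
  the same factor.\<close>

lemma sheaf_hom_proportional:
  assumes \<phi>: "\<phi> \<in> Hom_E s r a (k1, l1) Q" and U: "zariski_open s r a U" and \<sigma>: "\<sigma> \<in> E s r a (k1, l1) U"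
    and p: "p \<in> \<Union>U" and ij: "i \<le> s" "j \<le> r" "fst p i \<noteq> 0" "snd p j \<noteq> 0"
  shows "\<phi> U \<sigma> p * frame a k1 l1 i j p =
    \<phi> (proj_bundle s r a) (restrict_section (proj_bundle s r a) (frame a k1 l1 i j)) p * \<sigma> p"
proof -
  let ?X = "proj_bundle s r a" and ?f = "frame a k1 l1 i j" and ?V = "chart U i j"
  let ?e = "restrict_section ?X ?f"
  let ?g = "\<lambda>p. if p \<in> \<Union>?V then \<sigma> p * inverse (?f p) else 0"
  have V: "zariski_open s r a ?V" using zariski_open_chart[OF U ij(1,2)] .
  have VU: "?V \<subseteq> U" by (auto simp: chart_def)
  have UX: "U \<subseteq> ?X" using U by (simp add: zariski_open_def)
  have sub: "\<Union>?V \<subseteq> \<Union>U" using VU by blast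
  have pV: "p \<in> \<Union>?V" using p ij Union_chart[OF U] by simp
  have nz: "?f q \<noteq> 0" if "q \<in> \<Union>?V" for q using that Union_chart[OF U] frame_nonzero by simp
  have \<sigma>': "\<sigma> \<in> line_bundle s r a (int k1) (int l1) U" using \<sigma> by (simp add: E_def)
  have e: "?e \<in> E s r a (k1, l1) ?X" using frame_section[OF ij(1,2) zariski_open_whole] by (simp add: E_def)
  have eV: "restrict_section ?V ?e = restrict_section ?V ?f"
    using sub UX by (auto simp: restrict_section_def fun_eq_iff)
  have eV': "restrict_section ?V ?f \<in> E s r a (k1, l1) ?V" using frame_section[OF ij(1,2) V] by (simp add: E_def)
  have g: "?g \<in> line_bundle s r a 0 0 ?V"
  proof (rule line_bundleI)
    have "regular_on s r (\<Union>?V) (\<lambda>p. \<sigma> p * inverse (?f p))"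
      by (intro regular_on_mult regular_on_subset[OF line_bundleD(2)[OF \<sigma>'] sub]
        regular_on_inverse_polynomial frame_polynomial ij nz)
    then show "regular_on s r (\<Union>?V) ?g" by (rule regular_on_cong) (simp only: if_True)
    fix q and u v :: complex assume q: "q \<in> \<Union>?V" "u \<noteq> 0" "v \<noteq> 0"
    have qU: "q \<in> \<Union>U" using q(1) sub by blast
    have "act a u v q \<in> \<Union>?V" using open_union_act[OF V q] .
    then show "?g (act a u v q) = u powi 0 * v powi 0 * ?g q"
      using q(1) line_bundleD(3)[OF \<sigma>' qU q(2,3)] frame_act[OF ij(2) q(2,3), of k1 l1 i q] q(2,3) nz[OF q(1)]
      by (simp only: if_True) (simp add: field_simps)
  qed (simp only: if_False)
  have "restrict_section ?V \<sigma> = (\<lambda>q. ?g q * restrict_section ?V ?f q)"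
    using nz by (auto simp: restrict_section_def fun_eq_iff simp del: Union_iff)
  then have "\<phi> ?V (restrict_section ?V \<sigma>) = (\<lambda>q. ?g q * \<phi> ?V (restrict_section ?V ?f) q)"
    using Hom_E_D(3)[OF \<phi> V eV' g] by (simp only:)
  moreover have "\<phi> ?V (restrict_section ?V \<sigma>) = restrict_section ?V (\<phi> U \<sigma>)"
    using Hom_E_D(4)[OF \<phi> U \<sigma> V VU] .
  moreover have "\<phi> ?V (restrict_section ?V ?f) = restrict_section ?V (\<phi> ?X ?e)"
    using Hom_E_D(4)[OF \<phi> zariski_open_whole e V] VU UX unfolding eV by blast
  ultimately have "restrict_section ?V (\<phi> U \<sigma>) p = ?g p * restrict_section ?V (\<phi> ?X ?e) p" by metis
  then have "\<phi> U \<sigma> p = \<sigma> p * inverse (?f p) * \<phi> ?X ?e p"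
    using pV unfolding restrict_section_def by (simp only: if_True)
  then show ?thesis using nz[OF pV] by (simp add: field_simps)
qed

text \<open>The factor by which \<open>\<phi>\<close> multiplies sections at a point is the same for all sections and all charts.
  As a function \<open>S\<close> on the cone it is regular, being on each chart the quotient of the image of the
  frame by the frame, and it is homogeneous of the difference of the two weights.\<close>

theorem Hom_E_cox_poly:
  assumes \<phi>: "\<phi> \<in> Hom_E s r a (k1, l1) (k2, l2)"
  shows "\<exists>q. Poly_Mapping.keys q \<subseteq> weight_divisors s r a (int k2 - int k1) (int l2 - int l1) \<and>
    \<phi> = mult_map s r a (k1, l1) (cox_poly s r q)"
proof -
  let ?X = "proj_bundle s r a"
  define f where "f = frame a k1 l1"
  define e where "e i j = restrict_section ?X (f i j)" for i j
  have ex: "\<exists>i. i \<le> s \<and> fst p i \<noteq> 0" "\<exists>j. j \<le> r \<and> snd p j \<noteq> 0" if "p \<in> cone s r" for p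
    using that unfolding cone_def by (auto simp: not_less[symmetric])
  define i0 where "i0 p = (SOME i. i \<le> s \<and> fst p i \<noteq> 0)" for p :: pt
  define j0 where "j0 p = (SOME j. j \<le> r \<and> snd p j \<noteq> 0)" for p :: pt
  have i0: "i0 p \<le> s" "fst p (i0 p) \<noteq> 0" and j0: "j0 p \<le> r" "snd p (j0 p) \<noteq> 0" if "p \<in> cone s r" for p
    using someI_ex[OF ex(1)[OF that]] someI_ex[OF ex(2)[OF that]] by (simp_all add: i0_def j0_def)
  define S where "S p = \<phi> ?X (e (i0 p) (j0 p)) p / f (i0 p) (j0 p) p" for p
  have eE: "e i j \<in> E s r a (k1, l1) ?X" if "i \<le> s" "j \<le> r" for i j
    using frame_section[OF that zariski_open_whole] by (simp add: E_def e_def f_def)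
  have eF: "\<phi> ?X (e i j) \<in> line_bundle s r a (int k2) (int l2) ?X" if "i \<le> s" "j \<le> r" for i j
    using Hom_E_D(2)[OF \<phi> zariski_open_whole eE[OF that]] by (simp add: E_def)
  have ep: "e i j p = f i j p" if "p \<in> cone s r" for i j p
    using that unfolding e_def restrict_section_def Union_proj_bundle by simp
  have key: "\<phi> U \<sigma> p = S p * \<sigma> p"
    if "zariski_open s r a U" "\<sigma> \<in> E s r a (k1, l1) U" "p \<in> \<Union>U" for U \<sigma> p
  proof -
    have p: "p \<in> cone s r" using that(1,3) open_union_subset_cone by blast
    show ?thesis
      using sheaf_hom_proportional[OF \<phi> that i0(1) j0(1) i0(2) j0(2)] p
        frame_nonzero[OF i0(2) j0(2), of p] by (simp add: S_def e_def f_def field_simps)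
  qed
  have S: "\<phi> ?X (e i j) p = S p * f i j p" if "p \<in> cone s r" "i \<le> s" "j \<le> r" for i j p
    using key[OF zariski_open_whole eE[OF that(2,3)], of p] ep[OF that(1)] that(1) by (simp only: Union_proj_bundle)
  have reg: "regular_on s r (cone s r) S"
  proof (rule regular_on_local)
    fix p assume p: "p \<in> cone s r"
    let ?i = "i0 p" and ?j = "j0 p"
    let ?h = "\<lambda>p. coord p (Vv ?i) * coord p (Ve ?j)"
    let ?W = "{q \<in> cone s r. ?h q \<noteq> 0}"
    have h: "?h \<in> polynomials s r" using i0[OF p] j0[OF p] by (intro polynomials_mult polynomials_coord) simp_all
    have nz: "f ?i ?j q \<noteq> 0" if "q \<in> ?W" for q using that frame_nonzero by (simp add: f_def)
    have "regular_on s r ?W (\<lambda>q. \<phi> ?X (e ?i ?j) q * inverse (f ?i ?j q))"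
    proof (intro regular_on_mult)
      show "regular_on s r ?W (\<phi> ?X (e ?i ?j))"
        by (rule regular_on_subset[OF line_bundleD(2)[OF eF[OF i0(1)[OF p] j0(1)[OF p]]]])
           (simp add: Union_proj_bundle)
      show "regular_on s r ?W (\<lambda>q. inverse (f ?i ?j q))"
        using nz unfolding f_def by (intro regular_on_inverse_polynomial frame_polynomial i0(1)[OF p] j0(1)[OF p])
    qed
    then have "regular_on s r ?W S"
    proof (rule regular_on_cong)
      fix q assume q: "q \<in> ?W"
      then show "\<phi> ?X (e ?i ?j) q * inverse (f ?i ?j q) = S q"
        using S[OF _ i0(1)[OF p] j0(1)[OF p], of q] nz[OF q] by simp
    qed
    then show "\<exists>h\<in>polynomials s r. h p \<noteq> 0 \<and> regular_on s r {q \<in> cone s r. h q \<noteq> 0} S"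
      using h i0[OF p] j0[OF p] by (intro bexI[of _ ?h]) simp_all
  qed
  have weight: "S (act a u v p) = u powi (int k2 - int k1) * v powi (int l2 - int l1) * S p"
    if p: "p \<in> cone s r" and uv: "u \<noteq> 0" "v \<noteq> 0" for p and u v :: complex
  proof -
    let ?i = "i0 p" and ?j = "j0 p"
    have ij: "?i \<le> s" "?j \<le> r" using i0 j0 p by auto
    have nz: "f ?i ?j p \<noteq> 0" using frame_nonzero i0 j0 p by (simp add: f_def)
    have "S (act a u v p) * (u powi int k1 * v powi int l1 * f ?i ?j p) =
        u powi int k2 * v powi int l2 * (S p * f ?i ?j p)"
      using S[OF act_in_cone[OF p uv] ij] S[OF p ij] frame_act[OF ij(2) uv, of k1 l1 ?i p]
        line_bundleD(3)[OF eF[OF ij] _ uv, of p] p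
      unfolding Union_proj_bundle f_def by simp
    then show ?thesis using nz uv by (simp add: power_int_diff field_simps)
  qed
  obtain q where q: "Poly_Mapping.keys q \<subseteq> weight_divisors s r a (int k2 - int k1) (int l2 - int l1)"
      "\<And>p. p \<in> cone s r \<Longrightarrow> S p = cox_poly s r q p"
    using regular_section_cox_poly[OF reg weight] by blast
  have "\<phi> U \<sigma> p = mult_map s r a (k1, l1) (cox_poly s r q) U \<sigma> p" for U \<sigma> p
  proof (cases "zariski_open s r a U \<and> \<sigma> \<in> E s r a (k1, l1) U")
    case False
    then show ?thesis using Hom_E_D(1)[OF \<phi> False] by (simp only: mult_map_def if_False)
  next
    case True
    then have \<sigma>: "\<sigma> \<in> line_bundle s r a (int k1) (int l1) U" by (simp add: E_def)
    have \<phi>\<sigma>: "\<phi> U \<sigma> \<in> line_bundle s r a (int k2) (int l2) U"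
      using Hom_E_D(2)[OF \<phi>] True by (simp add: E_def)
    show ?thesis
    proof (cases "p \<in> \<Union>U")
      case p: True
      then have "p \<in> cone s r" using True open_union_subset_cone by blast
      then show ?thesis using key[OF _ _ p] True q(2) by (simp add: mult_map_def)
    next
      case False
      then show ?thesis using True line_bundleD(1)[OF \<sigma>] line_bundleD(1)[OF \<phi>\<sigma>] by (simp add: mult_map_def)
    qed
  qed
  then have "\<phi> = mult_map s r a (k1, l1) (cox_poly s r q)" by blast
  then show ?thesis using q(1) by blast
qed

lemma mult_map_inject:
  assumes "Poly_Mapping.keys q \<subseteq> Div_T_plus s r" "Poly_Mapping.keys q' \<subseteq> Div_T_plus s r"
    and eq: "mult_map s r a (k, l) (cox_poly s r q) = mult_map s r a (k, l) (cox_poly s r q')"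
  shows "q = q'"
proof (rule cox_poly_inject[OF assms(1,2)])
  fix p assume p: "p \<in> open_orbit s r"
  let ?X = "proj_bundle s r a"
  let ?e = "restrict_section ?X (frame a k l 0 0)"
  have e: "?e \<in> E s r a (k, l) ?X" using frame_section[OF _ _ zariski_open_whole] by (simp add: E_def)
  have "p \<in> cone s r" using p open_orbit_subset_cone by blast
  then have ep: "?e p = frame a k l 0 0 p" unfolding restrict_section_def Union_proj_bundle by simp
  have "coord p (Vv 0) \<noteq> 0" "coord p (Ve 0) \<noteq> 0" using p by (simp_all add: open_orbit_def del: coord_simps)
  then have "?e p \<noteq> 0" unfolding ep by (intro frame_nonzero) simp_all
  moreover have "mult_map s r a (k, l) (cox_poly s r q) ?X ?e p = mult_map s r a (k, l) (cox_poly s r q') ?X ?e p"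
    using eq by simp
  ultimately show "cox_poly s r q p = cox_poly s r q' p" using e zariski_open_whole by (simp add: mult_map_def)
qed

end

definition hom_coeffs :: "nat \<Rightarrow> nat \<Rightarrow> (nat \<Rightarrow> int) \<Rightarrow> nat \<times> nat \<Rightarrow> sheaf_map \<Rightarrow> (divisor \<Rightarrow>\<^sub>0 complex)" where
  "hom_coeffs s r a P \<phi> =
     (THE q. Poly_Mapping.keys q \<subseteq> Div_T_plus s r \<and> \<phi> = mult_map s r a P (cox_poly s r q))"

definition hom_divisors :: "nat \<Rightarrow> nat \<Rightarrow> (nat \<Rightarrow> int) \<Rightarrow> nat \<times> nat \<Rightarrow> nat \<times> nat \<Rightarrow> divisor set" where
  "hom_divisors s r a P Q =
     weight_divisors s r a (int (fst Q) - int (fst P)) (int (snd Q) - int (snd P))"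

lemma hom_divisors_effective: "hom_divisors s r a P Q \<subseteq> Div_T_plus s r"
  by (auto simp: hom_divisors_def weight_divisors_def)

lemma hom_divisors_add:
  "D1 \<in> hom_divisors s r a P Q \<Longrightarrow> D2 \<in> hom_divisors s r a Q R \<Longrightarrow> D1 + D2 \<in> hom_divisors s r a P R"
  by (simp add: hom_divisors_def weight_divisors_def Div_T_plus_add deg1_add deg2_add)

context twisted_bundle
begin

lemma hom_coeffs_mult_map:
  assumes "Poly_Mapping.keys q \<subseteq> Div_T_plus s r"
  shows "hom_coeffs s r a P (mult_map s r a P (cox_poly s r q)) = q"
  unfolding hom_coeffs_def
  by (rule the_equality) (use assms mult_map_inject[of _ _ "fst P" "snd P"] in \<open>auto simp: prod.collapse\<close>)

lemma Hom_E_eq: "Hom_E s r a P Q = {mult_map s r a P (cox_poly s r q) | q. Poly_Mapping.keys q \<subseteq> hom_divisors s r a P Q}"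
  using Hom_E_cox_poly[of _ "fst P" "snd P" "fst Q" "snd Q"]
    mult_map_in_Hom_E[of _ s r a "fst Q" "fst P" "snd Q" "snd P"]
  unfolding hom_divisors_def by auto

lemma mult_map_add:
  "sheaf_map_add (mult_map s r a P (cox_poly s r q)) (mult_map s r a P (cox_poly s r q')) = mult_map s r a P (cox_poly s r (q + q'))"
  by (auto simp: sheaf_map_add_def mult_map_def cox_poly_add fun_eq_iff algebra_simps)

lemma mult_map_scale:
  "sheaf_map_scale c (mult_map s r a P (cox_poly s r q)) = mult_map s r a P (cox_poly s r (Poly_Mapping.map ((*) c) q))"
  by (auto simp: sheaf_map_scale_def mult_map_def cox_poly_map_scale fun_eq_iff)

lemma keys_map_scale: "Poly_Mapping.keys (Poly_Mapping.map ((*) (c::complex)) q) \<subseteq> Poly_Mapping.keys q"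
  by (auto simp: in_keys_iff Poly_Mapping.map.rep_eq when_def)

theorem hom_coeffs_linear_iso:
  "linear_iso (Hom_E s r a P Q) {u. Poly_Mapping.keys u \<subseteq> hom_divisors s r a P Q} (hom_coeffs s r a P)"
proof -
  note eff = order.trans[OF _ hom_divisors_effective]
  have coeffs: "hom_coeffs s r a P (mult_map s r a P (cox_poly s r q)) = q"
    if "Poly_Mapping.keys q \<subseteq> hom_divisors s r a P Q" for q
    using hom_coeffs_mult_map[OF eff[OF that]] .
  have "bij_betw (hom_coeffs s r a P) (Hom_E s r a P Q) {u. Poly_Mapping.keys u \<subseteq> hom_divisors s r a P Q}"
    by (rule bij_betwI[where g = "\<lambda>q. mult_map s r a P (cox_poly s r q)"])
       (auto simp: Hom_E_eq coeffs)
  moreover have "hom_coeffs s r a P (sheaf_map_add \<phi> \<psi>) = hom_coeffs s r a P \<phi> + hom_coeffs s r a P \<psi>"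
    if \<phi>\<psi>: "\<phi> \<in> Hom_E s r a P Q" "\<psi> \<in> Hom_E s r a P Q" for \<phi> \<psi>
  proof -
    obtain q q' where q: "\<phi> = mult_map s r a P (cox_poly s r q)" "Poly_Mapping.keys q \<subseteq> hom_divisors s r a P Q"
      and q': "\<psi> = mult_map s r a P (cox_poly s r q')" "Poly_Mapping.keys q' \<subseteq> hom_divisors s r a P Q"
      using \<phi>\<psi> unfolding Hom_E_eq by auto
    have "Poly_Mapping.keys (q + q') \<subseteq> hom_divisors s r a P Q"
      using Poly_Mapping.keys_add[of q q'] q(2) q'(2) by blast
    then show ?thesis
      using q q' by (simp add: mult_map_add coeffs)
  qed
  moreover have "hom_coeffs s r a P (sheaf_map_scale c \<phi>) = Poly_Mapping.map ((*) c) (hom_coeffs s r a P \<phi>)"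
    if \<phi>: "\<phi> \<in> Hom_E s r a P Q" for \<phi> c
  proof -
    obtain q where q: "\<phi> = mult_map s r a P (cox_poly s r q)" "Poly_Mapping.keys q \<subseteq> hom_divisors s r a P Q"
      using \<phi> unfolding Hom_E_eq by auto
    have "Poly_Mapping.keys (Poly_Mapping.map ((*) c) q) \<subseteq> hom_divisors s r a P Q"
      using keys_map_scale[of c q] q(2) by blast
    then show ?thesis using q by (simp add: mult_map_scale coeffs)
  qed
  ultimately show ?thesis unfolding linear_iso_def by blast
qed

theorem hom_coeffs_comp:
  assumes "\<phi> \<in> Hom_E s r a P Q" "\<psi> \<in> Hom_E s r a Q R"
  shows "hom_coeffs s r a P (sheaf_map_comp \<psi> \<phi>) = mon_comp (hom_coeffs s r a P \<phi>) (hom_coeffs s r a Q \<psi>)"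
proof -
  obtain q q' where q: "\<phi> = mult_map s r a P (cox_poly s r q)" "Poly_Mapping.keys q \<subseteq> hom_divisors s r a P Q"
    and q': "\<psi> = mult_map s r a Q (cox_poly s r q')" "Poly_Mapping.keys q' \<subseteq> hom_divisors s r a Q R"
    using assms unfolding Hom_E_eq by auto
  have eff: "Poly_Mapping.keys q \<subseteq> Div_T_plus s r" "Poly_Mapping.keys q' \<subseteq> Div_T_plus s r"
    using q(2) q'(2) hom_divisors_effective by blast+
  have eff': "Poly_Mapping.keys (mon_comp q q') \<subseteq> Div_T_plus s r"
    using keys_mon_comp[of q q'] eff by (auto intro!: Div_T_plus_add)
  have "sheaf_map_comp \<psi> \<phi> U \<sigma> = mult_map s r a P (cox_poly s r (mon_comp q q')) U \<sigma>" for U \<sigma>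
  proof (cases "zariski_open s r a U \<and> \<sigma> \<in> E s r a P U")
    case True
    then have "\<phi> U \<sigma> \<in> E s r a Q U" using Hom_E_D(2)[OF assms(1)] by blast
    then show ?thesis
      using True unfolding sheaf_map_comp_def q q'
      by (simp add: mult_map_def cox_poly_mon_comp[OF eff] mult_ac)
  next
    case False
    then have "\<phi> U \<sigma> = (\<lambda>_. 0)" by (rule Hom_E_D(1)[OF assms(1)])
    then show ?thesis using False by (auto simp: sheaf_map_comp_def q' mult_map_def fun_eq_iff)
  qed
  then have "sheaf_map_comp \<psi> \<phi> = mult_map s r a P (cox_poly s r (mon_comp q q'))" by (intro ext) (simp only:)
  then show ?thesis using eff eff' q q' by (simp add: hom_coeffs_mult_map)
qed

end

section \<open>The critical locus as a branched covering\<close>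

text \<open>The map \<open>crit_map\<close> below is a quotient of products of linear forms, and its differential is easiest
  to handle through logarithmic derivatives, which turn products into sums.\<close>

definition log_derivative :: "('v::real_normed_vector \<Rightarrow> complex) \<Rightarrow> ('v \<Rightarrow> complex) \<Rightarrow> 'v \<Rightarrow> bool" where
  "log_derivative f g x \<longleftrightarrow> (f has_derivative (\<lambda>v. f x * g v)) (at x)"

lemma log_derivative_mult:
  "log_derivative f g x \<Longrightarrow> log_derivative f' g' x \<Longrightarrow> log_derivative (\<lambda>x. f x * f' x) (\<lambda>v. g v + g' v) x"
  unfolding log_derivative_def
  by (drule (1) has_derivative_mult) (simp add: algebra_simps)

lemma log_derivative_const: "log_derivative (\<lambda>_. c) (\<lambda>_. 0) x"
  by (simp add: log_derivative_def)

lemma log_derivative_power: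
  "log_derivative f g x \<Longrightarrow> log_derivative (\<lambda>x. f x ^ n) (\<lambda>v. of_nat n * g v) x"
proof (induction n)
  case 0
  then show ?case using log_derivative_const by simp
next
  case (Suc n)
  then show ?case using log_derivative_mult[of f g x "\<lambda>x. f x ^ n" "\<lambda>v. of_nat n * g v"]
    by (simp add: algebra_simps)
qed

lemma log_derivative_prod:
  "(\<And>i. i \<in> I \<Longrightarrow> log_derivative (f i) (g i) x) \<Longrightarrow>
     log_derivative (\<lambda>x. \<Prod>i\<in>I. f i x) (\<lambda>v. \<Sum>i\<in>I. g i v) x"
  by (induction I rule: infinite_finite_induct) (auto intro: log_derivative_const log_derivative_mult)

lemma log_derivative_divide:
  assumes "log_derivative f g x" "log_derivative f' g' x" "f' x \<noteq> 0"
  shows "log_derivative (\<lambda>x. f x / f' x) (\<lambda>v. g v - g' v) x"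
proof -
  have "((\<lambda>x. f x / f' x) has_derivative
      (\<lambda>v. - f x * (inverse (f' x) * (f' x * g' v) * inverse (f' x)) + f x * g v / f' x)) (at x)"
    using assms unfolding log_derivative_def by (intro has_derivative_divide)
  moreover have "(\<lambda>v. - f x * (inverse (f' x) * (f' x * g' v) * inverse (f' x)) + f x * g v / f' x) =
      (\<lambda>v. f x / f' x * (g v - g' v))"
    using assms(3) by (auto simp: fun_eq_iff field_simps)
  ultimately show ?thesis unfolding log_derivative_def by simp
qed

text \<open>The inverse function theorem for derivatives that are plain functions instead of bounded linear
  operators. That they stay injective on \<open>U\<close> will make nondegeneracy an open condition.\<close>

lemma local_inverse:
  fixes f :: "'v::euclidean_space \<Rightarrow> 'v"
  assumes "open S" and der: "\<And>x. x \<in> S \<Longrightarrow> (f has_derivative f' x) (at x)"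
    and cont: "\<And>v. continuous_on S (\<lambda>x. f' x v)" and x0: "x0 \<in> S" and inj: "inj (f' x0)"
  obtains U V g where "open U" "U \<subseteq> S" "x0 \<in> U" "open V" "f x0 \<in> V" "homeomorphism U V f g"
    "\<And>y. y \<in> V \<Longrightarrow> \<exists>g'. (g has_derivative g') (at y)" "\<And>x. x \<in> U \<Longrightarrow> inj (f' x)"
proof -
  define F where "F x = Blinfun (f' x)" for x
  have bl: "bounded_linear (f' x)" if "x \<in> S" for x using der[OF that] has_derivative_bounded_linear by blast
  have F: "blinfun_apply (F x) = f' x" if "x \<in> S" for x
    using bl[OF that] by (simp add: F_def bounded_linear_Blinfun_apply)
  obtain h where h: "linear h" "h \<circ> f' x0 = id"
    using linear_injective_left_inverse[OF bounded_linear.linear[OF bl[OF x0]] inj] by blast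
  have "bounded_linear h" using h(1) linear_conv_bounded_linear by blast
  then have inv: "Blinfun h o\<^sub>L F x0 = id_blinfun"
    using fun_cong[OF h(2)] x0 by (intro blinfun_eqI) (simp add: bounded_linear_Blinfun_apply F)
  have contF: "continuous_on S F"
  proof (rule continuous_on_blinfun_componentwise)
    show "continuous_on S (\<lambda>x. blinfun_apply (F x) i)" for i
      using cont[of i] by (rule continuous_on_eq) (simp add: F)
  qed
  obtain U V g g' where *: "open U" "U \<subseteq> S" "x0 \<in> U" "open V" "f x0 \<in> V" "homeomorphism U V f g"
    "\<And>y. y \<in> V \<Longrightarrow> (g has_derivative (g' y)) (at y)"
    "\<And>y. y \<in> V \<Longrightarrow> g' y = inv (blinfun_apply (F (g y)))"
    "\<And>y. y \<in> V \<Longrightarrow> bij (blinfun_apply (F (g y)))"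
    by (rule inverse_function_theorem[of S f F x0 "Blinfun h"])
       (use assms(1) der F contF x0 inv in simp_all)
  have "inj (f' x)" if "x \<in> U" for x
  proof -
    have "f x \<in> V" "g (f x) = x"
      using that homeomorphism_image1[OF *(6)] homeomorphism_apply1[OF *(6)] by auto
    then have "bij (blinfun_apply (F x))" using *(9) by metis
    then show ?thesis using subsetD[OF *(2) that] by (simp add: bij_def F)
  qed
  then show ?thesis using * that by blast
qed

context twisted_bundle
begin

definition b :: "nat \<Rightarrow> nat" where "b j = nat (a j)"

text \<open>The variables \<open>x = (A, B)\<close> stand for the values of the last two terms of the Laurent polynomial at a
  critical point, and \<open>lin j x = B - a j * A\<close> is then the value of \<open>\<beta> j * w j\<close>, with \<open>lin 0 x = B\<close>. The
  components of \<open>crit_map\<close> have the logarithmic derivatives \<open>dlog1 x\<close> and \<open>dlog2 x\<close>.\<close>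

definition lin :: "nat \<Rightarrow> complex \<times> complex \<Rightarrow> complex" where
  "lin j x = snd x - of_int (a j) * fst x"

definition crit_dom :: "(complex \<times> complex) set" where
  "crit_dom = {x. fst x \<noteq> 0 \<and> (\<forall>j\<le>r. lin j x \<noteq> 0)}"

definition crit_map :: "complex \<times> complex \<Rightarrow> complex \<times> complex" where
  "crit_map x = (fst x ^ (s + 1) / (\<Prod>j\<le>r. lin j x ^ b j), \<Prod>j\<le>r. lin j x)"

definition dlog1 :: "complex \<times> complex \<Rightarrow> complex \<times> complex \<Rightarrow> complex" where
  "dlog1 x v = of_nat (s + 1) * (fst v / fst x) - (\<Sum>j\<le>r. of_nat (b j) * (lin j v / lin j x))"

definition dlog2 :: "complex \<times> complex \<Rightarrow> complex \<times> complex \<Rightarrow> complex" where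
  "dlog2 x v = (\<Sum>j\<le>r. lin j v / lin j x)"

definition nondegenerate :: "complex \<times> complex \<Rightarrow> bool" where
  "nondegenerate x \<longleftrightarrow> (\<forall>v. dlog1 x v = 0 \<and> dlog2 x v = 0 \<longrightarrow> v = 0)"

lemma int_b: "j \<le> r \<Longrightarrow> int (b j) = a j"
  using a_nonneg by (simp add: b_def)

lemma of_nat_b: "j \<le> r \<Longrightarrow> of_nat (b j) = (of_int (a j) :: 'z::ring_1)"
  using int_b[of j] by (metis of_int_of_nat_eq)

lemma b_0: "b 0 = 0" by (simp add: b_def a_0)

lemma atMost_split: "{..r} = insert 0 {1..r}" by auto

lemma sum_b_le: "(\<Sum>j\<le>r. b j) \<le> s"
proof -
  have "int (\<Sum>j\<le>r. b j) = (\<Sum>j=1..r. a j)"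
    unfolding atMost_split using int_b by (simp add: b_0)
  then show ?thesis using sum_a_le by linarith
qed

lemma open_crit_dom: "open crit_dom"
proof -
  have "crit_dom = {x. fst x \<noteq> 0} \<inter> (\<Inter>j\<le>r. {x. lin j x \<noteq> 0})" by (auto simp: crit_dom_def)
  moreover have "open {x :: complex \<times> complex. fst x \<noteq> 0}" by (intro open_Collect_neq continuous_intros)
  moreover have "open {x. lin j x \<noteq> 0}" for j
    unfolding lin_def by (intro open_Collect_neq continuous_intros)
  ultimately show ?thesis by (metis finite_atMost open_INT open_Int)
qed

lemma continuous_on_lin [continuous_intros]:
  "continuous_on S f \<Longrightarrow> continuous_on S (\<lambda>x. lin j (f x))"
  unfolding lin_def by (intro continuous_intros)

lemma continuous_on_crit_map: "continuous_on crit_dom crit_map"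
  unfolding crit_map_def by (intro continuous_intros) (auto simp: crit_dom_def)

lemma crit_map_nonzero: "x \<in> crit_dom \<Longrightarrow> fst (crit_map x) \<noteq> 0 \<and> snd (crit_map x) \<noteq> 0"
  by (auto simp: crit_map_def crit_dom_def)

lemma log_derivative_lin: "lin j x \<noteq> 0 \<Longrightarrow> log_derivative (lin j) (\<lambda>v. lin j v / lin j x) x"
proof -
  assume "lin j x \<noteq> 0"
  moreover have "(lin j has_derivative lin j) (at x)"
    unfolding lin_def[abs_def] by (auto intro!: derivative_eq_intros)
  ultimately show ?thesis by (simp add: log_derivative_def eta_contract_eq)
qed

lemma log_derivative_crit_map:
  assumes "x \<in> crit_dom"
  shows "log_derivative (\<lambda>x. fst (crit_map x)) (dlog1 x) x" "log_derivative (\<lambda>x. snd (crit_map x)) (dlog2 x) x"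
proof -
  have A: "log_derivative fst (\<lambda>v. fst v / fst x) x"
    using assms by (auto simp: log_derivative_def crit_dom_def intro!: derivative_eq_intros)
  have B: "log_derivative (lin j) (\<lambda>v. lin j v / lin j x) x" if "j \<in> {..r}" for j
    using assms that by (auto simp: crit_dom_def intro!: log_derivative_lin)
  show "log_derivative (\<lambda>x. fst (crit_map x)) (dlog1 x) x"
    unfolding crit_map_def fst_conv dlog1_def[abs_def] using assms
    by (intro log_derivative_divide log_derivative_power A log_derivative_prod B) (auto simp: crit_dom_def)
  show "log_derivative (\<lambda>x. snd (crit_map x)) (dlog2 x) x"
    unfolding crit_map_def snd_conv dlog2_def[abs_def] by (intro log_derivative_prod B)
qed

definition dcrit_map :: "complex \<times> complex \<Rightarrow> complex \<times> complex \<Rightarrow> complex \<times> complex" where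
  "dcrit_map x v = (fst (crit_map x) * dlog1 x v, snd (crit_map x) * dlog2 x v)"

lemma crit_map_has_derivative: "x \<in> crit_dom \<Longrightarrow> (crit_map has_derivative dcrit_map x) (at x)"
  using has_derivative_Pair[OF log_derivative_crit_map[of x, unfolded log_derivative_def]]
  by (simp add: dcrit_map_def[abs_def])

lemma bounded_linear_dcrit_map: "x \<in> crit_dom \<Longrightarrow> bounded_linear (dcrit_map x)"
  using crit_map_has_derivative has_derivative_bounded_linear by blast

lemma nondegenerate_iff_inj: "x \<in> crit_dom \<Longrightarrow> nondegenerate x \<longleftrightarrow> inj (dcrit_map x)"
  using crit_map_nonzero[of x] linear_injective_0[OF bounded_linear.linear[OF bounded_linear_dcrit_map[of x]]]
  by (auto simp: nondegenerate_def dcrit_map_def zero_prod_def)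

lemma crit_map_local_homeomorphism:
  assumes x: "x \<in> crit_dom" and nd: "nondegenerate x"
  obtains U V g where "open U" "U \<subseteq> crit_dom" "x \<in> U" "open V" "crit_map x \<in> V" "homeomorphism U V crit_map g"
    "\<And>y. y \<in> V \<Longrightarrow> \<exists>g'. (g has_derivative g') (at y)" "\<And>x'. x' \<in> U \<Longrightarrow> nondegenerate x'"
proof -
  have cont: "continuous_on crit_dom (\<lambda>x. dcrit_map x v)" for v
    unfolding dcrit_map_def dlog1_def dlog2_def
    by (intro continuous_intros continuous_on_crit_map) (auto simp: crit_dom_def)
  have inj: "inj (dcrit_map x)" using nondegenerate_iff_inj[OF x] nd by simp
  obtain U V g where *: "open U" "U \<subseteq> crit_dom" "x \<in> U" "open V" "crit_map x \<in> V" "homeomorphism U V crit_map g"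
    "\<And>y. y \<in> V \<Longrightarrow> \<exists>g'. (g has_derivative g') (at y)" "\<And>x. x \<in> U \<Longrightarrow> inj (dcrit_map x)"
    by (rule local_inverse[OF open_crit_dom crit_map_has_derivative cont x inj]) (assumption | rule that)+
  have "nondegenerate x'" if "x' \<in> U" for x'
    using nondegenerate_iff_inj[OF subsetD[OF *(2) that]] *(8)[OF that] by simp
  then show ?thesis using * that by blast
qed

subsection \<open>Properness\<close>

definition torus2 :: "(complex \<times> complex) set" where
  "torus2 = {y. fst y \<noteq> 0 \<and> snd y \<noteq> 0}"

lemma compact_bounds:
  assumes "compact K" "K \<subseteq> torus2"
  obtains M where "M \<ge> 1" "\<And>y. y \<in> K \<Longrightarrow> norm (fst y) \<le> M \<and> norm (snd y) \<le> M \<and>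
    1 / M \<le> norm (fst y) \<and> 1 / M \<le> norm (snd y)"
proof -
  have nz: "fst y \<noteq> 0 \<and> snd y \<noteq> 0" if "y \<in> K" for y using that assms(2) by (auto simp: torus2_def)
  have "bounded ((\<lambda>y. norm (fst y) + norm (snd y) + norm (inverse (fst y)) + norm (inverse (snd y))) ` K)"
    using nz by (intro compact_imp_bounded compact_continuous_image assms continuous_intros) auto
  then obtain M where M: "\<And>y. y \<in> K \<Longrightarrow> norm (fst y) + norm (snd y) + norm (inverse (fst y)) + norm (inverse (snd y)) \<le> M"
    unfolding bounded_iff by fastforce
  show ?thesis
  proof (rule that[of "max 1 M"])
    fix y assume y: "y \<in> K"
    have "norm (fst y) \<le> M" "norm (snd y) \<le> M" "norm (inverse (fst y)) \<le> M" "norm (inverse (snd y)) \<le> M"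
      using M[OF y] by (smt (verit) norm_ge_zero)+
    then have "norm (fst y) \<le> max 1 M" "norm (snd y) \<le> max 1 M" "norm (inverse (fst y)) \<le> max 1 M"
      "norm (inverse (snd y)) \<le> max 1 M" by linarith+
    then show "norm (fst y) \<le> max 1 M \<and> norm (snd y) \<le> max 1 M \<and>
        1 / max 1 M \<le> norm (fst y) \<and> 1 / max 1 M \<le> norm (snd y)"
      using nz[OF y] by (simp add: norm_inverse norm_divide field_simps)
  qed simp
qed

text \<open>If \<open>B\<close> dominates \<open>A\<close>, then all linear forms have the size of \<open>B\<close>, and the bound on their product
  bounds \<open>B\<close>. Otherwise they are bounded by multiples of \<open>A\<close>, so that the first component of \<open>crit_map\<close>
  bounds \<open>norm A ^ (s + 1)\<close> by a multiple of \<open>norm A ^ N\<close> for \<open>norm A \<ge> 1\<close>, with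
  \<open>N = (\<Sum>j\<le>r. b j) \<le> s\<close>. This bounds \<open>A\<close>. The product of the linear forms then bounds each of them from
  below, and the first component does so for \<open>A\<close>.\<close>

lemma crit_map_fiber_bounds:
  assumes M: "M \<ge> 1"
  obtains m R where "m > 0" "\<And>x. x \<in> crit_dom \<Longrightarrow> norm (fst (crit_map x)) \<le> M \<Longrightarrow> norm (snd (crit_map x)) \<le> M \<Longrightarrow>
     1 / M \<le> norm (fst (crit_map x)) \<Longrightarrow> 1 / M \<le> norm (snd (crit_map x)) \<Longrightarrow>
     norm (fst x) \<le> R \<and> norm (snd x) \<le> R \<and> m \<le> norm (fst x) \<and> (\<forall>j\<le>r. m \<le> norm (lin j x))"
proof -
  define N where "N = (\<Sum>j\<le>r. b j)"
  define \<kappa> where "\<kappa> = 1 + (\<Sum>j\<le>r. real_of_int \<bar>a j\<bar>)"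
  have \<kappa>: "\<kappa> \<ge> 1" by (simp add: \<kappa>_def sum_nonneg)
  have a\<kappa>: "real_of_int \<bar>a j\<bar> \<le> \<kappa>" if "j \<le> r" for j
    using member_le_sum[of j "{..r}" "\<lambda>j. real_of_int \<bar>a j\<bar>"] that by (simp add: \<kappa>_def)
  define R1 where "R1 = max (2 * M) (M * (3 * \<kappa>) ^ N)"
  define R where "R = 2 * \<kappa> * R1"
  define R' where "R' = 2 * \<kappa> * R"
  have R1: "R1 \<ge> 1" using M by (simp add: R1_def)
  have R: "R \<ge> R1" "R \<ge> 1" using R1 \<kappa> mult_mono[of 1 "2 * \<kappa>" 1 R1] mult_right_mono[of 1 "2*\<kappa>" R1] by (simp_all add: R_def)
  have R': "R' \<ge> 1" using R \<kappa> mult_mono[of 1 "2 * \<kappa>" 1 R] by (simp add: R'_def)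
  define m1 where "m1 = 1 / (M * R' ^ r)"
  define m where "m = min (min 1 m1) (m1 ^ N / M)"
  have m1: "m1 > 0" using M R' by (simp add: m1_def)
  have m: "m > 0" using m1 M by (simp add: m_def)
  have "norm (fst x) \<le> R \<and> norm (snd x) \<le> R \<and> m \<le> norm (fst x) \<and> (\<forall>j\<le>r. m \<le> norm (lin j x))"
    if x: "x \<in> crit_dom" and bd: "norm (fst (crit_map x)) \<le> M" "norm (snd (crit_map x)) \<le> M"
      "1 / M \<le> norm (fst (crit_map x))" "1 / M \<le> norm (snd (crit_map x))" for x
  proof -
    have nz: "fst x \<noteq> 0" "\<And>j. j \<le> r \<Longrightarrow> lin j x \<noteq> 0" using x by (auto simp: crit_dom_def)
    have e2: "norm (snd (crit_map x)) = (\<Prod>j\<le>r. norm (lin j x))" by (simp add: crit_map_def prod_norm)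
    have "norm (fst (crit_map x)) = norm (fst x) ^ (s + 1) / (\<Prod>j\<le>r. norm (lin j x) ^ b j)"
      by (simp add: crit_map_def norm_divide norm_power norm_mult prod_norm[symmetric])
    moreover have "(\<Prod>j\<le>r. norm (lin j x) ^ b j) > 0" using nz by (intro prod_pos) auto
    ultimately have e1: "norm (fst x) ^ (s + 1) = norm (fst (crit_map x)) * (\<Prod>j\<le>r. norm (lin j x) ^ b j)"
      by (metis less_irrefl nonzero_eq_divide_eq)
    have lin_le: "norm (lin j x) \<le> norm (snd x) + \<kappa> * norm (fst x)" if "j \<le> r" for j
    proof -
      have "norm (lin j x) \<le> norm (snd x) + norm (of_int (a j) * fst x)"
        unfolding lin_def by (rule norm_triangle_ineq4)
      also have "norm (of_int (a j) * fst x) \<le> \<kappa> * norm (fst x)"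
        using a\<kappa>[OF that] by (simp add: norm_mult mult_right_mono)
      finally show ?thesis by simp
    qed
    have lin_ge: "norm (lin j x) \<ge> norm (snd x) - \<kappa> * norm (fst x)" if "j \<le> r" for j
    proof -
      have "norm (lin j x) \<ge> norm (snd x) - norm (of_int (a j) * fst x)"
        unfolding lin_def by (rule norm_triangle_ineq2)
      moreover have "norm (of_int (a j) * fst x) \<le> \<kappa> * norm (fst x)"
        using a\<kappa>[OF that] by (simp add: norm_mult mult_right_mono)
      ultimately show ?thesis by simp
    qed
    have AB: "norm (fst x) \<le> R1 \<and> norm (snd x) \<le> R"
    proof (cases "norm (snd x) \<ge> 2 * \<kappa> * norm (fst x)")
      case True
      let ?h = "norm (snd x) / 2"
      have "?h \<le> norm (lin j x)" if "j \<le> r" for j using lin_ge[OF that] True by simp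
      then have "(\<Prod>j\<le>r. ?h) \<le> (\<Prod>j\<le>r. norm (lin j x))" by (intro prod_mono) auto
      then have hM: "?h ^ (r + 1) \<le> M" using e2 bd(2) by simp
      have "?h \<le> M"
      proof (cases "?h \<ge> 1")
        case True
        then have "?h ^ 1 \<le> ?h ^ (r + 1)" by (intro power_increasing) auto
        then show ?thesis using hM by simp
      qed (use M in simp)
      then have B: "norm (snd x) \<le> 2 * M" by simp
      have "norm (fst x) \<le> \<kappa> * norm (fst x)" using \<kappa> by (simp add: mult_le_cancel_right1)
      then have "norm (fst x) \<le> M" using True B by linarith
      then show ?thesis using B R M by (auto simp: R1_def)
    next
      case False
      have lin3: "norm (lin j x) \<le> 3 * \<kappa> * norm (fst x)" if "j \<le> r" for j
        using lin_le[OF that] False by simp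
      have A: "norm (fst x) \<le> R1"
      proof (cases "norm (fst x) \<ge> 1")
        case True
        have "(\<Prod>j\<le>r. norm (lin j x) ^ b j) \<le> (\<Prod>j\<le>r. (3 * \<kappa> * norm (fst x)) ^ b j)"
          using lin3 by (intro prod_mono conjI power_mono) auto
        also have "\<dots> = (3 * \<kappa> * norm (fst x)) ^ N" by (simp add: N_def power_sum)
        also have "\<dots> = (3 * \<kappa>) ^ N * norm (fst x) ^ N" by (simp add: power_mult_distrib)
        also have "\<dots> \<le> (3 * \<kappa>) ^ N * norm (fst x) ^ s"
          using True sum_b_le \<kappa> by (intro mult_left_mono power_increasing) (auto simp: N_def)
        finally have "norm (fst x) ^ (s + 1) \<le> M * ((3 * \<kappa>) ^ N * norm (fst x) ^ s)"
          unfolding e1 using bd(1) \<kappa> M by (intro mult_mono) (auto intro!: prod_nonneg)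
        then have "norm (fst x) * norm (fst x) ^ s \<le> (M * (3 * \<kappa>) ^ N) * norm (fst x) ^ s" by (simp add: mult_ac)
        then have "norm (fst x) \<le> M * (3 * \<kappa>) ^ N" using nz(1) by (simp add: mult_le_cancel_right)
        then show ?thesis by (simp add: R1_def)
      qed (use R1 in simp)
      moreover have "2 * \<kappa> * norm (fst x) \<le> R" unfolding R_def using A \<kappa> by (intro mult_left_mono) auto
      ultimately show ?thesis using False by simp
    qed
    have linR: "norm (lin j x) \<le> R'" if "j \<le> r" for j
    proof -
      have "norm (snd x) + \<kappa> * norm (fst x) \<le> \<kappa> * R + \<kappa> * R"
      proof (intro add_mono mult_left_mono)
        have "R \<le> \<kappa> * R" using \<kappa> R by (simp add: mult_le_cancel_right1)
        then show "norm (snd x) \<le> \<kappa> * R" using AB by linarith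
      qed (use AB R \<kappa> in auto)
      then show ?thesis using lin_le[OF that] by (simp add: R'_def mult_ac)
    qed
    have lin_m1: "m1 \<le> norm (lin j x)" if j: "j \<le> r" for j
    proof -
      have "1 / M \<le> norm (lin j x) * (\<Prod>i\<in>{..r} - {j}. norm (lin i x))"
        using bd(4) e2 j by (simp add: prod.remove[of "{..r}" j])
      also have "(\<Prod>i\<in>{..r} - {j}. norm (lin i x)) \<le> (\<Prod>i\<in>{..r} - {j}. R')"
        using linR by (intro prod_mono) auto
      also have "(\<Prod>i\<in>{..r} - {j}. R') = R' ^ r" using j by simp
      finally have "1 / M \<le> norm (lin j x) * R' ^ r" by (simp add: mult_left_mono)
      then show ?thesis using M R' by (simp add: m1_def field_simps)
    qed
    have "m \<le> norm (fst x)"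
    proof (cases "norm (fst x) \<ge> 1")
      case False
      have "m1 ^ N = (\<Prod>j\<le>r. m1 ^ b j)" by (simp add: N_def power_sum)
      also have "\<dots> \<le> (\<Prod>j\<le>r. norm (lin j x) ^ b j)"
        using lin_m1 m1 by (intro prod_mono conjI power_mono) auto
      finally have "1 / M * m1 ^ N \<le> norm (fst (crit_map x)) * (\<Prod>j\<le>r. norm (lin j x) ^ b j)"
        using bd(3) m1 M by (intro mult_mono) auto
      also have "\<dots> = norm (fst x) ^ (s + 1)" using e1 by simp
      also have "\<dots> \<le> norm (fst x) ^ 1" using False by (intro power_decreasing) auto
      finally show ?thesis by (simp add: m_def)
    qed (simp add: m_def)
    moreover have "\<forall>j\<le>r. m \<le> norm (lin j x)" using lin_m1 by (force simp: m_def)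
    ultimately show ?thesis using AB R by auto
  qed
  then show ?thesis using that m by blast
qed

text \<open>The lower bounds confine the preimage to a set \<open>C\<close> that is closed in the whole plane and not only in
  the open set \<open>crit_dom\<close>.\<close>

lemma compact_crit_map_vimage:
  assumes "compact K" "K \<subseteq> torus2"
  shows "compact (crit_dom \<inter> crit_map -` K)"
proof -
  obtain M where M: "M \<ge> 1" "\<And>y. y \<in> K \<Longrightarrow> norm (fst y) \<le> M \<and> norm (snd y) \<le> M \<and>
    1 / M \<le> norm (fst y) \<and> 1 / M \<le> norm (snd y)" using compact_bounds[OF assms] by metis
  obtain m R where mR: "m > 0" "\<And>x. x \<in> crit_dom \<Longrightarrow> norm (fst (crit_map x)) \<le> M \<Longrightarrow> norm (snd (crit_map x)) \<le> M \<Longrightarrow>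
     1 / M \<le> norm (fst (crit_map x)) \<Longrightarrow> 1 / M \<le> norm (snd (crit_map x)) \<Longrightarrow>
     norm (fst x) \<le> R \<and> norm (snd x) \<le> R \<and> m \<le> norm (fst x) \<and> (\<forall>j\<le>r. m \<le> norm (lin j x))"
    using crit_map_fiber_bounds[OF M(1)] by metis
  define C where "C = {x. m \<le> norm (fst x)} \<inter> (\<Inter>j\<le>r. {x. m \<le> norm (lin j x)})"
  have "closed C"
    unfolding C_def by (intro closed_Int closed_INT ballI closed_Collect_le continuous_intros)
  have Cd: "C \<subseteq> crit_dom"
  proof
    fix x assume x: "x \<in> C"
    have "fst x \<noteq> 0" using x mR(1) by (auto simp: C_def)
    moreover have "lin j x \<noteq> 0" if "j \<le> r" for j
    proof -
      have "m \<le> norm (lin j x)" using x that by (simp add: C_def)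
      then show ?thesis using mR(1) by auto
    qed
    ultimately show "x \<in> crit_dom" by (simp add: crit_dom_def)
  qed
  have "closed (C \<inter> crit_map -` K)"
    using continuous_closed_preimage[OF continuous_on_subset[OF continuous_on_crit_map Cd] \<open>closed C\<close> compact_imp_closed[OF assms(1)]] .
  moreover have eq: "crit_dom \<inter> crit_map -` K = C \<inter> crit_map -` K"
  proof
    show "crit_dom \<inter> crit_map -` K \<subseteq> C \<inter> crit_map -` K"
      using mR(2) M(2) by (auto simp: C_def)
  qed (use Cd in auto)
  moreover have "bounded (crit_dom \<inter> crit_map -` K)"
  proof (rule boundedI)
    fix x assume "x \<in> crit_dom \<inter> crit_map -` K"
    then have "norm (fst x) \<le> R" "norm (snd x) \<le> R" using mR(2) M(2) by auto
    then show "norm x \<le> R + R" using norm_Pair_le[of "fst x" "snd x"] by simp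
  qed
  ultimately show ?thesis by (simp add: compact_eq_bounded_closed)
qed


subsection \<open>The covering over the regular values\<close>

definition regular_values :: "(complex \<times> complex) set" where
  "regular_values = {y \<in> torus2. \<forall>x\<in>crit_dom. crit_map x = y \<longrightarrow> nondegenerate x}"

text \<open>Values outside of the image are excluded because a covering map has to be surjective.\<close>

definition base :: "(complex \<times> complex) set" where
  "base = regular_values \<inter> crit_map ` crit_dom"

definition total :: "(complex \<times> complex) set" where
  "total = crit_dom \<inter> crit_map -` base"

lemma finite_fiber:
  assumes "y \<in> regular_values"
  shows "finite (crit_dom \<inter> crit_map -` {y})"
proof -
  let ?F = "crit_dom \<inter> crit_map -` {y}"
  have "\<exists>U. open U \<and> x \<in> U \<and> ?F \<inter> U \<subseteq> {x}" if x: "x \<in> ?F" for x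
  proof -
    have nd: "nondegenerate x" using x assms by (auto simp: regular_values_def)
    have "x \<in> crit_dom" using x by blast
    then obtain U V g where U: "open U" "x \<in> U" "homeomorphism U V crit_map g"
      using crit_map_local_homeomorphism[of x] nd by metis
    have "?F \<inter> U \<subseteq> {x}"
    proof
      fix x' assume "x' \<in> ?F \<inter> U"
      then have "crit_map x' = crit_map x" "x' \<in> U" using x by auto
      then show "x' \<in> {x}" using U by (metis homeomorphism_apply1 singletonI)
    qed
    then show ?thesis using U by blast
  qed
  then obtain U where U: "\<And>x. x \<in> ?F \<Longrightarrow> open (U x) \<and> x \<in> U x \<and> ?F \<inter> U x \<subseteq> {x}" by metis
  have "compact ?F" using assms by (intro compact_crit_map_vimage) (auto simp: regular_values_def)
  then obtain D where D: "D \<subseteq> ?F" "finite D" "?F \<subseteq> (\<Union>x\<in>D. U x)"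
    by (rule compactE_image[of ?F ?F U]) (use U in auto)
  have "?F \<subseteq> D"
  proof
    fix x assume x: "x \<in> ?F"
    then obtain d where "d \<in> D" "x \<in> U d" using D by blast
    then show "x \<in> D" using U[of d] D x by blast
  qed
  then show ?thesis using D finite_subset by blast
qed

lemma separated_neighbourhoods:
  fixes F :: "'m::metric_space set"
  assumes "finite F"
  obtains \<delta> where "\<delta> > 0" "\<And>x y. x \<in> F \<Longrightarrow> y \<in> F \<Longrightarrow> x \<noteq> y \<Longrightarrow> ball x \<delta> \<inter> ball y \<delta> = {}"
proof -
  let ?S = "insert 1 ((\<lambda>(x, y). dist x y) ` {(x, y) \<in> F \<times> F. x \<noteq> y})"
  have "finite {(x, y) \<in> F \<times> F. x \<noteq> y}" by (rule finite_subset[of _ "F \<times> F"]) (use assms in auto)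
  then have fin: "finite ?S" by simp
  have "Min ?S > 0" using fin by (subst Min_gr_iff) auto
  moreover have "ball x (Min ?S / 2) \<inter> ball y (Min ?S / 2) = {}" if "x \<in> F" "y \<in> F" "x \<noteq> y" for x y
  proof -
    have "Min ?S \<le> dist x y" using fin that by (intro Min_le) auto
    then show ?thesis by (intro disjoint_ballI) simp
  qed
  ultimately show ?thesis using that[of "Min ?S / 2"] by simp
qed

text \<open>Around each of the finitely many points \<open>x\<close> of the fibre, \<open>crit_map\<close> is a homeomorphism on a
  neighbourhood \<open>W x\<close>. The points outside of these neighbourhoods whose values lie in a compact ball
  around \<open>y\<close> form a compact set \<open>Z\<close> by properness, and its image is closed and misses \<open>y\<close>. Removing
  this image leaves a neighbourhood \<open>T\<close> whose preimage lies in the sets \<open>W x\<close>. An empty fibre is allowed;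
  it stays empty over \<open>T\<close>, so that \<open>base\<close> is also closed in the set of regular values.\<close>

lemma evenly_covered:
  assumes y: "y \<in> regular_values"
  obtains T v where "open T" "y \<in> T" "T \<subseteq> regular_values" "\<Union>v = crit_dom \<inter> crit_map -` T"
    "\<And>u. u \<in> v \<Longrightarrow> open u" "pairwise disjnt v" "\<And>u. u \<in> v \<Longrightarrow> \<exists>q. homeomorphism u T crit_map q"
    "y \<notin> crit_map ` crit_dom \<Longrightarrow> v = {}"
proof -
  let ?F = "crit_dom \<inter> crit_map -` {y}"
  have fin: "finite ?F" using finite_fiber[OF y] .
  have "\<forall>x\<in>?F. \<exists>U V g. open U \<and> U \<subseteq> crit_dom \<and> x \<in> U \<and> open V \<and> homeomorphism U V crit_map g \<and>
      (\<forall>x'\<in>U. nondegenerate x')"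
  proof
    fix x assume "x \<in> ?F"
    then have "x \<in> crit_dom" "nondegenerate x" using y by (auto simp: regular_values_def)
    then show "\<exists>U V g. open U \<and> U \<subseteq> crit_dom \<and> x \<in> U \<and> open V \<and> homeomorphism U V crit_map g \<and>
        (\<forall>x'\<in>U. nondegenerate x')"
      using crit_map_local_homeomorphism[of x] by metis
  qed
  then obtain U V g where UVg: "\<forall>x\<in>?F. open (U x) \<and> U x \<subseteq> crit_dom \<and> x \<in> U x \<and> open (V x) \<and>
      homeomorphism (U x) (V x) crit_map (g x) \<and> (\<forall>x'\<in>U x. nondegenerate x')"
    unfolding bchoice_iff by (elim exE)
  have U: "open (U x)" "U x \<subseteq> crit_dom" "x \<in> U x" "open (V x)" "homeomorphism (U x) (V x) crit_map (g x)"
     "\<And>x'. x' \<in> U x \<Longrightarrow> nondegenerate x'" if "x \<in> ?F" for x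
    using bspec[OF UVg that] by simp_all
  obtain \<delta> where \<delta>: "\<delta> > 0" "\<And>x x'. x \<in> ?F \<Longrightarrow> x' \<in> ?F \<Longrightarrow> x \<noteq> x' \<Longrightarrow> ball x \<delta> \<inter> ball x' \<delta> = {}"
    using separated_neighbourhoods[OF fin] by metis
  define W where "W x = U x \<inter> ball x \<delta>" for x
  have W: "open (W x)" "x \<in> W x" "W x \<subseteq> crit_dom" if "x \<in> ?F" for x
    using U(1-3)[OF that] \<delta>(1) by (auto simp: W_def)
  have homW: "homeomorphism (W x) (crit_map ` W x) crit_map (g x)" if "x \<in> ?F" for x
    using U(5)[OF that] by (rule homeomorphism_of_subsets) (auto simp: W_def)
  have openW: "open (crit_map ` W x)" if x: "x \<in> ?F" for x
  proof -
    have "openin (top_of_set (V x)) (crit_map ` W x)"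
      using homeomorphism_imp_open_map[OF U(5)[OF x], of "W x"] U(1)[OF x]
      by (simp add: W_def openin_open_Int)
    then show ?thesis using U(4)[OF x] openin_open_trans by blast
  qed
  have "open torus2"
    unfolding torus2_def by (intro open_Collect_conj open_Collect_neq continuous_intros)
  moreover have "y \<in> torus2" using y by (simp add: regular_values_def)
  ultimately obtain \<rho> where \<rho>: "\<rho> > 0" "cball y \<rho> \<subseteq> torus2" using open_contains_cball by blast
  define Z where "Z = (crit_dom \<inter> crit_map -` cball y \<rho>) - (\<Union>x\<in>?F. W x)"
  have "open (\<Union>x\<in>?F. W x)" using W(1) by blast
  then have "compact Z"
    unfolding Z_def using compact_crit_map_vimage[of "cball y \<rho>"] \<rho>(2) by (intro compact_diff) auto
  moreover have "Z \<subseteq> crit_dom" by (auto simp: Z_def)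
  ultimately have "closed (crit_map ` Z)"
    using continuous_on_subset[OF continuous_on_crit_map] by (intro compact_imp_closed compact_continuous_image)
  define T where "T = (ball y \<rho> \<inter> (\<Inter>x\<in>?F. crit_map ` W x)) - crit_map ` Z"
  have "open T"
    unfolding T_def using fin openW \<open>closed (crit_map ` Z)\<close> by (intro open_Diff open_Int open_INT) auto
  have "y \<in> T"
  proof -
    have "y \<in> crit_map ` W x" if "x \<in> ?F" for x using W(2)[OF that] that by force
    moreover have "y \<notin> crit_map ` Z" using W(2) by (auto simp: Z_def)
    ultimately show ?thesis using \<rho>(1) by (simp add: T_def)
  qed
  have inW: "\<exists>x'\<in>?F. x \<in> W x'" if "x \<in> crit_dom" "crit_map x \<in> T" for x
  proof (rule ccontr)
    assume "\<not> ?thesis"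
    then have "x \<in> Z" using that by (auto simp: Z_def T_def)
    then show False using that by (auto simp: T_def)
  qed
  have "T \<subseteq> regular_values"
  proof
    fix z assume z: "z \<in> T"
    then have "z \<in> torus2" using \<rho>(2) by (auto simp: T_def)
    moreover have "nondegenerate x" if "x \<in> crit_dom" "crit_map x = z" for x
    proof -
      have "\<exists>x'\<in>?F. x \<in> W x'" using \<open>z \<in> T\<close> that by (intro inW) auto
      then obtain x0 where "x0 \<in> ?F" "x \<in> W x0" by (elim bexE)
      then show ?thesis using U(6)[of x0 x] by (simp add: W_def)
    qed
    ultimately show "z \<in> regular_values" by (auto simp: regular_values_def)
  qed
  define v where "v = (\<lambda>x. W x \<inter> crit_map -` T) ` ?F"
  have "\<Union>v = crit_dom \<inter> crit_map -` T"
    using inW W(3) by (auto simp: v_def) blast+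
  moreover have "open u" if "u \<in> v" for u
    using that W \<open>open T\<close> continuous_on_subset[OF continuous_on_crit_map]
    by (auto simp: v_def intro!: continuous_open_preimage)
  moreover have "pairwise disjnt v"
    unfolding pairwise_def v_def disjnt_def using \<delta>(2) by (fastforce simp: W_def)
  moreover have "\<exists>q. homeomorphism u T crit_map q" if u: "u \<in> v" for u
  proof -
    obtain x where x: "x \<in> ?F" "u = W x \<inter> crit_map -` T" using u by (auto simp: v_def)
    have "T \<subseteq> crit_map ` W x" using x(1) by (auto simp: T_def)
    then have "crit_map ` u = T" using x(2) by auto
    then have "homeomorphism u T crit_map (g x)"
      using \<open>T \<subseteq> crit_map ` W x\<close> x(2)
      by (intro homeomorphism_of_subsets[OF homW[OF x(1)], where T'' = T]) auto
    then show ?thesis by blast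
  qed
  moreover have "v = {}" if "y \<notin> crit_map ` crit_dom"
  proof -
    have "?F = {}" using that by blast
    then show ?thesis unfolding v_def by (simp only: image_empty)
  qed
  ultimately show ?thesis using that \<open>open T\<close> \<open>y \<in> T\<close> \<open>T \<subseteq> regular_values\<close> by blast
qed

theorem covering_space_crit_map: "covering_space total crit_map base"
proof
  show "continuous_on total crit_map"
    by (rule continuous_on_subset[OF continuous_on_crit_map]) (auto simp: total_def)
  show "crit_map ` total = base" by (auto simp: total_def base_def)
  fix y assume y: "y \<in> base"
  then have "y \<in> regular_values" by (simp add: base_def)
  then obtain T v where T: "open T" "y \<in> T" "T \<subseteq> regular_values" "\<Union>v = crit_dom \<inter> crit_map -` T"
    "\<And>u. u \<in> v \<Longrightarrow> open u" "pairwise disjnt v" "\<And>u. u \<in> v \<Longrightarrow> \<exists>q. homeomorphism u T crit_map q"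
    "y \<notin> crit_map ` crit_dom \<Longrightarrow> v = {}"
    by (rule evenly_covered) (rule that)
  obtain x where x: "x \<in> crit_dom" "crit_map x = y" using y by (auto simp: base_def)
  then obtain u q where "u \<in> v" "homeomorphism u T crit_map q" using T(2,4,7) by blast
  moreover have "u \<subseteq> crit_dom" using calculation(1) T(4) by blast
  ultimately have "T \<subseteq> crit_map ` crit_dom" by (auto simp: homeomorphism_def)
  then have Tb: "T \<subseteq> base" using T(3) by (auto simp: base_def)
  have "\<Union>v = total \<inter> crit_map -` T" using T(4) Tb by (auto simp: total_def)
  moreover have "openin (top_of_set total) u" if "u \<in> v" for u
  proof -
    have "u \<subseteq> total" using that calculation by blast
    then show ?thesis using T(5)[OF that] by (simp add: open_subset)
  qed
  moreover have "openin (top_of_set base) T" using Tb T(1) by (simp add: open_subset)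
  ultimately show "\<exists>T. y \<in> T \<and> openin (top_of_set base) T \<and>
      (\<exists>v. \<Union>v = total \<inter> crit_map -` T \<and> (\<forall>u \<in> v. openin (top_of_set total) u) \<and>
        pairwise disjnt v \<and> (\<forall>u \<in> v. \<exists>q. homeomorphism u T crit_map q))"
    using T(2,6,7) by (intro exI[of _ T] exI[of _ v] conjI ballI)
qed

text \<open>Evenly covered neighbourhoods show that \<open>base\<close> is open and closed in the set of regular values.\<close>

lemma connected_subset_base:
  assumes "connected S" "S \<subseteq> regular_values" "S \<inter> base \<noteq> {}"
  shows "S \<subseteq> base"
proof -
  have "\<exists>T. open T \<and> y \<in> T \<and> T \<inter> S \<subseteq> base" if y: "y \<in> base" for y
  proof -
    have "y \<in> regular_values" using y by (simp add: base_def)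
    then obtain T v where T: "open T" "y \<in> T" "T \<subseteq> regular_values" "\<Union>v = crit_dom \<inter> crit_map -` T"
    "\<And>u. u \<in> v \<Longrightarrow> open u" "pairwise disjnt v" "\<And>u. u \<in> v \<Longrightarrow> \<exists>q. homeomorphism u T crit_map q"
    "y \<notin> crit_map ` crit_dom \<Longrightarrow> v = {}"
      by (rule evenly_covered) (rule that)
    obtain x where x: "x \<in> crit_dom" "crit_map x = y" using y by (auto simp: base_def)
    then obtain u q where u: "u \<in> v" "homeomorphism u T crit_map q" using T(2,4,7) by blast
    then have "u \<subseteq> crit_dom" using T(4) by blast
    then have "T \<subseteq> base" using u(2) T(3) by (auto simp: base_def homeomorphism_def)
    then have "T \<inter> S \<subseteq> base" by blast
    then show ?thesis using T(1,2) by blast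
  qed
  then obtain T where T: "\<And>y. y \<in> base \<Longrightarrow> open (T y) \<and> y \<in> T y \<and> T y \<inter> S \<subseteq> base" by metis
  have "\<exists>T. open T \<and> y \<in> T \<and> T \<inter> base = {}" if y: "y \<in> regular_values - base" for y
  proof -
    have "y \<in> regular_values" using y by blast
    then obtain T v where T: "open T" "y \<in> T" "T \<subseteq> regular_values" "\<Union>v = crit_dom \<inter> crit_map -` T"
    "\<And>u. u \<in> v \<Longrightarrow> open u" "pairwise disjnt v" "\<And>u. u \<in> v \<Longrightarrow> \<exists>q. homeomorphism u T crit_map q"
    "y \<notin> crit_map ` crit_dom \<Longrightarrow> v = {}"
      by (rule evenly_covered) (rule that)
    then have "crit_dom \<inter> crit_map -` T = {}" using y by (auto simp: base_def)
    then have "T \<inter> base = {}" by (auto simp: base_def)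
    then show ?thesis using T(1,2) by blast
  qed
  then obtain T' where T': "\<And>y. y \<in> regular_values - base \<Longrightarrow> open (T' y) \<and> y \<in> T' y \<and> T' y \<inter> base = {}"
    by metis
  let ?A = "\<Union>y\<in>base. T y" and ?B = "\<Union>y\<in>regular_values - base. T' y"
  have "open ?A" "open ?B" using T T' by (intro open_UN ballI; simp)+
  moreover have "T y \<inter> S \<subseteq> base" "y \<in> T y" if "y \<in> base" for y using T[OF that] by simp_all
  then have Ab: "?A \<inter> S \<subseteq> base" and bA: "base \<subseteq> ?A" by blast+
  moreover have "T' y \<inter> base = {}" "y \<in> T' y" if "y \<in> regular_values - base" for y using T'[OF that] by simp_all
  then have Bb: "?B \<inter> base = {}" and rB: "regular_values - base \<subseteq> ?B" by blast+
  have "?A \<inter> ?B \<inter> S = {}" using Ab Bb by blast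
  moreover have "S \<subseteq> ?A \<union> ?B" using assms(2) bA rB by blast
  ultimately have "?A \<inter> S = {} \<or> ?B \<inter> S = {}" using connectedD[OF assms(1), of ?A ?B] by blast
  moreover have "?A \<inter> S \<noteq> {}" using assms(3) bA by blast
  ultimately have "?B \<inter> S = {}" by blast
  then show ?thesis using rB assms(2) by blast
qed

end

section \<open>Critical points in coordinates\<close>

context twisted_bundle
begin

text \<open>Rescaling the coordinates shows that the critical points of \<open>f\<close> depend, up to this rescaling, only
  on these two combinations of the coefficients.\<close>

definition crit_value :: "pt \<Rightarrow> complex \<times> complex" where
  "crit_value f = ((\<Prod>i\<le>s. fst f i) / (\<Prod>j\<le>r. snd f j ^ b j), \<Prod>j\<le>r. snd f j)"

definition crit_point :: "pt \<Rightarrow> complex \<times> complex \<Rightarrow> pt" where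
  "crit_point f x = (\<lambda>i. if i \<in> {1..s} then fst x / fst f i else 0,
                     \<lambda>j. if j \<in> {1..r} then lin j x / snd f j else 0)"

text \<open>The values at \<open>p\<close> of the last two terms of the Laurent polynomial \<open>f\<close>. Products of inverses instead
  of quotients exhibit them as elements of \<open>laurent_polynomials\<close>.\<close>

definition A_of :: "pt \<Rightarrow> pt \<Rightarrow> complex" where
  "A_of f p = fst f 0 * (\<Prod>j=1..r. snd p j ^ b j) * (\<Prod>i=1..s. inverse (fst p i))"

definition B_of :: "pt \<Rightarrow> pt \<Rightarrow> complex" where
  "B_of f p = snd f 0 * (\<Prod>j=1..r. inverse (snd p j))"

lemma A_of_alt: "A_of f p = fst f 0 * (\<Prod>j=1..r. snd p j ^ b j) / (\<Prod>i=1..s. fst p i)"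
  by (simp add: A_of_def divide_inverse prod_inversef[symmetric] o_def)

lemma B_of_alt: "B_of f p = snd f 0 / (\<Prod>j=1..r. snd p j)"
  by (simp add: B_of_def divide_inverse prod_inversef[symmetric] o_def)

lemma powi_a: "j \<le> r \<Longrightarrow> x powi a j = x ^ b j"
  using int_b[of j] by (metis power_int_of_nat)

lemma torusD:
  assumes "p \<in> torus s r"
  shows "i \<in> {1..s} \<Longrightarrow> fst p i \<noteq> 0" "j \<in> {1..r} \<Longrightarrow> snd p j \<noteq> 0"
    "i \<notin> {1..s} \<Longrightarrow> fst p i = 0" "j \<notin> {1..r} \<Longrightarrow> snd p j = 0"
  using assms unfolding torus_def case_prod_beta by blast+

lemma L_D:
  assumes "f \<in> L s r"
  shows "i \<le> s \<Longrightarrow> fst f i \<noteq> 0" "j \<le> r \<Longrightarrow> snd f j \<noteq> 0"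
  using assms unfolding L_def case_prod_beta by blast+

lemma log_deriv_z_eq:
  assumes p: "p \<in> torus s r" and i: "i \<in> {1..s}"
  shows "log_deriv_z s r a f i p = fst f i * fst p i - A_of f p"
proof -
  obtain z w where zw: "p = (z, w)" by (cases p)
  obtain \<alpha> \<beta> where f: "f = (\<alpha>, \<beta>)" by (cases f)
  have zi: "z i \<noteq> 0" using torusD(1)[OF p i] zw by simp
  let ?I = "{1..s} - {i}"
  define P where "P = (\<Prod>k\<in>?I. z k)"
  define W where "W = (\<Prod>j=1..r. w j powi a j)"
  define c where "c = 1 + (\<Sum>k\<in>?I. \<alpha> k * z k) + (\<Sum>j=1..r. \<beta> j * w j) + \<beta> 0 * (1 / (\<Prod>j=1..r. w j))"
  define K where "K = \<alpha> 0 * W / P"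
  have LG: "LG s r a f (z(i := u), w) = c + \<alpha> i * u + K / u" for u
  proof -
    have "(\<Sum>k=1..s. \<alpha> k * (z(i := u)) k) = \<alpha> i * u + (\<Sum>k\<in>?I. \<alpha> k * z k)"
      using i by (subst sum.remove[of _ i]) auto
    moreover have "(\<Prod>k=1..s. (z(i := u)) k) = u * P"
      unfolding P_def using i by (subst prod.remove[of _ i]) auto
    ultimately show ?thesis unfolding LG_def f c_def W_def K_def by (simp add: algebra_simps)
  qed
  have "((\<lambda>u. c + \<alpha> i * u + K / u) has_field_derivative (\<alpha> i - K / z i ^ 2)) (at (z i))"
    using zi by (auto intro!: derivative_eq_intros simp: power2_eq_square field_simps)
  then have d: "deriv (\<lambda>u. LG s r a f (z(i := u), w)) (z i) = \<alpha> i - K / z i ^ 2"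
    unfolding LG by (rule DERIV_imp_deriv)
  have "W = (\<Prod>j=1..r. w j ^ b j)" unfolding W_def by (intro prod.cong) (auto simp: powi_a)
  moreover have "(\<Prod>k=1..s. z k) = z i * P" unfolding P_def using i by (subst prod.remove[of _ i]) auto
  ultimately have A: "A_of f p = K / z i" unfolding A_of_alt f zw K_def by (simp add: field_simps)
  have "log_deriv_z s r a f i p = z i * deriv (\<lambda>u. LG s r a f (z(i := u), w)) (z i)"
    by (simp add: log_deriv_z_def zw)
  also have "\<dots> = \<alpha> i * z i - K / z i" unfolding d using zi by (simp add: power2_eq_square field_simps)
  also have "\<dots> = fst f i * fst p i - A_of f p" unfolding A by (simp add: f zw)
  finally show ?thesis .
qed

lemma log_deriv_w_eq:
  assumes p: "p \<in> torus s r" and j: "j \<in> {1..r}"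
  shows "log_deriv_w s r a f j p = snd f j * snd p j + of_int (a j) * A_of f p - B_of f p"
proof -
  obtain z w where zw: "p = (z, w)" by (cases p)
  obtain \<alpha> \<beta> where f: "f = (\<alpha>, \<beta>)" by (cases f)
  have wj: "w j \<noteq> 0" using torusD(2)[OF p j] zw by simp
  let ?J = "{1..r} - {j}"
  define R where "R = (\<Prod>k\<in>?J. w k)"
  define Q where "Q = (\<Prod>k\<in>?J. w k ^ b k)"
  define Z where "Z = (\<Prod>i=1..s. z i)"
  define c where "c = 1 + (\<Sum>k=1..s. \<alpha> k * z k) + (\<Sum>k\<in>?J. \<beta> k * w k)"
  define K1 where "K1 = \<alpha> 0 * Q / Z"
  define K2 where "K2 = \<beta> 0 / R"
  have LG: "LG s r a f (z, w(j := u)) = c + \<beta> j * u + K1 * u ^ b j + K2 / u" for u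
  proof -
    have "(\<Sum>k=1..r. \<beta> k * (w(j := u)) k) = \<beta> j * u + (\<Sum>k\<in>?J. \<beta> k * w k)"
      using j by (subst sum.remove[of _ j]) auto
    moreover have "(\<Prod>k=1..r. (w(j := u)) k) = u * R"
      unfolding R_def using j by (subst prod.remove[of _ j]) auto
    moreover have "(\<Prod>k=1..r. (w(j := u)) k powi a k) = u ^ b j * Q"
    proof -
      have "(\<Prod>k=1..r. (w(j := u)) k powi a k) = (\<Prod>k=1..r. (w(j := u)) k ^ b k)"
        by (intro prod.cong) (auto simp: powi_a)
      also have "\<dots> = u ^ b j * Q" unfolding Q_def using j by (subst prod.remove[of _ j]) auto
      finally show ?thesis .
    qed
    ultimately show ?thesis unfolding LG_def f c_def Z_def K1_def K2_def by (simp add: algebra_simps)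
  qed
  have "((\<lambda>u. c + \<beta> j * u + K1 * u ^ b j + K2 / u) has_field_derivative
      (\<beta> j + K1 * (of_nat (b j) * w j ^ (b j - 1)) - K2 / w j ^ 2)) (at (w j))"
    using wj by (auto intro!: derivative_eq_intros simp: power2_eq_square field_simps)
  then have d: "deriv (\<lambda>u. LG s r a f (z, w(j := u))) (w j) =
      \<beta> j + K1 * (of_nat (b j) * w j ^ (b j - 1)) - K2 / w j ^ 2"
    unfolding LG by (rule DERIV_imp_deriv)
  have pw: "w j * (of_nat (b j) * w j ^ (b j - 1)) = of_nat (b j) * w j ^ b j"
    by (cases "b j") auto
  have "(\<Prod>k=1..r. w k ^ b k) = w j ^ b j * Q" unfolding Q_def using j by (subst prod.remove[of _ j]) auto
  then have A: "A_of f p = K1 * w j ^ b j" unfolding A_of_alt f zw K1_def Z_def by simp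
  have "(\<Prod>k=1..r. w k) = w j * R"
    unfolding R_def using j by (subst prod.remove[of _ j]) auto
  then have B: "B_of f p = K2 / w j" unfolding B_of_alt f zw K2_def by (simp add: field_simps)
  have "log_deriv_w s r a f j p = w j * deriv (\<lambda>u. LG s r a f (z, w(j := u))) (w j)"
    by (simp add: log_deriv_w_def zw)
  also have "\<dots> = \<beta> j * w j + K1 * (w j * (of_nat (b j) * w j ^ (b j - 1))) - K2 / w j"
    unfolding d using wj by (simp add: power2_eq_square field_simps)
  also have "\<dots> = \<beta> j * w j + of_nat (b j) * A_of f p - B_of f p"
    unfolding pw A B by simp
  also have "of_nat (b j) = (of_int (a j) :: complex)" using j by (intro of_nat_b) simp
  finally show ?thesis by (simp add: f zw)
qed

lemma Crit_iff:
  "p \<in> Crit s r a f \<longleftrightarrow> p \<in> torus s r \<and> (\<forall>i\<in>{1..s}. fst f i * fst p i = A_of f p) \<and>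
     (\<forall>j\<in>{1..r}. snd f j * snd p j = lin j (A_of f p, B_of f p))"
  unfolding Crit_def lin_def by (auto simp: log_deriv_z_eq log_deriv_w_eq algebra_simps)

lemma split_first:
  "(\<Prod>i\<le>n. g i) = g 0 * (\<Prod>i=1..n. g i)" for g :: "nat \<Rightarrow> 'z::comm_monoid_mult"
proof -
  have "{..n} = insert 0 {1..n}" by auto
  then show ?thesis by simp
qed

lemma lin_0: "lin 0 x = snd x" by (simp add: lin_def a_0)

lemma crit_point_in_torus:
  assumes "f \<in> L s r" "x \<in> crit_dom"
  shows "crit_point f x \<in> torus s r"
  using assms L_D[OF assms(1)] unfolding torus_def crit_point_def crit_dom_def by auto

text \<open>This and the next lemma are not restricted to the fibre over \<open>crit_value f\<close>, because
  \<open>crit_point f\<close> will be differentiated along lines through points of the fibre.\<close>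

lemma A_of_crit_point:
  assumes f: "f \<in> L s r" and x: "x \<in> crit_dom"
  shows "A_of f (crit_point f x) = fst x * (fst (crit_value f) / fst (crit_map x))"
proof -
  have "A_of f (crit_point f x) = fst f 0 * (\<Prod>j=1..r. lin j x ^ b j / snd f j ^ b j) * (\<Prod>i=1..s. fst f i / fst x)"
    unfolding A_of_def crit_point_def by (simp add: power_divide)
  also have "\<dots> = fst f 0 * ((\<Prod>j=1..r. lin j x ^ b j) / (\<Prod>j=1..r. snd f j ^ b j)) * ((\<Prod>i=1..s. fst f i) / fst x ^ s)"
    by (simp add: prod_dividef)
  also have "\<dots> = fst x * (fst (crit_value f) / fst (crit_map x))"
  proof -
    have "fst x \<noteq> 0" using x by (simp add: crit_dom_def)
    then show ?thesis unfolding crit_value_def crit_map_def split_first by (simp add: b_0 field_simps)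
  qed
  finally show ?thesis .
qed

lemma B_of_crit_point:
  assumes f: "f \<in> L s r" and x: "x \<in> crit_dom"
  shows "B_of f (crit_point f x) = snd x * (snd (crit_value f) / snd (crit_map x))"
proof -
  have "B_of f (crit_point f x) = snd f 0 * (\<Prod>j=1..r. snd f j / lin j x)"
    unfolding B_of_def crit_point_def by simp
  also have "\<dots> = snd f 0 * ((\<Prod>j=1..r. snd f j) / (\<Prod>j=1..r. lin j x))" by (simp add: prod_dividef)
  also have "\<dots> = snd x * (snd (crit_value f) / snd (crit_map x))"
  proof -
    have "lin 0 x \<noteq> 0" using x by (simp add: crit_dom_def)
    then have "snd x \<noteq> 0" by (simp add: lin_0)
    then show ?thesis unfolding crit_value_def crit_map_def split_first by (simp add: lin_0 field_simps)
  qed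
  finally show ?thesis .
qed

definition fiber :: "pt \<Rightarrow> (complex \<times> complex) set" where
  "fiber f = {x \<in> crit_dom. crit_map x = crit_value f}"

lemma crit_value_nonzero: "f \<in> L s r \<Longrightarrow> crit_value f \<in> torus2"
  by (auto simp: crit_value_def torus2_def dest: L_D)

lemma AB_of_crit_point:
  assumes f: "f \<in> L s r" and x: "x \<in> fiber f"
  shows "(A_of f (crit_point f x), B_of f (crit_point f x)) = x"
  using A_of_crit_point[OF f, of x] B_of_crit_point[OF f, of x] x crit_value_nonzero[OF f]
  by (simp add: fiber_def torus2_def prod_eq_iff)

lemma crit_point_in_Crit:
  assumes f: "f \<in> L s r" and x: "x \<in> fiber f"
  shows "crit_point f x \<in> Crit s r a f"
proof -
  have "x \<in> crit_dom" using x by (simp add: fiber_def)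
  moreover have "A_of f (crit_point f x) = fst x" "(A_of f (crit_point f x), B_of f (crit_point f x)) = x"
    using AB_of_crit_point[OF f x] by (simp_all add: prod_eq_iff)
  ultimately show ?thesis
    unfolding Crit_iff using crit_point_in_torus[OF f] L_D[OF f] by (simp add: crit_point_def)
qed

lemma AB_of_in_fiber:
  assumes f: "f \<in> L s r" and p: "p \<in> Crit s r a f"
  shows "(A_of f p, B_of f p) \<in> fiber f" "crit_point f (A_of f p, B_of f p) = p"
proof -
  let ?x = "(A_of f p, B_of f p)"
  have t: "p \<in> torus s r" and z: "\<And>i. i \<in> {1..s} \<Longrightarrow> fst f i * fst p i = A_of f p"
    and w: "\<And>j. j \<in> {1..r} \<Longrightarrow> snd f j * snd p j = lin j ?x" using p unfolding Crit_iff by auto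
  have A0: "A_of f p \<noteq> 0" using L_D[OF f] torusD[OF t] by (auto simp: A_of_def)
  have B0: "B_of f p \<noteq> 0" using L_D[OF f] torusD[OF t] by (auto simp: B_of_def)
  have dom: "?x \<in> crit_dom"
    unfolding crit_dom_def
  proof (intro CollectI conjI allI impI)
    fix j assume j: "j \<le> r"
    show "lin j ?x \<noteq> 0"
    proof (cases "j = 0")
      case True
      then show ?thesis using B0 by (simp add: lin_0)
    next
      case False
      then have "j \<in> {1..r}" using j by simp
      then show ?thesis using w[of j] L_D(2)[OF f j] torusD(2)[OF t, of j] by (metis mult_eq_0_iff)
    qed
  qed (simp add: A0)
  have "snd (crit_map ?x) = B_of f p * (\<Prod>j=1..r. snd f j * snd p j)"
    unfolding crit_map_def split_first using w by (simp add: lin_0)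
  also have "\<dots> = snd (crit_value f)"
    using torusD(2)[OF t] unfolding B_of_alt crit_value_def split_first
    by (simp add: prod.distrib field_simps)
  finally have 2: "snd (crit_map ?x) = snd (crit_value f)" .
  have "A_of f p * (\<Prod>i=1..s. fst f i * fst p i) = A_of f p ^ (s + 1)" using z by simp
  moreover have "(\<Prod>j\<le>r. lin j ?x ^ b j) = (\<Prod>j=1..r. (snd f j * snd p j) ^ b j)"
    unfolding split_first using w by (simp add: b_0)
  moreover have "A_of f p * (\<Prod>i=1..s. fst f i * fst p i) =
      fst (crit_value f) * (\<Prod>j=1..r. (snd f j * snd p j) ^ b j)"
    using torusD(1)[OF t] L_D(2)[OF f] unfolding A_of_alt crit_value_def split_first
    by (simp add: prod.distrib power_mult_distrib b_0 field_simps)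
  ultimately have "A_of f p ^ (s + 1) = fst (crit_value f) * (\<Prod>j\<le>r. lin j ?x ^ b j)" by (simp only:)
  moreover have "(\<Prod>j\<le>r. lin j ?x ^ b j) \<noteq> 0" using dom by (simp add: crit_dom_def)
  ultimately have 1: "fst (crit_map ?x) = fst (crit_value f)"
    unfolding crit_map_def fst_conv by (simp only: nonzero_divide_eq_eq not_False_eq_True)
  show "?x \<in> fiber f" using dom 1 2 by (simp add: fiber_def prod_eq_iff)
  have "fst (crit_point f ?x) i = fst p i" for i
    using z[of i] L_D(1)[OF f, of i] torusD(3)[OF t, of i] unfolding crit_point_def by (auto simp: field_simps)
  moreover have "snd (crit_point f ?x) j = snd p j" for j
    using w[of j] L_D(2)[OF f, of j] torusD(4)[OF t, of j] unfolding crit_point_def by (auto simp: field_simps)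
  ultimately show "crit_point f ?x = p" by (simp add: prod_eq_iff fun_eq_iff)
qed

lemma Crit_eq_image:
  assumes f: "f \<in> L s r"
  shows "Crit s r a f = crit_point f ` fiber f"
proof
  show "crit_point f ` fiber f \<subseteq> Crit s r a f" using crit_point_in_Crit[OF f] by (rule image_subsetI)
  show "Crit s r a f \<subseteq> crit_point f ` fiber f"
  proof
    fix p assume "p \<in> Crit s r a f"
    from AB_of_in_fiber[OF f this] show "p \<in> crit_point f ` fiber f"
      by (intro image_eqI[where x = "(A_of f p, B_of f p)"]) simp_all
  qed
qed

lemma inj_on_crit_point: "f \<in> L s r \<Longrightarrow> inj_on (crit_point f) (fiber f)"
  by (rule inj_on_inverseI[where g = "\<lambda>p. (A_of f p, B_of f p)"]) (rule AB_of_crit_point)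

end

section \<open>The ideal of the critical equations\<close>

lemma laurent_const: "(\<lambda>_. c) \<in> laurent_polynomials s r"
  and laurent_add: "g \<in> laurent_polynomials s r \<Longrightarrow> h \<in> laurent_polynomials s r \<Longrightarrow> (\<lambda>p. g p + h p) \<in> laurent_polynomials s r"
  and laurent_mult: "g \<in> laurent_polynomials s r \<Longrightarrow> h \<in> laurent_polynomials s r \<Longrightarrow> (\<lambda>p. g p * h p) \<in> laurent_polynomials s r"
  unfolding laurent_polynomials_def by (rule generated_algebra.intros; assumption?)+

lemma laurent_gen:
  "i \<in> {1..s} \<Longrightarrow> (\<lambda>p. fst p i) \<in> laurent_polynomials s r"
  "i \<in> {1..s} \<Longrightarrow> (\<lambda>p. inverse (fst p i)) \<in> laurent_polynomials s r"
  "j \<in> {1..r} \<Longrightarrow> (\<lambda>p. snd p j) \<in> laurent_polynomials s r"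
  "j \<in> {1..r} \<Longrightarrow> (\<lambda>p. inverse (snd p j)) \<in> laurent_polynomials s r"
  unfolding laurent_polynomials_def by (rule generated_algebra.gen; blast)+

lemma laurent_diff: "g \<in> laurent_polynomials s r \<Longrightarrow> h \<in> laurent_polynomials s r \<Longrightarrow> (\<lambda>p. g p - h p) \<in> laurent_polynomials s r"
  using laurent_add[OF _ laurent_mult[OF laurent_const[of "-1"]], of g s r h] by simp

lemma laurent_sum: "(\<And>i. i \<in> I \<Longrightarrow> g i \<in> laurent_polynomials s r) \<Longrightarrow> (\<lambda>p. \<Sum>i\<in>I. g i p) \<in> laurent_polynomials s r"
  by (induction I rule: infinite_finite_induct) (auto intro: laurent_const laurent_add)

lemma laurent_prod: "(\<And>i. i \<in> I \<Longrightarrow> g i \<in> laurent_polynomials s r) \<Longrightarrow> (\<lambda>p. \<Prod>i\<in>I. g i p) \<in> laurent_polynomials s r"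
  by (induction I rule: infinite_finite_induct) (auto intro: laurent_const laurent_mult)

lemma laurent_power: "g \<in> laurent_polynomials s r \<Longrightarrow> (\<lambda>p. g p ^ n) \<in> laurent_polynomials s r"
  by (induction n) (auto intro: laurent_const laurent_mult)

lemma laurent_poly: "g \<in> laurent_polynomials s r \<Longrightarrow> (\<lambda>p. poly Q (g p)) \<in> laurent_polynomials s r"
  by (induction Q) (auto intro: laurent_const laurent_mult laurent_add)

text \<open>The defining condition of \<open>Crit_ideal\<close> without membership in \<open>laurent_polynomials\<close>. It only concerns
  values on the torus, so that congruences can be verified there.\<close>

definition torus_ideal :: "nat \<Rightarrow> nat \<Rightarrow> (nat \<Rightarrow> int) \<Rightarrow> pt \<Rightarrow> (pt \<Rightarrow> complex) set" where
  "torus_ideal s r a f = {g. \<exists>c d. (\<forall>i\<in>{1..s}. c i \<in> laurent_polynomials s r) \<and>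
       (\<forall>j\<in>{1..r}. d j \<in> laurent_polynomials s r) \<and>
       (\<forall>p\<in>torus s r. g p = (\<Sum>i=1..s. c i p * log_deriv_z s r a f i p)
                              + (\<Sum>j=1..r. d j p * log_deriv_w s r a f j p))}"

lemma Crit_ideal_iff: "g \<in> Crit_ideal s r a f \<longleftrightarrow> g \<in> laurent_polynomials s r \<and> g \<in> torus_ideal s r a f"
  unfolding Crit_ideal_def torus_ideal_def by simp

lemma torus_ideal_cong:
  assumes "g \<in> torus_ideal s r a f" "\<And>p. p \<in> torus s r \<Longrightarrow> g p = h p"
  shows "h \<in> torus_ideal s r a f"
  using assms unfolding torus_ideal_def by simp

lemma torus_ideal_add:
  assumes "g \<in> torus_ideal s r a f" "h \<in> torus_ideal s r a f"
  shows "(\<lambda>p. g p + h p) \<in> torus_ideal s r a f"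
proof -
  obtain c d c' d' where *: "\<forall>i\<in>{1..s}. c i \<in> laurent_polynomials s r" "\<forall>j\<in>{1..r}. d j \<in> laurent_polynomials s r"
      "\<forall>p\<in>torus s r. g p = (\<Sum>i=1..s. c i p * log_deriv_z s r a f i p) + (\<Sum>j=1..r. d j p * log_deriv_w s r a f j p)"
      "\<forall>i\<in>{1..s}. c' i \<in> laurent_polynomials s r" "\<forall>j\<in>{1..r}. d' j \<in> laurent_polynomials s r"
      "\<forall>p\<in>torus s r. h p = (\<Sum>i=1..s. c' i p * log_deriv_z s r a f i p) + (\<Sum>j=1..r. d' j p * log_deriv_w s r a f j p)"
    using assms unfolding torus_ideal_def mem_Collect_eq by (elim exE conjE)
  show ?thesis
    unfolding torus_ideal_def mem_Collect_eq
    by (rule exI[of _ "\<lambda>i p. c i p + c' i p"], rule exI[of _ "\<lambda>j p. d j p + d' j p"])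
       (use * in \<open>simp add: laurent_add sum.distrib distrib_right\<close>)
qed

lemma torus_ideal_mult:
  assumes "g \<in> torus_ideal s r a f" "h \<in> laurent_polynomials s r"
  shows "(\<lambda>p. h p * g p) \<in> torus_ideal s r a f"
proof -
  obtain c d where *: "\<forall>i\<in>{1..s}. c i \<in> laurent_polynomials s r" "\<forall>j\<in>{1..r}. d j \<in> laurent_polynomials s r"
      "\<forall>p\<in>torus s r. g p = (\<Sum>i=1..s. c i p * log_deriv_z s r a f i p) + (\<Sum>j=1..r. d j p * log_deriv_w s r a f j p)"
    using assms unfolding torus_ideal_def mem_Collect_eq by (elim exE conjE)
  show ?thesis
    unfolding torus_ideal_def mem_Collect_eq
    by (rule exI[of _ "\<lambda>i p. h p * c i p"], rule exI[of _ "\<lambda>j p. h p * d j p"])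
       (use * assms(2) in \<open>simp add: laurent_mult sum_distrib_left distrib_left mult.assoc\<close>)
qed

lemma torus_ideal_zero: "(\<lambda>_. 0) \<in> torus_ideal s r a f"
  unfolding torus_ideal_def mem_Collect_eq
  by (rule exI[of _ "\<lambda>_ _. 0"], rule exI[of _ "\<lambda>_ _. 0"]) (simp add: laurent_const)

lemma torus_ideal_log_deriv:
  "i \<in> {1..s} \<Longrightarrow> log_deriv_z s r a f i \<in> torus_ideal s r a f"
  "j \<in> {1..r} \<Longrightarrow> log_deriv_w s r a f j \<in> torus_ideal s r a f"
proof -
  assume i: "i \<in> {1..s}"
  show "log_deriv_z s r a f i \<in> torus_ideal s r a f"
    unfolding torus_ideal_def mem_Collect_eq
    by (rule exI[of _ "\<lambda>k _. if k = i then 1 else 0"], rule exI[of _ "\<lambda>_ _. 0"])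
       (use i in \<open>auto simp: laurent_const if_distrib[of "\<lambda>x. x * _"] cong: if_cong\<close>)
next
  assume j: "j \<in> {1..r}"
  show "log_deriv_w s r a f j \<in> torus_ideal s r a f"
    unfolding torus_ideal_def mem_Collect_eq
    by (rule exI[of _ "\<lambda>_ _. 0"], rule exI[of _ "\<lambda>k _. if k = j then 1 else 0"])
       (use j in \<open>auto simp: laurent_const if_distrib[of "\<lambda>x. x * _"] cong: if_cong\<close>)
qed

lemma torus_ideal_at_Crit: "g \<in> torus_ideal s r a f \<Longrightarrow> p \<in> Crit s r a f \<Longrightarrow> g p = 0"
  unfolding torus_ideal_def Crit_def by auto

definition congruent :: "nat \<Rightarrow> nat \<Rightarrow> (nat \<Rightarrow> int) \<Rightarrow> pt \<Rightarrow> (pt \<Rightarrow> complex) \<Rightarrow> (pt \<Rightarrow> complex) \<Rightarrow> bool" where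
  "congruent s r a f g h \<longleftrightarrow> g \<in> laurent_polynomials s r \<and> h \<in> laurent_polynomials s r \<and>
     (\<lambda>p. g p - h p) \<in> torus_ideal s r a f"

lemma congruent_on_torus:
  "g \<in> laurent_polynomials s r \<Longrightarrow> h \<in> laurent_polynomials s r \<Longrightarrow> (\<And>p. p \<in> torus s r \<Longrightarrow> g p = h p) \<Longrightarrow> congruent s r a f g h"
  unfolding congruent_def using torus_ideal_cong[OF torus_ideal_zero] by simp

lemma congruent_refl: "g \<in> laurent_polynomials s r \<Longrightarrow> congruent s r a f g g"
  by (rule congruent_on_torus) simp_all

lemma congruent_trans: "congruent s r a f g h \<Longrightarrow> congruent s r a f h k \<Longrightarrow> congruent s r a f g k"
  unfolding congruent_def using torus_ideal_add[of "\<lambda>p. g p - h p" s r a f "\<lambda>p. h p - k p"] by simp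

lemma congruent_sym: "congruent s r a f g h \<Longrightarrow> congruent s r a f h g"
  unfolding congruent_def using torus_ideal_mult[OF _ laurent_const[of "-1"], of "\<lambda>p. g p - h p" s r a f] by simp

lemma congruent_mult:
  assumes "congruent s r a f g h" "congruent s r a f g' h'"
  shows "congruent s r a f (\<lambda>p. g p * g' p) (\<lambda>p. h p * h' p)"
proof -
  have "(\<lambda>p. g' p * (g p - h p) + h p * (g' p - h' p)) \<in> torus_ideal s r a f"
    using assms unfolding congruent_def by (intro torus_ideal_add torus_ideal_mult) auto
  then show ?thesis using assms unfolding congruent_def by (simp add: laurent_mult algebra_simps)
qed

lemma congruent_power: "congruent s r a f g h \<Longrightarrow> congruent s r a f (\<lambda>p. g p ^ n) (\<lambda>p. h p ^ n)"
  by (induction n) (auto intro: congruent_mult congruent_refl laurent_const)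

lemma congruent_prod:
  "(\<And>i. i \<in> I \<Longrightarrow> congruent s r a f (g i) (h i)) \<Longrightarrow> congruent s r a f (\<lambda>p. \<Prod>i\<in>I. g i p) (\<lambda>p. \<Prod>i\<in>I. h i p)"
  by (induction I rule: infinite_finite_induct) (auto intro: congruent_mult congruent_refl laurent_const)

context twisted_bundle
begin

lemma laurent_A: "A_of f \<in> laurent_polynomials s r"
  unfolding A_of_def[abs_def] by (intro laurent_mult laurent_const laurent_prod laurent_power laurent_gen)

lemma laurent_B: "B_of f \<in> laurent_polynomials s r"
  unfolding B_of_def[abs_def] by (intro laurent_mult laurent_const laurent_prod laurent_gen)

definition lin_of :: "pt \<Rightarrow> nat \<Rightarrow> pt \<Rightarrow> complex" where
  "lin_of f j p = lin j (A_of f p, B_of f p)"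

lemma laurent_lin: "lin_of f j \<in> laurent_polynomials s r"
  unfolding lin_of_def[abs_def] lin_def fst_conv snd_conv
  by (intro laurent_diff laurent_mult laurent_const laurent_A laurent_B)

lemma congruent_z: "i \<in> {1..s} \<Longrightarrow> congruent s r a f (\<lambda>p. fst f i * fst p i) (A_of f)"
  unfolding congruent_def
  using torus_ideal_cong[OF torus_ideal_log_deriv(1)] log_deriv_z_eq
  by (auto intro!: laurent_mult laurent_const laurent_gen laurent_A)

lemma congruent_w: "j \<in> {1..r} \<Longrightarrow> congruent s r a f (\<lambda>p. snd f j * snd p j) (lin_of f j)"
  unfolding congruent_def
  using torus_ideal_cong[OF torus_ideal_log_deriv(2), of j r s a f "\<lambda>p. snd f j * snd p j - lin_of f j p"] log_deriv_w_eq
  by (auto intro!: laurent_mult laurent_const laurent_gen laurent_lin simp: lin_of_def lin_def)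

text \<open>On the torus, \<open>A\<close> times the product of the \<open>\<alpha>\<^sub>i z\<^sub>i\<close> is a constant times a monomial in the \<open>\<beta>\<^sub>j w\<^sub>j\<close>,
  by the definition of \<open>A\<close>. Modulo the ideal the former are \<open>A\<close> and the latter are the linear forms.
  Similarly for \<open>B\<close> in the next lemma.\<close>

lemma A_relation:
  assumes f: "f \<in> L s r"
  shows "congruent s r a f (\<lambda>p. A_of f p ^ (s + 1)) (\<lambda>p. fst (crit_value f) * (\<Prod>j\<le>r. lin_of f j p ^ b j))"
proof -
  have "congruent s r a f (\<lambda>p. A_of f p * (\<Prod>i=1..s. fst f i * fst p i)) (\<lambda>p. A_of f p * (\<Prod>i=1..s. A_of f p))"
    by (intro congruent_mult congruent_prod congruent_z congruent_refl laurent_A)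
  then have 1: "congruent s r a f (\<lambda>p. A_of f p ^ (s + 1)) (\<lambda>p. A_of f p * (\<Prod>i=1..s. fst f i * fst p i))"
    using congruent_sym by fastforce
  have 2: "congruent s r a f (\<lambda>p. A_of f p * (\<Prod>i=1..s. fst f i * fst p i))
     (\<lambda>p. fst (crit_value f) * (\<Prod>j=1..r. (snd f j * snd p j) ^ b j))"
  proof (rule congruent_on_torus)
    fix p assume t: "p \<in> torus s r"
    show "A_of f p * (\<Prod>i=1..s. fst f i * fst p i) = fst (crit_value f) * (\<Prod>j=1..r. (snd f j * snd p j) ^ b j)"
      using torusD(1)[OF t] L_D(2)[OF f] unfolding A_of_alt crit_value_def split_first
      by (simp add: prod.distrib power_mult_distrib b_0 field_simps)
  qed (intro laurent_mult laurent_prod laurent_power laurent_const laurent_gen laurent_A; assumption)+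
  have "congruent s r a f (\<lambda>p. fst (crit_value f) * (\<Prod>j=1..r. (snd f j * snd p j) ^ b j))
     (\<lambda>p. fst (crit_value f) * (\<Prod>j=1..r. lin_of f j p ^ b j))"
    by (intro congruent_mult congruent_prod congruent_power congruent_w congruent_refl laurent_const)
  then show ?thesis
    using congruent_trans[OF 1 congruent_trans[OF 2]] unfolding split_first by (simp add: b_0)
qed

lemma B_relation:
  assumes f: "f \<in> L s r"
  shows "congruent s r a f (\<lambda>p. \<Prod>j\<le>r. lin_of f j p) (\<lambda>_. snd (crit_value f))"
proof -
  have 1: "congruent s r a f (\<lambda>p. B_of f p * (\<Prod>j=1..r. lin_of f j p)) (\<lambda>p. B_of f p * (\<Prod>j=1..r. snd f j * snd p j))"
    by (intro congruent_mult congruent_prod congruent_sym[OF congruent_w] congruent_refl laurent_B)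
  have 2: "congruent s r a f (\<lambda>p. B_of f p * (\<Prod>j=1..r. snd f j * snd p j)) (\<lambda>_. snd (crit_value f))"
  proof (rule congruent_on_torus)
    fix p assume t: "p \<in> torus s r"
    show "B_of f p * (\<Prod>j=1..r. snd f j * snd p j) = snd (crit_value f)"
      using torusD(2)[OF t] unfolding B_of_alt crit_value_def split_first
      by (simp add: prod.distrib field_simps)
  qed (intro laurent_mult laurent_prod laurent_const laurent_gen laurent_B; assumption)+
  have "lin_of f 0 p = B_of f p" for p by (simp add: lin_of_def lin_0)
  then show ?thesis using congruent_trans[OF 1 2] unfolding split_first by simp
qed


subsection \<open>Reducedness implies nondegeneracy\<close>

text \<open>The quotient \<open>A / B\<close>, which is a Laurent polynomial since \<open>B\<close> is a monomial.\<close>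

definition ratio :: "pt \<Rightarrow> pt \<Rightarrow> complex" where
  "ratio f p = A_of f p * (\<Prod>j=1..r. snd p j) * inverse (snd f 0)"

lemma laurent_ratio: "ratio f \<in> laurent_polynomials s r"
  unfolding ratio_def[abs_def] by (intro laurent_mult laurent_const laurent_prod laurent_gen laurent_A)

lemma ratio_mult_B: "f \<in> L s r \<Longrightarrow> p \<in> torus s r \<Longrightarrow> ratio f p * B_of f p = A_of f p"
  using torusD(2)[of p] L_D(2)[of f 0] by (simp add: ratio_def B_of_alt)

definition ratio_factor :: "nat \<Rightarrow> complex poly" where
  "ratio_factor j = [:1, - of_int (a j):]"

text \<open>The equation for \<open>\<tau> = A / B\<close> that results from eliminating \<open>B\<close>. With \<open>N = (\<Sum>j\<le>r. b j)\<close> and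
  \<open>m = s + 1 - N\<close>, the two relations read \<open>\<tau> ^ (s + 1) * B ^ m = c1 * (\<Prod>j\<le>r. (1 - a j * \<tau>) ^ b j)\<close> and
  \<open>B ^ (r + 1) * (\<Prod>j\<le>r. 1 - a j * \<tau>) = c2\<close>, where \<open>(c1, c2) = crit_value f\<close>. The \<open>(r + 1)\<close>-th power of
  the first one and the \<open>m\<close>-th power of the second one contain the same power of \<open>B\<close>.\<close>

definition ratio_poly :: "pt \<Rightarrow> complex poly" where
  "ratio_poly f = (let m = s + 1 - (\<Sum>j\<le>r. b j) in
     smult (snd (crit_value f) ^ m) (monom 1 ((s + 1) * (r + 1))) -
     smult (fst (crit_value f) ^ (r + 1)) ((\<Prod>j\<le>r. ratio_factor j ^ b j) ^ (r + 1) * (\<Prod>j\<le>r. ratio_factor j) ^ m))"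

lemma ratio_poly_nonzero:
  assumes "f \<in> L s r"
  shows "ratio_poly f \<noteq> 0"
proof -
  have "poly (ratio_poly f) 0 = - (fst (crit_value f) ^ (r + 1))"
    by (simp add: ratio_poly_def ratio_factor_def poly_prod poly_monom)
  then have "poly (ratio_poly f) 0 \<noteq> 0" using crit_value_nonzero[OF assms] by (simp add: torus2_def)
  then show ?thesis by auto
qed

lemma ratio_poly_in_torus_ideal:
  assumes f: "f \<in> L s r"
  shows "(\<lambda>p. poly (ratio_poly f) (ratio f p)) \<in> torus_ideal s r a f"
proof -
  define N where "N = (\<Sum>j\<le>r. b j)"
  define m where "m = s + 1 - N"
  have Nm: "N + m = s + 1" using sum_b_le by (simp add: m_def N_def)
  define h1 where "h1 p = (\<Prod>j\<le>r. poly (ratio_factor j) (ratio f p) ^ b j)" for p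
  define h2 where "h2 p = (\<Prod>j\<le>r. poly (ratio_factor j) (ratio f p))" for p
  let ?\<alpha> = "fst (crit_value f)" and ?\<beta> = "snd (crit_value f)"
  let ?R = "\<lambda>p. ratio f p" and ?B = "\<lambda>p. B_of f p" and ?B' = "\<lambda>p. (\<Prod>j=1..r. snd p j) * inverse (snd f 0)"
  have lh: "h1 \<in> laurent_polynomials s r" "h2 \<in> laurent_polynomials s r"
    unfolding h1_def[abs_def] h2_def[abs_def] by (intro laurent_prod laurent_power laurent_poly laurent_ratio)+
  have lB': "?B' \<in> laurent_polynomials s r" by (intro laurent_mult laurent_prod laurent_const laurent_gen)
  have BB': "?B p * ?B' p = 1" if "p \<in> torus s r" for p
    using torusD(2)[OF that] L_D(2)[OF f, of 0] by (simp add: B_of_alt)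
  have lin: "lin_of f j p = ?B p * poly (ratio_factor j) (?R p)" if "p \<in> torus s r" for j p
    using ratio_mult_B[OF f that] by (simp add: lin_of_def lin_def ratio_factor_def algebra_simps)
  have L1: "(\<lambda>p. \<Prod>j\<le>r. lin_of f j p ^ b j) \<in> laurent_polynomials s r"
    by (intro laurent_prod laurent_power laurent_lin)
  have "congruent s r a f (\<lambda>p. A_of f p ^ (s + 1) * ?B' p ^ N) (\<lambda>p. ?\<alpha> * (\<Prod>j\<le>r. lin_of f j p ^ b j) * ?B' p ^ N)"
    by (intro congruent_mult A_relation f congruent_power congruent_refl lB')
  moreover have "congruent s r a f (\<lambda>p. ?\<alpha> * (\<Prod>j\<le>r. lin_of f j p ^ b j) * ?B' p ^ N) (\<lambda>p. ?\<alpha> * h1 p)"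
  proof (rule congruent_on_torus)
    fix p assume p: "p \<in> torus s r"
    have "(\<Prod>j\<le>r. lin_of f j p ^ b j) = ?B p ^ N * h1 p"
      using p by (simp add: lin h1_def N_def power_mult_distrib prod.distrib power_sum)
    then have "(\<Prod>j\<le>r. lin_of f j p ^ b j) * ?B' p ^ N = h1 p * (?B p * ?B' p) ^ N"
      by (simp add: power_mult_distrib)
    then show "?\<alpha> * (\<Prod>j\<le>r. lin_of f j p ^ b j) * ?B' p ^ N = ?\<alpha> * h1 p" using BB'[OF p] by simp
  qed (intro laurent_mult laurent_const laurent_power lB' lh L1)+
  moreover have "congruent s r a f (\<lambda>p. ?R p ^ (s + 1) * ?B p ^ m) (\<lambda>p. A_of f p ^ (s + 1) * ?B' p ^ N)"
  proof (rule congruent_on_torus)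
    fix p assume p: "p \<in> torus s r"
    have "A_of f p ^ (s + 1) * ?B' p ^ N = ?R p ^ (s + 1) * ?B p ^ (N + m) * ?B' p ^ N"
      using ratio_mult_B[OF f p] Nm by (metis power_mult_distrib)
    also have "\<dots> = ?R p ^ (s + 1) * ?B p ^ m * (?B p * ?B' p) ^ N"
      by (simp add: power_add power_mult_distrib mult_ac)
    finally show "?R p ^ (s + 1) * ?B p ^ m = A_of f p ^ (s + 1) * ?B' p ^ N" using BB'[OF p] by simp
  qed (intro laurent_mult laurent_power laurent_ratio laurent_A laurent_B lB')+
  ultimately have "congruent s r a f (\<lambda>p. ?R p ^ (s + 1) * ?B p ^ m) (\<lambda>p. ?\<alpha> * h1 p)"
    using congruent_trans by blast
  then have "congruent s r a f (\<lambda>p. (?R p ^ (s + 1) * ?B p ^ m) ^ (r + 1) * h2 p ^ m) (\<lambda>p. (?\<alpha> * h1 p) ^ (r + 1) * h2 p ^ m)"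
    by (rule congruent_mult[OF congruent_power congruent_refl[OF laurent_power[OF lh(2)]]])
  moreover have "congruent s r a f (\<lambda>p. ?\<beta> ^ m * ?R p ^ ((s + 1) * (r + 1))) (\<lambda>p. (?R p ^ (s + 1) * ?B p ^ m) ^ (r + 1) * h2 p ^ m)"
  proof -
    have "congruent s r a f (\<lambda>p. (\<Prod>j\<le>r. lin_of f j p) ^ m * ?R p ^ ((s + 1) * (r + 1))) (\<lambda>p. ?\<beta> ^ m * ?R p ^ ((s + 1) * (r + 1)))"
      by (intro congruent_mult congruent_power B_relation f congruent_refl laurent_ratio)
    moreover have "congruent s r a f (\<lambda>p. (\<Prod>j\<le>r. lin_of f j p) ^ m * ?R p ^ ((s + 1) * (r + 1)))
        (\<lambda>p. (?R p ^ (s + 1) * ?B p ^ m) ^ (r + 1) * h2 p ^ m)"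
    proof (rule congruent_on_torus)
      fix p assume p: "p \<in> torus s r"
      have "(\<Prod>j\<le>r. lin_of f j p) = ?B p ^ (r + 1) * h2 p" using p by (simp add: lin h2_def prod.distrib)
      then show "(\<Prod>j\<le>r. lin_of f j p) ^ m * ?R p ^ ((s + 1) * (r + 1)) = (?R p ^ (s + 1) * ?B p ^ m) ^ (r + 1) * h2 p ^ m"
        by (simp add: power_mult_distrib power_mult[symmetric] mult_ac del: power_Suc mult_Suc mult_Suc_right)
    qed (intro laurent_mult laurent_power laurent_prod laurent_lin laurent_ratio laurent_B lh)+
    ultimately show ?thesis using congruent_sym congruent_trans by blast
  qed
  ultimately have "congruent s r a f (\<lambda>p. ?\<beta> ^ m * ?R p ^ ((s + 1) * (r + 1))) (\<lambda>p. (?\<alpha> * h1 p) ^ (r + 1) * h2 p ^ m)"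
    using congruent_trans by blast
  then have "(\<lambda>p. ?\<beta> ^ m * ?R p ^ ((s + 1) * (r + 1)) - (?\<alpha> * h1 p) ^ (r + 1) * h2 p ^ m) \<in> torus_ideal s r a f"
    by (simp add: congruent_def)
  moreover have "poly (ratio_poly f) (?R p) = ?\<beta> ^ m * ?R p ^ ((s + 1) * (r + 1)) - (?\<alpha> * h1 p) ^ (r + 1) * h2 p ^ m" for p
    unfolding ratio_poly_def Let_def N_def[symmetric] m_def[symmetric] h1_def h2_def
    by (simp add: poly_monom poly_prod power_mult_distrib mult.assoc del: power_Suc mult_Suc mult_Suc_right)
  ultimately show ?thesis by simp
qed

lemma laurent_along_curve:
  assumes "g \<in> laurent_polynomials s r" and t: "\<kappa> 0 \<in> torus s r"
    and d: "\<And>i. (\<lambda>e. fst (\<kappa> e) i) field_differentiable (at 0)" "\<And>j. (\<lambda>e. snd (\<kappa> e) j) field_differentiable (at 0)"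
  shows "(\<lambda>e. g (\<kappa> e)) field_differentiable (at (0::complex))"
  using assms(1) unfolding laurent_polynomials_def
proof induction
  case (gen g)
  then consider i where "i \<in> {1..s}" "g = (\<lambda>p. fst p i)" | i where "i \<in> {1..s}" "g = (\<lambda>p. inverse (fst p i))"
    | j where "j \<in> {1..r}" "g = (\<lambda>p. snd p j)" | j where "j \<in> {1..r}" "g = (\<lambda>p. inverse (snd p j))" by blast
  then show ?case using d torusD[OF t] by cases (auto intro!: derivative_intros field_differentiable_inverse)
next
  case (const c)
  show ?case by (rule field_differentiable_const)
next
  case (add g h)
  then show ?case by (intro field_differentiable_add)
next
  case (mult g h)
  then show ?case by (intro field_differentiable_mult)
qed

lemma crit_map_along_line:
  assumes x: "x \<in> crit_dom" and v: "dlog1 x v = 0" "dlog2 x v = 0"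
  shows "((\<lambda>e. fst (crit_map (fst x + e * fst v, snd x + e * snd v))) has_field_derivative 0) (at 0)"
    "((\<lambda>e. snd (crit_map (fst x + e * fst v, snd x + e * snd v))) has_field_derivative 0) (at 0)"
proof -
  have line: "((\<lambda>e. (fst x + e * fst v, snd x + e * snd v)) has_derivative (\<lambda>h. (h * fst v, h * snd v))) (at 0)"
    by (auto intro!: derivative_eq_intros)
  have lin: "lin j (h * fst v, h * snd v) = h * lin j v" for h j by (simp add: lin_def algebra_simps)
  have 1: "dlog1 x (h * fst v, h * snd v) = h * dlog1 x v" for h
    unfolding dlog1_def lin by (simp add: algebra_simps sum_distrib_left)
  have 2: "dlog2 x (h * fst v, h * snd v) = h * dlog2 x v" for h
    unfolding dlog2_def lin by (simp add: algebra_simps sum_distrib_left)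
  have "((\<lambda>e. fst (crit_map (fst x + e * fst v, snd x + e * snd v))) has_derivative
      (\<lambda>h. fst (crit_map x) * dlog1 x (h * fst v, h * snd v))) (at 0)"
    using log_derivative_crit_map(1)[OF x] unfolding log_derivative_def
    by (intro has_derivative_compose[OF line]) simp
  then show "((\<lambda>e. fst (crit_map (fst x + e * fst v, snd x + e * snd v))) has_field_derivative 0) (at 0)"
    unfolding has_field_derivative_def 1 v by (simp add: lambda_zero)
  have "((\<lambda>e. snd (crit_map (fst x + e * fst v, snd x + e * snd v))) has_derivative
      (\<lambda>h. snd (crit_map x) * dlog2 x (h * fst v, h * snd v))) (at 0)"
    using log_derivative_crit_map(2)[OF x] unfolding log_derivative_def
    by (intro has_derivative_compose[OF line]) simp
  then show "((\<lambda>e. snd (crit_map (fst x + e * fst v, snd x + e * snd v))) has_field_derivative 0) (at 0)"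
    unfolding has_field_derivative_def 2 v by (simp add: lambda_zero)
qed


text \<open>Let \<open>v\<close> be in the kernel of the differential at \<open>x\<close>, and let \<open>\<tau>\<close> be the value of \<open>A / B\<close> there. It is
  a root of \<open>ratio_poly f\<close>. Reducing its multiplicity to \<open>1\<close> gives a polynomial \<open>g\<close> with a simple root
  \<open>\<tau>\<close> such that a power of \<open>g (A / B)\<close> is in the ideal. As the ideal is radical, \<open>g (A / B)\<close> is a
  combination of the critical equations. Along the curve \<open>crit_point f (x + e * v)\<close> these vanish to
  second order at \<open>e = 0\<close>, hence so does \<open>g (A / B)\<close>, and the derivative of \<open>A / B\<close> is \<open>0\<close>. Thus \<open>v\<close> is
  proportional to \<open>x\<close>. But \<open>dlog2 x x = r + 1\<close> by homogeneity, and so \<open>v = 0\<close>.\<close>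

theorem reduced_imp_nondegenerate:
  assumes f: "f \<in> L s r" and red: "Crit_reduced s r a f" and x: "x \<in> fiber f"
  shows "nondegenerate x"
  unfolding nondegenerate_def
proof (intro allI impI, elim conjE)
  fix v assume v: "dlog1 x v = 0" "dlog2 x v = 0"
  have xd: "x \<in> crit_dom" and xv: "crit_map x = crit_value f" using x by (auto simp: fiber_def)
  have A0: "fst x \<noteq> 0" and "lin 0 x \<noteq> 0" using xd by (auto simp: crit_dom_def)
  then have B0: "snd x \<noteq> 0" by (simp add: lin_0)
  define \<tau> where "\<tau> = fst x / snd x"
  have AB: "A_of f (crit_point f x) = fst x" "B_of f (crit_point f x) = snd x"
    using AB_of_crit_point[OF f x] by (simp_all add: prod_eq_iff)
  have tp: "crit_point f x \<in> torus s r" using crit_point_in_torus[OF f xd] .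
  have \<tau>: "ratio f (crit_point f x) = \<tau>"
    using ratio_mult_B[OF f tp] AB B0 by (simp add: \<tau>_def field_simps)
  let ?Q = "ratio_poly f"
  have "poly ?Q (ratio f (crit_point f x)) = 0"
    by (rule torus_ideal_at_Crit[OF ratio_poly_in_torus_ideal[OF f] crit_point_in_Crit[OF f x]])
  then have root: "poly ?Q \<tau> = 0" by (simp add: \<tau>)
  define n where "n = order \<tau> ?Q"
  have n: "n \<noteq> 0" using root ratio_poly_nonzero[OF f] by (simp add: n_def order_root)
  obtain R where R: "?Q = [:- \<tau>, 1:] ^ n * R" "\<not> [:- \<tau>, 1:] dvd R"
    using order_decomp[OF ratio_poly_nonzero[OF f], of \<tau>] by (auto simp: n_def)
  have R\<tau>: "poly R \<tau> \<noteq> 0" using R(2) by (simp add: poly_eq_0_iff_dvd)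
  \<comment> \<open>\<open>g ^ n\<close> is a multiple of the ratio polynomial, while \<open>\<tau>\<close> is a simple root of \<open>g\<close>.\<close>
  define g where "g = [:- \<tau>, 1:] * R"
  let ?g = "\<lambda>p. poly g (ratio f p)"
  have "(l * R) ^ n = l ^ n * R * R ^ (n - 1)" for l
    using n by (cases n) (simp_all add: power_mult_distrib mult_ac)
  then have "g ^ n = ?Q * R ^ (n - 1)" unfolding g_def R(1) .
  then have "(\<lambda>p. ?g p ^ n) = (\<lambda>p. poly (R ^ (n - 1)) (ratio f p) * poly ?Q (ratio f p))"
    by (metis (no_types, opaque_lifting) mult.commute poly_mult poly_power)
  then have "(\<lambda>p. ?g p ^ n) \<in> torus_ideal s r a f"
    using torus_ideal_mult[OF ratio_poly_in_torus_ideal[OF f] laurent_poly[OF laurent_ratio, of "R ^ (n - 1)" f]] by simp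
  then have "(\<lambda>p. ?g p ^ n) \<in> Crit_ideal s r a f"
    unfolding Crit_ideal_iff by (intro conjI laurent_power laurent_poly laurent_ratio)
  moreover have "\<forall>n. (\<lambda>p. ?g p ^ n) \<in> Crit_ideal s r a f \<longrightarrow> ?g \<in> Crit_ideal s r a f"
    using red laurent_poly[OF laurent_ratio, of g f] unfolding Crit_reduced_def by (rule bspec)
  ultimately have "?g \<in> torus_ideal s r a f" unfolding Crit_ideal_iff by (elim allE impE conjunct2)
  then obtain c d where cd: "\<forall>i\<in>{1..s}. c i \<in> laurent_polynomials s r" "\<forall>j\<in>{1..r}. d j \<in> laurent_polynomials s r"
      "\<forall>p\<in>torus s r. ?g p = (\<Sum>i=1..s. c i p * log_deriv_z s r a f i p) + (\<Sum>j=1..r. d j p * log_deriv_w s r a f j p)"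
    unfolding torus_ideal_def mem_Collect_eq by (elim exE conjE)
  define line where "line e = (fst x + e * fst v, snd x + e * snd v)" for e :: complex
  define \<kappa> where "\<kappa> e = crit_point f (line e)" for e
  have line0: "line 0 = x" by (simp add: line_def)
  have \<kappa>0: "\<kappa> 0 = crit_point f x" by (simp add: \<kappa>_def line0)
  have "isCont line 0" unfolding line_def by (intro continuous_intros)
  then have "(line \<longlongrightarrow> line 0) (nhds 0)" by (simp add: isCont_def tendsto_at_iff_tendsto_nhds)
  then have ev: "\<forall>\<^sub>F e in nhds 0. line e \<in> crit_dom"
    using topological_tendstoD[OF _ open_crit_dom] xd by (simp add: line0)
  define \<phi>1 where "\<phi>1 e = fst (crit_value f) / fst (crit_map (line e))" for e
  define \<phi>2 where "\<phi>2 e = snd (crit_value f) / snd (crit_map (line e))" for e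
  have nz: "fst (crit_map (line 0)) \<noteq> 0" "snd (crit_map (line 0)) \<noteq> 0"
    using crit_map_nonzero[OF xd] by (simp_all add: line0)
  have \<phi>0: "\<phi>1 0 = 1" "\<phi>2 0 = 1" using nz xv by (simp_all add: \<phi>1_def \<phi>2_def line0)
  have d1: "(\<phi>1 has_field_derivative 0) (at 0)" and d2: "(\<phi>2 has_field_derivative 0) (at 0)"
    unfolding \<phi>1_def[abs_def] \<phi>2_def[abs_def]
    using crit_map_along_line[OF xd v, folded line_def] nz
    by (auto intro!: derivative_eq_intros)
  have Ad: "((\<lambda>e. fst (line e)) has_field_derivative fst v) (at 0)"
    and Bd: "((\<lambda>e. snd (line e)) has_field_derivative snd v) (at 0)"
    unfolding line_def by (auto intro!: derivative_eq_intros)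
  have A\<kappa>: "A_of f (\<kappa> e) = fst (line e) * \<phi>1 e" and B\<kappa>: "B_of f (\<kappa> e) = snd (line e) * \<phi>2 e"
    if "line e \<in> crit_dom" for e
    using A_of_crit_point[OF f that] B_of_crit_point[OF f that] by (simp_all add: \<kappa>_def \<phi>1_def \<phi>2_def)
  have dz: "fst f i * fst (\<kappa> e) i = fst (line e)" if "i \<in> {1..s}" for i e
    using that L_D(1)[OF f, of i] by (simp add: \<kappa>_def crit_point_def)
  have dw: "snd f j * snd (\<kappa> e) j = snd (line e) - of_int (a j) * fst (line e)" if "j \<in> {1..r}" for j e
    using that L_D(2)[OF f, of j] by (simp add: \<kappa>_def crit_point_def lin_def)
  have fd: "(\<lambda>e. fst (\<kappa> e) i) field_differentiable (at 0)" "(\<lambda>e. snd (\<kappa> e) j) field_differentiable (at 0)" for i j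
  proof -
    have A': "(\<lambda>e. (fst x + e * fst v) * inverse (fst f i)) field_differentiable (at 0)"
      and B': "(\<lambda>e. ((snd x + e * snd v) - of_int (a j) * (fst x + e * fst v)) * inverse (snd f j)) field_differentiable (at 0)"
      by (intro derivative_intros)+
    show "(\<lambda>e. fst (\<kappa> e) i) field_differentiable (at 0)"
      using A' unfolding \<kappa>_def crit_point_def line_def fst_conv divide_inverse
      by (cases "i \<in> {1..s}") (simp_all only: if_True if_False simp_thms field_differentiable_const)
    show "(\<lambda>e. snd (\<kappa> e) j) field_differentiable (at 0)"
      using B' unfolding \<kappa>_def crit_point_def lin_def line_def fst_conv snd_conv divide_inverse
      by (cases "j \<in> {1..r}") (simp_all only: if_True if_False simp_thms field_differentiable_const)
  qed
  \<comment> \<open>Along the curve, the critical equations have the values \<open>Z\<close> and \<open>Y - a j * Z\<close>.\<close>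
  define Z where "Z e = fst (line e) * (1 - \<phi>1 e)" for e
  define Y where "Y e = snd (line e) * (1 - \<phi>2 e)" for e
  have Z: "Z 0 = 0" "(Z has_field_derivative 0) (at 0)" and Y: "Y 0 = 0" "(Y has_field_derivative 0) (at 0)"
    unfolding Z_def[abs_def] Y_def[abs_def] using \<phi>0 Ad Bd d1 d2 by (auto intro!: derivative_eq_intros)
  define rhs where "rhs e = (\<Sum>i=1..s. c i (\<kappa> e) * Z e) + (\<Sum>j=1..r. d j (\<kappa> e) * (Y e - of_int (a j) * Z e))" for e
  have "(rhs has_field_derivative
      (\<Sum>i=1..s. deriv (\<lambda>e. c i (\<kappa> e)) 0 * Z 0 + 0 * c i (\<kappa> 0)) +
      (\<Sum>j=1..r. deriv (\<lambda>e. d j (\<kappa> e)) 0 * (Y 0 - of_int (a j) * Z 0) + (0 - of_int (a j) * 0) * d j (\<kappa> 0))) (at 0)"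
    unfolding rhs_def[abs_def]
  proof (intro DERIV_add DERIV_sum DERIV_mult DERIV_diff DERIV_cmult Z Y)
    show "((\<lambda>e. c i (\<kappa> e)) has_field_derivative deriv (\<lambda>e. c i (\<kappa> e)) 0) (at 0)" if "i \<in> {1..s}" for i
      using laurent_along_curve[OF cd(1)[rule_format, OF that] _ fd] tp
      by (simp add: \<kappa>0 field_differentiable_derivI)
    show "((\<lambda>e. d j (\<kappa> e)) has_field_derivative deriv (\<lambda>e. d j (\<kappa> e)) 0) (at 0)" if "j \<in> {1..r}" for j
      using laurent_along_curve[OF cd(2)[rule_format, OF that] _ fd] tp
      by (simp add: \<kappa>0 field_differentiable_derivI)
  qed
  then have rhs: "(rhs has_field_derivative 0) (at 0)" by (simp add: Z(1) Y(1))
  define q where "q e = fst (line e) * \<phi>1 e / (snd (line e) * \<phi>2 e)" for e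
  have ev': "\<forall>\<^sub>F e in nhds 0. poly g (q e) = rhs e"
    using ev
  proof eventually_elim
    case (elim e)
    have t: "\<kappa> e \<in> torus s r" using crit_point_in_torus[OF f elim] by (simp add: \<kappa>_def)
    have "B_of f (\<kappa> e) \<noteq> 0" using torusD(2)[OF t] L_D(2)[OF f] by (simp add: B_of_alt)
    then have "ratio f (\<kappa> e) = q e"
      using ratio_mult_B[OF f t] A\<kappa>[OF elim] B\<kappa>[OF elim] by (simp add: q_def field_simps)
    moreover have "?g (\<kappa> e) = rhs e"
      using cd(3)[rule_format, OF t] dz dw
      unfolding rhs_def Z_def Y_def
      by (simp add: log_deriv_z_eq[OF t] log_deriv_w_eq[OF t] A\<kappa>[OF elim] B\<kappa>[OF elim] algebra_simps)
    ultimately show ?case by simp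
  qed
  have q0: "q 0 = \<tau>" by (simp add: q_def \<phi>0 line0 \<tau>_def)
  have "(q has_field_derivative ((fst v * snd x - fst x * snd v) / snd x ^ 2)) (at 0)"
    unfolding q_def[abs_def] using Ad Bd d1 d2 \<phi>0 B0
    by (auto intro!: derivative_eq_intros simp: line0 power2_eq_square)
  then have "((\<lambda>e. poly g (q e)) has_field_derivative
      poly (pderiv g) (q 0) * ((fst v * snd x - fst x * snd v) / snd x ^ 2)) (at 0)"
    by (intro DERIV_chain2[OF poly_DERIV])
  then have "(rhs has_field_derivative poly (pderiv g) \<tau> * ((fst v * snd x - fst x * snd v) / snd x ^ 2)) (at 0)"
    using DERIV_cong_ev[OF refl ev' refl] q0 by simp
  then have "poly (pderiv g) \<tau> * ((fst v * snd x - fst x * snd v) / snd x ^ 2) = 0"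
    using rhs DERIV_unique by blast
  moreover have "poly (pderiv g) \<tau> = poly R \<tau>"
  proof -
    have "pderiv g = [:- \<tau>, 1:] * pderiv R + R * pderiv [:- \<tau>, 1:]"
      unfolding g_def by (rule pderiv_mult)
    then show ?thesis by (simp add: pderiv_pCons)
  qed
  ultimately have proportional: "fst v * snd x = fst x * snd v" using R\<tau> B0 by simp
  \<comment> \<open>For \<open>v = k * x\<close>, the second logarithmic derivative is \<open>(r + 1) * k\<close>.\<close>
  define k where "k = snd v / snd x"
  have vk: "fst v = k * fst x" "snd v = k * snd x" using proportional B0 by (simp_all add: k_def field_simps)
  have "lin j v = k * lin j x" for j by (simp add: lin_def vk algebra_simps)
  then have "dlog2 x v = (\<Sum>j\<le>r. k)"
    unfolding dlog2_def using xd by (intro sum.cong) (auto simp: crit_dom_def)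
  then have "k * of_nat (r + 1) = 0" using v(2) by (simp add: algebra_simps)
  then have "k = 0" by (metis mult_eq_0_iff of_nat_eq_0_iff add_is_0 one_neq_zero)
  then show "v = 0" using vk by (simp add: prod_eq_iff)
qed

corollary crit_value_regular:
  assumes "f \<in> L s r - R_X s r a"
  shows "crit_value f \<in> regular_values"
  using assms reduced_imp_nondegenerate[of f] crit_value_nonzero[of f]
  unfolding R_X_def regular_values_def fiber_def by blast


end

subsection \<open>Counting critical points\<close>

interpretation fspace: vector_space "\<lambda>(c::complex) (g::pt \<Rightarrow> complex) p. c * g p"
  by unfold_locales (auto simp: fun_eq_iff algebra_simps plus_fun_def)

lemma fspace_add: "g + h = (\<lambda>p. g p + h p)" for g h :: "pt \<Rightarrow> complex"
  by (simp add: fun_eq_iff)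

lemma fspace_zero: "(0 :: pt \<Rightarrow> complex) = (\<lambda>p. 0)"
  by (simp add: fun_eq_iff)

lemma subspace_torus_ideal: "fspace.subspace (torus_ideal s r a f)"
  unfolding fspace.subspace_def fspace_add fspace_zero
  by (auto intro: torus_ideal_zero torus_ideal_add torus_ideal_mult laurent_const)

text \<open>Laurent polynomials with arbitrary values off the torus. Unlike \<open>laurent_polynomials\<close>, this space
  contains \<open>torus_ideal\<close>.\<close>

definition torus_laurent :: "nat \<Rightarrow> nat \<Rightarrow> (pt \<Rightarrow> complex) set" where
  "torus_laurent s r = {h. \<exists>h'\<in>laurent_polynomials s r. \<forall>p\<in>torus s r. h p = h' p}"

lemma subspace_torus_laurent: "fspace.subspace (torus_laurent s r)"
proof -
  have "(\<lambda>_. 0) \<in> torus_laurent s r"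
    unfolding torus_laurent_def by (auto intro!: bexI[OF _ laurent_const[of 0]])
  moreover have "(\<lambda>p. g p + h p) \<in> torus_laurent s r"
    if gh: "g \<in> torus_laurent s r" "h \<in> torus_laurent s r" for g h
  proof -
    obtain g' h' where "g' \<in> laurent_polynomials s r" "h' \<in> laurent_polynomials s r"
      "\<forall>p\<in>torus s r. g p = g' p" "\<forall>p\<in>torus s r. h p = h' p" using gh unfolding torus_laurent_def by blast
    then show ?thesis unfolding torus_laurent_def by (auto intro!: bexI[OF _ laurent_add[of g' s r h']])
  qed
  moreover have "(\<lambda>p. c * g p) \<in> torus_laurent s r" if g: "g \<in> torus_laurent s r" for c g
  proof -
    obtain g' where "g' \<in> laurent_polynomials s r" "\<forall>p\<in>torus s r. g p = g' p" using g unfolding torus_laurent_def by blast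
    then show ?thesis unfolding torus_laurent_def by (auto intro!: bexI[OF _ laurent_mult[OF laurent_const[of c], of g']])
  qed
  ultimately show ?thesis unfolding fspace.subspace_def fspace_add fspace_zero by blast
qed

lemma laurent_subset_torus_laurent: "laurent_polynomials s r \<subseteq> torus_laurent s r"
  unfolding torus_laurent_def by blast

lemma torus_ideal_mult_torus:
  assumes "g \<in> torus_ideal s r a f" "h \<in> torus_laurent s r"
  shows "(\<lambda>p. g p * h p) \<in> torus_ideal s r a f"
proof -
  obtain h' where h': "h' \<in> laurent_polynomials s r" "\<forall>p\<in>torus s r. h p = h' p"
    using assms(2) unfolding torus_laurent_def by blast
  show ?thesis
    by (rule torus_ideal_cong[OF torus_ideal_mult[OF assms(1) h'(1)]]) (use h'(2) in simp)
qed

context twisted_bundle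
begin

lemma torus_ideal_subset_torus_laurent: "torus_ideal s r a f \<subseteq> torus_laurent s r"
proof
  fix g assume "g \<in> torus_ideal s r a f"
  then obtain c d where c: "\<forall>i\<in>{1..s}. c i \<in> laurent_polynomials s r" and d: "\<forall>j\<in>{1..r}. d j \<in> laurent_polynomials s r"
      and g: "\<forall>p\<in>torus s r. g p = (\<Sum>i=1..s. c i p * log_deriv_z s r a f i p) + (\<Sum>j=1..r. d j p * log_deriv_w s r a f j p)"
    unfolding torus_ideal_def mem_Collect_eq by (elim exE conjE)
  let ?h = "\<lambda>p. (\<Sum>i=1..s. c i p * (fst f i * fst p i - A_of f p)) +
      (\<Sum>j=1..r. d j p * ((snd f j * snd p j + of_int (a j) * A_of f p) - B_of f p))"
  have "?h \<in> laurent_polynomials s r"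
    by (intro laurent_add laurent_sum laurent_mult laurent_diff laurent_const laurent_A laurent_B laurent_gen)
       (use c d in auto)
  moreover have "g p = ?h p" if "p \<in> torus s r" for p
    using g that by (simp add: log_deriv_z_eq log_deriv_w_eq)
  ultimately show "g \<in> torus_laurent s r"
    unfolding torus_laurent_def by (intro CollectI bexI[of _ ?h] ballI)
qed

text \<open>The products \<open>B * (B - a 1 * A) * \<dots>\<close> replace the powers of \<open>B\<close>: multiplication by \<open>B\<close> leads from one
  product to the next up to a multiple of \<open>A\<close>, and the product of all linear forms is a constant modulo
  the ideal by \<open>B_relation\<close>.\<close>

definition partial_lin :: "pt \<Rightarrow> nat \<Rightarrow> pt \<Rightarrow> complex" where
  "partial_lin f j p = (\<Prod>i<j. lin_of f i p)"

definition basis_fn :: "pt \<Rightarrow> nat \<Rightarrow> nat \<Rightarrow> pt \<Rightarrow> complex" where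
  "basis_fn f i j p = A_of f p ^ i * partial_lin f j p"

definition filtered :: "pt \<Rightarrow> nat \<Rightarrow> (pt \<Rightarrow> complex) set" where
  "filtered f d = fspace.span ({basis_fn f i j | i j. i + j \<le> d \<and> j \<le> r} \<union> torus_ideal s r a f)"

lemma laurent_basis_fn: "basis_fn f i j \<in> laurent_polynomials s r"
  unfolding basis_fn_def[abs_def] partial_lin_def by (intro laurent_mult laurent_power laurent_A laurent_prod laurent_lin)

lemma subspace_preimage:
  assumes "fspace.subspace V"
  shows "fspace.subspace {h. (\<lambda>p. g p * h p) \<in> V}"
  using assms unfolding fspace.subspace_def fspace_add fspace_zero
  by (auto simp: distrib_left mult.left_commute[of "g _"])

lemma filtered_multiplier:
  assumes g: "g \<in> laurent_polynomials s r"
    and gens: "\<And>i j. i + j \<le> d \<Longrightarrow> j \<le> r \<Longrightarrow> (\<lambda>p. g p * basis_fn f i j p) \<in> filtered f d'"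
    and h: "h \<in> filtered f d"
  shows "(\<lambda>p. g p * h p) \<in> filtered f d'"
proof -
  have "h \<in> {h. (\<lambda>p. g p * h p) \<in> filtered f d'}"
  proof (rule fspace.span_minimal[THEN subsetD])
    show "fspace.subspace {h. (\<lambda>p. g p * h p) \<in> filtered f d'}"
      unfolding filtered_def by (rule subspace_preimage) simp
    show "h \<in> fspace.span ({basis_fn f i j | i j. i + j \<le> d \<and> j \<le> r} \<union> torus_ideal s r a f)"
      using h by (simp add: filtered_def)
    have "(\<lambda>p. g p * h p) \<in> filtered f d'" if "h \<in> torus_ideal s r a f" for h
      unfolding filtered_def using torus_ideal_mult[OF that g] by (intro fspace.span_base) simp
    then show "{basis_fn f i j | i j. i + j \<le> d \<and> j \<le> r} \<union> torus_ideal s r a f \<subseteq> {h. (\<lambda>p. g p * h p) \<in> filtered f d'}"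
      using gens by auto
  qed
  then show ?thesis by simp
qed

lemma basis_fn_in_filtered: "i + j \<le> d \<Longrightarrow> j \<le> r \<Longrightarrow> basis_fn f i j \<in> filtered f d"
  unfolding filtered_def by (rule fspace.span_base) blast

lemma filtered_add: "g \<in> filtered f d \<Longrightarrow> h \<in> filtered f d \<Longrightarrow> (\<lambda>p. g p + h p) \<in> filtered f d"
  unfolding filtered_def using fspace.span_add[of g _ h] by (simp add: fspace_add)

lemma filtered_scale: "g \<in> filtered f d \<Longrightarrow> (\<lambda>p. c * g p) \<in> filtered f d"
  unfolding filtered_def by (rule fspace.span_scale)

lemma filtered_torus_ideal: "g \<in> torus_ideal s r a f \<Longrightarrow> g \<in> filtered f d"
  unfolding filtered_def by (rule fspace.span_base) blast

lemma filtered_mult_A: "h \<in> filtered f d \<Longrightarrow> (\<lambda>p. A_of f p * h p) \<in> filtered f (d + 1)"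
proof (rule filtered_multiplier[OF laurent_A])
  fix i j assume "i + j \<le> d" "j \<le> r"
  then have "basis_fn f (i + 1) j \<in> filtered f (d + 1)" by (intro basis_fn_in_filtered) auto
  then show "(\<lambda>p. A_of f p * basis_fn f i j p) \<in> filtered f (d + 1)" by (simp add: basis_fn_def[abs_def] mult.assoc)
qed

lemma filtered_mult_B:
  assumes f: "f \<in> L s r"
  shows "h \<in> filtered f d \<Longrightarrow> (\<lambda>p. B_of f p * h p) \<in> filtered f (d + 1)"
proof (rule filtered_multiplier[OF laurent_B])
  fix i j assume ij: "i + j \<le> d" "j \<le> r"
  have next_lin: "basis_fn f i (j + 1) \<in> filtered f (d + 1)"
  proof (cases "j + 1 \<le> r")
    case True
    then show ?thesis using ij by (intro basis_fn_in_filtered) auto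
  next
    case False
    then have "{..<j + 1} = {..r}" using ij by auto
    then have "basis_fn f i (j + 1) = (\<lambda>p. A_of f p ^ i * (\<Prod>j\<le>r. lin_of f j p))"
      by (simp add: basis_fn_def[abs_def] partial_lin_def)
    moreover have "congruent s r a f (\<lambda>p. A_of f p ^ i * (\<Prod>j\<le>r. lin_of f j p)) (\<lambda>p. A_of f p ^ i * snd (crit_value f))"
      by (intro congruent_mult congruent_refl laurent_power laurent_A B_relation f)
    ultimately have "(\<lambda>p. basis_fn f i (j + 1) p - A_of f p ^ i * snd (crit_value f)) \<in> torus_ideal s r a f"
      by (simp add: congruent_def)
    moreover have "(\<lambda>p. snd (crit_value f) * basis_fn f i 0 p) \<in> filtered f (d + 1)"
      using ij by (intro filtered_scale basis_fn_in_filtered) auto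
    ultimately have "(\<lambda>p. (basis_fn f i (j + 1) p - A_of f p ^ i * snd (crit_value f)) + snd (crit_value f) * basis_fn f i 0 p) \<in> filtered f (d + 1)"
      using filtered_add[OF filtered_torus_ideal] by blast
    then show ?thesis by (simp add: basis_fn_def[of f i 0] partial_lin_def mult.commute)
  qed
  have "B_of f p * basis_fn f i j p = basis_fn f i (j + 1) p + of_int (a j) * basis_fn f (i + 1) j p" for p
    by (simp add: basis_fn_def partial_lin_def lin_of_def lin_def algebra_simps)
  then show "(\<lambda>p. B_of f p * basis_fn f i j p) \<in> filtered f (d + 1)"
    using next_lin ij by (simp add: filtered_add filtered_scale basis_fn_in_filtered)
qed

lemma filtered_mult_lin:
  assumes f: "f \<in> L s r" and h: "h \<in> filtered f d"
  shows "(\<lambda>p. lin_of f j p * h p) \<in> filtered f (d + 1)"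
proof -
  have "(\<lambda>p. lin_of f j p * h p) = (\<lambda>p. B_of f p * h p + - of_int (a j) * (A_of f p * h p))"
    by (simp add: lin_of_def lin_def algebra_simps)
  then show ?thesis
    using filtered_add[OF filtered_mult_B[OF f h] filtered_scale[OF filtered_mult_A[OF h]]] by (simp only:)
qed

lemma filtered_mult_lin_power:
  assumes f: "f \<in> L s r" and h: "h \<in> filtered f d"
  shows "(\<lambda>p. lin_of f j p ^ n * h p) \<in> filtered f (d + n)"
  using filtered_mult_lin[OF f] h by (induction n) (simp_all add: mult.assoc)

lemma filtered_mult_lin_prod:
  assumes f: "f \<in> L s r" and h: "h \<in> filtered f d" and "finite I"
  shows "(\<lambda>p. (\<Prod>j\<in>I. lin_of f j p ^ n j) * h p) \<in> filtered f (d + (\<Sum>j\<in>I. n j))"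
  using \<open>finite I\<close>
proof (induction I rule: finite_induct)
  case (insert j I)
  then show ?case using filtered_mult_lin_power[OF f insert.IH, of j "n j"] by (simp add: mult.assoc add_ac)
qed (use h in simp)

definition basis :: "pt \<Rightarrow> (pt \<Rightarrow> complex) set" where
  "basis f = (\<lambda>(i, j). basis_fn f i j) ` ({..s} \<times> {..r})"

definition basis_span :: "pt \<Rightarrow> (pt \<Rightarrow> complex) set" where
  "basis_span f = fspace.span (basis f \<union> torus_ideal s r a f)"

text \<open>By \<open>A_relation\<close>, \<open>A ^ (s + 1)\<close> is congruent to a form of degree \<open>(\<Sum>j\<le>r. b j) \<le> s\<close> in \<open>A\<close> and \<open>B\<close>, so
  that exponents of \<open>A\<close> above \<open>s\<close> can be removed by induction on the degree.\<close>

lemma filtered_subset_basis_span: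
  assumes f: "f \<in> L s r"
  shows "filtered f d \<subseteq> basis_span f"
proof (induction d rule: less_induct)
  case (less d)
  have sub: "fspace.subspace (basis_span f)" unfolding basis_span_def by simp
  have "basis_fn f i j \<in> basis_span f" if ij: "i + j \<le> d" "j \<le> r" for i j
  proof (cases "i \<le> s")
    case True
    then show ?thesis unfolding basis_span_def basis_def using ij by (intro fspace.span_base) auto
  next
    case False
    define k where "k = i - (s + 1)"
    have k: "i = (s + 1) + k" using False by (simp add: k_def)
    let ?m = "basis_fn f k j"
    have "congruent s r a f (\<lambda>p. A_of f p ^ (s + 1) * ?m p)
       (\<lambda>p. fst (crit_value f) * (\<Prod>j\<le>r. lin_of f j p ^ b j) * ?m p)"
      by (intro congruent_mult[OF A_relation] f congruent_refl laurent_basis_fn)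
    then have "(\<lambda>p. basis_fn f i j p - fst (crit_value f) * ((\<Prod>j\<le>r. lin_of f j p ^ b j) * ?m p)) \<in> torus_ideal s r a f"
      by (simp add: congruent_def basis_fn_def k power_add mult_ac)
    then have 1: "(\<lambda>p. basis_fn f i j p - fst (crit_value f) * ((\<Prod>j\<le>r. lin_of f j p ^ b j) * ?m p)) \<in> basis_span f"
      unfolding basis_span_def by (intro fspace.span_base) simp
    have "(\<lambda>p. fst (crit_value f) * ((\<Prod>j\<le>r. lin_of f j p ^ b j) * ?m p)) \<in> filtered f (k + j + (\<Sum>j\<le>r. b j))"
      using ij by (intro filtered_scale filtered_mult_lin_prod f basis_fn_in_filtered) auto
    moreover have "k + j + (\<Sum>j\<le>r. b j) < d" using k ij sum_b_le by linarith
    ultimately have 2: "(\<lambda>p. fst (crit_value f) * ((\<Prod>j\<le>r. lin_of f j p ^ b j) * ?m p)) \<in> basis_span f"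
      using less by blast
    show ?thesis using fspace.subspace_add[OF sub 1 2] by (simp add: fspace_add)
  qed
  moreover have "torus_ideal s r a f \<subseteq> basis_span f"
    unfolding basis_span_def using fspace.span_superset by blast
  ultimately show ?case unfolding filtered_def by (intro fspace.span_minimal sub) auto
qed

lemma basis_span_subset_filtered: "basis_span f \<subseteq> filtered f (s + r)"
  unfolding basis_span_def filtered_def basis_def by (intro fspace.span_mono) force

lemma basis_span_subset_torus_laurent: "basis_span f \<subseteq> torus_laurent s r"
  unfolding basis_span_def
proof (intro fspace.span_minimal subspace_torus_laurent Un_least torus_ideal_subset_torus_laurent)
  show "basis f \<subseteq> torus_laurent s r"
    using subsetD[OF laurent_subset_torus_laurent laurent_basis_fn] unfolding basis_def
    by (intro image_subsetI) (simp add: case_prod_beta)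
qed

text \<open>The multipliers \<open>M\<close> of the span form an algebra, and the span contains \<open>1\<close>. The preceding lemmas put
  \<open>A\<close>, \<open>B\<close> and the linear forms into \<open>M\<close>. The congruences of the critical equations add the coordinates,
  and the definitions of \<open>A\<close> and \<open>B\<close> add their inverses.\<close>

lemma laurent_subset_basis_span:
  assumes f: "f \<in> L s r"
  shows "laurent_polynomials s r \<subseteq> basis_span f"
proof -
  define M where "M = {g \<in> laurent_polynomials s r. \<forall>h\<in>basis_span f. (\<lambda>p. g p * h p) \<in> basis_span f}"
  have sub: "fspace.subspace (basis_span f)" unfolding basis_span_def by simp
  note up = subsetD[OF filtered_subset_basis_span[OF f]] and down = subsetD[OF basis_span_subset_filtered]
  have M_const: "(\<lambda>_. c) \<in> M" for c
    using fspace.subspace_scale[OF sub] by (simp add: M_def laurent_const)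
  have M_add: "(\<lambda>p. g p + g' p) \<in> M" if "g \<in> M" "g' \<in> M" for g g'
    using that fspace.subspace_add[OF sub] by (simp add: M_def laurent_add distrib_right fspace_add)
  have M_mult: "(\<lambda>p. g p * g' p) \<in> M" if "g \<in> M" "g' \<in> M" for g g'
    using that by (simp add: M_def laurent_mult mult.assoc)
  have M_prod: "(\<lambda>p. \<Prod>i\<in>I. g i p) \<in> M" if "\<And>i. i \<in> I \<Longrightarrow> g i \<in> M" for I :: "nat set" and g
    using that by (induction I rule: infinite_finite_induct) (auto intro: M_const M_mult)
  have M_power: "(\<lambda>p. g p ^ n) \<in> M" if "g \<in> M" for g n
    using M_prod[of "{..<n}" "\<lambda>_. g"] that by simp
  have M_A: "A_of f \<in> M" unfolding M_def using laurent_A up[OF filtered_mult_A[OF down]] by simp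
  have M_B: "B_of f \<in> M" unfolding M_def using laurent_B up[OF filtered_mult_B[OF f down]] by simp
  have M_lin: "lin_of f j \<in> M" for j
    unfolding M_def using laurent_lin up[OF filtered_mult_lin[OF f down]] by simp
  have M_cong: "g \<in> M" if gh: "congruent s r a f g h" "h \<in> M" for g h
  proof -
    have "(\<lambda>p. g p * k p) \<in> basis_span f" if k: "k \<in> basis_span f" for k
    proof -
      have "(\<lambda>p. (g p - h p) * k p) \<in> torus_ideal s r a f"
      proof (rule torus_ideal_mult_torus)
        show "(\<lambda>p. g p - h p) \<in> torus_ideal s r a f" using gh(1) unfolding congruent_def by (elim conjE)
        show "k \<in> torus_laurent s r" using subsetD[OF basis_span_subset_torus_laurent k] .
      qed
      then have "(\<lambda>p. (g p - h p) * k p) \<in> basis_span f"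
        unfolding basis_span_def by (intro fspace.span_base) simp
      moreover have "(\<lambda>p. h p * k p) \<in> basis_span f" using gh(2) k by (simp add: M_def)
      ultimately have "(\<lambda>p. (g p - h p) * k p) + (\<lambda>p. h p * k p) \<in> basis_span f" by (rule fspace.subspace_add[OF sub])
      then show ?thesis by (simp add: fspace_add algebra_simps)
    qed
    then show ?thesis using gh(1) by (simp add: M_def congruent_def)
  qed
  have M_w: "(\<lambda>p. snd p j) \<in> M" if j: "j \<in> {1..r}" for j
  proof -
    have "(\<lambda>p. snd f j * snd p j) \<in> M" using M_cong[OF congruent_w[OF j] M_lin] .
    then have "(\<lambda>p. inverse (snd f j) * (snd f j * snd p j)) \<in> M" by (rule M_mult[OF M_const])
    moreover have "inverse (snd f j) * (snd f j * snd p j) = snd p j" for p :: pt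
      using L_D(2)[OF f, of j] j by (simp add: mult.assoc[symmetric])
    ultimately show ?thesis by (simp only:)
  qed
  have M_z: "(\<lambda>p. fst p i) \<in> M" if i: "i \<in> {1..s}" for i
  proof -
    have "(\<lambda>p. fst f i * fst p i) \<in> M" using M_cong[OF congruent_z[OF i] M_A] .
    then have "(\<lambda>p. inverse (fst f i) * (fst f i * fst p i)) \<in> M" by (rule M_mult[OF M_const])
    moreover have "inverse (fst f i) * (fst f i * fst p i) = fst p i" for p :: pt
      using L_D(1)[OF f, of i] i by (simp add: mult.assoc[symmetric])
    ultimately show ?thesis by (simp only:)
  qed
  have M_iw: "(\<lambda>p. inverse (snd p j)) \<in> M" if j: "j \<in> {1..r}" for j
  proof (rule M_cong[OF congruent_on_torus])
    let ?h = "\<lambda>p. inverse (snd f 0) * B_of f p * (\<Prod>k\<in>{1..r} - {j}. snd p k)"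
    show "?h \<in> M" by (intro M_mult M_const M_B M_prod M_w) auto
    then show "?h \<in> laurent_polynomials s r" by (simp add: M_def)
    show "(\<lambda>p. inverse (snd p j)) \<in> laurent_polynomials s r" using laurent_gen(4)[OF j] .
    fix p assume t: "p \<in> torus s r"
    have "(\<Prod>k=1..r. snd p k) = snd p j * (\<Prod>k\<in>{1..r} - {j}. snd p k)" using j by (subst prod.remove[of _ j]) auto
    moreover have "(\<Prod>k=1..r. snd p k) \<noteq> 0" using torusD(2)[OF t] by simp
    ultimately show "inverse (snd p j) = ?h p"
      using L_D(2)[OF f, of 0] unfolding B_of_alt by (simp add: field_simps)
  qed
  have M_iz: "(\<lambda>p. inverse (fst p i)) \<in> M" if i: "i \<in> {1..s}" for i
  proof (rule M_cong[OF congruent_on_torus])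
    let ?h = "\<lambda>p. inverse (fst f 0) * A_of f p * (\<Prod>k\<in>{1..s} - {i}. fst p k) * (\<Prod>j=1..r. inverse (snd p j) ^ b j)"
    show "?h \<in> M" by (intro M_mult M_const M_A M_prod M_power M_z M_iw) auto
    then show "?h \<in> laurent_polynomials s r" by (simp add: M_def)
    show "(\<lambda>p. inverse (fst p i)) \<in> laurent_polynomials s r" using laurent_gen(2)[OF i] .
    fix p assume t: "p \<in> torus s r"
    have "(\<Prod>k=1..s. fst p k) = fst p i * (\<Prod>k\<in>{1..s} - {i}. fst p k)" using i by (subst prod.remove[of _ i]) auto
    moreover have "(\<Prod>k=1..s. fst p k) \<noteq> 0" using torusD(1)[OF t] by simp
    moreover have "(\<Prod>j=1..r. snd p j ^ b j) * (\<Prod>j=1..r. inverse (snd p j) ^ b j) = 1"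
      using torusD(2)[OF t] by (simp add: prod.distrib[symmetric] power_mult_distrib[symmetric])
    ultimately show "inverse (fst p i) = ?h p"
      using L_D(1)[OF f, of 0] unfolding A_of_alt by (simp add: field_simps)
  qed
  have "g \<in> M" if "g \<in> laurent_polynomials s r" for g
    using that unfolding laurent_polynomials_def
  proof induction
    case (gen g)
    then consider i where "i \<in> {1..s}" "g = (\<lambda>p. fst p i)" | i where "i \<in> {1..s}" "g = (\<lambda>p. inverse (fst p i))"
      | j where "j \<in> {1..r}" "g = (\<lambda>p. snd p j)" | j where "j \<in> {1..r}" "g = (\<lambda>p. inverse (snd p j))" by blast
    then show ?case using M_z M_iz M_w M_iw by cases auto
  qed (auto intro: M_const M_add M_mult)
  moreover have "(\<lambda>_. 1) \<in> basis_span f"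
    using up[OF basis_fn_in_filtered[of 0 0 0]] by (simp add: basis_fn_def[abs_def] partial_lin_def)
  ultimately show ?thesis unfolding M_def by fastforce
qed


definition restrict_to :: "pt set \<Rightarrow> (pt \<Rightarrow> complex) \<Rightarrow> pt \<Rightarrow> complex" where
  "restrict_to X g = (\<lambda>p. if p \<in> X then g p else 0)"

lemma restrict_to_span:
  assumes "g \<in> fspace.span G"
  shows "restrict_to X g \<in> fspace.span (restrict_to X ` G)"
proof -
  have "g \<in> {g. restrict_to X g \<in> fspace.span (restrict_to X ` G)}"
  proof (rule fspace.span_minimal[THEN subsetD, OF _ _ assms])
    have *: "restrict_to X 0 = 0" "restrict_to X (g + h) = restrict_to X g + restrict_to X h"
        "restrict_to X (\<lambda>p. c * g p) = (\<lambda>p. c * restrict_to X g p)" for g h c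
      by (auto simp: restrict_to_def fun_eq_iff)
    show "fspace.subspace {g. restrict_to X g \<in> fspace.span (restrict_to X ` G)}"
      unfolding fspace.subspace_def mem_Collect_eq *
      by (intro conjI ballI allI impI fspace.span_zero fspace.span_add fspace.span_scale) auto
    show "G \<subseteq> {g. restrict_to X g \<in> fspace.span (restrict_to X ` G)}"
      by (auto intro: fspace.span_base)
  qed
  then show ?thesis by simp
qed

definition point_mass :: "pt \<Rightarrow> pt \<Rightarrow> complex" where
  "point_mass p = (\<lambda>q. if q = p then 1 else 0)"

lemma independent_point_masses:
  assumes "finite X"
  shows "fspace.independent (point_mass ` X)" "card (point_mass ` X) = card X"
proof -
  have inj: "inj_on point_mass X"
  proof (rule inj_onI)
    fix p q assume "point_mass p = point_mass q"
    then have "point_mass p p = point_mass q p" by simp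
    then show "p = q" by (simp add: point_mass_def split: if_splits)
  qed
  then show "card (point_mass ` X) = card X" by (rule card_image)
  show "fspace.independent (point_mass ` X)"
  proof (rule fspace.independent_if_scalars_zero)
    show "finite (point_mass ` X)" using assms by simp
    fix c x assume sum0: "(\<Sum>x\<in>point_mass ` X. (\<lambda>p. c x * x p)) = 0" and "x \<in> point_mass ` X"
    then obtain q where q: "q \<in> X" "x = point_mass q" by blast
    have sum_apply: "(\<Sum>x\<in>S. F x) q = (\<Sum>x\<in>S. F x q)" for S and F :: "(pt \<Rightarrow> complex) \<Rightarrow> pt \<Rightarrow> complex"
      by (induction S rule: infinite_finite_induct) auto
    have "(\<Sum>x\<in>point_mass ` X. c x * x q) = 0" using fun_cong[OF sum0, of q] unfolding sum_apply by simp
    also have "(\<Sum>x\<in>point_mass ` X. c x * x q) = (\<Sum>p\<in>X. c (point_mass p) * point_mass p q)"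
      by (subst sum.reindex[OF inj]) simp
    also have "\<dots> = (\<Sum>p\<in>X. if p = q then c (point_mass p) else 0)"
      by (rule sum.cong) (auto simp: point_mass_def)
    also have "\<dots> = c x" using q assms by simp
    finally show "c x = 0" .
  qed
qed

lemma laurent_separates:
  assumes X: "finite X" "X \<subseteq> torus s r" and p: "p \<in> X"
  obtains g where "g \<in> laurent_polynomials s r" "restrict_to X g = point_mass p"
proof -
  have "\<exists>g\<in>laurent_polynomials s r. g p = 1 \<and> g q = 0" if q: "q \<in> X - {p}" for q
  proof -
    have t: "p \<in> torus s r" "q \<in> torus s r" using X p q by auto
    have "fst p \<noteq> fst q \<or> snd p \<noteq> snd q" using q by (auto simp: prod_eq_iff)
    then have "(\<exists>i\<in>{1..s}. fst p i \<noteq> fst q i) \<or> (\<exists>j\<in>{1..r}. snd p j \<noteq> snd q j)"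
      using torusD(3,4)[OF t(1)] torusD(3,4)[OF t(2)] by (metis ext)
    then obtain h where h: "h \<in> laurent_polynomials s r" "h p \<noteq> h q" using laurent_gen by blast
    have "(\<lambda>x. (h x - h q) * inverse (h p - h q)) \<in> laurent_polynomials s r"
      by (intro laurent_mult laurent_diff laurent_const h)
    then show ?thesis using h(2) by (intro bexI[of _ "\<lambda>x. (h x - h q) * inverse (h p - h q)"]) auto
  qed
  then obtain g where g: "\<And>q. q \<in> X - {p} \<Longrightarrow> g q \<in> laurent_polynomials s r \<and> g q p = 1 \<and> g q q = 0" by metis
  let ?g = "\<lambda>x. \<Prod>q\<in>X - {p}. g q x"
  have "?g \<in> laurent_polynomials s r" using g by (intro laurent_prod) auto
  moreover have "restrict_to X ?g = point_mass p"
  proof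
    fix x
    show "restrict_to X ?g x = point_mass p x"
    proof (cases "x \<in> X - {p}")
      case True
      have "\<exists>q\<in>X - {p}. g q x = 0" using g[OF True] True by (intro bexI[of _ x]) simp_all
      then have "?g x = 0" using X(1) by (intro prod_zero) simp_all
      then show ?thesis using True by (simp add: restrict_to_def point_mass_def)
    next
      case False
      then consider "x \<notin> X" | "x = p" by blast
      then show ?thesis
      proof cases
        case 1
        then have "x \<noteq> p" using p by blast
        then show ?thesis using 1 by (simp add: restrict_to_def point_mass_def)
      next
        case 2
        have "?g p = 1" by (intro prod.neutral ballI) (simp add: g)
        then show ?thesis using 2 p by (simp add: restrict_to_def point_mass_def)
      qed
    qed
  qed
  ultimately show ?thesis using that by blast
qed

lemma finite_basis: "finite (basis f)" "card (basis f) \<le> (s + 1) * (r + 1)"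
  unfolding basis_def using card_image_le[of "{..s} \<times> {..r}" "\<lambda>(i, j). basis_fn f i j"] by auto

lemma laurent_decomposition:
  assumes f: "f \<in> L s r" and g: "g \<in> laurent_polynomials s r"
  obtains h k where "h \<in> fspace.span (basis f)" "k \<in> torus_ideal s r a f" "g = (\<lambda>p. h p + k p)"
proof -
  have "g \<in> fspace.span (basis f \<union> torus_ideal s r a f)"
    using laurent_subset_basis_span[OF f] g by (auto simp: basis_span_def)
  then obtain h k where "g = h + k" "h \<in> fspace.span (basis f)" "k \<in> fspace.span (torus_ideal s r a f)"
    unfolding fspace.span_Un by auto
  moreover have "fspace.span (torus_ideal s r a f) = torus_ideal s r a f"
    using subspace_torus_ideal by (simp add: fspace.span_eq_iff)
  ultimately show ?thesis using that by (simp add: fspace_add)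
qed

text \<open>Laurent polynomials interpolate arbitrary values on \<open>X\<close>, and the elements of the ideal vanish there.\<close>

lemma point_masses_in_span:
  assumes f: "f \<in> L s r" and X: "finite X" "X \<subseteq> Crit s r a f"
  shows "point_mass ` X \<subseteq> fspace.span (restrict_to X ` basis f)"
proof
  fix x assume "x \<in> point_mass ` X"
  then obtain p where p: "p \<in> X" "x = point_mass p" by blast
  have "X \<subseteq> torus s r" using X(2) by (auto simp: Crit_def)
  then obtain g where g: "g \<in> laurent_polynomials s r" "restrict_to X g = point_mass p"
    by (rule laurent_separates[OF X(1) _ p(1)]) (rule that)
  obtain h k where hk: "h \<in> fspace.span (basis f)" "k \<in> torus_ideal s r a f" "g = (\<lambda>p. h p + k p)"
    by (rule laurent_decomposition[OF f g(1)]) (rule that)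
  have "k q = 0" if "q \<in> X" for q using torus_ideal_at_Crit[OF hk(2) subsetD[OF X(2) that]] .
  then have "restrict_to X g = restrict_to X h" unfolding hk(3) by (auto simp: restrict_to_def fun_eq_iff)
  then show "x \<in> fspace.span (restrict_to X ` basis f)"
    using restrict_to_span[OF hk(1), of X] g(2) p(2) by simp
qed

theorem card_Crit_le:
  assumes f: "f \<in> L s r" and X: "finite X" "X \<subseteq> Crit s r a f"
  shows "card X \<le> (s + 1) * (r + 1)"
proof -
  have "card (point_mass ` X) \<le> card (restrict_to X ` basis f)"
    using fspace.independent_span_bound[OF _ independent_point_masses(1)[OF X(1)] point_masses_in_span[OF f X]] finite_basis(1)
    by blast
  also have "\<dots> \<le> card (basis f)" using finite_basis(1) by (rule card_image_le)
  also have "\<dots> \<le> (s + 1) * (r + 1)" by (rule finite_basis(2))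
  finally show ?thesis using independent_point_masses(2)[OF X(1)] by simp
qed

text \<open>With \<open>(s + 1) * (r + 1)\<close> points, the elements of the basis have independent restrictions to \<open>X\<close>,
  as these span all functions on \<open>X\<close>. If a power of \<open>g\<close> is in the ideal, then \<open>g\<close> vanishes on \<open>X\<close>, and so
  does its part \<open>h\<close> in the span of the basis. Hence \<open>h = 0\<close>, and \<open>g\<close> is in the ideal.\<close>

theorem reduced_of_card:
  assumes f: "f \<in> L s r" and X: "finite X" "X \<subseteq> Crit s r a f" "card X = (s + 1) * (r + 1)"
  shows "Crit_reduced s r a f"
  unfolding Crit_reduced_def
proof (intro ballI allI impI)
  fix g n assume g: "g \<in> laurent_polynomials s r" and gn: "(\<lambda>p. g p ^ n) \<in> Crit_ideal s r a f"
  obtain h k where hk: "h \<in> fspace.span (basis f)" "k \<in> torus_ideal s r a f" "g = (\<lambda>p. h p + k p)"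
    by (rule laurent_decomposition[OF f g]) (rule that)
  have hX: "h q = 0" if q: "q \<in> X" for q
  proof -
    have qC: "q \<in> Crit s r a f" using q X(2) by blast
    have "g q ^ n = 0" using torus_ideal_at_Crit[OF _ qC, of "\<lambda>p. g p ^ n"] gn by (simp add: Crit_ideal_iff)
    then have "g q = 0" by simp
    then show ?thesis using torus_ideal_at_Crit[OF hk(2) qC] hk(3) by simp
  qed
  obtain u where u: "h = (\<Sum>v\<in>basis f. (\<lambda>p. u v * v p))"
    using hk(1) fspace.span_finite[OF finite_basis(1)[of f]] by auto
  have u0: "u v = 0" if v: "v \<in> basis f" for v
  proof (rule ccontr)
    assume nz: "u v \<noteq> 0"
    let ?G = "restrict_to X ` (basis f - {v})"
    have eq: "restrict_to X v = (\<Sum>w\<in>basis f - {v}. (\<lambda>p. (- u w / u v) * restrict_to X w p))"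
    proof
      fix q
      have sum_apply: "(\<Sum>x\<in>S. F x) q = (\<Sum>x\<in>S. F x q)" for S and F :: "(pt \<Rightarrow> complex) \<Rightarrow> pt \<Rightarrow> complex"
        by (induction S rule: infinite_finite_induct) auto
      show "restrict_to X v q = (\<Sum>w\<in>basis f - {v}. (\<lambda>p. (- u w / u v) * restrict_to X w p)) q"
      proof (cases "q \<in> X")
        case True
        have "0 = (\<Sum>w\<in>basis f. u w * w q)" using hX[OF True] unfolding u sum_apply by simp
        also have "\<dots> = u v * v q + (\<Sum>w\<in>basis f - {v}. u w * w q)" using v finite_basis(1) by (subst sum.remove[of _ v]) auto
        finally have "u v * v q = - (\<Sum>w\<in>basis f - {v}. u w * w q)" by (simp add: eq_neg_iff_add_eq_0)
        then have "v q = - (\<Sum>w\<in>basis f - {v}. u w * w q) / u v" using nz by (simp add: field_simps)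
        then show ?thesis
          using True unfolding sum_apply by (simp add: restrict_to_def sum_divide_distrib sum_negf)
      next
        case False
        then show ?thesis unfolding sum_apply by (simp add: restrict_to_def)
      qed
    qed
    have "restrict_to X v \<in> fspace.span ?G"
      unfolding eq by (intro fspace.span_sum fspace.span_scale fspace.span_base imageI)
    moreover have "?G \<subseteq> fspace.span ?G" by (rule fspace.span_superset)
    ultimately have "insert (restrict_to X v) ?G \<subseteq> fspace.span ?G" by (rule insert_subsetI)
    moreover have "restrict_to X ` basis f = insert (restrict_to X v) ?G"
      using v by (metis image_insert insert_Diff)
    ultimately have "restrict_to X ` basis f \<subseteq> fspace.span ?G" by (simp only:)
    then have "fspace.span (restrict_to X ` basis f) \<subseteq> fspace.span ?G" by (rule fspace.span_minimal) simp
    then have "point_mass ` X \<subseteq> fspace.span ?G" using point_masses_in_span[OF f X(1,2)] by (rule order.trans[rotated])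
    then have "card (point_mass ` X) \<le> card ?G"
      using fspace.independent_span_bound[OF _ independent_point_masses(1)[OF X(1)], of ?G] finite_basis(1)[of f] by simp
    also have "\<dots> \<le> card (basis f - {v})" using finite_basis(1) by (intro card_image_le) simp
    also have "\<dots> < card (basis f)" using v finite_basis(1) by (meson card_Diff1_less)
    also have "\<dots> \<le> (s + 1) * (r + 1)" by (rule finite_basis(2))
    finally show False using independent_point_masses(2)[OF X(1)] X(3) by simp
  qed
  then have "h = 0" unfolding u by (intro sum.neutral) (auto simp: fun_eq_iff)
  then have "g = k" using hk(3) by (simp add: fun_eq_iff)
  then show "g \<in> Crit_ideal s r a f" using hk(2) g by (simp add: Crit_ideal_iff)
qed

end

section \<open>Critical points in the limit of small parameters\<close>

lemma roots_of_unity_separated: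
  assumes "n \<ge> 1"
  obtains \<eta> where "\<eta> > 0" "\<And>z::complex. z ^ n = 1 \<Longrightarrow> norm (z - 1) < \<eta> \<Longrightarrow> z = 1"
proof -
  let ?S = "insert 1 ((\<lambda>z::complex. norm (z - 1)) ` ({z. z ^ n = 1} - {1}))"
  have fin: "finite ?S" using finite_roots_unity[OF assms, where 'a = complex] by simp
  then have "Min ?S > 0" by (subst Min_gr_iff) auto
  moreover have "z = 1" if "z ^ n = 1" "norm (z - 1) < Min ?S" for z :: complex
  proof (rule ccontr)
    assume "z \<noteq> 1"
    then have "Min ?S \<le> norm (z - 1)" using fin that by (intro Min_le) auto
    then show False using that by simp
  qed
  ultimately show ?thesis using that by blast
qed

lemma cis_quotient_eq_one:
  assumes "cis (2 * pi * real k / real n) = cis (2 * pi * real k' / real n)" "k < n" "k' < n"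
  shows "k = k'"
proof -
  have "n > 0" using assms(2) by simp
  then have "inj_on (\<lambda>k. cis (2 * pi * real k / real n)) {..<n}"
    using bij_betw_imp_inj_on[OF Complex.bij_betw_roots_unity[of n]] by simp
  then show ?thesis by (rule inj_onD) (use assms in simp_all)
qed

context twisted_bundle
begin

definition total_twist :: nat where "total_twist = (\<Sum>j\<le>r. b j)"

text \<open>For small \<open>\<alpha>\<^sub>0\<close> all critical points approach \<open>A = 0\<close>. The coordinates \<open>(\<delta>, X, Y)\<close> stand for the point
  \<open>A = \<rho> * cis \<psi>1 * X\<close>, \<open>B = cis \<psi>2 * Y\<close> with \<open>\<delta> = \<rho> * cis (\<psi>1 - \<psi>2)\<close>, and then \<open>lin j\<close> becomes
  \<open>cis \<psi>2\<close> times \<open>blow_lin j\<close>. The equations in \<open>X\<close> and \<open>Y\<close> depend on the phases through \<open>\<delta>\<close> only and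
  are regular in the limit \<open>\<delta> = 0\<close>, where \<open>X = Y = 1\<close> is a solution.\<close>

definition blow_lin :: "nat \<Rightarrow> complex \<times> complex \<times> complex \<Rightarrow> complex" where
  "blow_lin j = (\<lambda>(d, X, Y). Y - of_int (a j) * d * X)"

definition blow_lin' :: "nat \<Rightarrow> complex \<times> complex \<times> complex \<Rightarrow> complex \<times> complex \<times> complex \<Rightarrow> complex" where
  "blow_lin' j = (\<lambda>(d, X, Y) (d', X', Y'). Y' - of_int (a j) * (d' * X + d * X'))"

definition blow_map :: "complex \<times> complex \<times> complex \<Rightarrow> complex \<times> complex \<times> complex" where
  "blow_map y = (fst y, fst (snd y) ^ (s + 1) / (\<Prod>j\<le>r. blow_lin j y ^ b j), \<Prod>j\<le>r. blow_lin j y)"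

definition blow_dom :: "(complex \<times> complex \<times> complex) set" where
  "blow_dom = {y. fst (snd y) \<noteq> 0 \<and> (\<forall>j\<le>r. blow_lin j y \<noteq> 0)}"

definition blow_map' :: "complex \<times> complex \<times> complex \<Rightarrow> complex \<times> complex \<times> complex \<Rightarrow> complex \<times> complex \<times> complex" where
  "blow_map' y v = (fst v,
     fst (snd (blow_map y)) * (of_nat (s + 1) * (fst (snd v) / fst (snd y)) - (\<Sum>j\<le>r. of_nat (b j) * (blow_lin' j y v / blow_lin j y))),
     snd (snd (blow_map y)) * (\<Sum>j\<le>r. blow_lin' j y v / blow_lin j y))"

lemma continuous_on_blow_lin [continuous_intros]: "continuous_on S (blow_lin j)"
  unfolding blow_lin_def case_prod_beta by (intro continuous_intros)

lemma open_blow_dom: "open blow_dom"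
proof -
  have "blow_dom = {y. fst (snd y) \<noteq> 0} \<inter> (\<Inter>j\<le>r. {y. blow_lin j y \<noteq> 0})" by (auto simp: blow_dom_def)
  moreover have "open {y :: complex \<times> complex \<times> complex. fst (snd y) \<noteq> 0}" by (intro open_Collect_neq continuous_intros)
  moreover have "open (\<Inter>j\<le>r. {y. blow_lin j y \<noteq> 0})"
    by (intro open_INT ballI finite_atMost open_Collect_neq continuous_intros)
  ultimately show ?thesis by (simp only: open_Int)
qed

lemma blow_map_has_derivative:
  assumes "y \<in> blow_dom"
  shows "(blow_map has_derivative blow_map' y) (at y)"
proof -
  have lin: "log_derivative (blow_lin j) (\<lambda>v. blow_lin' j y v / blow_lin j y) y" if "j \<in> {..r}" for j
  proof -
    have "blow_lin j y \<noteq> 0" using assms that by (simp add: blow_dom_def)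
    moreover have "(blow_lin j has_derivative blow_lin' j y) (at y)"
      unfolding blow_lin_def[abs_def] blow_lin'_def case_prod_beta
      by (auto intro!: derivative_eq_intros simp: algebra_simps)
    ultimately show ?thesis by (simp add: log_derivative_def eta_contract_eq)
  qed
  have X: "log_derivative (\<lambda>y. fst (snd y)) (\<lambda>v. fst (snd v) / fst (snd y)) y"
    using assms by (auto simp: log_derivative_def blow_dom_def intro!: derivative_eq_intros)
  have 1: "log_derivative (\<lambda>y. fst (snd (blow_map y)))
      (\<lambda>v. of_nat (s + 1) * (fst (snd v) / fst (snd y)) - (\<Sum>j\<le>r. of_nat (b j) * (blow_lin' j y v / blow_lin j y))) y"
    unfolding blow_map_def fst_conv snd_conv using assms
    by (intro log_derivative_divide log_derivative_power X log_derivative_prod lin) (auto simp: blow_dom_def)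
  have 2: "log_derivative (\<lambda>y. snd (snd (blow_map y))) (\<lambda>v. \<Sum>j\<le>r. blow_lin' j y v / blow_lin j y) y"
    unfolding blow_map_def fst_conv snd_conv by (intro log_derivative_prod lin)
  have "((\<lambda>y. (fst y, fst (snd (blow_map y)), snd (snd (blow_map y)))) has_derivative blow_map' y) (at y)"
    unfolding blow_map'_def[abs_def]
    by (intro has_derivative_Pair has_derivative_fst has_derivative_ident 1[unfolded log_derivative_def] 2[unfolded log_derivative_def])
  moreover have "(\<lambda>y. (fst y, fst (snd (blow_map y)), snd (snd (blow_map y)))) = blow_map"
    by (simp add: fun_eq_iff blow_map_def)
  ultimately show ?thesis by (simp only:)
qed

text \<open>At \<open>(0, 1, 1)\<close> the differential of \<open>blow_map\<close> is triangular with nonzero diagonal, and the local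
  inverse is applied to the points \<open>(\<delta>, 1, 1)\<close>.\<close>

lemma blow_solution:
  assumes "\<eta> > 0"
  obtains \<rho>0 X Y where "\<rho>0 > 0" "continuous_on (ball 0 \<rho>0) X" "continuous_on (ball 0 \<rho>0) Y" "X 0 = 1" "Y 0 = 1"
    "\<And>d. d \<in> ball 0 \<rho>0 \<Longrightarrow> (d, X d, Y d) \<in> blow_dom \<and> blow_map (d, X d, Y d) = (d, 1, 1)"
    "\<And>d. d \<in> ball 0 \<rho>0 \<Longrightarrow> norm (X d - 1) < \<eta> \<and> norm (Y d - 1) < \<eta>"
proof -
  let ?y = "(0, 1, 1) :: complex \<times> complex \<times> complex"
  have lin1: "blow_lin j ?y = 1" and lin': "blow_lin' j ?y v = snd (snd v) - of_int (a j) * fst v" for j v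
    by (simp_all add: blow_lin_def blow_lin'_def case_prod_beta)
  have y: "?y \<in> blow_dom" by (simp add: blow_dom_def lin1)
  have F: "blow_map ?y = ?y" by (simp add: blow_map_def lin1)
  have cont: "continuous_on blow_dom (\<lambda>y. blow_map' y v)" for v
    unfolding blow_map'_def blow_map_def fst_conv snd_conv blow_lin'_def case_prod_beta
    by (intro continuous_intros) (auto simp: blow_dom_def)
  have bl: "bounded_linear (blow_map' ?y)"
    using blow_map_has_derivative[OF y] has_derivative_bounded_linear by blast
  have "v = 0" if v0: "blow_map' ?y v = 0" for v
  proof -
    have v1: "fst v = 0" using v0 by (simp add: blow_map'_def zero_prod_def)
    have "(\<Sum>j\<le>r. blow_lin' j ?y v) = 0" using v0 F by (simp add: blow_map'_def zero_prod_def lin1)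
    then have "of_nat (r + 1) * snd (snd v) = 0" by (simp add: lin' v1)
    then have v3: "snd (snd v) = 0" by (metis mult_eq_0_iff of_nat_eq_0_iff add_is_0 one_neq_zero)
    have "of_nat (s + 1) * fst (snd v) - (\<Sum>j\<le>r. of_nat (b j) * blow_lin' j ?y v) = 0"
      using v0 F by (simp add: blow_map'_def zero_prod_def lin1)
    then have "of_nat (s + 1) * fst (snd v) = 0" by (simp add: lin' v1 v3)
    then have "fst (snd v) = 0" by (metis mult_eq_0_iff of_nat_eq_0_iff add_is_0 one_neq_zero)
    then show ?thesis using v1 v3 by (simp add: prod_eq_iff)
  qed
  then have inj: "inj (blow_map' ?y)" using linear_injective_0[OF bounded_linear.linear[OF bl]] by blast
  obtain U V g where *: "open U" "U \<subseteq> blow_dom" "?y \<in> U" "open V" "blow_map ?y \<in> V" "homeomorphism U V blow_map g"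
    "\<And>y. y \<in> V \<Longrightarrow> \<exists>g'. (g has_derivative g') (at y)" "\<And>x. x \<in> U \<Longrightarrow> inj (blow_map' x)"
    by (rule local_inverse[OF open_blow_dom blow_map_has_derivative cont y inj]) (assumption | rule that)+
  define e :: "complex \<Rightarrow> complex \<times> complex \<times> complex" where "e d = (d, 1, 1)" for d
  have e: "continuous_on S e" for S unfolding e_def by (intro continuous_intros)
  define X where "X d = fst (snd (g (e d)))" for d
  define Y where "Y d = snd (snd (g (e d)))" for d
  have "open (e -` V)" by (rule open_vimage[OF *(4) e])
  moreover have "0 \<in> e -` V" using *(5) F by (simp add: e_def)
  ultimately obtain \<rho>1 where \<rho>1: "\<rho>1 > 0" "ball 0 \<rho>1 \<subseteq> e -` V" using openE by blast
  have "continuous_on V g" using *(6) by (simp add: homeomorphism_def)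
  then have "continuous_on (ball 0 \<rho>1) (g \<circ> e)"
    using \<rho>1(2) by (intro continuous_on_compose e continuous_on_subset[OF \<open>continuous_on V g\<close>]) blast
  then have contg: "continuous_on (ball 0 \<rho>1) (\<lambda>d. g (e d))" by (simp add: o_def)
  have contX: "continuous_on (ball 0 \<rho>1) X" and contY: "continuous_on (ball 0 \<rho>1) Y"
    unfolding X_def[abs_def] Y_def[abs_def] by (intro continuous_intros contg)+
  have ge: "g (e d) \<in> blow_dom \<and> blow_map (g (e d)) = e d" if "d \<in> ball 0 \<rho>1" for d
  proof -
    have "e d \<in> V" using that \<rho>1(2) by blast
    then have "g (e d) \<in> U" "blow_map (g (e d)) = e d"
      using homeomorphism_image2[OF *(6)] homeomorphism_apply2[OF *(6)] by auto
    then show ?thesis using *(2) by blast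
  qed
  have gXY: "g (e d) = (d, X d, Y d)" if "d \<in> ball 0 \<rho>1" for d
  proof -
    have "fst (blow_map (g (e d))) = d" using ge[OF that] by (simp add: e_def)
    then show ?thesis by (simp add: blow_map_def X_def Y_def prod_eq_iff)
  qed
  have "g (e 0) = ?y" using homeomorphism_apply1[OF *(6,3)] F by (simp add: e_def)
  then have XY0: "X 0 = 1" "Y 0 = 1" by (simp_all add: X_def Y_def)
  have "continuous_on (ball 0 \<rho>1) (\<lambda>d. max (norm (X d - 1)) (norm (Y d - 1)))"
    by (intro continuous_intros contX contY)
  then have "isCont (\<lambda>d. max (norm (X d - 1)) (norm (Y d - 1))) 0"
    using \<rho>1(1) by (simp add: continuous_on_eq_continuous_at)
  then obtain \<rho>2 where \<rho>2: "\<rho>2 > 0" "\<And>d. dist d 0 < \<rho>2 \<Longrightarrow> max (norm (X d - 1)) (norm (Y d - 1)) < \<eta>"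
    using assms XY0 unfolding continuous_at_eps_delta by (fastforce simp: dist_real_def)
  show ?thesis
  proof (rule that[of "min \<rho>1 \<rho>2" X Y])
    show "min \<rho>1 \<rho>2 > 0" using \<rho>1 \<rho>2 by simp
    show "continuous_on (ball 0 (min \<rho>1 \<rho>2)) X" by (rule continuous_on_subset[OF contX]) auto
    show "continuous_on (ball 0 (min \<rho>1 \<rho>2)) Y" by (rule continuous_on_subset[OF contY]) auto
    show "(d, X d, Y d) \<in> blow_dom \<and> blow_map (d, X d, Y d) = (d, 1, 1)" if "d \<in> ball 0 (min \<rho>1 \<rho>2)" for d
      using ge[of d] gXY[of d] that by (simp add: e_def)
    show "norm (X d - 1) < \<eta> \<and> norm (Y d - 1) < \<eta>" if "d \<in> ball 0 (min \<rho>1 \<rho>2)" for d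
      using \<rho>2(2)[of d] that by (simp add: dist_norm)
  qed (use XY0 in simp_all)
qed

end

section \<open>Solutions for small parameters\<close>

text \<open>The bound \<open>\<eta>\<close> on the distance of \<open>X\<close> and \<open>Y\<close> from \<open>1\<close> is so small that solutions whose phases differ
  by nontrivial roots of unity cannot coincide.\<close>

locale small_solutions = twisted_bundle +
  fixes \<eta> \<rho>0 :: real and X Y :: "complex \<Rightarrow> complex"
  assumes \<eta>: "\<eta> > 0" "\<eta> \<le> 1"
    and sep_r: "\<And>z::complex. z ^ (r + 1) = 1 \<Longrightarrow> norm (z - 1) < 2 * \<eta> \<Longrightarrow> z = 1"
    and sep_s: "\<And>z::complex. z ^ (s + 1) = 1 \<Longrightarrow> norm (z - 1) < 2 * \<eta> \<Longrightarrow> z = 1"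
    and \<rho>0: "\<rho>0 > 0"
    and contX: "continuous_on (ball 0 \<rho>0) X" and contY: "continuous_on (ball 0 \<rho>0) Y"
    and X0: "X 0 = 1" and Y0: "Y 0 = 1"
    and XY: "\<And>d. d \<in> ball 0 \<rho>0 \<Longrightarrow> (d, X d, Y d) \<in> blow_dom \<and> blow_map (d, X d, Y d) = (d, 1, 1)"
    and XY_near: "\<And>d. d \<in> ball 0 \<rho>0 \<Longrightarrow> norm (X d - 1) < \<eta> \<and> norm (Y d - 1) < \<eta>"

context twisted_bundle
begin

lemma small_solutions_exist: "\<exists>\<eta> \<rho>0 X Y. small_solutions r s a \<eta> \<rho>0 X Y"
proof -
  obtain \<eta>1 where \<eta>1: "\<eta>1 > 0" "\<And>z::complex. z ^ (r + 1) = 1 \<Longrightarrow> norm (z - 1) < \<eta>1 \<Longrightarrow> z = 1"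
    by (rule roots_of_unity_separated[OF le_add2[of 1 r]]) (rule that)
  obtain \<eta>2 where \<eta>2: "\<eta>2 > 0" "\<And>z::complex. z ^ (s + 1) = 1 \<Longrightarrow> norm (z - 1) < \<eta>2 \<Longrightarrow> z = 1"
    by (rule roots_of_unity_separated[OF le_add2[of 1 s]]) (rule that)
  define \<eta> where "\<eta> = min 1 (min \<eta>1 \<eta>2 / 2)"
  have \<eta>: "\<eta> > 0" "\<eta> \<le> 1" "2 * \<eta> \<le> \<eta>1" "2 * \<eta> \<le> \<eta>2" using \<eta>1(1) \<eta>2(1) by (auto simp: \<eta>_def)
  obtain \<rho>0 X Y where *: "\<rho>0 > 0" "continuous_on (ball 0 \<rho>0) X" "continuous_on (ball 0 \<rho>0) Y" "X 0 = 1" "Y 0 = 1"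
    "\<And>d. d \<in> ball 0 \<rho>0 \<Longrightarrow> (d, X d, Y d) \<in> blow_dom \<and> blow_map (d, X d, Y d) = (d, 1, 1)"
    "\<And>d. d \<in> ball 0 \<rho>0 \<Longrightarrow> norm (X d - 1) < \<eta> \<and> norm (Y d - 1) < \<eta>"
    by (rule blow_solution[OF \<eta>(1)]) (rule that)
  have "small_solutions r s a \<eta> \<rho>0 X Y"
  proof (intro small_solutions.intro small_solutions_axioms.intro)
    show "twisted_bundle r s a" by (rule twisted_bundle_axioms)
    show "z = 1" if "z ^ (r + 1) = 1" "norm (z - 1) < 2 * \<eta>" for z :: complex using \<eta>1(2)[of z] that \<eta>(3) by simp
    show "z = 1" if "z ^ (s + 1) = 1" "norm (z - 1) < 2 * \<eta>" for z :: complex using \<eta>2(2)[of z] that \<eta>(4) by simp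
  qed (use \<eta> * in simp_all)
  then show ?thesis by blast
qed

end

context small_solutions
begin

definition sol :: "real \<Rightarrow> real \<Rightarrow> real \<Rightarrow> complex \<times> complex" where
  "sol \<rho> \<psi>1 \<psi>2 = (of_real \<rho> * cis \<psi>1 * X (of_real \<rho> * cis (\<psi>1 - \<psi>2)), cis \<psi>2 * Y (of_real \<rho> * cis (\<psi>1 - \<psi>2)))"

lemma in_small_ball: "0 \<le> \<rho> \<Longrightarrow> \<rho> < \<rho>0 \<Longrightarrow> of_real \<rho> * cis \<psi> \<in> ball 0 \<rho>0"
  by (simp add: norm_mult)

lemma sol_in_crit_dom:
  assumes "0 < \<rho>" "\<rho> < \<rho>0"
  shows "sol \<rho> \<psi>1 \<psi>2 \<in> crit_dom"
    "crit_map (sol \<rho> \<psi>1 \<psi>2) = (of_real \<rho> ^ (s + 1) * cis (real (s + 1) * \<psi>1 - real total_twist * \<psi>2), cis (real (r + 1) * \<psi>2))"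
proof -
  let ?d = "of_real \<rho> * cis (\<psi>1 - \<psi>2)"
  let ?y = "(?d, X ?d, Y ?d)"
  have y: "?y \<in> blow_dom" "blow_map ?y = (?d, 1, 1)" using XY[OF in_small_ball] assms by auto
  have lin: "lin j (sol \<rho> \<psi>1 \<psi>2) = cis \<psi>2 * blow_lin j ?y" for j
  proof -
    have "cis \<psi>2 * cis (\<psi>1 - \<psi>2) = cis \<psi>1" by (simp add: cis_mult)
    moreover have "cis \<psi>2 * blow_lin j ?y =
        cis \<psi>2 * Y ?d - of_int (a j) * (of_real \<rho> * (cis \<psi>2 * cis (\<psi>1 - \<psi>2)) * X ?d)"
      by (simp add: blow_lin_def algebra_simps)
    ultimately show ?thesis by (simp add: lin_def sol_def)
  qed
  have XYnz: "X ?d \<noteq> 0" "\<And>j. j \<le> r \<Longrightarrow> blow_lin j ?y \<noteq> 0" using y(1) by (auto simp: blow_dom_def)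
  show "sol \<rho> \<psi>1 \<psi>2 \<in> crit_dom"
    unfolding crit_dom_def using XYnz assms by (simp add: lin) (simp add: sol_def)
  have b1: "X ?d ^ (s + 1) = (\<Prod>j\<le>r. blow_lin j ?y ^ b j)" and b2: "(\<Prod>j\<le>r. blow_lin j ?y) = 1"
    using y(2) XYnz by (auto simp: blow_map_def)
  have "(\<Prod>j\<le>r. lin j (sol \<rho> \<psi>1 \<psi>2) ^ b j) = cis \<psi>2 ^ total_twist * (\<Prod>j\<le>r. blow_lin j ?y ^ b j)"
    by (simp add: lin power_mult_distrib prod.distrib power_sum total_twist_def)
  moreover have "fst (sol \<rho> \<psi>1 \<psi>2) ^ (s + 1) = of_real \<rho> ^ (s + 1) * cis \<psi>1 ^ (s + 1) * X ?d ^ (s + 1)"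
    by (simp add: sol_def power_mult_distrib)
  moreover have "(\<Prod>j\<le>r. blow_lin j ?y ^ b j) \<noteq> 0" using XYnz(2) by auto
  moreover have "cis \<psi>1 ^ (s + 1) / cis \<psi>2 ^ total_twist = cis (real (s + 1) * \<psi>1 - real total_twist * \<psi>2)"
    by (simp only: Complex.DeMoivre cis_divide)
  ultimately have "fst (crit_map (sol \<rho> \<psi>1 \<psi>2)) = of_real \<rho> ^ (s + 1) * cis (real (s + 1) * \<psi>1 - real total_twist * \<psi>2)"
    unfolding crit_map_def fst_conv b1[symmetric] by (simp add: field_simps del: power_Suc)
  moreover have "snd (crit_map (sol \<rho> \<psi>1 \<psi>2)) = cis (real (r + 1) * \<psi>2)"
    using b2 unfolding Complex.DeMoivre[symmetric] by (simp add: crit_map_def lin prod.distrib)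
  ultimately show "crit_map (sol \<rho> \<psi>1 \<psi>2) = (of_real \<rho> ^ (s + 1) * cis (real (s + 1) * \<psi>1 - real total_twist * \<psi>2), cis (real (r + 1) * \<psi>2))"
    by (simp add: prod_eq_iff)
qed

lemma unit_separation:
  assumes "cis x * u = cis y * v" "norm (u - 1) < \<eta>" "norm (v - 1) < \<eta>"
  shows "norm (cis (x - y) - 1) < 2 * \<eta>"
proof -
  have "cis x - cis y = cis y * (v - 1) - cis x * (u - 1)" using assms(1) by (simp add: algebra_simps)
  then have "norm (cis x - cis y) \<le> norm (cis y * (v - 1)) + norm (cis x * (u - 1))"
    by (metis norm_triangle_ineq4)
  then have "norm (cis x - cis y) < 2 * \<eta>" using assms(2,3) by (simp add: norm_mult)
  moreover have "cis x - cis y = cis y * (cis (x - y) - 1)" by (simp add: algebra_simps cis_mult)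
  ultimately show ?thesis by (simp add: norm_mult)
qed

text \<open>The point \<open>sol \<rho> \<psi>1 \<psi>2\<close> lies over a value with the phases \<open>\<phi>1\<close> and \<open>\<phi>2\<close> if
  \<open>(r + 1) * \<psi>2 = \<phi>2\<close> and \<open>(s + 1) * \<psi>1 - total_twist * \<psi>2 = \<phi>1\<close> modulo \<open>2 * pi\<close>. The label \<open>(k, l)\<close> selects
  one of the solutions of these equations.\<close>

definition phase2 :: "real \<Rightarrow> nat \<Rightarrow> real" where
  "phase2 \<phi>2 l = (\<phi>2 + 2 * pi * real l) / real (r + 1)"

definition phase1 :: "real \<Rightarrow> real \<Rightarrow> nat \<Rightarrow> nat \<Rightarrow> real" where
  "phase1 \<phi>1 \<phi>2 k l = (\<phi>1 + real total_twist * phase2 \<phi>2 l + 2 * pi * real k) / real (s + 1)"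

definition lsol :: "real \<Rightarrow> real \<Rightarrow> real \<Rightarrow> nat \<Rightarrow> nat \<Rightarrow> complex \<times> complex" where
  "lsol \<rho> \<phi>1 \<phi>2 k l = sol \<rho> (phase1 \<phi>1 \<phi>2 k l) (phase2 \<phi>2 l)"

lemma phase_eq:
  "real (r + 1) * phase2 \<phi>2 l = \<phi>2 + 2 * pi * real l"
  "real (s + 1) * phase1 \<phi>1 \<phi>2 k l - real total_twist * phase2 \<phi>2 l = \<phi>1 + 2 * pi * real k"
proof -
  show "real (r + 1) * phase2 \<phi>2 l = \<phi>2 + 2 * pi * real l" by (simp add: phase2_def)
  have "real (s + 1) * phase1 \<phi>1 \<phi>2 k l = \<phi>1 + real total_twist * phase2 \<phi>2 l + 2 * pi * real k"
    by (simp add: phase1_def)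
  then show "real (s + 1) * phase1 \<phi>1 \<phi>2 k l - real total_twist * phase2 \<phi>2 l = \<phi>1 + 2 * pi * real k"
    by linarith
qed

lemma lsol_in_crit_dom: "0 < \<rho> \<Longrightarrow> \<rho> < \<rho>0 \<Longrightarrow> lsol \<rho> \<phi>1 \<phi>2 k l \<in> crit_dom"
  by (simp add: lsol_def sol_in_crit_dom)

lemma cis_add_multiple: "cis (x + 2 * pi * real n) = cis x"
  by (metis cis_mult cis_multiple_2pi mult.right_neutral Ints_of_nat)

lemma crit_map_lsol:
  assumes "0 < \<rho>" "\<rho> < \<rho>0"
  shows "crit_map (lsol \<rho> \<phi>1 \<phi>2 k l) = (of_real \<rho> ^ (s + 1) * cis \<phi>1, cis \<phi>2)"
  unfolding lsol_def sol_in_crit_dom(2)[OF assms] phase_eq by (simp add: cis_add_multiple)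

lemma inj_lsol:
  assumes \<rho>: "0 < \<rho>" "\<rho> < \<rho>0" and le: "k \<le> s" "l \<le> r" "k' \<le> s" "l' \<le> r"
    and eq: "lsol \<rho> \<phi>1 \<phi>2 k l = lsol \<rho> \<phi>1 \<phi>2 k' l'"
  shows "k = k' \<and> l = l'"
proof -
  let ?p2 = "phase2 \<phi>2" and ?p1 = "phase1 \<phi>1 \<phi>2"
  let ?d = "of_real \<rho> * cis (?p1 k l - ?p2 l)" and ?d' = "of_real \<rho> * cis (?p1 k' l' - ?p2 l')"
  have d: "?d \<in> ball 0 \<rho>0" "?d' \<in> ball 0 \<rho>0" using in_small_ball \<rho> by auto
  have eqs: "cis (?p1 k l) * X ?d = cis (?p1 k' l') * X ?d'" "cis (?p2 l) * Y ?d = cis (?p2 l') * Y ?d'"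
    using eq \<rho> by (auto simp: lsol_def sol_def)
  have "norm (cis (?p2 l - ?p2 l') - 1) < 2 * \<eta>"
    using unit_separation[OF eqs(2)] XY_near d by blast
  moreover have e2: "cis (?p2 l - ?p2 l') ^ (r + 1) = 1"
  proof -
    have "cis (?p2 l - ?p2 l') ^ (r + 1) = cis (real (r + 1) * ?p2 l - real (r + 1) * ?p2 l')"
      by (simp only: Complex.DeMoivre right_diff_distrib)
    also have "\<dots> = cis (2 * pi * real l) / cis (2 * pi * real l')"
      unfolding phase_eq cis_divide by simp
    also have "\<dots> = 1" by (simp only: cis_multiple_2pi[OF Ints_of_nat] div_by_1)
    finally show ?thesis .
  qed
  ultimately have one2: "cis (?p2 l - ?p2 l') = 1" using sep_r by blast
  have "?p2 l - ?p2 l' = 2 * pi * real l / real (r + 1) - 2 * pi * real l' / real (r + 1)"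
    by (simp add: phase2_def diff_divide_distrib[symmetric])
  then have "cis (2 * pi * real l / real (r + 1)) = cis (2 * pi * real l' / real (r + 1))"
    using one2 by (simp flip: cis_divide)
  then have l: "l = l'" using cis_quotient_eq_one[of l "r + 1" l'] le by simp
  have "norm (cis (?p1 k l - ?p1 k' l') - 1) < 2 * \<eta>"
    using unit_separation[OF eqs(1)] XY_near d by blast
  moreover have diff: "?p1 k l - ?p1 k' l' = 2 * pi * real k / real (s + 1) - 2 * pi * real k' / real (s + 1)"
    by (simp add: phase1_def l diff_divide_distrib[symmetric])
  moreover have "cis (?p1 k l - ?p1 k' l') ^ (s + 1) = 1"
  proof -
    have "cis (?p1 k l - ?p1 k' l') ^ (s + 1) = cis (real (s + 1) * (?p1 k l - ?p1 k' l'))"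
      by (simp only: Complex.DeMoivre)
    also have "real (s + 1) * (?p1 k l - ?p1 k' l') = 2 * pi * real k - 2 * pi * real k'"
      unfolding diff by (simp add: right_diff_distrib)
    also have "cis \<dots> = cis (2 * pi * real k) / cis (2 * pi * real k')" by (simp only: cis_divide)
    also have "\<dots> = 1" by (simp only: cis_multiple_2pi[OF Ints_of_nat] div_by_1)
    finally show ?thesis .
  qed
  ultimately have "cis (?p1 k l - ?p1 k' l') = 1" using sep_s by blast
  then have "cis (2 * pi * real k / real (s + 1)) = cis (2 * pi * real k' / real (s + 1))"
    unfolding diff by (simp flip: cis_divide)
  then have "k = k'" using cis_quotient_eq_one[of k "s + 1" k'] le by simp
  then show ?thesis using l by simp
qed

definition all_lsol :: "real \<Rightarrow> real \<Rightarrow> real \<Rightarrow> (complex \<times> complex) set" where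
  "all_lsol \<rho> \<phi>1 \<phi>2 = (\<lambda>(k, l). lsol \<rho> \<phi>1 \<phi>2 k l) ` labels s r"

lemma card_all_lsol:
  assumes "0 < \<rho>" "\<rho> < \<rho>0"
  shows "finite (all_lsol \<rho> \<phi>1 \<phi>2)" "card (all_lsol \<rho> \<phi>1 \<phi>2) = (s + 1) * (r + 1)"
proof -
  have "inj_on (\<lambda>(k, l). lsol \<rho> \<phi>1 \<phi>2 k l) (labels s r)"
    by (rule inj_onI) (use inj_lsol[OF assms] in \<open>auto simp: labels_def\<close>)
  then show "card (all_lsol \<rho> \<phi>1 \<phi>2) = (s + 1) * (r + 1)"
    unfolding all_lsol_def by (simp add: card_image labels_def)
  show "finite (all_lsol \<rho> \<phi>1 \<phi>2)" by (simp add: all_lsol_def labels_def)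
qed

text \<open>The known solutions attain the maximal number of critical points.\<close>

theorem small_fiber:
  assumes f: "f \<in> L s r" and \<rho>: "0 < \<rho>" "\<rho> < \<rho>0" and v: "crit_value f = (of_real \<rho> ^ (s + 1) * cis \<phi>1, cis \<phi>2)"
  shows "fiber f = all_lsol \<rho> \<phi>1 \<phi>2" "Crit_reduced s r a f"
proof -
  let ?S = "all_lsol \<rho> \<phi>1 \<phi>2"
  have sub: "?S \<subseteq> fiber f"
    using crit_map_lsol[OF \<rho>] lsol_in_crit_dom[OF \<rho>] v by (auto simp: all_lsol_def fiber_def)
  note card = card_all_lsol[OF \<rho>, of \<phi>1 \<phi>2]
  have im: "crit_point f ` S \<subseteq> Crit s r a f" "card (crit_point f ` S) = card S" if "S \<subseteq> fiber f" for S
    using that Crit_eq_image[OF f] inj_on_subset[OF inj_on_crit_point[OF f] that] by (auto simp: card_image)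
  show "Crit_reduced s r a f"
    by (rule reduced_of_card[OF f, of "crit_point f ` ?S"]) (use im[OF sub] card in auto)
  show "fiber f = ?S"
  proof (rule ccontr)
    assume "fiber f \<noteq> ?S"
    then obtain x where x: "x \<in> fiber f" "x \<notin> ?S" using sub by blast
    then have ins: "insert x ?S \<subseteq> fiber f" using sub by blast
    have "card (crit_point f ` insert x ?S) \<le> (s + 1) * (r + 1)"
      using card(1) by (intro card_Crit_le[OF f] im(1)[OF ins]) simp
    then show False using im(2)[OF ins] card x(2) by simp
  qed
qed

lemma continuous_on_sol:
  assumes "continuous_on S \<rho>" "continuous_on S \<psi>1" "continuous_on S \<psi>2" "\<And>x. x \<in> S \<Longrightarrow> 0 \<le> \<rho> x \<and> \<rho> x < \<rho>0"
  shows "continuous_on S (\<lambda>x. sol (\<rho> x) (\<psi>1 x) (\<psi>2 x))"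
proof -
  have "continuous_on S (\<lambda>x. of_real (\<rho> x) * cis (\<psi>1 x - \<psi>2 x))" by (intro continuous_intros assms)
  moreover have "(\<lambda>x. of_real (\<rho> x) * cis (\<psi>1 x - \<psi>2 x)) ` S \<subseteq> ball 0 \<rho>0"
    using assms(4) in_small_ball by blast
  ultimately have "continuous_on S (\<lambda>x. X (of_real (\<rho> x) * cis (\<psi>1 x - \<psi>2 x)))"
    "continuous_on S (\<lambda>x. Y (of_real (\<rho> x) * cis (\<psi>1 x - \<psi>2 x)))"
    using continuous_on_compose2[OF contX] continuous_on_compose2[OF contY] by auto
  then show ?thesis unfolding sol_def by (intro continuous_intros assms)
qed

end


section \<open>Solution curves\<close>

definition has_derivative_in :: "(real \<Rightarrow> complex) \<Rightarrow> (real \<Rightarrow> complex) set \<Rightarrow> bool" where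
  "has_derivative_in g G \<longleftrightarrow> (\<exists>g'\<in>G. \<forall>t\<le>0. (g has_vector_derivative g' t) (at t within {..0}))"

text \<open>Iterating a choice of derivatives inside \<open>G\<close> gives the sequence that \<open>smooth_nonpos\<close> asks for.\<close>

lemma smooth_of_closed_under_derivative:
  assumes G: "\<And>g. g \<in> G \<Longrightarrow> has_derivative_in g G" and g: "g \<in> G"
  shows "smooth_nonpos g"
proof -
  obtain D where D: "\<And>g. g \<in> G \<Longrightarrow> D g \<in> G \<and> (\<forall>t\<le>0. (g has_vector_derivative D g t) (at t within {..0}))"
    using G unfolding has_derivative_in_def by metis
  have in_G: "(D ^^ n) g \<in> G" for n using g D by (induction n) auto
  show ?thesis
    unfolding smooth_nonpos_def
  proof (intro exI[of _ "\<lambda>n. (D ^^ n) g"] conjI allI impI)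
    fix n and t :: real assume "t \<le> 0"
    then show "((D ^^ n) g has_vector_derivative (D ^^ Suc n) g t) (at t within {..0})"
      using D[OF in_G[of n]] by simp
  qed simp
qed

text \<open>The functions that are rational in given ones without poles on the half line. They are closed under
  differentiation as soon as they contain the derivatives of the given ones, which yields smoothness
  from a single differential equation.\<close>

inductive_set rational_functions :: "(real \<Rightarrow> complex) set \<Rightarrow> (real \<Rightarrow> complex) set" for G where
  gen: "g \<in> G \<Longrightarrow> g \<in> rational_functions G"
| const: "(\<lambda>_. c) \<in> rational_functions G"
| add: "g \<in> rational_functions G \<Longrightarrow> h \<in> rational_functions G \<Longrightarrow> (\<lambda>t. g t + h t) \<in> rational_functions G"
| mult: "g \<in> rational_functions G \<Longrightarrow> h \<in> rational_functions G \<Longrightarrow> (\<lambda>t. g t * h t) \<in> rational_functions G"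
| inverse: "g \<in> rational_functions G \<Longrightarrow> (\<And>t. t \<le> 0 \<Longrightarrow> g t \<noteq> 0) \<Longrightarrow> (\<lambda>t. inverse (g t)) \<in> rational_functions G"

lemma rational_sum: "(\<And>i. i \<in> I \<Longrightarrow> g i \<in> rational_functions G) \<Longrightarrow> (\<lambda>t. \<Sum>i\<in>I. g i t) \<in> rational_functions G"
  by (induction I rule: infinite_finite_induct) (auto intro: rational_functions.intros)

lemma rational_diff: "g \<in> rational_functions G \<Longrightarrow> h \<in> rational_functions G \<Longrightarrow> (\<lambda>t. g t - h t) \<in> rational_functions G"
  using rational_functions.add[OF _ rational_functions.mult[OF rational_functions.const[of "-1"]], of g G h] by simp

lemma rational_functions_derivative:
  assumes G: "\<And>g. g \<in> G \<Longrightarrow> has_derivative_in g (rational_functions G)"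
  shows "g \<in> rational_functions G \<Longrightarrow> has_derivative_in g (rational_functions G)"
proof (induction rule: rational_functions.induct)
  case (gen g)
  then show ?case by (rule G)
next
  case (const c)
  show ?case unfolding has_derivative_in_def
    by (rule bexI[OF _ rational_functions.const[of 0]]) simp
next
  case (add g h)
  obtain g' h' where "g' \<in> rational_functions G" "h' \<in> rational_functions G"
    "\<forall>t\<le>0. (g has_vector_derivative g' t) (at t within {..0})" "\<forall>t\<le>0. (h has_vector_derivative h' t) (at t within {..0})"
    using add.IH unfolding has_derivative_in_def by (elim bexE)
  then show ?case unfolding has_derivative_in_def
    by (intro bexI[of _ "\<lambda>t. g' t + h' t"] rational_functions.add allI impI has_vector_derivative_add) simp_all
next
  case (mult g h)
  obtain g' h' where *: "g' \<in> rational_functions G" "h' \<in> rational_functions G"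
    "\<forall>t\<le>0. (g has_vector_derivative g' t) (at t within {..0})" "\<forall>t\<le>0. (h has_vector_derivative h' t) (at t within {..0})"
    using mult.IH unfolding has_derivative_in_def by (elim bexE)
  have "((\<lambda>t. g t * h t) has_vector_derivative g t * h' t + g' t * h t) (at t within {..0})" if "t \<le> 0" for t
    using *(3,4) that by (intro has_vector_derivative_mult) simp_all
  then show ?case unfolding has_derivative_in_def
    by (intro bexI[of _ "\<lambda>t. g t * h' t + g' t * h t"])
       (use * mult.hyps in \<open>auto intro: rational_functions.intros\<close>)
next
  case (inverse g)
  obtain g' where *: "g' \<in> rational_functions G" "\<forall>t\<le>0. (g has_vector_derivative g' t) (at t within {..0})"
    using inverse.IH unfolding has_derivative_in_def by (elim bexE)
  have "((\<lambda>t. inverse (g t)) has_vector_derivative (- 1) * (inverse (g t) * (inverse (g t) * g' t))) (at t within {..0})" if "t \<le> 0" for t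
  proof -
    have "((\<lambda>t. inverse (g t)) has_derivative (\<lambda>h. - (inverse (g t) * (h *\<^sub>R g' t) * inverse (g t)))) (at t within {..0})"
      using *(2) that inverse.hyps(2)[OF that] unfolding has_vector_derivative_def by (intro Deriv.has_derivative_inverse) auto
    then show ?thesis unfolding has_vector_derivative_def by (simp add: mult_ac scaleR_conv_of_real)
  qed
  moreover have "(\<lambda>t. (- 1) * (inverse (g t) * (inverse (g t) * g' t))) \<in> rational_functions G"
    by (intro rational_functions.mult rational_functions.const rational_functions.inverse inverse.hyps *(1))
  ultimately show ?case unfolding has_derivative_in_def by (intro bexI allI impI)
qed

locale monodromy_setup = small_solutions +
  assumes f_at_reduced: "\<And>t. t \<le> 0 \<Longrightarrow> f_at s r t \<notin> R_X s r a"
begin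

definition ray :: "real \<Rightarrow> complex \<times> complex" where
  "ray t = (of_real (exp t), 1)"

definition rad :: "real \<Rightarrow> real" where
  "rad t = exp (t / real (s + 1))"

text \<open>Up to this time the parameter of \<open>f_at\<close> is in the range of the implicit functions.\<close>

definition T0 :: real where
  "T0 = min 0 (real (s + 1) * ln \<rho>0 - 1)"

lemma f_at_L: "f_at s r t \<in> L s r"
  by (auto simp: f_at_def L_def)

lemma crit_value_f_at: "crit_value (f_at s r t) = ray t"
proof -
  have "(\<Prod>i\<le>s. fst (f_at s r t) i) = of_real (exp t)" unfolding split_first by (simp add: f_at_def)
  moreover have "(\<Prod>j\<le>r. snd (f_at s r t) j ^ b j) = 1" "(\<Prod>j\<le>r. snd (f_at s r t) j) = 1"
    by (simp_all add: f_at_def)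
  ultimately show ?thesis by (simp add: crit_value_def ray_def)
qed

lemma rad_power: "of_real (rad t) ^ (s + 1) = (of_real (exp t) :: complex)"
proof -
  have "rad t ^ (s + 1) = exp (real (s + 1) * (t / real (s + 1)))" unfolding rad_def by (rule exp_of_nat_mult[symmetric])
  also have "\<dots> = exp t" by simp
  finally show ?thesis by (metis of_real_power)
qed

lemma T0_nonpos: "T0 \<le> 0" by (simp add: T0_def)

lemma rad_small: "t \<le> T0 \<Longrightarrow> 0 < rad t \<and> rad t < \<rho>0"
proof -
  assume "t \<le> T0"
  then have "t < real (s + 1) * ln \<rho>0" by (simp add: T0_def)
  then have "t / real (s + 1) < ln \<rho>0" by (simp add: field_simps)
  then have "rad t < exp (ln \<rho>0)" unfolding rad_def by (simp only: exp_less_mono)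
  then show ?thesis using \<rho>0 by (simp add: rad_def)
qed

lemma fiber_f_at: "t \<le> T0 \<Longrightarrow> fiber (f_at s r t) = all_lsol (rad t) 0 0"
  using small_fiber(1)[OF f_at_L, of "rad t" t 0 0] rad_small[of t] crit_value_f_at[of t] rad_power[of t]
  by (simp add: ray_def del: power_Suc)

lemma crit_map_lsol_ray: "t \<le> T0 \<Longrightarrow> crit_map (lsol (rad t) 0 0 k l) = ray t"
  using crit_map_lsol[of "rad t" 0 0 k l] rad_small[of t] rad_power[of t] by (simp add: ray_def del: power_Suc)

lemma ray_regular: "t \<le> 0 \<Longrightarrow> ray t \<in> regular_values"
  using crit_value_regular[of "f_at s r t"] f_at_L f_at_reduced crit_value_f_at by simp

lemma continuous_on_ray: "continuous_on S ray"
  unfolding ray_def by (intro continuous_intros)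

lemma ray_in_base: "t \<le> 0 \<Longrightarrow> ray t \<in> base"
proof -
  assume t: "t \<le> 0"
  have "ray T0 \<in> crit_map ` crit_dom"
    using crit_map_lsol_ray[of T0 0 0] lsol_in_crit_dom[of "rad T0" 0 0 0 0] rad_small[of T0] by force
  then have "ray T0 \<in> base" using ray_regular[OF T0_nonpos] by (simp add: base_def)
  then have "ray ` {..0} \<subseteq> base"
    using ray_regular T0_nonpos
    by (intro connected_subset_base connected_continuous_image continuous_on_ray) auto
  then show ?thesis using t by blast
qed

definition is_lift :: "(real \<Rightarrow> complex \<times> complex) \<Rightarrow> bool" where
  "is_lift c \<longleftrightarrow> continuous_on {..0} c \<and> (\<forall>t\<le>0. c t \<in> crit_dom \<and> crit_map (c t) = ray t)"

lemma lift_unique_on: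
  assumes "connected S" "S \<subseteq> {..0}" "t0 \<in> S" "t \<in> S" "c t0 = c' t0"
    and "continuous_on S c" "\<And>t. t \<in> S \<Longrightarrow> c t \<in> crit_dom \<and> crit_map (c t) = ray t"
    and "continuous_on S c'" "\<And>t. t \<in> S \<Longrightarrow> c' t \<in> crit_dom \<and> crit_map (c' t) = ray t"
  shows "c t = c' t"
proof (rule covering_space_lift_unique[OF covering_space_crit_map, of c t0 c' S ray])
  have rb: "ray u \<in> base" if "u \<in> S" for u using ray_in_base that assms(2) by blast
  show "ray \<in> S \<rightarrow> base" using rb by blast
  show "c \<in> S \<rightarrow> total" using assms(7) rb by (simp add: total_def)
  show "c' \<in> S \<rightarrow> total" using assms(9) rb by (simp add: total_def)
  show "ray x = crit_map (c x)" "ray x = crit_map (c' x)" if "x \<in> S" for x using assms(7,9) that by simp_all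
qed (use assms continuous_on_ray in simp_all)

lemma lift_unique: "is_lift c \<Longrightarrow> is_lift c' \<Longrightarrow> t0 \<le> 0 \<Longrightarrow> c t0 = c' t0 \<Longrightarrow> t \<le> 0 \<Longrightarrow> c t = c' t"
  by (rule lift_unique_on[of "{..0}" t0]) (auto simp: is_lift_def)

lemma lift_exists:
  assumes "t0 \<le> 0" "x \<in> crit_dom" "crit_map x = ray t0"
  obtains c where "is_lift c" "c t0 = x"
proof -
  have x: "x \<in> total" using assms ray_in_base by (simp add: total_def)
  obtain c where c: "continuous_on {..0} c" "c \<in> {..0} \<rightarrow> total" "c t0 = x" "\<And>y. y \<in> {..0} \<Longrightarrow> crit_map (c y) = ray y"
  proof (rule covering_space_lift_strong[OF covering_space_crit_map x, of t0 "{..0}" ray])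
    show "simply_connected {..0::real}" by (intro convex_imp_simply_connected convex_real_interval)
    show "locally path_connected {..0::real}" by (intro convex_imp_locally_path_connected convex_real_interval)
    show "ray \<in> {..0} \<rightarrow> base" using ray_in_base by auto
  qed (use assms continuous_on_ray in auto)
  have "is_lift c" unfolding is_lift_def using c by (auto simp: total_def)
  then show ?thesis using that c(3) by blast
qed

definition branch :: "nat \<Rightarrow> nat \<Rightarrow> real \<Rightarrow> complex \<times> complex" where
  "branch k l = (SOME c. is_lift c \<and> c T0 = lsol (rad T0) 0 0 k l)"

lemma branch: "is_lift (branch k l)" "branch k l T0 = lsol (rad T0) 0 0 k l"
proof -
  have "\<exists>c. is_lift c \<and> c T0 = lsol (rad T0) 0 0 k l"
    using lift_exists[OF T0_nonpos lsol_in_crit_dom crit_map_lsol_ray] rad_small[of T0] by (metis order_refl)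
  from someI_ex[OF this] show "is_lift (branch k l)" "branch k l T0 = lsol (rad T0) 0 0 k l"
    by (simp_all add: branch_def)
qed

lemma branch_small:
  assumes t: "t \<le> T0"
  shows "branch k l t = lsol (rad t) 0 0 k l"
proof (rule lift_unique_on[of "{..T0}" T0 t "branch k l" "\<lambda>t. lsol (rad t) 0 0 k l"])
  show "continuous_on {..T0} (branch k l)"
    using branch(1)[of k l] T0_nonpos unfolding is_lift_def by (auto elim: continuous_on_subset)
  show "continuous_on {..T0} (\<lambda>t. lsol (rad t) 0 0 k l)"
    unfolding lsol_def using rad_small by (intro continuous_on_sol) (auto simp: rad_def intro!: continuous_intros less_imp_le)
  show "branch k l u \<in> crit_dom \<and> crit_map (branch k l u) = ray u" if "u \<in> {..T0}" for u
    using branch(1)[of k l] T0_nonpos that unfolding is_lift_def by simp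
  show "lsol (rad u) 0 0 k l \<in> crit_dom \<and> crit_map (lsol (rad u) 0 0 k l) = ray u" if "u \<in> {..T0}" for u
    using lsol_in_crit_dom crit_map_lsol_ray rad_small that by simp
qed (use branch(2) t T0_nonpos in auto)


lemma lift_nondegenerate: "is_lift c \<Longrightarrow> t \<le> 0 \<Longrightarrow> nondegenerate (c t)"
  using ray_regular[of t] unfolding is_lift_def regular_values_def by blast

lemma lift_derivative:
  assumes c: "is_lift c" and t: "t \<le> 0"
  obtains v where "(c has_vector_derivative v) (at t within {..0})" "dlog1 (c t) v = 1" "dlog2 (c t) v = 0"
proof -
  have ct: "c t \<in> crit_dom" "crit_map (c t) = ray t" and cont: "continuous_on {..0} c"
    using c t by (auto simp: is_lift_def)
  obtain U V g where *: "open U" "U \<subseteq> crit_dom" "c t \<in> U" "open V" "crit_map (c t) \<in> V" "homeomorphism U V crit_map g"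
    "\<And>y. y \<in> V \<Longrightarrow> \<exists>g'. (g has_derivative g') (at y)" "\<And>x'. x' \<in> U \<Longrightarrow> nondegenerate x'"
    by (rule crit_map_local_homeomorphism[OF ct(1) lift_nondegenerate[OF c t]]) (rule that)
  obtain g' where g': "(g has_derivative g') (at (ray t))" using *(7)[OF *(5)] ct(2) by auto
  have ray': "(ray has_vector_derivative (of_real (exp t), 0)) (at t within S)" for S
    unfolding ray_def has_vector_derivative_def
    by (auto intro!: derivative_eq_intros simp: scaleR_prod_def scaleR_conv_of_real mult_ac)
  have gr: "((\<lambda>t. g (ray t)) has_vector_derivative g' (of_real (exp t), 0)) (at t within {..0})"
    using vector_derivative_diff_chain_within[OF ray', of g g'] g'
    by (simp add: o_def has_derivative_at_withinI)
  obtain \<epsilon> where \<epsilon>: "\<epsilon> > 0" "ball (c t) \<epsilon> \<subseteq> U" using *(1,3) openE by blast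
  obtain d where d: "d > 0" "\<And>t'. t' \<in> {..0} \<Longrightarrow> dist t' t < d \<Longrightarrow> dist (c t') (c t) < \<epsilon>"
    using cont t \<epsilon>(1) unfolding continuous_on_iff by (metis atMost_iff)
  have eq: "c t' = g (ray t')" if "t' \<in> {..0}" "dist t' t < d" for t'
  proof -
    have "c t' \<in> U" using d(2)[OF that] \<epsilon>(2) by (auto simp: dist_commute)
    then show ?thesis using homeomorphism_apply1[OF *(6)] c that(1) unfolding is_lift_def by (metis atMost_iff)
  qed
  have v: "(c has_vector_derivative g' (of_real (exp t), 0)) (at t within {..0})"
    by (rule has_vector_derivative_transform_within[OF gr d(1)]) (use t eq in auto)
  let ?v = "g' (of_real (exp t), 0)"
  have "((\<lambda>t. crit_map (c t)) has_vector_derivative dcrit_map (c t) ?v) (at t within {..0})"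
    using vector_derivative_diff_chain_within[OF v, of crit_map "dcrit_map (c t)"] crit_map_has_derivative[OF ct(1)]
    by (simp add: o_def has_derivative_at_withinI)
  then have "(ray has_vector_derivative dcrit_map (c t) ?v) (at t within {..0})"
    by (rule has_vector_derivative_transform_within[where d = 1]) (use t c in \<open>auto simp: is_lift_def\<close>)
  then have "(ray has_vector_derivative dcrit_map (c t) ?v) (at t within cbox (t - 1) t)"
    by (rule has_vector_derivative_within_subset) (use t in auto)
  then have "dcrit_map (c t) ?v = (of_real (exp t), 0)"
    by (rule vector_derivative_unique_within_closed_interval[rotated 2]) (auto intro: ray')
  then have "dlog1 (c t) ?v = 1" "dlog2 (c t) ?v = 0"
    using ct(2) by (simp_all add: dcrit_map_def ray_def)
  then show ?thesis using that v by blast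
qed

text \<open>The velocity of the curve solves a linear system whose coefficients are rational in its position and
  whose determinant \<open>J\<close> has no zeros by nondegeneracy. By Cramer's rule the velocity is rational in the
  position too.\<close>

lemma lift_smooth:
  assumes c: "is_lift c" and g: "g \<in> rational_functions {\<lambda>t. fst (c t), \<lambda>t. snd (c t)}"
  shows "smooth_nonpos g"
proof -
  let ?G = "{\<lambda>t. fst (c t), \<lambda>t. snd (c t)}"
  let ?R = "rational_functions ?G"
  have AR: "(\<lambda>t. fst (c t)) \<in> ?R" and BR: "(\<lambda>t. snd (c t)) \<in> ?R" by (auto intro: rational_functions.gen)
  have dom: "c t \<in> crit_dom" if "t \<le> 0" for t using c that by (simp add: is_lift_def)
  have iA: "(\<lambda>t. inverse (fst (c t))) \<in> ?R"
    using dom by (intro rational_functions.inverse AR) (auto simp: crit_dom_def)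
  have ilin: "(\<lambda>t. inverse (lin j (c t))) \<in> ?R" if "j \<le> r" for j
  proof (rule rational_functions.inverse)
    show "(\<lambda>t. lin j (c t)) \<in> ?R"
      unfolding lin_def by (intro rational_diff rational_functions.mult rational_functions.const AR BR)
  qed (use dom that in \<open>auto simp: crit_dom_def\<close>)
  \<comment> \<open>The system has the rows \<open>(P, - Q)\<close> and \<open>(- Q, W)\<close>.\<close>
  define P where "P t = of_nat (s + 1) * inverse (fst (c t)) + (\<Sum>j\<le>r. of_nat (b j) * (of_int (a j) * inverse (lin j (c t))))" for t
  define Q where "Q t = (\<Sum>j\<le>r. of_nat (b j) * inverse (lin j (c t)))" for t
  define W where "W t = (\<Sum>j\<le>r. inverse (lin j (c t)))" for t
  define J where "J t = P t * W t - Q t * Q t" for t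
  have PR: "P \<in> ?R" and QR: "Q \<in> ?R" and WR: "W \<in> ?R"
    unfolding P_def[abs_def] Q_def[abs_def] W_def[abs_def]
    by (intro rational_functions.add rational_functions.mult rational_functions.const rational_sum iA ilin; simp)+
  have JR: "J \<in> ?R" unfolding J_def[abs_def] by (intro rational_diff rational_functions.mult PR QR WR)
  have d1: "dlog1 (c t) v = P t * fst v - Q t * snd v" for t v
    unfolding dlog1_def P_def Q_def
    by (simp add: lin_def[of _ v] sum_distrib_left sum_distrib_right divide_inverse algebra_simps sum_subtractf sum.distrib)
  have d2: "dlog2 (c t) v = W t * snd v - Q t * fst v" for t v
  proof -
    have "Q t = (\<Sum>j\<le>r. of_int (a j) * inverse (lin j (c t)))"
      unfolding Q_def by (intro sum.cong) (simp_all add: of_nat_b)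
    then show ?thesis
      unfolding dlog2_def W_def
      by (simp add: lin_def[of _ v] sum_distrib_left sum_distrib_right divide_inverse algebra_simps sum_subtractf)
  qed
  have J0: "J t \<noteq> 0" if t: "t \<le> 0" for t
  proof
    assume J: "J t = 0"
    have nd: "\<And>v. dlog1 (c t) v = 0 \<Longrightarrow> dlog2 (c t) v = 0 \<Longrightarrow> v = 0"
      using lift_nondegenerate[OF c t] unfolding nondegenerate_def by blast
    have "(W t, Q t) = 0" by (rule nd) (use J in \<open>simp_all add: d1 d2 J_def\<close>)
    then have WQ: "W t = 0" "Q t = 0" by (simp_all add: zero_prod_def)
    have "(0, 1) = (0 :: complex \<times> complex)" by (rule nd) (simp_all add: d1 d2 WQ)
    then show False by (simp add: zero_prod_def)
  qed
  have iJ: "(\<lambda>t. inverse (J t)) \<in> ?R" by (rule rational_functions.inverse[OF JR J0])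
  have der: "((\<lambda>t. fst (c t)) has_vector_derivative W t * inverse (J t)) (at t within {..0}) \<and>
      ((\<lambda>t. snd (c t)) has_vector_derivative Q t * inverse (J t)) (at t within {..0})" if t: "t \<le> 0" for t
  proof -
    obtain v where v: "(c has_vector_derivative v) (at t within {..0})" "dlog1 (c t) v = 1" "dlog2 (c t) v = 0"
      by (rule lift_derivative[OF c t]) (rule that)
    have e: "P t * fst v - Q t * snd v = 1" "W t * snd v = Q t * fst v" using v(2,3) unfolding d1 d2 by simp_all
    have "J t * fst v = W t * (P t * fst v) - Q t * (Q t * fst v)" by (simp add: J_def algebra_simps)
    also have "\<dots> = W t * (P t * fst v - Q t * snd v)" unfolding e(2)[symmetric] by (simp add: algebra_simps)
    finally have "J t * fst v = W t" by (simp only: e(1) mult_1_right)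
    then have 1: "fst v = W t * inverse (J t)" using J0[OF t] by (simp add: field_simps)
    have "J t * snd v = P t * (W t * snd v) - Q t * Q t * snd v" by (simp add: J_def algebra_simps)
    also have "\<dots> = Q t * (P t * fst v - Q t * snd v)" unfolding e(2) by (simp add: algebra_simps)
    finally have "J t * snd v = Q t" by (simp only: e(1) mult_1_right)
    then have 2: "snd v = Q t * inverse (J t)" using J0[OF t] by (simp add: field_simps)
    show ?thesis
      using has_derivative_fst[OF v(1)[unfolded has_vector_derivative_def]]
        has_derivative_snd[OF v(1)[unfolded has_vector_derivative_def]]
      unfolding has_vector_derivative_def 1[symmetric] 2[symmetric] by simp
  qed
  have "has_derivative_in h ?R" if h: "h \<in> ?G" for h
  proof -
    consider "h = (\<lambda>t. fst (c t))" | "h = (\<lambda>t. snd (c t))" using h by blast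
    then show ?thesis
    proof cases
      case 1
      show ?thesis unfolding has_derivative_in_def 1
        by (rule bexI[OF _ rational_functions.mult[OF WR iJ]]) (use der in simp)
    next
      case 2
      show ?thesis unfolding has_derivative_in_def 2
        by (rule bexI[OF _ rational_functions.mult[OF QR iJ]]) (use der in simp)
    qed
  qed
  then show ?thesis
    using smooth_of_closed_under_derivative[OF rational_functions_derivative g] by blast
qed

section \<open>Labels\<close>

text \<open>All points \<open>f_at s r t\<close> have the same \<open>crit_point\<close>, as it does not involve the coefficient \<open>\<alpha>\<^sub>0\<close>.\<close>

definition plain_point :: "complex \<times> complex \<Rightarrow> pt" where
  "plain_point x = (\<lambda>i. if i \<in> {1..s} then fst x else 0, \<lambda>j. if j \<in> {1..r} then lin j x else 0)"

lemma crit_point_f_at: "crit_point (f_at s r t) x = plain_point x"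
  by (auto simp: crit_point_def plain_point_def f_at_def fun_eq_iff)

lemma Crit_f_at: "Crit s r a (f_at s r t) = plain_point ` fiber (f_at s r t)"
  unfolding Crit_eq_image[OF f_at_L] by (simp add: crit_point_f_at)

lemma inj_plain_point: "inj plain_point"
proof (rule injI)
  fix x y assume eq: "plain_point x = plain_point y"
  have "fst (plain_point x) 1 = fst (plain_point y) 1" "snd (plain_point x) 1 = snd (plain_point y) 1"
    using eq by simp_all
  then have "fst x = fst y" "lin 1 x = lin 1 y" using r_pos s_pos by (simp_all add: plain_point_def)
  then show "x = y" by (simp add: lin_def prod_eq_iff)
qed

lemma lift_in_fiber: "is_lift c \<Longrightarrow> t \<le> 0 \<Longrightarrow> c t \<in> fiber (f_at s r t)"
  by (simp add: is_lift_def fiber_def crit_value_f_at)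

lemma solution_curve_of_lift:
  assumes c: "is_lift c"
  shows "is_solution_curve s r a (plain_point (c 0)) (\<lambda>t. plain_point (c t))"
  unfolding is_solution_curve_def
proof (intro conjI allI impI refl)
  show "plain_point (c t) \<in> Crit s r a (f_at s r t)" if "t \<le> 0" for t
    unfolding Crit_f_at using lift_in_fiber[OF c that] by blast
  have z: "(\<lambda>t. 0) \<in> rational_functions {\<lambda>t. fst (c t), \<lambda>t. snd (c t)}" by (rule rational_functions.const)
  have A: "(\<lambda>t. fst (c t)) \<in> rational_functions {\<lambda>t. fst (c t), \<lambda>t. snd (c t)}"
    and B: "(\<lambda>t. snd (c t)) \<in> rational_functions {\<lambda>t. fst (c t), \<lambda>t. snd (c t)}"
    by (auto intro: rational_functions.gen)
  show "smooth_nonpos (\<lambda>t. fst (plain_point (c t)) i)" for i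
    by (rule lift_smooth[OF c], cases "i \<in> {1..s}") (simp_all only: plain_point_def fst_conv if_True if_False A z simp_thms)
  have lin: "(\<lambda>t. lin j (c t)) \<in> rational_functions {\<lambda>t. fst (c t), \<lambda>t. snd (c t)}" for j
    unfolding lin_def by (intro rational_diff rational_functions.mult rational_functions.const A B)
  show "smooth_nonpos (\<lambda>t. snd (plain_point (c t)) j)" for j
    by (rule lift_smooth[OF c], cases "j \<in> {1..r}") (simp_all only: plain_point_def snd_conv if_True if_False lin z simp_thms)
qed

text \<open>The coordinates that enter \<open>Theta\<close> are \<open>A\<close> and \<open>B\<close> up to the positive factor \<open>exp t\<close>.\<close>

lemma Theta_plain_point:
  assumes x: "x \<in> fiber (f_at s r t)"
  shows "Theta s r a (plain_point x) = (sgn (fst x), sgn (snd x))"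
proof -
  have AB: "A_of (f_at s r t) (plain_point x) = fst x" "B_of (f_at s r t) (plain_point x) = snd x"
    using AB_of_crit_point[OF f_at_L x] by (simp_all add: crit_point_f_at prod_eq_iff)
  let ?W = "\<Prod>j=1..r. snd (plain_point x) j powi a j" and ?Z = "\<Prod>i=1..s. fst (plain_point x) i"
  have "?W = (\<Prod>j=1..r. snd (plain_point x) j ^ b j)" by (intro prod.cong) (auto simp: powi_a)
  then have "fst x = of_real (exp t) * (?W / ?Z)" using AB(1) by (simp add: A_of_alt f_at_def)
  then have "sgn (fst x) = sgn (?W / ?Z)" by (simp add: sgn_mult sgn_of_real)
  moreover have "1 / (\<Prod>j=1..r. snd (plain_point x) j) = snd x" using AB(2) by (simp add: B_of_alt f_at_def)
  ultimately show ?thesis unfolding Theta_def case_prod_beta by (simp only:)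
qed

lemma continuous_of_smooth: "smooth_nonpos g \<Longrightarrow> continuous_on {..0} g"
  unfolding smooth_nonpos_def continuous_on_eq_continuous_within
  by (metis atMost_iff has_vector_derivative_continuous)

text \<open>The coordinates \<open>z 1 = A\<close> and \<open>w 1 = B - a 1 * A\<close> determine \<open>(A, B)\<close> and make it continuous in \<open>t\<close>.\<close>

lemma lift_of_solution_curve:
  assumes "is_solution_curve s r a p c"
  obtains x where "is_lift x" "\<And>t. t \<le> 0 \<Longrightarrow> c t = plain_point (x t)"
proof -
  define x where "x t = (fst (c t) 1, snd (c t) 1 + of_int (a 1) * fst (c t) 1)" for t
  have *: "c t = plain_point (x t) \<and> x t \<in> fiber (f_at s r t)" if t: "t \<le> 0" for t
  proof -
    have "c t \<in> plain_point ` fiber (f_at s r t)"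
      using assms t unfolding is_solution_curve_def Crit_f_at by blast
    then obtain y where y: "y \<in> fiber (f_at s r t)" "c t = plain_point y" by blast
    have "x t = y" using r_pos s_pos by (simp add: x_def y(2) plain_point_def lin_def prod_eq_iff)
    then show ?thesis using y by simp
  qed
  have "continuous_on {..0} x"
    unfolding x_def using assms
    by (intro continuous_intros continuous_of_smooth) (auto simp: is_solution_curve_def)
  then have "is_lift x" unfolding is_lift_def using * by (simp add: fiber_def crit_value_f_at)
  then show ?thesis using that * by blast
qed

lemma branch_Theta_limit:
  "((\<lambda>t. Theta s r a (plain_point (branch k l t))) \<longlongrightarrow> (cis (phase1 0 0 k l), cis (phase2 0 l))) at_bot"
proof -
  define d where "d t = of_real (rad t) * cis (phase1 0 0 k l - phase2 0 l)" for t
  have "filterlim (\<lambda>t. (1 / real (s + 1)) * t) at_bot at_bot"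
    by (rule filterlim_tendsto_pos_mult_at_bot[OF tendsto_const]) (simp_all add: filterlim_ident)
  then have "(rad \<longlongrightarrow> 0) at_bot"
    unfolding rad_def using filterlim_compose[OF exp_at_bot] by (simp add: mult.commute)
  then have "(d \<longlongrightarrow> of_real 0 * cis (phase1 0 0 k l - phase2 0 l)) at_bot"
    unfolding d_def by (intro tendsto_intros)
  then have d: "(d \<longlongrightarrow> 0) at_bot" by simp
  have "isCont X 0" "isCont Y 0"
    using contX contY \<rho>0 by (simp_all add: continuous_on_eq_continuous_at)
  then have "((\<lambda>t. X (d t)) \<longlongrightarrow> 1) at_bot" "((\<lambda>t. Y (d t)) \<longlongrightarrow> 1) at_bot"
    using isCont_tendsto_compose[OF _ d] X0 Y0 by fastforce+
  then have S: "((\<lambda>t. sgn (X (d t))) \<longlongrightarrow> sgn 1) at_bot" "((\<lambda>t. sgn (Y (d t))) \<longlongrightarrow> sgn 1) at_bot"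
    by (intro tendsto_sgn; simp)+
  have "((\<lambda>t. (cis (phase1 0 0 k l) * sgn (X (d t)), cis (phase2 0 l) * sgn (Y (d t)))) \<longlongrightarrow>
      (cis (phase1 0 0 k l) * sgn 1, cis (phase2 0 l) * sgn 1)) at_bot"
    by (rule tendsto_Pair[OF tendsto_mult[OF tendsto_const S(1)] tendsto_mult[OF tendsto_const S(2)]])
  then have lim: "((\<lambda>t. (cis (phase1 0 0 k l) * sgn (X (d t)), cis (phase2 0 l) * sgn (Y (d t)))) \<longlongrightarrow>
      (cis (phase1 0 0 k l), cis (phase2 0 l))) at_bot" by simp
  have "\<forall>\<^sub>F t in at_bot. (cis (phase1 0 0 k l) * sgn (X (d t)), cis (phase2 0 l) * sgn (Y (d t))) =
      Theta s r a (plain_point (branch k l t))"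
    using eventually_le_at_bot[of T0]
  proof eventually_elim
    case (elim t)
    have t: "t \<le> 0" using elim T0_nonpos by simp
    have pos: "rad t > 0" using rad_small[OF elim] by simp
    have scis: "sgn (cis \<psi>) = cis \<psi>" for \<psi> by (simp add: sgn_div_norm)
    have "branch k l t = (of_real (rad t) * cis (phase1 0 0 k l) * X (d t), cis (phase2 0 l) * Y (d t))"
      using branch_small[OF elim] by (simp add: lsol_def sol_def d_def)
    then show ?case
      unfolding Theta_plain_point[OF lift_in_fiber[OF branch(1) t]]
      using pos by (simp add: sgn_mult scis sgn_of_real)
  qed
  then show ?thesis by (rule Lim_transform_eventually[OF lim])
qed

lemma label_phases:
  "cis (phase1 0 0 k l) = cis (2 * pi * (real l * real_of_int (\<Sum>j=1..r. a j) / (real (s + 1) * real (r + 1))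
                            + real k / real (s + 1)))"
  "cis (phase2 0 l) = cis (2 * pi * real l / real (r + 1))"
proof -
  have "int total_twist = (\<Sum>j=1..r. a j)"
    unfolding total_twist_def atMost_split using int_b by (simp add: b_0)
  then have "real_of_int (\<Sum>j=1..r. a j) = real total_twist" by (metis of_int_of_nat_eq)
  moreover have "phase1 0 0 k l = 2 * pi * (real l * real total_twist / (real (s + 1) * real (r + 1)) + real k / real (s + 1))"
    by (simp add: phase1_def phase2_def add_divide_distrib distrib_left mult_ac)
  ultimately show "cis (phase1 0 0 k l) = cis (2 * pi * (real l * real_of_int (\<Sum>j=1..r. a j) / (real (s + 1) * real (r + 1))
                            + real k / real (s + 1)))" by simp
  show "cis (phase2 0 l) = cis (2 * pi * real l / real (r + 1))" by (simp add: phase2_def)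
qed

lemma label_phases_inject:
  assumes "cis (phase1 0 0 k l) = cis (phase1 0 0 k' l')" "cis (phase2 0 l) = cis (phase2 0 l')"
    and "k \<le> s" "l \<le> r" "k' \<le> s" "l' \<le> r"
  shows "k = k' \<and> l = l'"
proof -
  have l: "l = l'" using cis_quotient_eq_one[of l "r + 1" l'] assms by (simp add: phase2_def)
  have "phase1 0 0 k l = real total_twist * phase2 0 l / real (s + 1) + 2 * pi * real k / real (s + 1)" for k
    by (simp add: phase1_def add_divide_distrib)
  then have "cis (real total_twist * phase2 0 l / real (s + 1)) * cis (2 * pi * real k / real (s + 1)) =
      cis (real total_twist * phase2 0 l / real (s + 1)) * cis (2 * pi * real k' / real (s + 1))"
    using assms(1) by (simp only: l cis_mult)
  then have "k = k'" using cis_quotient_eq_one[of k "s + 1" k'] assms by simp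
  then show ?thesis using l by simp
qed

text \<open>A solution curve is the image of a lift of the ray, and every lift is one of the branches, because at
  time \<open>T0\<close> it passes through one of the small solutions. Different branches have different limits of
  \<open>Theta\<close>.\<close>

theorem has_label_iff:
  "has_label s r a p (k, l) \<longleftrightarrow> (k, l) \<in> labels s r \<and> p = plain_point (branch k l 0)"
proof
  assume kl: "(k, l) \<in> labels s r \<and> p = plain_point (branch k l 0)"
  then show "has_label s r a p (k, l)"
    unfolding has_label_def label_phases(1)[symmetric] label_phases(2)[symmetric] split
    using solution_curve_of_lift[OF branch(1)] branch_Theta_limit by blast
next
  assume "has_label s r a p (k, l)"
  then obtain c where kl: "(k, l) \<in> labels s r" and c: "is_solution_curve s r a p c"
    and lim: "((\<lambda>t. Theta s r a (c t)) \<longlongrightarrow> (cis (phase1 0 0 k l), cis (phase2 0 l))) at_bot"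
    unfolding has_label_def label_phases(1)[symmetric] label_phases(2)[symmetric] split by blast
  obtain x where x: "is_lift x" "\<And>t. t \<le> 0 \<Longrightarrow> c t = plain_point (x t)"
    by (rule lift_of_solution_curve[OF c]) (rule that)
  have "x T0 \<in> all_lsol (rad T0) 0 0" using lift_in_fiber[OF x(1) T0_nonpos] fiber_f_at[of T0] by simp
  then obtain k' l' where kl': "(k', l') \<in> labels s r" "x T0 = lsol (rad T0) 0 0 k' l'"
    by (auto simp: all_lsol_def)
  have xb: "x t = branch k' l' t" if "t \<le> 0" for t
    using lift_unique[OF x(1) branch(1) T0_nonpos _ that] kl'(2) branch(2) by simp
  have "\<forall>\<^sub>F t in at_bot. Theta s r a (plain_point (branch k' l' t)) = Theta s r a (c t)"
    using eventually_le_at_bot[of 0] by eventually_elim (simp add: x(2) xb)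
  then have "((\<lambda>t. Theta s r a (c t)) \<longlongrightarrow> (cis (phase1 0 0 k' l'), cis (phase2 0 l'))) at_bot"
    by (rule Lim_transform_eventually[OF branch_Theta_limit])
  then have "(cis (phase1 0 0 k l), cis (phase2 0 l)) = (cis (phase1 0 0 k' l'), cis (phase2 0 l'))"
    using lim tendsto_unique trivial_limit_at_bot_linorder by blast
  then have "k = k' \<and> l = l'"
    using kl kl'(1) by (intro label_phases_inject) (auto simp: labels_def)
  moreover have "p = c 0" using c by (simp add: is_solution_curve_def)
  ultimately show "(k, l) \<in> labels s r \<and> p = plain_point (branch k l 0)" using kl x(2)[of 0] xb[of 0] by simp
qed

theorem solution_eq:
  assumes "(k, l) \<in> labels s r"
  shows "solution s r a (k, l) = plain_point (branch k l 0)"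
proof -
  have "plain_point (branch k l 0) \<in> Crit_X s r a"
    unfolding Crit_X_def f_X_def Crit_f_at using lift_in_fiber[OF branch(1), of 0] by blast
  then show ?thesis unfolding solution_def has_label_iff using assms by (intro the_equality) auto
qed

theorem solution_inject:
  assumes "P \<in> labels s r" "Q \<in> labels s r" "solution s r a P = solution s r a Q"
  shows "P = Q"
proof -
  obtain k l k' l' where PQ: "P = (k, l)" "Q = (k', l')" by (metis surj_pair)
  have "branch k l 0 = branch k' l' 0"
    using assms(3) solution_eq assms(1,2) inj_plain_point unfolding PQ by (auto dest: injD)
  then have "branch k l T0 = branch k' l' T0" using lift_unique[OF branch(1) branch(1), of 0] T0_nonpos by blast
  then have "k = k' \<and> l = l'"
    using inj_lsol[of "rad T0" k l k' l' 0 0] rad_small[of T0] assms(1,2) by (auto simp: branch(2) PQ labels_def)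
  then show ?thesis by (simp add: PQ)
qed

end

section \<open>Monodromy\<close>

lemma continues_to_join:
  assumes "continues_to s r a \<gamma> p q" "continues_to s r a \<gamma>' q q'"
  shows "continues_to s r a (\<gamma> +++ \<gamma>') p q'"
proof -
  obtain c c' where c: "path c" "\<forall>\<theta>\<in>{0..1}. c \<theta> \<in> Crit s r a (\<gamma> \<theta>)" "pathstart c = p" "pathfinish c = q"
    and c': "path c'" "\<forall>\<theta>\<in>{0..1}. c' \<theta> \<in> Crit s r a (\<gamma>' \<theta>)" "pathstart c' = q" "pathfinish c' = q'"
    using assms unfolding continues_to_def by (elim exE conjE)
  have "(c +++ c') \<theta> \<in> Crit s r a ((\<gamma> +++ \<gamma>') \<theta>)" if "\<theta> \<in> {0..1}" for \<theta>
    using c(2) c'(2) that unfolding joinpaths_def by simp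
  then show ?thesis
    unfolding continues_to_def using c c' by (intro exI[of _ "c +++ c'"] conjI path_join_imp ballI) simp_all
qed

lemma continues_to_reverse:
  assumes "continues_to s r a \<gamma> p q"
  shows "continues_to s r a (reversepath \<gamma>) q p"
proof -
  obtain c where c: "path c" "\<forall>\<theta>\<in>{0..1}. c \<theta> \<in> Crit s r a (\<gamma> \<theta>)" "pathstart c = p" "pathfinish c = q"
    using assms unfolding continues_to_def by (elim exE conjE)
  then have "reversepath c \<theta> \<in> Crit s r a (reversepath \<gamma> \<theta>)" if "\<theta> \<in> {0..1}" for \<theta>
    using that unfolding reversepath_def by simp
  then show ?thesis
    unfolding continues_to_def using c by (intro exI[of _ "reversepath c"]) simp
qed

context twisted_bundle
begin

text \<open>At a critical point this is the pair \<open>(A, B)\<close>, written in a form that is continuous in \<open>f\<close> and \<open>p\<close>.\<close>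

definition lift_coords :: "pt \<Rightarrow> pt \<Rightarrow> complex \<times> complex" where
  "lift_coords f p = (fst f 1 * fst p 1, snd f 1 * snd p 1 + of_int (a 1) * (fst f 1 * fst p 1))"

lemma lift_coords_Crit:
  assumes f: "f \<in> L s r" and p: "p \<in> Crit s r a f"
  shows "lift_coords f p \<in> fiber f" "crit_point f (lift_coords f p) = p"
proof -
  have "lift_coords f p = (A_of f p, B_of f p)"
    using p r_pos s_pos unfolding Crit_iff lift_coords_def by (simp add: lin_def)
  then show "lift_coords f p \<in> fiber f" "crit_point f (lift_coords f p) = p"
    using AB_of_in_fiber[OF f p] by simp_all
qed

lemma continuous_on_component:
  assumes "continuous_on S (\<gamma> :: 'x::topological_space \<Rightarrow> pt)"
  shows "continuous_on S (\<lambda>x. fst (\<gamma> x) i)" "continuous_on S (\<lambda>x. snd (\<gamma> x) j)"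
  using continuous_on_product_then_coordinatewise[OF continuous_on_fst[OF assms]]
    continuous_on_product_then_coordinatewise[OF continuous_on_snd[OF assms]] by auto

lemma continuous_on_pt:
  assumes "\<And>i. continuous_on S (\<lambda>x. fst (\<gamma> x) i)" "\<And>j. continuous_on S (\<lambda>x. snd (\<gamma> x) j)"
  shows "continuous_on S (\<gamma> :: 'x::topological_space \<Rightarrow> pt)"
proof -
  have "continuous_on S (\<lambda>x. (\<lambda>i. fst (\<gamma> x) i, \<lambda>j. snd (\<gamma> x) j))"
    by (intro continuous_on_Pair continuous_on_coordinatewise_then_product assms)
  then show ?thesis by simp
qed

lemma continuous_on_crit_value:
  assumes "continuous_on S \<gamma>" "\<And>x. x \<in> S \<Longrightarrow> \<gamma> x \<in> L s r"
  shows "continuous_on S (\<lambda>x. crit_value (\<gamma> x))"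
proof -
  have "(\<Prod>j\<le>r. snd (\<gamma> x) j ^ b j) \<noteq> 0" if "x \<in> S" for x using L_D(2)[OF assms(2)[OF that]] by auto
  then show ?thesis unfolding crit_value_def by (intro continuous_intros continuous_on_component assms(1)) auto
qed

lemma continuous_on_crit_point:
  assumes "continuous_on S \<gamma>" "continuous_on S x" "\<And>t. t \<in> S \<Longrightarrow> \<gamma> t \<in> L s r"
  shows "continuous_on S (\<lambda>t. crit_point (\<gamma> t) (x t))"
proof (rule continuous_on_pt)
  have A: "continuous_on S (\<lambda>t. fst (x t))" by (intro continuous_intros assms(2))
  have l: "continuous_on S (\<lambda>t. lin j (x t))" for j by (intro continuous_intros assms(2))
  show "continuous_on S (\<lambda>t. fst (crit_point (\<gamma> t) (x t)) i)" for i
  proof (cases "i \<in> {1..s}")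
    case True
    have "continuous_on S (\<lambda>t. fst (x t) / fst (\<gamma> t) i)"
      using True L_D(1)[OF assms(3)] by (intro continuous_on_divide A continuous_on_component assms(1)) auto
    then show ?thesis using True by (simp add: crit_point_def)
  next
    case False
    then show ?thesis unfolding crit_point_def fst_conv by (simp only: if_False continuous_on_const)
  qed
  show "continuous_on S (\<lambda>t. snd (crit_point (\<gamma> t) (x t)) j)" for j
  proof (cases "j \<in> {1..r}")
    case True
    have "continuous_on S (\<lambda>t. lin j (x t) / snd (\<gamma> t) j)"
      using True L_D(2)[OF assms(3)] by (intro continuous_on_divide l continuous_on_component assms(1)) auto
    then show ?thesis using True by (simp add: crit_point_def)
  next
    case False
    then show ?thesis unfolding crit_point_def snd_conv by (simp only: if_False continuous_on_const)
  qed
qed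

text \<open>Along both continuations \<open>(A, B)\<close> is a lift of the path of values through the covering \<open>crit_map\<close>.
  The image of the homotopy under \<open>crit_value\<close> is connected and consists of regular values, hence stays
  in \<open>base\<close>, and the monodromy theorem for coverings applies.\<close>

theorem continuation_homotopy_invariant:
  assumes hom: "homotopic_paths (L s r - R_X s r a) \<gamma> \<gamma>'" and start: "crit_value (pathstart \<gamma>) \<in> base"
    and c: "continues_to s r a \<gamma> p q" and c': "continues_to s r a \<gamma>' p q'"
  shows "q = q'"
proof -
  obtain h :: "real \<times> real \<Rightarrow> _" where "continuous_on ({0..1} \<times> {0..1}) h \<and> h \<in> ({0..1} \<times> {0..1}) \<rightarrow> L s r - R_X s r a \<and>
      (\<forall>x\<in>{0..1}. h (0, x) = \<gamma> x) \<and> (\<forall>x\<in>{0..1}. h (1, x) = \<gamma>' x) \<and>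
      (\<forall>t\<in>{0..1}. pathstart (h \<circ> Pair t) = pathstart \<gamma> \<and> pathfinish (h \<circ> Pair t) = pathfinish \<gamma>)"
    using hom unfolding homotopic_paths by (rule exE)
  then have h: "continuous_on ({0..1} \<times> {0..1}) h" "h \<in> ({0..1} \<times> {0..1}) \<rightarrow> L s r - R_X s r a"
      "\<forall>x\<in>{0..1}. h (0, x) = \<gamma> x" "\<forall>x\<in>{0..1}. h (1, x) = \<gamma>' x"
      "\<forall>t\<in>{0..1}. pathstart (h \<circ> Pair t) = pathstart \<gamma> \<and> pathfinish (h \<circ> Pair t) = pathfinish \<gamma>"
    by blast+
  define k where "k y = crit_value (h y)" for y
  have hL: "h y \<in> L s r" "h y \<notin> R_X s r a" if "y \<in> {0..1} \<times> {0..1}" for y using h(2) that by auto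
  have contk: "continuous_on ({0..1} \<times> {0..1}) k"
    unfolding k_def by (intro continuous_on_crit_value h(1) hL)
  have "k ` ({0..1} \<times> {0..1}) \<subseteq> base"
  proof (rule connected_subset_base)
    show "connected (k ` ({0..1} \<times> {0..1}))"
      by (intro connected_continuous_image contk connected_Times) (simp_all add: convex_connected)
    show "k ` ({0..1} \<times> {0..1}) \<subseteq> regular_values"
      using hL unfolding k_def by (intro image_subsetI crit_value_regular) blast
    have "k (0, 0) = crit_value (pathstart \<gamma>)" using h(3) by (simp add: k_def pathstart_def)
    then show "k ` ({0..1} \<times> {0..1}) \<inter> base \<noteq> {}" using start by force
  qed
  then have kb: "k y \<in> base" if "y \<in> {0..1} \<times> {0..1}" for y using that by blast
  have hom': "homotopic_paths base (crit_value \<circ> \<gamma>) (crit_value \<circ> \<gamma>')"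
    unfolding homotopic_paths
    by (rule exI[of _ k])
       (use contk kb h(3-5) in \<open>auto simp: k_def pathstart_def pathfinish_def\<close>)
  obtain d where d: "path d" "\<forall>\<theta>\<in>{0..1}. d \<theta> \<in> Crit s r a (\<gamma> \<theta>)" "pathstart d = p" "pathfinish d = q"
    using c unfolding continues_to_def by (elim exE conjE)
  obtain d' where d': "path d'" "\<forall>\<theta>\<in>{0..1}. d' \<theta> \<in> Crit s r a (\<gamma>' \<theta>)" "pathstart d' = p" "pathfinish d' = q'"
    using c' unfolding continues_to_def by (elim exE conjE)
  have \<gamma>: "path \<gamma>" "path_image \<gamma> \<subseteq> L s r - R_X s r a" and \<gamma>': "path \<gamma>'" "path_image \<gamma>' \<subseteq> L s r - R_X s r a"
    using homotopic_paths_imp_path[OF hom] homotopic_paths_imp_subset[OF hom] by auto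
  have lift: "path (\<lambda>\<theta>. lift_coords (\<gamma> \<theta>) (d \<theta>))" "path_image (\<lambda>\<theta>. lift_coords (\<gamma> \<theta>) (d \<theta>)) \<subseteq> total"
      "\<And>\<theta>. \<theta> \<in> {0..1} \<Longrightarrow> crit_map (lift_coords (\<gamma> \<theta>) (d \<theta>)) = (crit_value \<circ> \<gamma>) \<theta>"
    if \<gamma>: "path \<gamma>" "path_image \<gamma> \<subseteq> L s r - R_X s r a" "path_image (crit_value \<circ> \<gamma>) \<subseteq> base"
      and d: "path d" "\<forall>\<theta>\<in>{0..1}. d \<theta> \<in> Crit s r a (\<gamma> \<theta>)" for \<gamma> d
  proof -
    show "path (\<lambda>\<theta>. lift_coords (\<gamma> \<theta>) (d \<theta>))"
      using \<gamma>(1) d(1) unfolding path_def lift_coords_def by (intro continuous_intros continuous_on_component)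
    have fib: "lift_coords (\<gamma> \<theta>) (d \<theta>) \<in> fiber (\<gamma> \<theta>)" if "\<theta> \<in> {0..1}" for \<theta>
    proof (rule lift_coords_Crit)
      have "\<gamma> \<theta> \<in> L s r - R_X s r a" using \<gamma>(2) that unfolding path_image_def by (rule set_mp[OF _ imageI])
      then show "\<gamma> \<theta> \<in> L s r" by simp
      show "d \<theta> \<in> Crit s r a (\<gamma> \<theta>)" using d(2) that by simp
    qed
    then show *: "crit_map (lift_coords (\<gamma> \<theta>) (d \<theta>)) = (crit_value \<circ> \<gamma>) \<theta>" if "\<theta> \<in> {0..1}" for \<theta>
      using that by (simp add: fiber_def)
    show "path_image (\<lambda>\<theta>. lift_coords (\<gamma> \<theta>) (d \<theta>)) \<subseteq> total"
      unfolding path_image_def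
    proof (rule image_subsetI)
      fix \<theta> :: real assume \<theta>: "\<theta> \<in> {0..1}"
      have "(crit_value \<circ> \<gamma>) \<theta> \<in> base" using \<gamma>(3) \<theta> unfolding path_image_def by blast
      then show "lift_coords (\<gamma> \<theta>) (d \<theta>) \<in> total" using fib[OF \<theta>] *[OF \<theta>] by (simp add: total_def fiber_def)
    qed
  qed
  note base_paths = homotopic_paths_imp_path[OF hom'] homotopic_paths_imp_subset[OF hom']
  have ends: "\<gamma> 0 = \<gamma>' 0" "\<gamma> 1 = \<gamma>' 1"
    using homotopic_paths_imp_pathstart[OF hom] homotopic_paths_imp_pathfinish[OF hom]
    by (simp_all add: pathstart_def pathfinish_def)
  have "pathfinish (\<lambda>\<theta>. lift_coords (\<gamma> \<theta>) (d \<theta>)) = pathfinish (\<lambda>\<theta>. lift_coords (\<gamma>' \<theta>) (d' \<theta>))"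
  proof (rule covering_space_monodromy[OF covering_space_crit_map _ _ _ _ hom'])
    show "pathstart (\<lambda>\<theta>. lift_coords (\<gamma> \<theta>) (d \<theta>)) = pathstart (\<lambda>\<theta>. lift_coords (\<gamma>' \<theta>) (d' \<theta>))"
      using ends d(3) d'(3) by (simp add: pathstart_def)
  qed (use base_paths lift[OF \<gamma> _ d(1,2)] lift[OF \<gamma>' _ d'(1,2)] in auto)
  then have "lift_coords (\<gamma> 1) q = lift_coords (\<gamma> 1) q'" using ends d(4) d'(4) by (simp add: pathfinish_def)
  moreover have "\<gamma> 1 \<in> L s r" using subsetD[OF \<gamma>(2), of "\<gamma> 1"] by (simp add: path_image_def)
  moreover have "q \<in> Crit s r a (\<gamma> 1)" "q' \<in> Crit s r a (\<gamma> 1)"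
    using bspec[OF d(2), of 1] bspec[OF d'(2), of 1] d(4) d'(4) ends by (simp_all add: pathfinish_def)
  ultimately show ?thesis using lift_coords_Crit(2) by metis
qed

end

text \<open>A formula for \<open>gamma_tilde\<close> that is continuous in both the loop parameter and the position \<open>t\<close>. The
  association of \<open>+++\<close> makes the outward segment occupy \<open>{0..1/2}\<close>, the loop \<open>{1/2..3/4}\<close> and the way
  back \<open>{3/4..1}\<close>.\<close>

definition loop_radius :: "real \<Rightarrow> real" where
  "loop_radius x = min (min (2 * x) 1) (4 - 4 * x)"

definition loop_angle :: "real \<Rightarrow> real" where
  "loop_angle x = max 0 (min 1 (4 * x - 2))"

definition loop_point :: "nat \<Rightarrow> nat \<Rightarrow> divisor \<Rightarrow> real \<Rightarrow> real \<Rightarrow> pt" where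
  "loop_point s r D t x =
     (\<lambda>i. (if i = 0 then of_real (1 + loop_radius x * (exp t - 1)) else if i \<le> s then 1 else 0) *
            cis (2 * pi * real_of_int (Poly_Mapping.lookup D (Vv i)) * loop_angle x),
      \<lambda>j. (if j \<le> r then 1 else 0) * cis (2 * pi * real_of_int (Poly_Mapping.lookup D (Ve j)) * loop_angle x))"

lemma cis_int_multiple: "cis (2 * pi * real_of_int n) = 1"
  by (rule cis_multiple_2pi) simp

lemma segment_to_eq:
  "segment_to s r t \<theta> = (\<lambda>i. if i = 0 then of_real (1 + \<theta> * (exp t - 1)) else if i \<le> s then 1 else 0, \<lambda>j. if j \<le> r then 1 else 0)"
  by (auto simp: segment_to_def f_X_def f_at_def linepath_def fun_eq_iff scaleR_conv_of_real algebra_simps)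

lemma gamma_tilde_eq:
  assumes "x \<in> {0..1}"
  shows "gamma_tilde s r D t x = loop_point s r D t x"
proof -
  consider "x \<le> 1 / 2" | "x > 1 / 2" "x \<le> 3 / 4" | "x > 3 / 4" by linarith
  then show ?thesis
  proof cases
    case 1
    then have "loop_angle x = 0" "loop_radius x = 2 * x" using assms by (simp_all add: loop_angle_def loop_radius_def)
    then show ?thesis using 1 by (auto simp: gamma_tilde_def joinpaths_def segment_to_eq loop_point_def fun_eq_iff)
  next
    case 2
    then have *: "loop_angle x = 4 * x - 2" "loop_radius x = 1" "2 * (2 * x - 1) = 4 * x - 2"
      by (simp_all add: loop_angle_def loop_radius_def)
    have "gamma_tilde s r D t x = gamma s r D t (4 * x - 2)" using 2 *(3) by (simp add: gamma_tilde_def joinpaths_def)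
    also have "\<dots> = loop_point s r D t x" by (auto simp: gamma_def loop_point_def f_at_def * fun_eq_iff)
    finally show ?thesis .
  next
    case 3
    then have *: "loop_angle x = 1" "loop_radius x = 4 - 4 * x" "1 - (2 * (2 * x - 1) - 1) = 4 - 4 * x"
      using assms by (simp_all add: loop_angle_def loop_radius_def)
    have "gamma_tilde s r D t x = segment_to s r t (4 - 4 * x)"
      using 3 *(3) by (simp add: gamma_tilde_def joinpaths_def reversepath_def)
    also have "\<dots> = loop_point s r D t x" by (auto simp: segment_to_eq loop_point_def * fun_eq_iff cis_int_multiple)
    finally show ?thesis .
  qed
qed

lemma continuous_on_loop_point:
  assumes "continuous_on S f" "continuous_on S g"
  shows "continuous_on S (\<lambda>y. loop_point s r D (f y) (g y))"
proof -
  have "continuous_on S (\<lambda>y. loop_radius (g y))" "continuous_on S (\<lambda>y. loop_angle (g y))"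
    unfolding loop_radius_def loop_angle_def by (intro continuous_intros assms)+
  note cont = this
  have 1: "continuous_on S (\<lambda>y. if i = 0 then of_real (1 + loop_radius (g y) * (exp (f y) - 1)) else if i \<le> s then 1 else (0::complex))" for i
  proof (cases "i = 0")
    case True
    then show ?thesis by simp (intro continuous_intros assms cont)
  next
    case False
    then show ?thesis by (cases "i \<le> s") simp_all
  qed
  have 2: "continuous_on S (\<lambda>y. if j \<le> r then 1 else (0::complex))" for j by (cases "j \<le> r") simp_all
  have "continuous_on S (\<lambda>y. fst (loop_point s r D (f y) (g y)) i)" for i
    unfolding loop_point_def fst_conv by (intro continuous_on_mult 1) (intro continuous_intros cont)
  moreover have "continuous_on S (\<lambda>y. snd (loop_point s r D (f y) (g y)) j)" for j
    unfolding loop_point_def snd_conv by (intro continuous_on_mult 2) (intro continuous_intros cont)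
  ultimately have "continuous_on S (\<lambda>y. (\<lambda>i. fst (loop_point s r D (f y) (g y)) i, \<lambda>j. snd (loop_point s r D (f y) (g y)) j))"
    by (intro continuous_on_Pair continuous_on_coordinatewise_then_product)
  then show ?thesis by simp
qed

context monodromy_setup
begin

definition segment_time :: "real \<Rightarrow> real \<Rightarrow> real" where
  "segment_time t \<theta> = ln (1 + \<theta> * (exp t - 1))"

lemma segment_value_pos: "\<theta> \<in> {0..1} \<Longrightarrow> 1 + \<theta> * (exp t - 1) > 0" for t \<theta> :: real
proof -
  assume \<theta>: "\<theta> \<in> {0..1}"
  show ?thesis
  proof (cases "\<theta> = 0")
    case False
    then have "\<theta> * exp t > 0" using \<theta> by simp
    moreover have "1 + \<theta> * (exp t - 1) = (1 - \<theta>) + \<theta> * exp t" by (simp add: algebra_simps)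
    ultimately show ?thesis using \<theta> by simp
  qed simp
qed

lemma segment_time_nonpos:
  assumes "\<theta> \<in> {0..1}" "t \<le> 0"
  shows "segment_time t \<theta> \<le> 0"
proof -
  have "\<theta> * (exp t - 1) \<le> 0" using assms by (intro mult_nonneg_nonpos) auto
  then show ?thesis using segment_value_pos[OF assms(1), of t] by (simp add: segment_time_def)
qed

lemma segment_to_f_at: "\<theta> \<in> {0..1} \<Longrightarrow> segment_to s r t \<theta> = f_at s r (segment_time t \<theta>)"
  using segment_value_pos[of \<theta> t] by (auto simp: segment_to_eq f_at_def segment_time_def fun_eq_iff)

lemma gamma_in_L: "gamma s r D t \<theta> \<in> L s r"
  by (auto simp: gamma_def f_at_def L_def)

text \<open>The degrees combine the multiplicities of \<open>D\<close>, which are the winding numbers of the coefficients, in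
  the way in which \<open>crit_value\<close> combines the coefficients.\<close>

lemma crit_value_gamma:
  "crit_value (gamma s r D t \<theta>) =
     (of_real (exp t) * cis (2 * pi * real_of_int (deg1 s r a D) * \<theta>), cis (2 * pi * real_of_int (deg2 r D) * \<theta>))"
proof -
  let ?n = "\<lambda>i. Poly_Mapping.lookup D (Vv i)" and ?m = "\<lambda>j. Poly_Mapping.lookup D (Ve j)"
  have cis_prod: "(\<Prod>i\<in>I. cis (f i)) = cis (\<Sum>i\<in>I. f i)" for I and f :: "nat \<Rightarrow> real"
    by (induction I rule: infinite_finite_induct) (simp_all add: cis_mult)
  have sums: "{0..s} = {..s}" "{0..r} = {..r}" by auto
  have \<beta>: "snd (gamma s r D t \<theta>) j = cis (2 * pi * real_of_int (?m j) * \<theta>)" if "j \<in> {..r}" for j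
    using that by (simp add: gamma_def f_at_def)
  have 2: "(\<Prod>j\<le>r. snd (gamma s r D t \<theta>) j) = cis (2 * pi * real_of_int (deg2 r D) * \<theta>)"
  proof -
    have "(\<Prod>j\<le>r. snd (gamma s r D t \<theta>) j) = (\<Prod>j\<le>r. cis (2 * pi * real_of_int (?m j) * \<theta>))"
      by (intro prod.cong refl) (simp only: \<beta>)
    then show ?thesis by (simp add: cis_prod deg2_def sums sum_distrib_left sum_distrib_right)
  qed
  have "(\<Prod>j\<le>r. snd (gamma s r D t \<theta>) j ^ b j) = (\<Prod>j\<le>r. cis (real (b j) * (2 * pi * real_of_int (?m j) * \<theta>)))"
    by (intro prod.cong refl) (simp only: \<beta> Complex.DeMoivre)
  also have "\<dots> = cis (\<Sum>j\<le>r. real (b j) * (2 * pi * real_of_int (?m j) * \<theta>))" by (rule cis_prod)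
  also have "(\<Sum>j\<le>r. real (b j) * (2 * pi * real_of_int (?m j) * \<theta>)) = 2 * pi * real_of_int (\<Sum>j\<le>r. a j * ?m j) * \<theta>"
    by (simp add: sum_distrib_left sum_distrib_right of_nat_b mult_ac)
  finally have 3: "(\<Prod>j\<le>r. snd (gamma s r D t \<theta>) j ^ b j) = cis (2 * pi * real_of_int (\<Sum>j\<le>r. a j * ?m j) * \<theta>)" .
  have "(\<Prod>i\<le>s. fst (gamma s r D t \<theta>) i) = (\<Prod>i\<le>s. fst (f_at s r t) i) * (\<Prod>i\<le>s. cis (2 * pi * real_of_int (?n i) * \<theta>))"
    by (simp add: gamma_def prod.distrib)
  also have "(\<Prod>i\<le>s. fst (f_at s r t) i) = of_real (exp t)" unfolding split_first by (simp add: f_at_def)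
  also have "(\<Prod>i\<le>s. cis (2 * pi * real_of_int (?n i) * \<theta>)) = cis (2 * pi * real_of_int (\<Sum>i\<le>s. ?n i) * \<theta>)"
    by (simp add: cis_prod sum_distrib_left sum_distrib_right)
  finally have 1: "(\<Prod>i\<le>s. fst (gamma s r D t \<theta>) i) = of_real (exp t) * cis (2 * pi * real_of_int (\<Sum>i\<le>s. ?n i) * \<theta>)" .
  have "2 * pi * real_of_int (\<Sum>i\<le>s. ?n i) * \<theta> - 2 * pi * real_of_int (\<Sum>j\<le>r. a j * ?m j) * \<theta> = 2 * pi * real_of_int (deg1 s r a D) * \<theta>"
    by (simp add: deg1_def sums algebra_simps)
  moreover have "c * cis x / cis y = c * cis (x - y)" for c x y by (simp add: cis_divide[symmetric])
  ultimately show ?thesis unfolding crit_value_def 1 2 3 by (simp only:)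
qed

lemma gamma_reduced:
  assumes "t \<le> T0"
  shows "gamma s r D t \<theta> \<in> L s r - R_X s r a"
  using small_fiber(2)[OF gamma_in_L, of "rad t" D t \<theta>] rad_small[OF assms] crit_value_gamma[of D t \<theta>] rad_power[of t] gamma_in_L
  by (simp add: R_X_def del: power_Suc)

lemma loop_point_reduced:
  assumes x: "x \<in> {0..1}" and t: "t \<le> T0"
  shows "loop_point s r D t x \<in> L s r - R_X s r a"
proof -
  have seg: "segment_to s r t \<theta> \<in> L s r - R_X s r a" if "\<theta> \<in> {0..1}" for \<theta>
    using segment_to_f_at[OF that] f_at_L f_at_reduced segment_time_nonpos[OF that] t T0_nonpos by simp
  have "gamma_tilde s r D t x \<in> L s r - R_X s r a"
    using x seg[of "2 * x"] seg[of "4 - 4 * x"] gamma_reduced[OF t, of D "2 * (2 * x - 1)"]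
    unfolding gamma_tilde_def joinpaths_def reversepath_def by (auto simp: algebra_simps)
  then show ?thesis using gamma_tilde_eq[OF x] by simp
qed

text \<open>The loops at all positions up to \<open>T0\<close> avoid \<open>R_X\<close>, so that moving \<open>t\<close> is a homotopy.\<close>

lemma gamma_tilde_homotopic:
  assumes t: "t \<le> T0" "t' \<le> T0"
  shows "homotopic_paths (L s r - R_X s r a) (gamma_tilde s r D t) (gamma_tilde s r D t')"
proof -
  define h where "h y = loop_point s r D ((1 - fst y) * t + fst y * t') (snd y)" for y
  have le: "(1 - u) * t + u * t' \<le> T0" if "u \<in> {0..1}" for u
    using convex_bound_le[OF t, of "1 - u" u] that by simp
  have "h y \<in> L s r - R_X s r a" if "y \<in> {0..1} \<times> {0..1}" for y
    unfolding h_def using that by (intro loop_point_reduced le) auto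
  then have h: "h \<in> ({0..1} \<times> {0..1}) \<rightarrow> L s r - R_X s r a" by (rule funcsetI)
  have cont: "continuous_on ({0..1} \<times> {0..1}) h"
    unfolding h_def by (intro continuous_on_loop_point continuous_intros)
  have ends: "loop_point s r D u 0 = loop_point s r D t 0" "loop_point s r D u 1 = loop_point s r D t 1" for u
    by (auto simp: loop_point_def loop_radius_def fun_eq_iff)
  show ?thesis
    unfolding homotopic_paths
  proof (intro exI[of _ h] conjI ballI)
    show "h (0, x) = gamma_tilde s r D t x" "h (1, x) = gamma_tilde s r D t' x" if "x \<in> {0..1}" for x
      using that by (simp_all add: h_def gamma_tilde_eq)
    show "pathstart (h \<circ> Pair u) = pathstart (gamma_tilde s r D t)"
      "pathfinish (h \<circ> Pair u) = pathfinish (gamma_tilde s r D t)" for u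
      unfolding pathstart_def pathfinish_def o_def h_def fst_conv snd_conv
      using ends gamma_tilde_eq[of 0 s r D t] gamma_tilde_eq[of 1 s r D t] by simp_all
  qed (use h cont in simp_all)
qed

lemma Gamma_class_eq: "Gamma_class s r a D = loop_class s r a (gamma_tilde s r D T0)"
proof -
  have *: "\<forall>\<^sub>F t in at_bot. loop_class s r a (gamma_tilde s r D t) = loop_class s r a (gamma_tilde s r D T0)"
    using eventually_le_at_bot[of T0]
  proof eventually_elim
    case (elim t)
    have hom: "homotopic_paths (L s r - R_X s r a) (gamma_tilde s r D t) (gamma_tilde s r D T0)"
      by (rule gamma_tilde_homotopic[OF elim order_refl])
    show ?case
      unfolding loop_class_def
    proof (intro Collect_cong iffI)
      show "homotopic_paths (L s r - R_X s r a) (gamma_tilde s r D T0) \<gamma>"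
        if "homotopic_paths (L s r - R_X s r a) (gamma_tilde s r D t) \<gamma>" for \<gamma>
        by (rule homotopic_paths_trans[OF homotopic_paths_sym[OF hom] that])
      show "homotopic_paths (L s r - R_X s r a) (gamma_tilde s r D t) \<gamma>"
        if "homotopic_paths (L s r - R_X s r a) (gamma_tilde s r D T0) \<gamma>" for \<gamma>
        by (rule homotopic_paths_trans[OF hom that])
    qed
  qed
  show ?thesis
    unfolding Gamma_class_def
  proof (rule the_equality)
    show "\<forall>\<^sub>F t in at_bot. loop_class s r a (gamma_tilde s r D t) = loop_class s r a (gamma_tilde s r D T0)"
      by (rule *)
    fix C assume "\<forall>\<^sub>F t in at_bot. loop_class s r a (gamma_tilde s r D t) = C"
    with * have "\<forall>\<^sub>F t::real in at_bot. C = loop_class s r a (gamma_tilde s r D T0)" by eventually_elim simp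
    then show "C = loop_class s r a (gamma_tilde s r D T0)" by (simp add: eventually_const)
  qed
qed

lemma continues_along_segment:
  assumes c: "is_lift c" and t: "t \<le> 0"
  shows "continues_to s r a (segment_to s r t) (plain_point (c 0)) (plain_point (c t))"
proof -
  have cont: "continuous_on {0..1} (segment_time t)"
  proof -
    have "1 + \<theta> * (exp t - 1) \<noteq> 0" if "\<theta> \<in> {0..1}" for \<theta> using segment_value_pos[OF that, of t] by simp
    then show ?thesis unfolding segment_time_def by (intro continuous_intros) simp
  qed
  have "continuous_on {0..1} (\<lambda>\<theta>. c (segment_time t \<theta>))"
    using c segment_time_nonpos[OF _ t] unfolding is_lift_def
    by (intro continuous_on_compose2[OF _ cont, of "{..0}" c]) auto
  then have "continuous_on {0..1} (\<lambda>\<theta>. crit_point (f_at s r 0) (c (segment_time t \<theta>)))"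
    by (intro continuous_on_crit_point continuous_on_const f_at_L)
  then have "path (\<lambda>\<theta>. plain_point (c (segment_time t \<theta>)))" by (simp add: path_def crit_point_f_at)
  moreover have "plain_point (c (segment_time t \<theta>)) \<in> Crit s r a (segment_to s r t \<theta>)" if "\<theta> \<in> {0..1}" for \<theta>
    unfolding segment_to_f_at[OF that] Crit_f_at using lift_in_fiber[OF c segment_time_nonpos[OF that t]] by (rule imageI)
  ultimately show ?thesis
    unfolding continues_to_def
    by (intro exI[of _ "\<lambda>\<theta>. plain_point (c (segment_time t \<theta>))"])
       (simp add: pathstart_def pathfinish_def segment_time_def)
qed

text \<open>Along the loop the solution is continued with fixed \<open>k\<close> and \<open>l\<close> while the phases \<open>\<phi>1\<close> and \<open>\<phi>2\<close> of the
  value grow from \<open>0\<close> to \<open>2 * pi * deg1 D\<close> and \<open>2 * pi * deg2 D\<close>. In \<open>phase1\<close> and \<open>phase2\<close> the final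
  phases have the same effect as adding the degrees to \<open>k\<close> and \<open>l\<close>.\<close>

lemma continues_along_gamma:
  assumes t: "t \<le> T0" and k': "int k' = int k + deg1 s r a D" and l': "int l' = int l + deg2 r D"
  shows "continues_to s r a (gamma s r D t) (plain_point (branch k l t)) (plain_point (branch k' l' t))"
proof -
  let ?p1 = "\<lambda>\<theta>. 2 * pi * real_of_int (deg1 s r a D) * \<theta>" and ?p2 = "\<lambda>\<theta>. 2 * pi * real_of_int (deg2 r D) * \<theta>"
  define x where "x \<theta> = lsol (rad t) (?p1 \<theta>) (?p2 \<theta>) k l" for \<theta>
  note rad = rad_small[OF t]
  have "continuous_on {0..1} x"
    unfolding x_def lsol_def phase1_def phase2_def using rad
    by (intro continuous_on_sol continuous_intros) auto
  moreover have contg: "continuous_on {0..1} (gamma s r D t)"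
  proof (rule continuous_on_pt)
    show "continuous_on {0..1} (\<lambda>\<theta>. fst (gamma s r D t \<theta>) i)" "continuous_on {0..1} (\<lambda>\<theta>. snd (gamma s r D t \<theta>) j)" for i j
      unfolding gamma_def fst_conv snd_conv by (intro continuous_intros)+
  qed
  ultimately have "path (\<lambda>\<theta>. crit_point (gamma s r D t \<theta>) (x \<theta>))"
    unfolding path_def by (intro continuous_on_crit_point gamma_in_L)
  moreover have "crit_point (gamma s r D t \<theta>) (x \<theta>) \<in> Crit s r a (gamma s r D t \<theta>)" for \<theta>
  proof -
    have "x \<theta> \<in> fiber (gamma s r D t \<theta>)"
      using lsol_in_crit_dom crit_map_lsol rad rad_power[of t]
      unfolding fiber_def crit_value_gamma x_def by (simp del: power_Suc)
    then show ?thesis unfolding Crit_eq_image[OF gamma_in_L] by (rule imageI)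
  qed
  moreover have "gamma s r D t 0 = f_at s r t" "gamma s r D t 1 = f_at s r t"
    by (simp_all add: gamma_def cis_int_multiple)
  moreover have "x 0 = branch k l t" using branch_small[OF t] by (simp add: x_def)
  moreover have "x 1 = branch k' l' t"
  proof -
    have "real k' = real k + real_of_int (deg1 s r a D)" "real l' = real l + real_of_int (deg2 r D)"
      using k' l' by (metis of_int_add of_int_of_nat_eq)+
    then have "phase2 (?p2 1) l = phase2 0 l'" by (simp add: phase2_def algebra_simps)
    moreover have "phase1 (?p1 1) (?p2 1) k l = phase1 0 0 k' l'"
      unfolding phase1_def calculation using \<open>real k' = _\<close> by (simp add: algebra_simps)
    ultimately show ?thesis using branch_small[OF t] by (simp add: x_def lsol_def)
  qed
  ultimately show ?thesis
    unfolding continues_to_def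
    by (intro exI[of _ "\<lambda>\<theta>. crit_point (gamma s r D t \<theta>) (x \<theta>)"])
       (simp add: pathstart_def pathfinish_def crit_point_f_at)
qed

text \<open>The solution follows its branch from \<open>0\<close> to \<open>T0\<close>, passes to the branch with the shifted label along the
  loop, and follows the latter back to \<open>0\<close>.\<close>

theorem M_tilde_solution:
  assumes P: "(k, l) \<in> labels s r" "(k', l') \<in> labels s r"
    and "int k' = int k + deg1 s r a D" "int l' = int l + deg2 r D"
  shows "M_tilde s r a D (solution s r a (k, l)) = solution s r a (k', l')"
proof -
  let ?p = "solution s r a (k, l)" and ?q = "solution s r a (k', l')" and ?\<gamma> = "gamma_tilde s r D T0"
  have c: "continues_to s r a ?\<gamma> ?p ?q"
    unfolding gamma_tilde_def solution_eq[OF P(1)] solution_eq[OF P(2)]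
    by (rule continues_to_join[OF continues_along_segment[OF branch(1) T0_nonpos]
        continues_to_join[OF continues_along_gamma[OF order_refl assms(3,4)]
        continues_to_reverse[OF continues_along_segment[OF branch(1) T0_nonpos]]]])
  have hom: "homotopic_paths (L s r - R_X s r a) ?\<gamma> ?\<gamma>" using gamma_tilde_homotopic[of T0 T0] by simp
  have start: "crit_value (pathstart ?\<gamma>) \<in> base"
    using ray_in_base[of 0] crit_value_f_at[of 0]
    by (simp add: gamma_tilde_def segment_to_f_at pathstart_def joinpaths_def segment_time_def)
  show ?thesis
    unfolding M_tilde_def monodromy_def Gamma_class_eq
  proof (rule the_equality)
    show "\<exists>\<gamma>\<in>loop_class s r a ?\<gamma>. continues_to s r a \<gamma> ?p ?q"
      using c hom by (intro bexI[of _ ?\<gamma>]) (simp_all add: loop_class_def)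
    show "q = ?q" if q: "\<exists>\<gamma>\<in>loop_class s r a ?\<gamma>. continues_to s r a \<gamma> ?p q" for q
    proof -
      obtain \<gamma> where "homotopic_paths (L s r - R_X s r a) ?\<gamma> \<gamma>" "continues_to s r a \<gamma> ?p q"
        using q by (auto simp: loop_class_def)
      then show ?thesis using continuation_homotopy_invariant[OF _ start c] by metis
    qed
  qed
qed

text \<open>By the bounds in the definition of \<open>Div_plus\<close>, the shifted label of \<open>P\<close> is again a label, and labels
  are determined by their solutions.\<close>

theorem M_set_eq:
  assumes P: "P \<in> labels s r" and Q: "Q \<in> labels s r"
  shows "M_set s r a P Q = hom_divisors s r a P Q"
proof -
  obtain k l k' l' where PQ: "P = (k, l)" "Q = (k', l')" by (metis surj_pair)
  have le: "k \<le> s" "l \<le> r" "k' \<le> s" "l' \<le> r" using P Q by (auto simp: PQ labels_def)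
  have "D \<in> M_set s r a P Q \<longleftrightarrow> D \<in> hom_divisors s r a P Q" for D
  proof
    assume "D \<in> M_set s r a P Q"
    then have D: "D \<in> Div_plus s r a P" "M_tilde s r a D (solution s r a P) = solution s r a Q"
      by (simp_all add: M_set_def)
    define k2 where "k2 = nat (int k + deg1 s r a D)"
    define l2 where "l2 = nat (int l + deg2 r D)"
    have eff: "D \<in> Div_T_plus s r" and bounds: "0 \<le> int k + deg1 s r a D" "int k + deg1 s r a D \<le> int s"
        "0 \<le> int l + deg2 r D" "int l + deg2 r D \<le> int r"
      using D(1) by (simp_all add: Div_plus_def PQ)
    then have k2: "int k2 = int k + deg1 s r a D" "int l2 = int l + deg2 r D" by (simp_all add: k2_def l2_def)
    have lab: "(k2, l2) \<in> labels s r" using bounds k2 by (simp add: labels_def)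
    have "solution s r a (k2, l2) = solution s r a Q"
      using M_tilde_solution[of k l k2 l2 D] D(2) P lab k2 by (simp add: PQ)
    then have "(k2, l2) = Q" by (rule solution_inject[OF lab Q])
    then show "D \<in> hom_divisors s r a P Q"
      using eff k2 by (auto simp: hom_divisors_def weight_divisors_def PQ)
  next
    assume D: "D \<in> hom_divisors s r a P Q"
    then have eff: "D \<in> Div_T_plus s r" and k': "int k' = int k + deg1 s r a D" and l': "int l' = int l + deg2 r D"
      by (auto simp: hom_divisors_def weight_divisors_def PQ)
    then have "D \<in> Div_plus s r a P" using le by (simp add: Div_plus_def PQ flip: k' l')
    then show "D \<in> M_set s r a P Q"
      using M_tilde_solution[OF _ _ k' l'] P Q by (simp add: M_set_def PQ)
  qed
  then show ?thesis by blast
qed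

end

theorem corollary4p3:
  fixes r s :: nat and a :: "nat \<Rightarrow> int"
  assumes "r \<ge> 1" and "s \<ge> 1"
    and "a 0 = 0" and "\<forall>j<r. a j \<le> a (Suc j)"
    and "(\<Sum>j=1..r. a j) \<le> int s"
    and "\<forall>t\<le>0. f_at s r t \<notin> R_X s r a"
  shows "\<exists>\<Phi>.
    (\<forall>P\<in>labels s r. \<forall>Q\<in>labels s r. linear_iso (Hom_E s r a P Q) (Hom_mon s r a P Q) (\<Phi> P Q)) \<and>
    (\<forall>P\<in>labels s r. \<forall>Q\<in>labels s r. \<forall>R\<in>labels s r.
       (\<forall>D1\<in>M_set s r a P Q. \<forall>D2\<in>M_set s r a Q R. D1 + D2 \<in> M_set s r a P R) \<and>
       (\<forall>\<phi>\<in>Hom_E s r a P Q. \<forall>\<psi>\<in>Hom_E s r a Q R.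
          \<Phi> P R (sheaf_map_comp \<psi> \<phi>) = mon_comp (\<Phi> P Q \<phi>) (\<Phi> Q R \<psi>)))"
proof -
  interpret twisted_bundle r s a using assms by unfold_locales auto
  obtain \<eta> \<rho>0 X Y where "small_solutions r s a \<eta> \<rho>0 X Y" using small_solutions_exist by blast
  then interpret monodromy_setup r s a \<eta> \<rho>0 X Y
    using assms(6) by (intro monodromy_setup.intro monodromy_setup_axioms.intro) auto
  show ?thesis
  proof (intro exI[of _ "\<lambda>P Q. hom_coeffs s r a P"] conjI ballI)
    show "linear_iso (Hom_E s r a P Q) (Hom_mon s r a P Q) (hom_coeffs s r a P)"
      if "P \<in> labels s r" "Q \<in> labels s r" for P Q
      unfolding Hom_mon_def M_set_eq[OF that] by (rule hom_coeffs_linear_iso)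
    show "D1 + D2 \<in> M_set s r a P R"
      if "P \<in> labels s r" "Q \<in> labels s r" "R \<in> labels s r" "D1 \<in> M_set s r a P Q" "D2 \<in> M_set s r a Q R" for P Q R D1 D2
      using that by (simp add: M_set_eq hom_divisors_add)
    show "hom_coeffs s r a P (sheaf_map_comp \<psi> \<phi>) = mon_comp (hom_coeffs s r a P \<phi>) (hom_coeffs s r a Q \<psi>)"
      if "\<phi> \<in> Hom_E s r a P Q" "\<psi> \<in> Hom_E s r a Q R" for P Q R \<phi> \<psi>
      using that by (rule hom_coeffs_comp)
  qed
qed

end
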